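(* Let $N\ge 2$ and let $P_N$ be the iterated conditional SMC (i-cSMC) kernel on $\mathsf X=\mathsf Z^T$ with $N$ particles and target distribution $\pi$, as defined in the context. (a) $P_N$ is reversible with respect to $\pi$ and defines a positive operator on $L^2(\mathsf X,\pi)$. (b) If $\pi_t\text{-}\mathrm{ess\,sup}_{z_t}G_t(z_t)<\infty$ for all $t\in\{1,\dots,T\}$, then there exists $\epsilon_N>0$ such that: (i) for any $(x,B)\in\mathsf X\times\mathcal B(\mathsf X)$, $P_N(x,B)\ge\epsilon_N\,\pi(B)$, where $1-\epsilon_N=O(1/N)$; (ii) for any probability distribution $\nu\ll\pi$ on $(\mathsf X,\mathcal B(\mathsf X))$ and any $k\ge1$, $\|\nu P_N^k-\pi\|_{L^2(\mathsf X,\pi)}\le\|\nu-\pi\|_{L^2(\mathsf X,\pi)}(1-\epsilon_N)^k$; (iii) for any $x\in\mathsf X$ and $k\ge1$, $\|\delta_xP_N^k-\pi\|_{TV}\le(1-\epsilon_N)^k$; (iv) for any $f\in L^2(\mathsf X,\pi)$, $\mathrm{var}_\pi(f)\le\mathrm{var}(f,P_N)\le[2\epsilon_N^{-1}-1]\,\mathrm{var}_\pi(f)$. (c) If $\pi_t\text{-}\mathrm{ess\,sup}_{z_t}G_t(z_t)=\infty$ for some $t\in[T]$, then $P_N$ is not uniformly ergodic for any $N\in\mathbb N$. (d) If $\pi_t\text{-}\mathrm{ess\,sup}_{z_t}G_t(z_t)=\infty$ for some $t\in[T]$, then $P_N$ cannot be geometrically ergodic for any $N\in\mathbb N$ if $\pi$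 is equivalent (mutually absolutely continuous) to a Lebesgue or counting measure on $\mathsf X$.
   Context: Setting. $[N]:=\{1,\dots,N\}$. $(\mathsf Z,\mathcal B(\mathsf Z))$ is a measurable space, $T\ge1$, $\mathsf X:=\mathsf Z^T$ with the product $\sigma$-algebra. $M_1$ is a probability on $\mathsf Z$; $M_t$ ($2\le t\le T$) are Markov kernels on $\mathsf Z$; $G_t:\mathsf Z\to[0,\infty)$ ($t\in[T]$) are measurable. Under $\mathbb P$, $(Z_1,\dots,Z_T)$ is the Markov chain with $Z_1\sim M_1$ and transition $M_t(Z_{t-1},\cdot)$ at time $t$. $\gamma_T:=\mathbb E[\prod_{t=1}^TG_t(Z_t)]$, with $0<\gamma_T<\infty$, and $\pi(B):=\gamma_T^{-1}\mathbb E[\mathbb I\{Z_{1:T}\in B\}\prod_{t=1}^TG_t(Z_t)]$ for $B\in\mathcal B(\mathsf X)$. $\pi_t$ is the $t$-th coordinate marginal of $\pi$, and $\pi_t\text{-}\mathrm{ess\,sup}$ is the essential supremum with respect to $\pi_t$. cSMC process. Given $x=(x_1,\dots,x_T)\in\mathsf X$, $\mathbb P^N_{\mathbf 1,x}$ is the law of $Z_t=(Z_t^1,\dots,Z_t^N)\in\mathsf Z^N$ ($t\in[T]$), $A_t=(A_t^1,\dots,A_t^N)\in[N]^N$ ($t\le T-1$), $A_T\in[N]$, such that: $Z_1^1=x_1$ and $Z_1^2,\dots,Z_1^N$ are i.i.d. $M_1$; for $2\le t\le T$, given the past (depending only on $Z_{t-1}$), $Z_t^1=x_t$, $A_{t-1}^1=1$,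 and independently for $i=2,\dots,N$, $A_{t-1}^i=k$ with probability $G_{t-1}(Z_{t-1}^k)/\sum_{j=1}^NG_{t-1}(Z_{t-1}^j)$ and then $Z_t^i\sim M_t(Z_{t-1}^{A_{t-1}^i},\cdot)$; finally $A_T=k$ with probability $G_T(Z_T^k)/\sum_{j=1}^NG_T(Z_T^j)$. Convention: if a denominator is zero the index $1$ is selected. i-cSMC kernel. Set $i_T:=A_T$, $i_t:=A_t^{i_{t+1}}$ for $t=T-1,\dots,1$. Then $P_N(x,B):=\mathbb P^N_{\mathbf 1,x}\big((Z_1^{i_1},\dots,Z_T^{i_T})\in B\big)$. For (c) and (d): $\mathsf S\subset\mathsf X$ is a fixed measurable set with $\pi(\mathsf S)=1$ and $\prod_{t=1}^TG_t(x_t)>0$ for all $x\in\mathsf S$, and the state space of the i-cSMC chain is taken to be $\mathsf S$; also, without loss of generality, $\pi_1$ is not concentrated on a single point. Uniform ergodicity means: there are $K<\infty$, $\rho\in(0,1)$ with $\sup_{x\in\mathsf S}\|P_N^n(x,\cdot)-\pi\|_{TV}\le K\rho^n$ for all $n\in\mathbb N$. Geometric ergodicity has its usual meaning: there are $\rho\in(0,1)$ and $C(x)<\infty$ for $\pi$-a.e. $x$ with $\|P_N^n(x,\cdot)-\pi\|_{TV}\le C(x)\rho^n$ for all $n$. Notation. For a signed measure $\nu$, $\|\nu\|_{TV}:=\frac12\sup_{f:\mathsf X\to[-1,1]}\nu(f)$; for $\nu\ll\pi$, $\|\nu\|^2_{L^2(\mathsf X,\pi)}:=\int|d\nu/d\pi|^2d\pi$.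 $L^2(\mathsf X,\pi)$ is the space of real measurable functions with $\pi(f^2)<\infty$; $\mathrm{var}_\pi(f):=\pi(f^2)-\pi(f)^2$; $\mathrm{var}(f,\Pi):=\lim_{M\to\infty}\mathrm{var}\big(M^{-1/2}\sum_{i=1}^M[f(\xi_i)-\pi(f)]\big)$ for the stationary chain $(\xi_i)$ with kernel $\Pi$. Positive operator means $\langle f,P_Nf\rangle_\pi\ge0$ for all $f\in L^2(\mathsf X,\pi)$.
   Formalization: As printed (b) fails; here (i) and (iii) hold for π-a.e. x, and for every x if all G_t are bounded on Z; 1-ε_N=O(1/N) is claimed when each G_t is essentially bounded under the law of Z_t for the unweighted chain. The remaining parts are as stated. *)

theory Defs
  imports "HOL-Probability.Probability" "HOL-Library.Landau_Symbols"
begin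

section \<open>Markov chains and kernels\<close>

(* Law of (Y_1, ..., Y_n), where Y_1 has law mu and K t is the transition kernel from time t - 1
   to time t. A vector indexed by {1..n} is an element of the space of PiM {1..n} (%_. S). *)
primrec markov_law ::
  "'a measure \<Rightarrow> 'a measure \<Rightarrow> (nat \<Rightarrow> 'a \<Rightarrow> 'a measure) \<Rightarrow> nat \<Rightarrow> (nat \<Rightarrow> 'a) measure" where
  "markov_law S \<mu> K 0 = return (PiM {1..0} (\<lambda>_. S)) (\<lambda>_. undefined)"
| "markov_law S \<mu> K (Suc n) =
     bind (markov_law S \<mu> K n)
       (\<lambda>y. distr (if n = 0 then \<mu> else K (Suc n) (y n)) (PiM {1..Suc n} (\<lambda>_. S))
              (\<lambda>w. y(Suc n := w)))"

primrec kernel_pow :: "'a measure \<Rightarrow> ('a \<Rightarrow> 'a measure) \<Rightarrow> nat \<Rightarrow> 'a \<Rightarrow> 'a measure" where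
  "kernel_pow S P 0 x = return S x"
| "kernel_pow S P (Suc n) x = bind (kernel_pow S P n x) P"

definition kernel_op :: "('a \<Rightarrow> 'a measure) \<Rightarrow> ('a \<Rightarrow> real) \<Rightarrow> 'a \<Rightarrow> real" where
  "kernel_op P f x = (\<integral>y. f y \<partial>P x)"

definition reversible :: "'a measure \<Rightarrow> ('a \<Rightarrow> 'a measure) \<Rightarrow> bool" where
  "reversible \<pi> P \<longleftrightarrow>
     (\<forall>A\<in>sets \<pi>. \<forall>B\<in>sets \<pi>.
        (\<integral>\<^sup>+x\<in>A. emeasure (P x) B \<partial>\<pi>) = (\<integral>\<^sup>+x\<in>B. emeasure (P x) A \<partial>\<pi>))"

definition L2 :: "'a measure \<Rightarrow> ('a \<Rightarrow> real) set" where
  "L2 \<pi> = {f \<in> borel_measurable \<pi>. integrable \<pi> (\<lambda>x. (f x)\<^sup>2)}"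

(* The integral defining kernel_op P f exists almost everywhere, the result is again in L2, and it
   depends only on the equivalence class of f. *)
definition defines_L2_operator :: "'a measure \<Rightarrow> ('a \<Rightarrow> 'a measure) \<Rightarrow> bool" where
  "defines_L2_operator \<pi> P \<longleftrightarrow>
     (\<forall>f\<in>L2 \<pi>. (AE x in \<pi>. integrable (P x) f) \<and> kernel_op P f \<in> L2 \<pi>) \<and>
     (\<forall>f\<in>L2 \<pi>. \<forall>g\<in>L2 \<pi>. (AE x in \<pi>. f x = g x) \<longrightarrow> (AE x in \<pi>. kernel_op P f x = kernel_op P g x))"

definition positive_L2_operator :: "'a measure \<Rightarrow> ('a \<Rightarrow> 'a measure) \<Rightarrow> bool" where
  "positive_L2_operator \<pi> P \<longleftrightarrow>
     defines_L2_operator \<pi> P \<and> (\<forall>f\<in>L2 \<pi>. 0 \<le> (\<integral>x. f x * kernel_op P f x \<partial>\<pi>))"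

(* The total variation norm of nu - mu, with the normalisation 1/2. *)
definition tv_dist :: "'a measure \<Rightarrow> 'a measure \<Rightarrow> real" where
  "tv_dist \<nu> \<mu> =
     (1 / 2) * (SUP f\<in>{f \<in> borel_measurable \<mu>. \<forall>x\<in>space \<mu>. f x \<in> {-1..1}}.
                  (\<integral>x. f x \<partial>\<nu>) - (\<integral>x. f x \<partial>\<mu>))"

definition sqrt_ennreal :: "ennreal \<Rightarrow> ennreal" where
  "sqrt_ennreal a = (if a = \<infinity> then \<infinity> else ennreal (sqrt (enn2real a)))"

(* The L2(pi) norm of the signed measure nu - mu, for finite measures nu, mu that are absolutely
   continuous with respect to pi; its density is the difference of the two densities. *)
definition L2_dist :: "'a measure \<Rightarrow> 'a measure \<Rightarrow> 'a measure \<Rightarrow> ennreal" where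
  "L2_dist \<pi> \<nu> \<mu> = sqrt_ennreal
     (\<integral>\<^sup>+x. ennreal (\<bar>enn2real (RN_deriv \<pi> \<nu> x) - enn2real (RN_deriv \<pi> \<mu> x)\<bar>\<^sup>2) \<partial>\<pi>)"

definition var_of :: "'a measure \<Rightarrow> ('a \<Rightarrow> real) \<Rightarrow> real" where
  "var_of \<mu> h = (\<integral>x. (h x)\<^sup>2 \<partial>\<mu>) - (\<integral>x. h x \<partial>\<mu>)\<^sup>2"

(* var(M^(-1/2) * (sum over i = 1, ..., M of f(xi_i) - pi(f))) for the chain (xi_i) with kernel P
   started from pi. *)
definition scaled_sum_var ::
  "'a measure \<Rightarrow> ('a \<Rightarrow> 'a measure) \<Rightarrow> ('a \<Rightarrow> real) \<Rightarrow> nat \<Rightarrow> real" where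
  "scaled_sum_var \<pi> P f M =
     var_of (markov_law \<pi> \<pi> (\<lambda>_. P) M)
       (\<lambda>\<xi>. (1 / sqrt (real M)) * (\<Sum>i\<in>{1..M}. (f (\<xi> i) - (\<integral>x. f x \<partial>\<pi>))))"

definition asymptotic_var ::
  "'a measure \<Rightarrow> ('a \<Rightarrow> 'a measure) \<Rightarrow> ('a \<Rightarrow> real) \<Rightarrow> real" where
  "asymptotic_var \<pi> P f = lim (scaled_sum_var \<pi> P f)"

definition uniformly_ergodic_on ::
  "'a set \<Rightarrow> 'a measure \<Rightarrow> ('a \<Rightarrow> 'a measure) \<Rightarrow> bool" where
  "uniformly_ergodic_on S \<pi> P \<longleftrightarrow>
     (\<exists>K \<rho>. 0 < \<rho> \<and> \<rho> < 1 \<and> (\<forall>n. \<forall>x\<in>S. tv_dist (kernel_pow \<pi> P n x) \<pi> \<le> K * \<rho> ^ n))"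

definition geometrically_ergodic :: "'a measure \<Rightarrow> ('a \<Rightarrow> 'a measure) \<Rightarrow> bool" where
  "geometrically_ergodic \<pi> P \<longleftrightarrow>
     (\<exists>C \<rho>. 0 < \<rho> \<and> \<rho> < 1 \<and> (AE x in \<pi>. \<forall>n. tv_dist (kernel_pow \<pi> P n x) \<pi> \<le> C x * \<rho> ^ n))"

definition equivalent_measures :: "'a measure \<Rightarrow> 'a measure \<Rightarrow> bool" where
  "equivalent_measures \<mu> \<nu> \<longleftrightarrow> absolutely_continuous \<mu> \<nu> \<and> absolutely_continuous \<nu> \<mu>"

(* L is Lebesgue measure on a Borel subset D of R^d, carried over along a measurable
   identification psi of D with the space of L. The points of R^d are vectors indexed by {..<d}. *)
definition lebesgue_type :: "'a measure \<Rightarrow> bool" where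
  "lebesgue_type L \<longleftrightarrow>
     (\<exists>(d::nat) D \<phi> \<psi>.
        D \<in> sets (PiM {..<d} (\<lambda>_. lborel :: real measure)) \<and>
        \<phi> \<in> measurable L (restrict_space (PiM {..<d} (\<lambda>_. lborel)) D) \<and>
        \<psi> \<in> measurable (restrict_space (PiM {..<d} (\<lambda>_. lborel)) D) L \<and>
        (\<forall>z\<in>space L. \<psi> (\<phi> z) = z) \<and> (\<forall>v\<in>D. \<phi> (\<psi> v) = v) \<and>
        L = distr (restrict_space (PiM {..<d} (\<lambda>_. lborel)) D) L \<psi>)"


section \<open>The target distribution\<close>

abbreviation path_space :: "'z measure \<Rightarrow> nat \<Rightarrow> (nat \<Rightarrow> 'z) measure" where
  "path_space Z T \<equiv> PiM {1..T} (\<lambda>_. Z)"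

definition normalising_constant ::
  "'z measure \<Rightarrow> nat \<Rightarrow> 'z measure \<Rightarrow> (nat \<Rightarrow> 'z \<Rightarrow> 'z measure) \<Rightarrow> (nat \<Rightarrow> 'z \<Rightarrow> real) \<Rightarrow> ennreal"
where
  "normalising_constant Z T M1 M G =
     (\<integral>\<^sup>+x. ennreal (\<Prod>t\<in>{1..T}. G t (x t)) \<partial>markov_law Z M1 M T)"

definition target ::
  "'z measure \<Rightarrow> nat \<Rightarrow> 'z measure \<Rightarrow> (nat \<Rightarrow> 'z \<Rightarrow> 'z measure) \<Rightarrow> (nat \<Rightarrow> 'z \<Rightarrow> real)
     \<Rightarrow> (nat \<Rightarrow> 'z) measure"
where
  "target Z T M1 M G =
     density (markov_law Z M1 M T)
       (\<lambda>x. ennreal (\<Prod>t\<in>{1..T}. G t (x t)) / normalising_constant Z T M1 M G)"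

locale smc_model =
  fixes Z :: "'z measure" and T :: nat and M1 :: "'z measure"
    and M :: "nat \<Rightarrow> 'z \<Rightarrow> 'z measure" and G :: "nat \<Rightarrow> 'z \<Rightarrow> real"
  assumes T_ge_1: "1 \<le> T"
    and init_prob: "prob_space M1" "sets M1 = sets Z"
    and kernel: "t \<in> {2..T} \<Longrightarrow> M t \<in> measurable Z (prob_algebra Z)"
    and G_measurable: "t \<in> {1..T} \<Longrightarrow> G t \<in> borel_measurable Z"
    and G_nonneg: "t \<in> {1..T} \<Longrightarrow> z \<in> space Z \<Longrightarrow> 0 \<le> G t z"
    and normalising_constant_pos: "0 < normalising_constant Z T M1 M G"
    and normalising_constant_finite: "normalising_constant Z T M1 M G < \<infinity>"

definition marginal :: "'z measure \<Rightarrow> (nat \<Rightarrow> 'z) measure \<Rightarrow> nat \<Rightarrow> 'z measure" where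
  "marginal Z \<pi> t = distr \<pi> Z (\<lambda>x. x t)"


section \<open>Conditional SMC\<close>

(* Law of an index in {1..N} drawn with probabilities proportional to w; the index is 1 if all
   weights vanish. *)
definition select_index :: "nat \<Rightarrow> (nat \<Rightarrow> real) \<Rightarrow> nat measure" where
  "select_index N w = point_measure {1..N}
     (\<lambda>k. if (\<Sum>j\<in>{1..N}. w j) = 0 then indicator {1} k
          else ennreal (w k / (\<Sum>j\<in>{1..N}. w j)))"

(* Law of (A_{t-1}^i, Z_t^i), i in {1..N}, given Z_{t-1} = z, where g = G_{t-1}, K = M_t and
   xt = x_t. *)
definition csmc_step ::
  "'z measure \<Rightarrow> nat \<Rightarrow> ('z \<Rightarrow> real) \<Rightarrow> ('z \<Rightarrow> 'z measure) \<Rightarrow> 'z \<Rightarrow> (nat \<Rightarrow> 'z)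
     \<Rightarrow> (nat \<Rightarrow> nat \<times> 'z) measure"
where
  "csmc_step Z N g K xt z = PiM {1..N} (\<lambda>i.
     if i = 1 then return (count_space {1..N} \<Otimes>\<^sub>M Z) (1, xt)
     else bind (select_index N (\<lambda>k. g (z k)))
            (\<lambda>k. distr (K (z k)) (count_space {1..N} \<Otimes>\<^sub>M Z) (\<lambda>y. (k, y))))"

(* Pairs of particles z t i = Z_t^i, for t in {1..n}, and ancestor indices a t i = A_t^i, for
   t in {1..n-1}. *)
definition csmc_space ::
  "'z measure \<Rightarrow> nat \<Rightarrow> nat \<Rightarrow> ((nat \<Rightarrow> nat \<Rightarrow> 'z) \<times> (nat \<Rightarrow> nat \<Rightarrow> nat)) measure"
where
  "csmc_space Z N n =
     PiM {1..n} (\<lambda>_. PiM {1..N} (\<lambda>_. Z)) \<Otimes>\<^sub>M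
     PiM {1..<n} (\<lambda>_. PiM {1..N} (\<lambda>_. count_space {1..N}))"

primrec csmc_particles ::
  "'z measure \<Rightarrow> 'z measure \<Rightarrow> (nat \<Rightarrow> 'z \<Rightarrow> 'z measure) \<Rightarrow> (nat \<Rightarrow> 'z \<Rightarrow> real) \<Rightarrow> nat
     \<Rightarrow> (nat \<Rightarrow> 'z) \<Rightarrow> nat \<Rightarrow> ((nat \<Rightarrow> nat \<Rightarrow> 'z) \<times> (nat \<Rightarrow> nat \<Rightarrow> nat)) measure"
where
  "csmc_particles Z M1 M G N x 0 = return (csmc_space Z N 0) (\<lambda>_. undefined, \<lambda>_. undefined)"
| "csmc_particles Z M1 M G N x (Suc n) =
     bind (csmc_particles Z M1 M G N x n) (\<lambda>(z, a).
       if n = 0 then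
         distr (PiM {1..N} (\<lambda>i. if i = 1 then return Z (x 1) else M1)) (csmc_space Z N (Suc n))
           (\<lambda>z1. (z(1 := z1), a))
       else
         distr (csmc_step Z N (G n) (M (Suc n)) (x (Suc n)) (z n)) (csmc_space Z N (Suc n))
           (\<lambda>m. (z(Suc n := (\<lambda>i\<in>{1..N}. snd (m i))), a(n := (\<lambda>i\<in>{1..N}. fst (m i))))))"

(* Law of (Z_1, ..., Z_T, A_1, ..., A_{T-1}, A_T) conditional on the reference path x. *)
definition csmc_law ::
  "'z measure \<Rightarrow> nat \<Rightarrow> 'z measure \<Rightarrow> (nat \<Rightarrow> 'z \<Rightarrow> 'z measure) \<Rightarrow> (nat \<Rightarrow> 'z \<Rightarrow> real)
     \<Rightarrow> nat \<Rightarrow> (nat \<Rightarrow> 'z) \<Rightarrow> (((nat \<Rightarrow> nat \<Rightarrow> 'z) \<times> (nat \<Rightarrow> nat \<Rightarrow> nat)) \<times> nat) measure"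
where
  "csmc_law Z T M1 M G N x =
     bind (csmc_particles Z M1 M G N x T) (\<lambda>(z, a).
       distr (select_index N (\<lambda>k. G T (z T k))) (csmc_space Z N T \<Otimes>\<^sub>M count_space {1..N})
         (\<lambda>k. ((z, a), k)))"

(* lineage T a k d is i_{T-d}: i_T = k and i_t = A_t^{i_{t+1}} for t < T. *)
primrec lineage :: "nat \<Rightarrow> (nat \<Rightarrow> nat \<Rightarrow> nat) \<Rightarrow> nat \<Rightarrow> nat \<Rightarrow> nat" where
  "lineage T a k 0 = k"
| "lineage T a k (Suc d) = a (T - Suc d) (lineage T a k d)"

definition icsmc ::
  "'z measure \<Rightarrow> nat \<Rightarrow> 'z measure \<Rightarrow> (nat \<Rightarrow> 'z \<Rightarrow> 'z measure) \<Rightarrow> (nat \<Rightarrow> 'z \<Rightarrow> real)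
     \<Rightarrow> nat \<Rightarrow> (nat \<Rightarrow> 'z) \<Rightarrow> (nat \<Rightarrow> 'z) measure"
where
  "icsmc Z T M1 M G N x =
     distr (csmc_law Z T M1 M G N x) (path_space Z T)
       (\<lambda>((z, a), k). \<lambda>t\<in>{1..T}. z t (lineage T a k (T - t)))"

end

(* Following ancestral lines, conditional SMC becomes a system of N paths in which slot 1 always holds
   the reference path. Exchangeability of the slots gives P_N = W^* W on L^2(pi), where W selects a
   path from an unconditional weighted system; hence reversibility and positivity.

   For bounded potentials, the ratio of two backward recursions summed over the particles is a
   submartingale, by 1/s + s/b^2 >= 2/b and independence of the particles given the past. This
   yields the minorisation with 1 - eps = O(1/N). If the potentials are bounded only pi-almost
   everywhere, the event that the free particles evolve as independent chains with bounded
   potentials gives a cruder constant. Minorisation contracts in total variation and in L^2(pi).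

   From {G_t >= K L} the kernel leaves {G_t >= K} with probability at most N^(T+1) / L, since the
   reference path outweighs its competitors; for unbounded G_t the chain therefore gets stuck, which
   excludes uniform ergodicity. Geometric ergodicity needs a single set that is sticky up to delta:
   paths with G_t >= 2^a for which, given any initial segment, potentials slightly below 2^a are
   unlikely. Summing over a shows that most scales a qualify. Fixing the value of x_1 makes this set
   null in the Lebesgue case; in the discrete case a finite subset carries most of its mass. *)
theory Submission
  imports Defs
begin

text \<open>Three obstacles shape the proof. If all weights vanish, index 1 is selected, which
  breaks the symmetry of the slots. Integrands are therefore set to 0 there, at no cost: slot 1
  holds the reference path, whose potential is then 0. Next, free particles are proposed by the
  Markov chain and not by \<pi>; they may meet huge potentials where later potentials vanish. An
  essential bound under \<pi> does not control them, so the constant with 1 - eps = O(1/N) comes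
  from a bound under the chain. Finally, a geometric rate has a constant C(x), so starting from ever
  higher levels, as against uniform ergodicity, proves nothing: one fixed set must retain the chain.
  In it a competitor slightly below the level is not outweighed, so its appearance must be
  improbable given the past. If such a set is null, staying in it with probability (1 - \<delta>)^n
  contradicts the rate at once. If it has positive mass, positivity of the operator helps: the
  moments <f, P^n f> are log-convex, hence bounded below by powers of the Rayleigh quotient, while
  C(x) is bounded on a finite set.\<close>

declare One_nat_def [simp del] markov_law.simps [simp del]

section \<open>Probability kernels\<close>

lemma prob_kernelD:
  assumes "K \<in> L \<rightarrow>\<^sub>M prob_algebra S" "x \<in> space L"
  shows "prob_space (K x)" "sets (K x) = sets S" "space (K x) = space S"
  using measurable_space[OF assms] by (auto simp: space_prob_algebra dest: sets_eq_imp_space_eq)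

lemma nn_integral_bind_kernel:
  assumes "K \<in> L \<rightarrow>\<^sub>M prob_algebra S" "sets \<mu> = sets L" "f \<in> borel_measurable S"
  shows "(\<integral>\<^sup>+y. f y \<partial>bind \<mu> K) = (\<integral>\<^sup>+x. \<integral>\<^sup>+y. f y \<partial>K x \<partial>\<mu>)"
  using assms by (intro nn_integral_bind[where B=S])
    (auto intro: measurable_prob_algebraD cong: measurable_cong_sets)

lemma nn_integral_kernel_measurable:
  assumes K: "K \<in> L \<rightarrow>\<^sub>M prob_algebra S" and f: "f \<in> borel_measurable S"
  shows "(\<lambda>x. \<integral>\<^sup>+y. f y \<partial>K x) \<in> borel_measurable L"
  using f by (intro nn_integral_measurable_subprob_algebra2[OF _ measurable_prob_algebraD[OF K]]) auto

lemma nn_integral_kernel_const: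
  assumes "K \<in> L \<rightarrow>\<^sub>M prob_algebra S" "x \<in> space L"
  shows "(\<integral>\<^sup>+y. c \<partial>K x) = (c :: ennreal)"
  using prob_kernelD(1)[OF assms] by (simp add: prob_space.emeasure_space_1)

lemma prob_algebra_cong: "sets M = sets N \<Longrightarrow> prob_algebra M = prob_algebra N"
  by (simp add: prob_algebra_def cong: subprob_algebra_cong)

lemma bind_in_prob_algebra:
  assumes "\<mu> \<in> space (prob_algebra L)" "K \<in> L \<rightarrow>\<^sub>M prob_algebra S"
  shows "bind \<mu> K \<in> space (prob_algebra S)"
  using prob_space_bind'[OF assms] sets_bind'[OF assms] by (simp add: space_prob_algebra)

text \<open>Rectangles generate the product sigma-algebra and are stable under intersection; on a
  rectangle the product measure is a finite product of measurable functions of the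
  parameter.\<close>

lemma measurable_PiM_kernel:
  assumes I: "finite I" and K: "\<And>i. i \<in> I \<Longrightarrow> K i \<in> L \<rightarrow>\<^sub>M prob_algebra S"
  shows "(\<lambda>\<omega>. PiM I (\<lambda>i. K i \<omega>)) \<in> L \<rightarrow>\<^sub>M prob_algebra (PiM I (\<lambda>_. S))"
proof (rule measurable_prob_algebra_generated)
  show "sets (Pi\<^sub>M I (\<lambda>_. S)) = sigma_sets (\<Pi>\<^sub>E i\<in>I. space S) (prod_algebra I (\<lambda>_. S))"
    by (simp add: sets_PiM)
  show "Int_stable (prod_algebra I (\<lambda>_. S))" by (rule Int_stable_prod_algebra)
  show "prod_algebra I (\<lambda>_. S) \<subseteq> Pow (\<Pi>\<^sub>E i\<in>I. space S)" by (rule prod_algebra_sets_into_space)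
  fix \<omega> assume \<omega>: "\<omega> \<in> space L"
  show "prob_space (Pi\<^sub>M I (\<lambda>i. K i \<omega>))"
    using K \<omega> by (intro prob_space_PiM) (auto dest: prob_kernelD)
  show "sets (Pi\<^sub>M I (\<lambda>i. K i \<omega>)) = sets (Pi\<^sub>M I (\<lambda>_. S))"
    using K \<omega> by (intro sets_PiM_cong) (auto dest: prob_kernelD)
next
  fix A assume "A \<in> prod_algebra I (\<lambda>_. S)"
  then obtain E where E: "A = Pi\<^sub>E I E" "\<And>i. i \<in> I \<Longrightarrow> E i \<in> sets S"
    using I by (auto simp: prod_algebra_eq_finite Pi_iff)
  have "(\<lambda>\<omega>. emeasure (Pi\<^sub>M I (\<lambda>i. K i \<omega>)) A) \<in> borel_measurable L \<longleftrightarrow>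
        (\<lambda>\<omega>. \<Prod>i\<in>I. emeasure (K i \<omega>) (E i)) \<in> borel_measurable L"
  proof (intro measurable_cong)
    fix \<omega> assume \<omega>: "\<omega> \<in> space L"
    \<comment> \<open>\<open>product_prob_space\<close> asks for a probability measure at every
      index, whereas \<open>K i \<omega>\<close> is one for \<open>i \<in> I\<close>; a point mass
      fills the other indices.\<close>
    define K' where "K' = (\<lambda>i. if i \<in> I then K i \<omega> else return (count_space UNIV) undefined)"
    have "prob_space (K' i)" for i
      using prob_kernelD(1)[OF K \<omega>, of i] by (cases "i \<in> I") (auto simp: K'_def intro: prob_space_return)
    then interpret product_prob_space K' by (rule product_prob_spaceI)
    have "Pi\<^sub>M I (\<lambda>i. K i \<omega>) = Pi\<^sub>M I K'" by (intro PiM_cong) (auto simp: K'_def)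
    moreover have "emeasure (Pi\<^sub>M I K') (Pi\<^sub>E I E) = (\<Prod>i\<in>I. emeasure (K' i) (E i))"
      using E(2) prob_kernelD(2)[OF K \<omega>] by (intro emeasure_PiM I) (auto simp: K'_def)
    ultimately show "emeasure (Pi\<^sub>M I (\<lambda>i. K i \<omega>)) A = (\<Prod>i\<in>I. emeasure (K i \<omega>) (E i))"
      by (simp add: E(1) K'_def)
  qed
  moreover have "(\<lambda>\<omega>. \<Prod>i\<in>I. emeasure (K i \<omega>) (E i)) \<in> borel_measurable L"
    using E(2) by (intro borel_measurable_prod_ennreal)
      (auto intro: measurable_emeasure_kernel measurable_prob_algebraD K)
  ultimately show "(\<lambda>\<omega>. emeasure (Pi\<^sub>M I (\<lambda>i. K i \<omega>)) A) \<in> borel_measurable L" by simp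
qed

lemma (in prob_space) nn_integral_square_le:
  assumes [measurable]: "f \<in> borel_measurable M"
  shows "(\<integral>\<^sup>+x. f x \<partial>M)\<^sup>2 \<le> (\<integral>\<^sup>+x. (f x)\<^sup>2 \<partial>M)"
  using Cauchy_Schwarz_nn_integral[OF assms, of "\<lambda>_. 1"] by (simp add: emeasure_space_1)

section \<open>Measure preserving kernels on $L^2$\<close>

lemma L2_D: "f \<in> L2 \<pi> \<Longrightarrow> f \<in> borel_measurable \<pi>" "f \<in> L2 \<pi> \<Longrightarrow> integrable \<pi> (\<lambda>x. (f x)\<^sup>2)"
  by (auto simp: L2_def)

lemma L2_prod_integrable:
  assumes "f \<in> L2 \<pi>" "g \<in> L2 \<pi>"
  shows "integrable \<pi> (\<lambda>x. f x * g x)"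
proof (rule Bochner_Integration.integrable_bound)
  note [measurable] = L2_D(1)[OF assms(1)] L2_D(1)[OF assms(2)]
  show "integrable \<pi> (\<lambda>x. (f x)\<^sup>2 + (g x)\<^sup>2)" using assms by (auto simp: L2_def)
  show "(\<lambda>x. f x * g x) \<in> borel_measurable \<pi>" by measurable
  have "\<bar>a * b\<bar> \<le> a\<^sup>2 + b\<^sup>2" for a b :: real
  proof -
    have "0 \<le> (\<bar>a\<bar> - \<bar>b\<bar>)\<^sup>2" by simp
    then have "2 * (\<bar>a\<bar> * \<bar>b\<bar>) \<le> a\<^sup>2 + b\<^sup>2" unfolding power2_diff by simp
    moreover have "0 \<le> \<bar>a\<bar> * \<bar>b\<bar>" by simp
    ultimately show ?thesis unfolding abs_mult by linarith
  qed
  then show "AE x in \<pi>. norm (f x * g x) \<le> norm ((f x)\<^sup>2 + (g x)\<^sup>2)" by (auto simp: real_norm_def)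
qed

lemma L2_add: assumes "f \<in> L2 \<pi>" "g \<in> L2 \<pi>" shows "(\<lambda>x. f x + g x) \<in> L2 \<pi>"
  using assms L2_prod_integrable[OF assms]
  by (auto simp: L2_def power2_sum mult.assoc intro!: Bochner_Integration.integrable_add)

lemma L2_cmult: "f \<in> L2 \<pi> \<Longrightarrow> (\<lambda>x. c * f x) \<in> L2 \<pi>"
  by (auto simp: L2_def power_mult_distrib)

lemma L2_diff: assumes "f \<in> L2 \<pi>" "g \<in> L2 \<pi>" shows "(\<lambda>x. f x - g x) \<in> L2 \<pi>"
  using L2_add[OF assms(1) L2_cmult[OF assms(2), of "-1"]] by simp

lemma L2_bound:
  assumes "g \<in> L2 \<pi>" "f \<in> borel_measurable \<pi>" "AE x in \<pi>. \<bar>f x\<bar> \<le> \<bar>g x\<bar>"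
  shows "f \<in> L2 \<pi>"
  using assms unfolding L2_def mem_Collect_eq
  by (intro conjI Bochner_Integration.integrable_bound[where f="\<lambda>x. (g x)\<^sup>2" and g="\<lambda>x. (f x)\<^sup>2"])
    (auto elim!: eventually_mono simp flip: abs_le_square_iff)

lemma (in prob_space) L2_bounded:
  assumes "f \<in> borel_measurable M" "\<And>x. x \<in> space M \<Longrightarrow> \<bar>f x\<bar> \<le> c"
  shows "f \<in> L2 M"
  by (rule L2_bound[where g="\<lambda>_. c"]) (use assms in \<open>auto simp: L2_def intro!: AE_I2, fastforce\<close>)

lemma (in prob_space) L2_integrable: "f \<in> L2 M \<Longrightarrow> integrable M f"
  using L2_prod_integrable[of f M "\<lambda>_. 1"] L2_bounded[of "\<lambda>_. 1" 1] by simp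

lemma L2_nn_iff: "f \<in> L2 \<pi> \<longleftrightarrow> f \<in> borel_measurable \<pi> \<and> (\<integral>\<^sup>+x. ennreal ((f x)\<^sup>2) \<partial>\<pi>) < \<infinity>"
  by (auto simp: L2_def integrable_iff_bounded)

text \<open>Drawing \<open>s\<close> from \<open>\<mu>\<close> and then a point from
  \<open>K s\<close> gives the law \<open>\<pi>\<close>. This common pattern covers the kernel
  \<open>P\<close> and its powers, the selection kernel \<open>W\<close>, the extension of a path
  law by one step and the projection of a path to a coordinate.\<close>

locale mp_kernel =
  fixes \<mu> :: "'s measure" and K :: "'s \<Rightarrow> 'a measure" and \<pi> :: "'a measure"
  assumes K_kernel: "K \<in> \<mu> \<rightarrow>\<^sub>M prob_algebra \<pi>"
    and pi_prob: "prob_space \<pi>"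
    and K_preserves: "\<And>f. f \<in> borel_measurable \<pi> \<Longrightarrow> (\<integral>\<^sup>+s. \<integral>\<^sup>+x. f x \<partial>K s \<partial>\<mu>) = (\<integral>\<^sup>+x. f x \<partial>\<pi>)"
begin

lemma K_subprob [measurable]: "K \<in> \<mu> \<rightarrow>\<^sub>M subprob_algebra \<pi>"
  by (rule measurable_prob_algebraD[OF K_kernel])

lemma K_meas: "f \<in> borel_measurable \<pi> \<Longrightarrow> s \<in> space \<mu> \<Longrightarrow> f \<in> borel_measurable (K s)"
  using prob_kernelD(2)[OF K_kernel] by (simp cong: measurable_cong_sets)

lemma integral_K_meas [measurable]:
  fixes f :: "'a \<Rightarrow> real"
  shows "f \<in> borel_measurable \<pi> \<Longrightarrow> (\<lambda>s. \<integral>x. f x \<partial>K s) \<in> borel_measurable \<mu>"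
  by (rule measurable_compose[OF K_subprob integral_measurable_subprob_algebra])

lemma K_integrable:
  fixes f :: "'a \<Rightarrow> real"
  assumes "integrable \<pi> f"
  shows "AE s in \<mu>. integrable (K s) f"
proof -
  have [measurable]: "f \<in> borel_measurable \<pi>" using assms by auto
  have "(\<integral>\<^sup>+s. \<integral>\<^sup>+x. ennreal (norm (f x)) \<partial>K s \<partial>\<mu>) = (\<integral>\<^sup>+x. ennreal (norm (f x)) \<partial>\<pi>)"
    by (intro K_preserves) measurable
  also have "\<dots> < \<infinity>" using assms by (auto simp: integrable_iff_bounded)
  finally have "AE s in \<mu>. (\<integral>\<^sup>+x. ennreal (norm (f x)) \<partial>K s) \<noteq> \<infinity>"
    by (intro nn_integral_noteq_infinite nn_integral_kernel_measurable[OF K_kernel]) auto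
  then show ?thesis
    using AE_space by eventually_elim (auto simp: integrable_iff_bounded K_meas less_top)
qed

lemma K_AE:
  assumes "AE x in \<pi>. Q x"
  shows "AE s in \<mu>. AE x in K s. Q x"
proof -
  obtain A where A: "A \<in> sets \<pi>" "emeasure \<pi> A = 0" "{x\<in>space \<pi>. \<not> Q x} \<subseteq> A"
    using AE_E[OF assms] by metis
  have "(\<integral>\<^sup>+s. emeasure (K s) A \<partial>\<mu>) = (\<integral>\<^sup>+s. \<integral>\<^sup>+x. indicator A x \<partial>K s \<partial>\<mu>)"
    using A prob_kernelD(2)[OF K_kernel] by (intro nn_integral_cong) auto
  also have "\<dots> = 0" using A by (subst K_preserves) auto
  finally have "AE s in \<mu>. emeasure (K s) A = 0"
    using A by (subst (asm) nn_integral_0_iff_AE) (auto intro: measurable_emeasure_kernel[OF K_subprob])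
  then show ?thesis using AE_space
  proof eventually_elim
    case (elim s)
    then show ?case using A prob_kernelD[OF K_kernel, of s]
      by (intro AE_I[of _ _ A]) auto
  qed
qed

text \<open>Jensen's inequality under each \<open>K s\<close>, then preservation of the measure.
  Where \<open>f\<close> is not integrable under \<open>K s\<close>, the Bochner integral is 0 by
  default and the bound is trivial.\<close>

lemma K_square_le:
  assumes f: "f \<in> L2 \<pi>"
  shows "(\<integral>\<^sup>+s. ennreal ((\<integral>x. f x \<partial>K s)\<^sup>2) \<partial>\<mu>) \<le> (\<integral>\<^sup>+x. ennreal ((f x)\<^sup>2) \<partial>\<pi>)"
proof -
  have [measurable]: "f \<in> borel_measurable \<pi>" using L2_D f by auto
  have "(\<integral>\<^sup>+s. ennreal ((\<integral>x. f x \<partial>K s)\<^sup>2) \<partial>\<mu>) \<le> (\<integral>\<^sup>+s. \<integral>\<^sup>+x. ennreal ((f x)\<^sup>2) \<partial>K s \<partial>\<mu>)"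
  proof (intro nn_integral_mono)
    fix s assume s: "s \<in> space \<mu>"
    interpret prob_space "K s" using prob_kernelD[OF K_kernel s] by simp
    have m: "f \<in> borel_measurable (K s)" by (rule K_meas) (use s in auto)
    have "ennreal \<bar>\<integral>x. f x \<partial>K s\<bar> \<le> (\<integral>\<^sup>+x. ennreal \<bar>f x\<bar> \<partial>K s)"
    proof (cases "integrable (K s) f")
      case True then show ?thesis using integral_norm_bound_ennreal[OF True] by simp
    qed (simp add: not_integrable_integral_eq)
    then have "(ennreal \<bar>\<integral>x. f x \<partial>K s\<bar>)\<^sup>2 \<le> (\<integral>\<^sup>+x. ennreal \<bar>f x\<bar> \<partial>K s)\<^sup>2" by (rule power_mono) simp
    also have "\<dots> \<le> (\<integral>\<^sup>+x. (ennreal \<bar>f x\<bar>)\<^sup>2 \<partial>K s)" by (rule nn_integral_square_le) (use m in auto)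
    finally show "ennreal ((\<integral>x. f x \<partial>K s)\<^sup>2) \<le> (\<integral>\<^sup>+x. ennreal ((f x)\<^sup>2) \<partial>K s)"
      by (simp add: ennreal_power)
  qed
  also have "\<dots> = (\<integral>\<^sup>+x. ennreal ((f x)\<^sup>2) \<partial>\<pi>)" by (intro K_preserves) measurable
  finally show ?thesis .
qed

lemma K_L2: assumes f: "f \<in> L2 \<pi>" shows "(\<lambda>s. \<integral>x. f x \<partial>K s) \<in> L2 \<mu>"
proof -
  from f have "(\<integral>\<^sup>+x. ennreal ((f x)\<^sup>2) \<partial>\<pi>) < \<infinity>" by (simp add: L2_nn_iff)
  with K_square_le[OF f] have "(\<integral>\<^sup>+s. ennreal ((\<integral>x. f x \<partial>K s)\<^sup>2) \<partial>\<mu>) < \<infinity>" by (rule le_less_trans)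
  moreover have "(\<lambda>s. \<integral>x. f x \<partial>K s) \<in> borel_measurable \<mu>" using L2_D(1)[OF f] by (rule integral_K_meas)
  ultimately show ?thesis by (simp add: L2_nn_iff)
qed

lemma K_preserves_integral:
  fixes f :: "'a \<Rightarrow> real"
  assumes f: "integrable \<pi> f"
  shows "(\<integral>s. \<integral>x. f x \<partial>K s \<partial>\<mu>) = (\<integral>x. f x \<partial>\<pi>)" "integrable \<mu> (\<lambda>s. \<integral>x. f x \<partial>K s)"
proof -
  have [measurable]: "f \<in> borel_measurable \<pi>" using f by auto
  have nn: "integrable \<mu> (\<lambda>s. \<integral>x. g x \<partial>K s) \<and> (\<integral>s. \<integral>x. g x \<partial>K s \<partial>\<mu>) = (\<integral>x. g x \<partial>\<pi>)"
    if g: "integrable \<pi> g" "\<And>x. 0 \<le> g x" for g :: "'a \<Rightarrow> real"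
  proof -
    have [measurable]: "g \<in> borel_measurable \<pi>" using g by auto
    have "AE s in \<mu>. ennreal (\<integral>x. g x \<partial>K s) = (\<integral>\<^sup>+x. ennreal (g x) \<partial>K s)"
      using K_integrable[OF g(1)] by eventually_elim (auto simp: nn_integral_eq_integral g)
    then have e: "(\<integral>\<^sup>+s. ennreal (\<integral>x. g x \<partial>K s) \<partial>\<mu>) = (\<integral>\<^sup>+x. ennreal (g x) \<partial>\<pi>)"
      using K_preserves[of "\<lambda>x. ennreal (g x)"] by (simp add: nn_integral_cong_AE)
    then have 1: "integrable \<mu> (\<lambda>s. \<integral>x. g x \<partial>K s)"
      using g by (intro integrableI_nonneg) (auto simp: integrable_iff_bounded intro: integral_nonneg)
    have "(\<integral>s. \<integral>x. g x \<partial>K s \<partial>\<mu>) = (\<integral>x. g x \<partial>\<pi>)"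
      using e g by (simp add: integral_eq_nn_integral)
    with 1 show ?thesis by simp
  qed
  let ?p = "\<lambda>x. max 0 (f x)" and ?n = "\<lambda>x. max 0 (- f x)"
  have pn: "integrable \<pi> ?p" "integrable \<pi> ?n" using f by auto
  have eq: "f = (\<lambda>x. ?p x - ?n x)" by auto
  have ae: "AE s in \<mu>. (\<integral>x. f x \<partial>K s) = (\<integral>x. ?p x \<partial>K s) - (\<integral>x. ?n x \<partial>K s)"
    using K_integrable[OF pn(1)] K_integrable[OF pn(2)]
  proof eventually_elim
    case (elim s)
    then show ?case by (subst (1) eq) (rule Bochner_Integration.integral_diff)
  qed
  have i: "integrable \<mu> (\<lambda>s. (\<integral>x. ?p x \<partial>K s) - (\<integral>x. ?n x \<partial>K s))"
    using nn[OF pn(1)] nn[OF pn(2)] by auto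
  show "integrable \<mu> (\<lambda>s. \<integral>x. f x \<partial>K s)"
    using i by (rule integrable_cong_AE_imp) (use ae in auto)
  have "(\<integral>s. \<integral>x. f x \<partial>K s \<partial>\<mu>) = (\<integral>s. (\<integral>x. ?p x \<partial>K s) - (\<integral>x. ?n x \<partial>K s) \<partial>\<mu>)"
    using ae by (intro integral_cong_AE) auto
  also have "\<dots> = (\<integral>x. ?p x \<partial>\<pi>) - (\<integral>x. ?n x \<partial>\<pi>)"
    using nn[OF pn(1)] nn[OF pn(2)] by (subst Bochner_Integration.integral_diff) auto
  also have "\<dots> = (\<integral>x. f x \<partial>\<pi>)"
    by (subst (3) eq) (rule Bochner_Integration.integral_diff[OF pn, symmetric])
  finally show "(\<integral>s. \<integral>x. f x \<partial>K s \<partial>\<mu>) = (\<integral>x. f x \<partial>\<pi>)" .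
qed

end

section \<open>Kernels that factor through an auxiliary space\<close>

text \<open>The factorisation says that $P = W^* W$ on $L^2(\pi)$.\<close>

locale factored_kernel = prob_space \<pi> for \<pi> :: "'a measure" +
  fixes P :: "'a \<Rightarrow> 'a measure" and \<nu> :: "'s measure" and W :: "'s \<Rightarrow> 'a measure"
  assumes P_kernel: "P \<in> \<pi> \<rightarrow>\<^sub>M prob_algebra \<pi>"
    and W_kernel: "W \<in> \<nu> \<rightarrow>\<^sub>M prob_algebra \<pi>"
    and factor: "\<And>f g. f \<in> borel_measurable \<pi> \<Longrightarrow> g \<in> borel_measurable \<pi> \<Longrightarrow>
      (\<integral>\<^sup>+x. f x * (\<integral>\<^sup>+y. g y \<partial>P x) \<partial>\<pi>) = (\<integral>\<^sup>+s. (\<integral>\<^sup>+x. f x \<partial>W s) * (\<integral>\<^sup>+x. g x \<partial>W s) \<partial>\<nu>)"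
begin

lemma nn_symmetric:
  assumes "f \<in> borel_measurable \<pi>" "g \<in> borel_measurable \<pi>"
  shows "(\<integral>\<^sup>+x. f x * (\<integral>\<^sup>+y. g y \<partial>P x) \<partial>\<pi>) = (\<integral>\<^sup>+x. g x * (\<integral>\<^sup>+y. f y \<partial>P x) \<partial>\<pi>)"
  by (simp add: factor assms mult.commute)

text \<open>Invariance is symmetry tested against the constant 1.\<close>

sublocale P: mp_kernel \<pi> P \<pi>
proof
  fix f :: "'a \<Rightarrow> ennreal" assume f: "f \<in> borel_measurable \<pi>"
  have "(\<integral>\<^sup>+x. \<integral>\<^sup>+y. f y \<partial>P x \<partial>\<pi>) = (\<integral>\<^sup>+x. f x * (\<integral>\<^sup>+y. 1 \<partial>P x) \<partial>\<pi>)"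
    using nn_symmetric[OF f, of "\<lambda>_. 1"] by simp
  also have "\<dots> = (\<integral>\<^sup>+x. f x \<partial>\<pi>)"
    by (intro nn_integral_cong) (simp only: nn_integral_kernel_const[OF P_kernel] mult_1_right)
  finally show "(\<integral>\<^sup>+x. \<integral>\<^sup>+y. f y \<partial>P x \<partial>\<pi>) = (\<integral>\<^sup>+x. f x \<partial>\<pi>)" .
qed (fact P_kernel, unfold_locales)

sublocale W: mp_kernel \<nu> W \<pi>
proof
  fix f :: "'a \<Rightarrow> ennreal" assume f: "f \<in> borel_measurable \<pi>"
  have "(\<integral>\<^sup>+s. \<integral>\<^sup>+x. f x \<partial>W s \<partial>\<nu>) = (\<integral>\<^sup>+s. (\<integral>\<^sup>+x. f x \<partial>W s) * (\<integral>\<^sup>+x. 1 \<partial>W s) \<partial>\<nu>)"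
    by (intro nn_integral_cong) (simp only: nn_integral_kernel_const[OF W_kernel] mult_1_right)
  also have "\<dots> = (\<integral>\<^sup>+x. f x * (\<integral>\<^sup>+y. 1 \<partial>P x) \<partial>\<pi>)" by (rule factor[symmetric]) (use f in auto)
  also have "\<dots> = (\<integral>\<^sup>+x. f x \<partial>\<pi>)"
    by (intro nn_integral_cong) (simp only: nn_integral_kernel_const[OF P_kernel] mult_1_right)
  finally show "(\<integral>\<^sup>+s. \<integral>\<^sup>+x. f x \<partial>W s \<partial>\<nu>) = (\<integral>\<^sup>+x. f x \<partial>\<pi>)" .
qed (fact W_kernel, unfold_locales)

lemma reversible: "reversible \<pi> P"
  unfolding reversible_def
proof (intro ballI)
  fix A B assume AB [measurable]: "A \<in> sets \<pi>" "B \<in> sets \<pi>"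
  have e: "(\<integral>\<^sup>+x\<in>A. emeasure (P x) B \<partial>\<pi>) = (\<integral>\<^sup>+x. indicator A x * (\<integral>\<^sup>+y. indicator B y \<partial>P x) \<partial>\<pi>)"
    if "A \<in> sets \<pi>" "B \<in> sets \<pi>" for A B
    using that prob_kernelD(2)[OF P_kernel] by (intro nn_integral_cong) (auto simp: mult.commute)
  show "(\<integral>\<^sup>+x\<in>A. emeasure (P x) B \<partial>\<pi>) = (\<integral>\<^sup>+x\<in>B. emeasure (P x) A \<partial>\<pi>)"
    unfolding e[OF AB] e[OF AB(2,1)] by (rule nn_symmetric) auto
qed

lemma op_L2: "f \<in> L2 \<pi> \<Longrightarrow> kernel_op P f \<in> L2 \<pi>"
  using P.K_L2[of f] by (simp add: kernel_op_def[abs_def])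

lemma op_integrable: "f \<in> L2 \<pi> \<Longrightarrow> AE x in \<pi>. integrable (P x) f"
  by (rule P.K_integrable) (rule L2_integrable)

lemma op_cong_AE:
  assumes "f \<in> L2 \<pi>" "g \<in> L2 \<pi>" "AE x in \<pi>. f x = g x"
  shows "AE x in \<pi>. kernel_op P f x = kernel_op P g x"
  using P.K_AE[OF assms(3)] AE_space
proof eventually_elim
  case (elim x)
  then show ?case
    unfolding kernel_op_def using assms(1,2)
    by (intro integral_cong_AE) (auto simp: L2_def P.K_meas)
qed

text \<open>\<open>factor\<close> carried over from nonnegative functions to real square integrable
  ones: for nonnegative functions the two notions of integral agree almost everywhere, and the rest
  is bilinearity in positive and negative parts.\<close>

lemma op_inner:
  assumes f: "f \<in> L2 \<pi>" and g: "g \<in> L2 \<pi>"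
  shows "(\<integral>x. f x * kernel_op P g x \<partial>\<pi>) = (\<integral>s. (\<integral>x. f x \<partial>W s) * (\<integral>x. g x \<partial>W s) \<partial>\<nu>)"
proof -
  have nonneg: "(\<integral>x. a x * kernel_op P b x \<partial>\<pi>) = (\<integral>s. (\<integral>x. a x \<partial>W s) * (\<integral>x. b x \<partial>W s) \<partial>\<nu>)"
    if ab: "a \<in> L2 \<pi>" "b \<in> L2 \<pi>" "\<And>x. 0 \<le> a x" "\<And>x. 0 \<le> b x" for a b :: "'a \<Rightarrow> real"
  proof -
    have [measurable]: "a \<in> borel_measurable \<pi>" "b \<in> borel_measurable \<pi>" using ab by (auto simp: L2_def)
    have "(\<integral>x. a x * kernel_op P b x \<partial>\<pi>) = enn2real (\<integral>\<^sup>+x. ennreal (a x * kernel_op P b x) \<partial>\<pi>)"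
      using ab by (intro integral_eq_nn_integral) (auto simp: kernel_op_def[abs_def] intro: Bochner_Integration.integral_nonneg)
    also have "(\<integral>\<^sup>+x. ennreal (a x * kernel_op P b x) \<partial>\<pi>) = (\<integral>\<^sup>+x. ennreal (a x) * (\<integral>\<^sup>+y. ennreal (b y) \<partial>P x) \<partial>\<pi>)"
    proof (intro nn_integral_cong_AE)
      show "AE x in \<pi>. ennreal (a x * kernel_op P b x) = ennreal (a x) * (\<integral>\<^sup>+y. ennreal (b y) \<partial>P x)"
        using op_integrable[OF ab(2)] by eventually_elim
          (simp add: kernel_op_def ennreal_mult ab integral_nonneg nn_integral_eq_integral)
    qed
    also have "\<dots> = (\<integral>\<^sup>+s. (\<integral>\<^sup>+x. ennreal (a x) \<partial>W s) * (\<integral>\<^sup>+x. ennreal (b x) \<partial>W s) \<partial>\<nu>)"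
      by (rule factor) auto
    also have "\<dots> = (\<integral>\<^sup>+s. ennreal ((\<integral>x. a x \<partial>W s) * (\<integral>x. b x \<partial>W s)) \<partial>\<nu>)"
    proof (intro nn_integral_cong_AE)
      show "AE s in \<nu>. (\<integral>\<^sup>+x. ennreal (a x) \<partial>W s) * (\<integral>\<^sup>+x. ennreal (b x) \<partial>W s) =
          ennreal ((\<integral>x. a x \<partial>W s) * (\<integral>x. b x \<partial>W s))"
        using W.K_integrable[OF L2_integrable[OF ab(1)]] W.K_integrable[OF L2_integrable[OF ab(2)]]
        by eventually_elim (simp add: ennreal_mult ab integral_nonneg nn_integral_eq_integral)
    qed
    also have "enn2real \<dots> = (\<integral>s. (\<integral>x. a x \<partial>W s) * (\<integral>x. b x \<partial>W s) \<partial>\<nu>)"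
      using ab by (intro integral_eq_nn_integral[symmetric]) (auto intro: Bochner_Integration.integral_nonneg)
    finally show ?thesis .
  qed
  define p :: "('a \<Rightarrow> real) \<Rightarrow> 'a \<Rightarrow> real" where "p = (\<lambda>h x. max 0 (h x))"
  define n :: "('a \<Rightarrow> real) \<Rightarrow> 'a \<Rightarrow> real" where "n = (\<lambda>h x. max 0 (- h x))"
  have pn: "p h \<in> L2 \<pi>" "n h \<in> L2 \<pi>" if "h \<in> L2 \<pi>" for h :: "'a \<Rightarrow> real"
    using that L2_D(1)[OF that] by (auto intro!: L2_bound[OF that] simp: p_def n_def)
  have pos: "0 \<le> p h x" "0 \<le> n h x" and eq: "h x = p h x - n h x" for h x by (auto simp: p_def n_def)
  have W: "AE s in \<nu>. (\<integral>x. h x \<partial>W s) = (\<integral>x. p h x \<partial>W s) - (\<integral>x. n h x \<partial>W s)" if "h \<in> L2 \<pi>" for h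
    using W.K_integrable[OF L2_integrable[OF pn(1)[OF that]]] W.K_integrable[OF L2_integrable[OF pn(2)[OF that]]]
    by eventually_elim (simp add: eq[of h] flip: Bochner_Integration.integral_diff)
  have P: "AE x in \<pi>. kernel_op P h x = kernel_op P (p h) x - kernel_op P (n h) x" if "h \<in> L2 \<pi>" for h
    using op_integrable[OF pn(1)[OF that]] op_integrable[OF pn(2)[OF that]]
    by eventually_elim (simp add: eq[of h] kernel_op_def flip: Bochner_Integration.integral_diff)
  let ?I = "\<lambda>a b. \<integral>x. a x * kernel_op P b x \<partial>\<pi>"
  let ?w = "\<lambda>h s. \<integral>x. h x \<partial>W s"
  let ?J = "\<lambda>a b. \<integral>s. ?w a s * ?w b s \<partial>\<nu>"
  note L = pn[OF f] pn[OF g]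
  have i: "integrable \<pi> (\<lambda>x. a x * kernel_op P b x)" if "a \<in> L2 \<pi>" "b \<in> L2 \<pi>" for a b
    using that op_L2 by (intro L2_prod_integrable) auto
  have j: "integrable \<nu> (\<lambda>s. ?w a s * ?w b s)" if "a \<in> L2 \<pi>" "b \<in> L2 \<pi>" for a b
    using that W.K_L2 by (intro L2_prod_integrable) auto
  have m: "kernel_op P h \<in> borel_measurable \<pi>" if "h \<in> L2 \<pi>" for h using op_L2[OF that] by (rule L2_D)
  have mw: "?w h \<in> borel_measurable \<nu>" if "h \<in> L2 \<pi>" for h using W.K_L2[OF that] by (rule L2_D)
  note [measurable] = L2_D(1)[OF f] L2_D(1)[OF g] m[OF g] L[THEN m] L[THEN L2_D(1)] L[THEN mw] mw[OF f] mw[OF g]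
  have "?I f g = (\<integral>x. p f x * kernel_op P (p g) x + n f x * kernel_op P (n g) x
      - (p f x * kernel_op P (n g) x + n f x * kernel_op P (p g) x) \<partial>\<pi>)"
  proof (intro integral_cong_AE)
    show "AE x in \<pi>. f x * kernel_op P g x = p f x * kernel_op P (p g) x + n f x * kernel_op P (n g) x
        - (p f x * kernel_op P (n g) x + n f x * kernel_op P (p g) x)"
      using P[OF g] by eventually_elim (simp only: eq[of f], simp add: algebra_simps)
  qed measurable
  also have "\<dots> = ?I (p f) (p g) + ?I (n f) (n g) - (?I (p f) (n g) + ?I (n f) (p g))"
    using L by (simp add: i)
  also have "\<dots> = ?J (p f) (p g) + ?J (n f) (n g) - (?J (p f) (n g) + ?J (n f) (p g))"
    using L by (simp add: nonneg pos)
  also have "\<dots> = (\<integral>s. ?w (p f) s * ?w (p g) s + ?w (n f) s * ?w (n g) s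
      - (?w (p f) s * ?w (n g) s + ?w (n f) s * ?w (p g) s) \<partial>\<nu>)"
    using L by (simp add: j)
  also have "\<dots> = ?J f g"
  proof (intro integral_cong_AE)
    show "AE s in \<nu>. ?w (p f) s * ?w (p g) s + ?w (n f) s * ?w (n g) s
        - (?w (p f) s * ?w (n g) s + ?w (n f) s * ?w (p g) s) = ?w f s * ?w g s"
      using W[OF f] W[OF g] by eventually_elim (simp only:, simp add: algebra_simps)
  qed measurable
  finally show ?thesis .
qed

lemma op_positive: "f \<in> L2 \<pi> \<Longrightarrow> 0 \<le> (\<integral>x. f x * kernel_op P f x \<partial>\<pi>)"
  by (simp add: op_inner integral_nonneg)

lemma op_symmetric:
  "f \<in> L2 \<pi> \<Longrightarrow> g \<in> L2 \<pi> \<Longrightarrow> (\<integral>x. f x * kernel_op P g x \<partial>\<pi>) = (\<integral>x. kernel_op P f x * g x \<partial>\<pi>)"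
  using op_inner[of f g] op_inner[of g f] by (simp add: mult.commute)

lemma positive_L2_operator: "positive_L2_operator \<pi> P"
  unfolding positive_L2_operator_def defines_L2_operator_def
  using op_integrable op_L2 op_cong_AE op_positive by blast

abbreviation "opn k \<equiv> (kernel_op P ^^ k)"

lemma opn_L2: "f \<in> L2 \<pi> \<Longrightarrow> opn k f \<in> L2 \<pi>"
  by (induction k) (auto intro: op_L2)

lemma opn_integral: "f \<in> L2 \<pi> \<Longrightarrow> (\<integral>x. opn k f x \<partial>\<pi>) = (\<integral>x. f x \<partial>\<pi>)"
proof (induction k)
  case (Suc k)
  then show ?case
    using P.K_preserves_integral(1)[OF L2_integrable[OF opn_L2[OF Suc.prems, of k]]]
    by (simp add: kernel_op_def[abs_def])
qed simp

lemma opn_symmetric: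
  assumes f: "f \<in> L2 \<pi>" and g: "g \<in> L2 \<pi>"
  shows "(\<integral>x. f x * opn k g x \<partial>\<pi>) = (\<integral>x. opn k f x * g x \<partial>\<pi>)"
  using g
proof (induction k arbitrary: g)
  case (Suc k)
  have "(\<integral>x. f x * opn (Suc k) g x \<partial>\<pi>) = (\<integral>x. f x * opn k (kernel_op P g) x \<partial>\<pi>)"
    by (simp add: funpow_swap1)
  also have "\<dots> = (\<integral>x. opn k f x * kernel_op P g x \<partial>\<pi>)" by (rule Suc.IH[OF op_L2[OF Suc.prems]])
  also have "\<dots> = (\<integral>x. kernel_op P (opn k f) x * g x \<partial>\<pi>)"
    using opn_L2[OF f] Suc.prems by (rule op_symmetric)
  finally show ?case by simp
qed simp

lemma opn_split:
  assumes f: "f \<in> L2 \<pi>"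
  shows "(\<integral>x. f x * opn (k + l) f x \<partial>\<pi>) = (\<integral>x. opn k f x * opn l f x \<partial>\<pi>)"
  using opn_symmetric[OF f opn_L2[OF f, of l], of k] by (simp add: funpow_add)

text \<open>By symmetry half of the powers move to the other side. An even power becomes a squared
  norm; an odd one leaves a single \<open>P\<close> in the middle, where positivity of the operator
  applies.\<close>

lemma opn_nonneg:
  assumes f: "f \<in> L2 \<pi>"
  shows "0 \<le> (\<integral>x. f x * opn k f x \<partial>\<pi>)"
proof (cases "even k")
  case True
  then obtain j where k: "k = j + j" by (auto elim!: evenE simp: mult_2)
  show ?thesis unfolding k opn_split[OF f] by (rule Bochner_Integration.integral_nonneg) simp
next
  case False
  then obtain j where k: "k = j + Suc j" by (auto elim!: oddE simp: mult_2)
  show ?thesis unfolding k opn_split[OF f] using op_positive[OF opn_L2[OF f, of j]] by simp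
qed

end

lemma (in prob_space) L2_Cauchy_Schwarz:
  assumes f: "f \<in> L2 M" and g: "g \<in> L2 M"
  shows "(\<integral>x. f x * g x \<partial>M)\<^sup>2 \<le> (\<integral>x. (f x)\<^sup>2 \<partial>M) * (\<integral>x. (g x)\<^sup>2 \<partial>M)"
proof -
  note [measurable] = L2_D(1)[OF f] L2_D(1)[OF g]
  have "ennreal \<bar>\<integral>x. f x * g x \<partial>M\<bar> \<le> (\<integral>\<^sup>+x. ennreal \<bar>f x\<bar> * ennreal \<bar>g x\<bar> \<partial>M)"
    using integral_norm_bound_ennreal[OF L2_prod_integrable[OF f g]] by (simp add: abs_mult ennreal_mult)
  then have "(ennreal \<bar>\<integral>x. f x * g x \<partial>M\<bar>)\<^sup>2 \<le> (\<integral>\<^sup>+x. ennreal \<bar>f x\<bar> * ennreal \<bar>g x\<bar> \<partial>M)\<^sup>2"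
    by (rule power_mono) simp
  also have "\<dots> \<le> (\<integral>\<^sup>+x. (ennreal \<bar>f x\<bar>)\<^sup>2 \<partial>M) * (\<integral>\<^sup>+x. (ennreal \<bar>g x\<bar>)\<^sup>2 \<partial>M)"
    by (rule Cauchy_Schwarz_nn_integral) auto
  also have "\<dots> = ennreal ((\<integral>x. (f x)\<^sup>2 \<partial>M) * (\<integral>x. (g x)\<^sup>2 \<partial>M))"
    using L2_D(2)[OF f] L2_D(2)[OF g]
    by (simp add: ennreal_power ennreal_mult nn_integral_eq_integral integral_nonneg)
  finally have "ennreal (\<bar>\<integral>x. f x * g x \<partial>M\<bar>\<^sup>2) \<le> ennreal ((\<integral>x. (f x)\<^sup>2 \<partial>M) * (\<integral>x. (g x)\<^sup>2 \<partial>M))"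
    by (simp add: ennreal_power)
  then show ?thesis by (subst (asm) ennreal_le_iff) (auto intro!: mult_nonneg_nonneg Bochner_Integration.integral_nonneg)
qed

text \<open>The discriminant argument, including the case in which the quadratic degenerates to an
  affine function.\<close>

lemma semi_inner_Cauchy_Schwarz:
  fixes a b c :: real
  assumes "\<And>t. 0 \<le> a + 2 * t * b + t\<^sup>2 * c" "0 \<le> c"
  shows "b\<^sup>2 \<le> a * c"
proof (cases "c = 0")
  case True
  have "b = 0"
  proof (rule ccontr)
    assume "b \<noteq> 0"
    \<comment> \<open>With \<open>c = 0\<close> this choice of \<open>t\<close> makes the expression
      equal to \<open>-1\<close>.\<close>
    then show False using assms(1)[of "- (a + 1) / (2 * b)"] True by (simp add: field_simps)
  qed
  then show ?thesis using True by simp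
next
  case False
  then have "c > 0" using assms(2) by simp
  have "0 \<le> a + 2 * (- b / c) * b + (- b / c)\<^sup>2 * c" by (rule assms)
  also have "\<dots> = a - b\<^sup>2 / c" using \<open>c > 0\<close> by (simp add: field_simps power2_eq_square)
  finally show ?thesis using \<open>c > 0\<close> by (simp add: field_simps)
qed

context factored_kernel
begin

lemma op_Cauchy_Schwarz:
  assumes f: "f \<in> L2 \<pi>" and g: "g \<in> L2 \<pi>"
  shows "(\<integral>x. f x * kernel_op P g x \<partial>\<pi>)\<^sup>2 \<le>
    (\<integral>x. f x * kernel_op P f x \<partial>\<pi>) * (\<integral>x. g x * kernel_op P g x \<partial>\<pi>)"
proof (rule semi_inner_Cauchy_Schwarz)
  show "0 \<le> (\<integral>x. g x * kernel_op P g x \<partial>\<pi>)" by (rule op_positive[OF g])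
  fix t :: real
  let ?F = "\<lambda>s. \<integral>x. f x \<partial>W s" and ?G = "\<lambda>s. \<integral>x. g x \<partial>W s"
  have i: "integrable \<nu> (\<lambda>s. ?F s * ?F s)" "integrable \<nu> (\<lambda>s. ?F s * ?G s)" "integrable \<nu> (\<lambda>s. ?G s * ?G s)"
    by (intro L2_prod_integrable W.K_L2 f g)+
  have "0 \<le> (\<integral>s. (?F s + t * ?G s)\<^sup>2 \<partial>\<nu>)" by (rule Bochner_Integration.integral_nonneg) simp
  also have "\<dots> = (\<integral>s. ?F s * ?F s + (2 * t) * (?F s * ?G s) + t\<^sup>2 * (?G s * ?G s) \<partial>\<nu>)"
    by (simp add: power2_sum power_mult_distrib algebra_simps power2_eq_square)
  also have "\<dots> = (\<integral>s. ?F s * ?F s \<partial>\<nu>) + 2 * t * (\<integral>s. ?F s * ?G s \<partial>\<nu>) + t\<^sup>2 * (\<integral>s. ?G s * ?G s \<partial>\<nu>)"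
    using i by simp
  finally show "0 \<le> (\<integral>x. f x * kernel_op P f x \<partial>\<pi>) + 2 * t * (\<integral>x. f x * kernel_op P g x \<partial>\<pi>)
      + t\<^sup>2 * (\<integral>x. g x * kernel_op P g x \<partial>\<pi>)"
    by (simp add: op_inner f g)
qed

text \<open>Cauchy-Schwarz for \<open>opn j f\<close> and \<open>opn (Suc j) f\<close>: in the inner
  product of \<open>L2\<close> for even \<open>k\<close>, in the semi-inner product given by the
  positive operator \<open>P\<close> for odd \<open>k\<close>.\<close>

lemma moments_log_convex:
  assumes f: "f \<in> L2 \<pi>"
  shows "(\<integral>x. f x * opn (Suc k) f x \<partial>\<pi>)\<^sup>2 \<le>
    (\<integral>x. f x * opn k f x \<partial>\<pi>) * (\<integral>x. f x * opn (Suc (Suc k)) f x \<partial>\<pi>)"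
proof (cases "even k")
  case True
  then obtain j where k: "k = j + j" by (auto elim!: evenE simp: mult_2)
  show ?thesis
    using L2_Cauchy_Schwarz[OF opn_L2[OF f, of j] opn_L2[OF f, of "Suc j"]]
      opn_split[OF f, of j j] opn_split[OF f, of "Suc j" "Suc j"] opn_split[OF f, of j "Suc j"]
    by (simp add: power2_eq_square k)
next
  case False
  then obtain j where k: "k = j + Suc j" by (auto elim!: oddE simp: mult_2)
  show ?thesis
    using op_Cauchy_Schwarz[OF opn_L2[OF f, of j] opn_L2[OF f, of "Suc j"]]
      opn_split[OF f, of j "Suc j"] opn_split[OF f, of "Suc j" "Suc (Suc j)"] opn_split[OF f, of j "Suc (Suc j)"]
    by (simp add: k)
qed

text \<open>Log-convexity makes the ratios of successive moments nondecreasing, so each is at least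
  the first one, the Rayleigh quotient. This takes the place of a spectral measure of
  \<open>f\<close>.\<close>

lemma moments_lower_bound:
  assumes f: "f \<in> L2 \<pi>" and pos: "0 < (\<integral>x. f x * f x \<partial>\<pi>)"
  shows "(\<integral>x. f x * f x \<partial>\<pi>) * ((\<integral>x. f x * kernel_op P f x \<partial>\<pi>) / (\<integral>x. f x * f x \<partial>\<pi>)) ^ k
    \<le> (\<integral>x. f x * opn k f x \<partial>\<pi>)"
proof -
  define m where "m k = (\<integral>x. f x * opn k f x \<partial>\<pi>)" for k
  define r where "r = m 1 / m 0"
  have m0: "m 0 > 0" using pos by (simp add: m_def)
  have nn: "0 \<le> m k" for k unfolding m_def by (rule opn_nonneg[OF f])
  have cv: "(m (Suc k))\<^sup>2 \<le> m k * m (Suc (Suc k))" for k unfolding m_def by (rule moments_log_convex[OF f])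
  have r0: "0 \<le> r" using m0 nn[of 1] by (simp add: r_def)
  have step: "r * m k \<le> m (Suc k)" for k
  proof (cases "r = 0")
    case False
    then have r: "r > 0" using r0 by simp
    \<comment> \<open>Positivity is carried along because the step cancels the factor
      \<open>m k\<close>.\<close>
    have "m k > 0 \<and> r * m k \<le> m (Suc k)"
    proof (induction k)
      case 0 then show ?case using m0 by (simp add: r_def One_nat_def)
    next
      case (Suc k)
      then have k: "m k > 0" "r * m k \<le> m (Suc k)" by auto
      then have s: "m (Suc k) > 0" using r by (smt (verit) mult_pos_pos)
      have "(r * m (Suc k)) * m k \<le> m (Suc k) * m (Suc k)"
        using k(2) s by (simp add: mult.commute mult.left_commute)
      also have "\<dots> \<le> m (Suc (Suc k)) * m k" using cv[of k] by (simp add: power2_eq_square mult.commute)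
      finally have "r * m (Suc k) \<le> m (Suc (Suc k))" using k(1) by simp
      with s show ?case by simp
    qed
    then show ?thesis by simp
  qed (simp add: nn)
  have "m 0 * r ^ k \<le> m k"
  proof (induction k)
    case (Suc k)
    have "m 0 * r ^ Suc k = r * (m 0 * r ^ k)" by simp
    also have "\<dots> \<le> r * m k" using Suc r0 by (rule mult_left_mono)
    also have "\<dots> \<le> m (Suc k)" by (rule step)
    finally show ?case .
  qed simp
  then show ?thesis by (simp add: m_def r_def One_nat_def)
qed

end

section \<open>Powers of a kernel\<close>

text \<open>The theorem iterates the kernel on \<open>X\<close>, the locale iterates it on
  \<open>\<pi>\<close>; the measure enters only through \<open>return\<close>, hence only through
  its sigma-algebra.\<close>

lemma kernel_pow_cong_sets:
  assumes "sets S = sets S'" shows "kernel_pow S P k = kernel_pow S' P k"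
proof (induction k)
  case 0 then show ?case using return_sets_cong[OF assms] by (auto simp: fun_eq_iff)
qed (auto simp: fun_eq_iff)

lemma kernel_pow_kernel:
  assumes P: "P \<in> S \<rightarrow>\<^sub>M prob_algebra S"
  shows "kernel_pow S P k \<in> S \<rightarrow>\<^sub>M prob_algebra S"
proof (induction k)
  case 0
  have "kernel_pow S P 0 = return S" by (auto simp: fun_eq_iff)
  then show ?case by simp
next
  case (Suc k)
  have "kernel_pow S P (Suc k) = (\<lambda>x. bind (kernel_pow S P k x) P)" by (auto simp: fun_eq_iff)
  then show ?case using measurable_bind_prob_space[OF Suc P] by simp
qed

lemma nn_integral_kernel_pow_Suc:
  assumes P: "P \<in> S \<rightarrow>\<^sub>M prob_algebra S" and x: "x \<in> space S" and f: "f \<in> borel_measurable S"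
  shows "(\<integral>\<^sup>+y. f y \<partial>kernel_pow S P (Suc k) x) = (\<integral>\<^sup>+y. \<integral>\<^sup>+z. f z \<partial>P y \<partial>kernel_pow S P k x)"
  using nn_integral_bind_kernel[OF P prob_kernelD(2)[OF kernel_pow_kernel[OF P] x] f] by simp

text \<open>\<open>kernel_pow\<close> appends a new step at the end. Time reversal turns the last
  step into the first one, so this second form is needed as well.\<close>

lemma nn_integral_kernel_pow_Suc':
  assumes P: "P \<in> S \<rightarrow>\<^sub>M prob_algebra S" and x: "x \<in> space S" and f: "f \<in> borel_measurable S"
  shows "(\<integral>\<^sup>+y. f y \<partial>kernel_pow S P (Suc k) x) = (\<integral>\<^sup>+y. \<integral>\<^sup>+z. f z \<partial>kernel_pow S P k y \<partial>P x)"
  using f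
proof (induction k arbitrary: f)
  case 0
  have "(\<integral>\<^sup>+y. f y \<partial>kernel_pow S P (Suc 0) x) = (\<integral>\<^sup>+y. f y \<partial>P x)"
    using nn_integral_kernel_pow_Suc[OF P x 0, of 0] nn_integral_kernel_measurable[OF P 0] x
    by (simp add: nn_integral_return)
  also have "\<dots> = (\<integral>\<^sup>+y. \<integral>\<^sup>+z. f z \<partial>kernel_pow S P 0 y \<partial>P x)"
    using prob_kernelD(3)[OF P x] 0 by (intro nn_integral_cong) (simp add: nn_integral_return)
  finally show ?case .
next
  case (Suc k)
  have m: "(\<lambda>y. \<integral>\<^sup>+z. f z \<partial>P y) \<in> borel_measurable S" by (rule nn_integral_kernel_measurable[OF P Suc.prems])
  have "(\<integral>\<^sup>+y. f y \<partial>kernel_pow S P (Suc (Suc k)) x) = (\<integral>\<^sup>+y. \<integral>\<^sup>+z. f z \<partial>P y \<partial>kernel_pow S P (Suc k) x)"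
    by (rule nn_integral_kernel_pow_Suc[OF P x Suc.prems])
  also have "\<dots> = (\<integral>\<^sup>+y. \<integral>\<^sup>+z. \<integral>\<^sup>+w. f w \<partial>P z \<partial>kernel_pow S P k y \<partial>P x)" by (rule Suc.IH[OF m])
  also have "\<dots> = (\<integral>\<^sup>+y. \<integral>\<^sup>+z. f z \<partial>kernel_pow S P (Suc k) y \<partial>P x)"
    using prob_kernelD(3)[OF P x] Suc.prems
    by (intro nn_integral_cong nn_integral_kernel_pow_Suc[OF P, symmetric]) auto
  finally show ?case .
qed

context factored_kernel
begin

abbreviation "Pn k \<equiv> kernel_pow \<pi> P k"

lemma Pn_kernel: "Pn k \<in> \<pi> \<rightarrow>\<^sub>M prob_algebra \<pi>"
  by (rule kernel_pow_kernel[OF P_kernel])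

text \<open>First the power and then the single step are moved across, so the steps come out in
  reverse order.\<close>

lemma Pn_nn_symmetric:
  assumes f: "f \<in> borel_measurable \<pi>" and g: "g \<in> borel_measurable \<pi>"
  shows "(\<integral>\<^sup>+x. f x * (\<integral>\<^sup>+y. g y \<partial>Pn k x) \<partial>\<pi>) = (\<integral>\<^sup>+x. g x * (\<integral>\<^sup>+y. f y \<partial>Pn k x) \<partial>\<pi>)"
  using f g
proof (induction k arbitrary: f g)
  case 0
  have "(\<integral>\<^sup>+x. f x * (\<integral>\<^sup>+y. g y \<partial>Pn 0 x) \<partial>\<pi>) = (\<integral>\<^sup>+x. f x * g x \<partial>\<pi>)"
    using 0 by (intro nn_integral_cong) (simp add: nn_integral_return)
  also have "\<dots> = (\<integral>\<^sup>+x. g x * (\<integral>\<^sup>+y. f y \<partial>Pn 0 x) \<partial>\<pi>)"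
    using 0 by (intro nn_integral_cong) (simp add: nn_integral_return mult.commute)
  finally show ?case .
next
  case (Suc k)
  note m = nn_integral_kernel_measurable[OF P_kernel] nn_integral_kernel_measurable[OF Pn_kernel]
  have "(\<integral>\<^sup>+x. f x * (\<integral>\<^sup>+y. g y \<partial>Pn (Suc k) x) \<partial>\<pi>) = (\<integral>\<^sup>+x. f x * (\<integral>\<^sup>+y. \<integral>\<^sup>+z. g z \<partial>P y \<partial>Pn k x) \<partial>\<pi>)"
    using Suc.prems by (intro nn_integral_cong) (simp only: nn_integral_kernel_pow_Suc[OF P_kernel])
  also have "\<dots> = (\<integral>\<^sup>+x. (\<integral>\<^sup>+z. g z \<partial>P x) * (\<integral>\<^sup>+y. f y \<partial>Pn k x) \<partial>\<pi>)"
    using Suc.prems by (intro Suc.IH m) auto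
  also have "\<dots> = (\<integral>\<^sup>+x. (\<integral>\<^sup>+y. f y \<partial>Pn k x) * (\<integral>\<^sup>+z. g z \<partial>P x) \<partial>\<pi>)" by (simp add: mult.commute)
  also have "\<dots> = (\<integral>\<^sup>+x. g x * (\<integral>\<^sup>+y. \<integral>\<^sup>+z. f z \<partial>Pn k y \<partial>P x) \<partial>\<pi>)"
    using Suc.prems by (intro nn_symmetric m) auto
  also have "\<dots> = (\<integral>\<^sup>+x. g x * (\<integral>\<^sup>+y. f y \<partial>Pn (Suc k) x) \<partial>\<pi>)"
    using Suc.prems by (intro nn_integral_cong) (simp only: nn_integral_kernel_pow_Suc'[OF P_kernel])
  finally show ?case .
qed

lemma Pn_mp: "mp_kernel \<pi> (Pn k) \<pi>"
proof
  fix f :: "'a \<Rightarrow> ennreal" assume f: "f \<in> borel_measurable \<pi>"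
  have "(\<integral>\<^sup>+x. \<integral>\<^sup>+y. f y \<partial>Pn k x \<partial>\<pi>) = (\<integral>\<^sup>+x. f x * (\<integral>\<^sup>+y. 1 \<partial>Pn k x) \<partial>\<pi>)"
    using Pn_nn_symmetric[OF f, of "\<lambda>_. 1" k] by simp
  also have "\<dots> = (\<integral>\<^sup>+x. f x \<partial>\<pi>)"
    by (intro nn_integral_cong) (simp only: nn_integral_kernel_const[OF Pn_kernel] mult_1_right)
  finally show "(\<integral>\<^sup>+x. \<integral>\<^sup>+y. f y \<partial>Pn k x \<partial>\<pi>) = (\<integral>\<^sup>+x. f x \<partial>\<pi>)" .
qed (fact Pn_kernel, unfold_locales)

end

section \<open>Minorised kernels\<close>

lemma minor_nn_integral:
  assumes Q: "finite_measure Q" "finite_measure \<pi>" "sets Q = sets \<pi>" and c: "0 \<le> c"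
    and minor: "\<And>B. B \<in> sets \<pi> \<Longrightarrow> c * measure \<pi> B \<le> measure Q B"
    and f: "f \<in> borel_measurable \<pi>"
  shows "ennreal c * (\<integral>\<^sup>+x. f x \<partial>\<pi>) \<le> (\<integral>\<^sup>+x. f x \<partial>Q)"
proof -
  interpret Q: finite_measure Q by fact
  interpret \<pi>: finite_measure \<pi> by fact
  have "emeasure (scale_measure (ennreal c) \<pi>) B \<le> emeasure Q B" if "B \<in> sets \<pi>" for B
    using minor[OF that] c by (simp add: \<pi>.emeasure_eq_measure Q.emeasure_eq_measure flip: ennreal_mult)
  then have "scale_measure (ennreal c) \<pi> \<le> Q" by (subst le_measure) (auto simp: Q)
  then have "(\<integral>\<^sup>+x. f x \<partial>scale_measure (ennreal c) \<pi>) \<le> (\<integral>\<^sup>+x. f x \<partial>Q)"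
    by (intro nn_integral_mono_measure) (simp_all add: Q)
  then show ?thesis using f by (simp add: nn_integral_scale_measure)
qed

lemma minor_integral:
  fixes f :: "'a \<Rightarrow> real"
  assumes Q: "finite_measure Q" "finite_measure \<pi>" "sets Q = sets \<pi>" and c: "0 \<le> c"
    and minor: "\<And>B. B \<in> sets \<pi> \<Longrightarrow> c * measure \<pi> B \<le> measure Q B"
    and f: "integrable \<pi> f" "integrable Q f" "\<And>x. 0 \<le> f x"
  shows "c * (\<integral>x. f x \<partial>\<pi>) \<le> (\<integral>x. f x \<partial>Q)"
proof -
  have "ennreal c * (\<integral>\<^sup>+x. ennreal (f x) \<partial>\<pi>) \<le> (\<integral>\<^sup>+x. ennreal (f x) \<partial>Q)"
    by (rule minor_nn_integral) (use assms in auto)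
  then show ?thesis
    using f c by (simp add: nn_integral_eq_integral integral_nonneg flip: ennreal_mult)
qed

text \<open>The supremum in \<open>tv_dist\<close> is one of real numbers, so it dominates its
  elements only once boundedness is known.\<close>

lemma tv_dist_bdd:
  assumes "prob_space \<nu>" "prob_space \<mu>" "sets \<nu> = sets \<mu>"
  shows "bdd_above ((\<lambda>f. (\<integral>x. f x \<partial>\<nu>) - (\<integral>x. f x \<partial>\<mu>)) ` {f \<in> borel_measurable \<mu>. \<forall>x\<in>space \<mu>. f x \<in> {-1..1::real}})"
proof (rule bdd_aboveI2[where M=2])
  interpret \<nu>: prob_space \<nu> by fact
  interpret \<mu>: prob_space \<mu> by fact
  fix f assume f: "f \<in> {f \<in> borel_measurable \<mu>. \<forall>x\<in>space \<mu>. f x \<in> {-1..1::real}}"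
  have sp: "space \<nu> = space \<mu>" using assms(3) by (rule sets_eq_imp_space_eq)
  have i: "integrable \<nu> f" using f assms(3) sp
    by (intro \<nu>.integrable_const_bound[where B=1]) (auto cong: measurable_cong_sets simp: abs_le_iff)
  have j: "integrable \<mu> f" using f
    by (intro \<mu>.integrable_const_bound[where B=1]) (auto simp: abs_le_iff)
  have "(\<integral>x. f x \<partial>\<nu>) \<le> 1" by (rule \<nu>.integral_le_const[OF i]) (use f sp in auto)
  moreover have "-1 \<le> (\<integral>x. f x \<partial>\<mu>)" by (rule \<mu>.integral_ge_const[OF j]) (use f in auto)
  ultimately show "(\<integral>x. f x \<partial>\<nu>) - (\<integral>x. f x \<partial>\<mu>) \<le> 2" by simp
qed

lemma tv_dist_upper:
  assumes "prob_space \<nu>" "prob_space \<mu>" "sets \<nu> = sets \<mu>"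
    and f: "f \<in> borel_measurable \<mu>" "\<And>x. x \<in> space \<mu> \<Longrightarrow> \<bar>f x\<bar> \<le> (1::real)"
  shows "(\<integral>x. f x \<partial>\<nu>) - (\<integral>x. f x \<partial>\<mu>) \<le> 2 * tv_dist \<nu> \<mu>"
  unfolding tv_dist_def
  using cSUP_upper[OF _ tv_dist_bdd[OF assms(1-3)], of f] f
  by (auto simp: abs_le_iff)

text \<open>The test function \<open>2 * indicator A - 1\<close> uses the whole range from -1 to 1
  and thereby absorbs the factor 1/2 of \<open>tv_dist\<close>.\<close>

lemma tv_dist_set:
  assumes "prob_space \<nu>" "prob_space \<mu>" "sets \<nu> = sets \<mu>" and A: "A \<in> sets \<mu>"
  shows "measure \<nu> A - measure \<mu> A \<le> tv_dist \<nu> \<mu>"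
proof -
  interpret \<nu>: prob_space \<nu> by fact
  interpret \<mu>: prob_space \<mu> by fact
  have A': "A \<in> sets \<nu>" using A assms(3) by simp
  have "(\<integral>x. 2 * indicator A x - 1 \<partial>\<nu>) - (\<integral>x. 2 * indicator A x - 1 \<partial>\<mu>) \<le> 2 * tv_dist \<nu> \<mu>"
    by (rule tv_dist_upper[OF assms(1-3)]) (use A in \<open>auto simp: indicator_def\<close>)
  moreover have "(\<integral>x. 2 * indicator A x - 1 \<partial>\<nu>) = 2 * measure \<nu> A - 1"
    using A' by (simp add: \<nu>.prob_space \<nu>.emeasure_eq_measure)
  moreover have "(\<integral>x. 2 * indicator A x - 1 \<partial>\<mu>) = 2 * measure \<mu> A - 1"
    using A by (simp add: \<mu>.prob_space \<mu>.emeasure_eq_measure)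
  ultimately show ?thesis by simp
qed

text \<open>The minorisation applied to the nonnegative function \<open>1 - f\<close> bounds the
  difference of the integrals of \<open>f\<close> by \<open>(1 - c)\<close> times the integral of
  \<open>1 - f\<close> under \<open>\<pi>\<close>, and that integral is at most 2.\<close>

lemma tv_dist_minor:
  assumes "prob_space Q" "prob_space \<pi>" "sets Q = sets \<pi>" and c: "0 \<le> c"
    and minor: "\<And>B. B \<in> sets \<pi> \<Longrightarrow> c * measure \<pi> B \<le> measure Q B"
  shows "tv_dist Q \<pi> \<le> 1 - c"
proof -
  interpret Q: prob_space Q by fact
  interpret \<pi>: prob_space \<pi> by fact
  have sp: "space Q = space \<pi>" using assms(3) by (rule sets_eq_imp_space_eq)
  have c1: "c \<le> 1" using minor[OF sets.top] sp Q.prob_space \<pi>.prob_space by simp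
  have "(SUP f\<in>{f \<in> borel_measurable \<pi>. \<forall>x\<in>space \<pi>. f x \<in> {-1..1::real}}.
      (\<integral>x. f x \<partial>Q) - (\<integral>x. f x \<partial>\<pi>)) \<le> 2 * (1 - c)"
  proof (rule cSUP_least)
    show "{f \<in> borel_measurable \<pi>. \<forall>x\<in>space \<pi>. f x \<in> {-1..1::real}} \<noteq> {}"
      by (intro ex_in_conv[THEN iffD1] exI[of _ "\<lambda>_. 0"]) auto
    fix f assume f: "f \<in> {f \<in> borel_measurable \<pi>. \<forall>x\<in>space \<pi>. f x \<in> {-1..1::real}}"
    \<comment> \<open>The truncation acts only outside the space, where \<open>f\<close> may exceed
      1.\<close>
    define g where "g x = max 0 (1 - f x)" for x
    have m: "f \<in> borel_measurable \<pi>" "f \<in> borel_measurable Q" using f assms(3) by (auto cong: measurable_cong_sets)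
    have i: "integrable Q f" using f m sp
      by (intro Q.integrable_const_bound[where B=1]) (auto simp: abs_le_iff)
    have j: "integrable \<pi> f" using f m
      by (intro \<pi>.integrable_const_bound[where B=1]) (auto simp: abs_le_iff)
    have "c * (\<integral>x. g x \<partial>\<pi>) \<le> (\<integral>x. g x \<partial>Q)"
      by (rule minor_integral)
        (use i j c minor assms(3) in \<open>auto simp: g_def Q.finite_measure_axioms \<pi>.finite_measure_axioms\<close>)
    also have "(\<integral>x. g x \<partial>Q) = (\<integral>x. 1 - f x \<partial>Q)"
      using f sp by (intro Bochner_Integration.integral_cong) (auto simp: g_def)
    also have "(\<integral>x. g x \<partial>\<pi>) = (\<integral>x. 1 - f x \<partial>\<pi>)"
      using f by (intro Bochner_Integration.integral_cong) (auto simp: g_def)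
    finally have le: "c * (1 - (\<integral>x. f x \<partial>\<pi>)) \<le> 1 - (\<integral>x. f x \<partial>Q)"
      using i j by (simp add: Q.prob_space \<pi>.prob_space)
    have "-1 \<le> (\<integral>x. f x \<partial>\<pi>)" by (rule \<pi>.integral_ge_const[OF j]) (use f in auto)
    then have "(1 - c) * (1 - (\<integral>x. f x \<partial>\<pi>)) \<le> (1 - c) * 2" using c1 by (intro mult_left_mono) auto
    then show "(\<integral>x. f x \<partial>Q) - (\<integral>x. f x \<partial>\<pi>) \<le> 2 * (1 - c)" using le by (simp add: algebra_simps)
  qed
  then show ?thesis by (simp add: tv_dist_def)
qed

definition minorised :: "'a measure \<Rightarrow> real \<Rightarrow> 'a measure \<Rightarrow> bool" where
  "minorised \<pi> c Q \<longleftrightarrow> (\<forall>B\<in>sets \<pi>. c * measure \<pi> B \<le> measure Q B)"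

text \<open>The share \<open>c\<close> of \<open>Q\<close> that is distributed as
  \<open>\<pi>\<close> remains so by invariance, and the rest is minorised afresh, so the defects
  \<open>1 - c\<close> and \<open>1 - \<epsilon>\<close> multiply. To avoid splitting measures, the
  argument compares the integrals of the excess \<open>u\<close> of \<open>P y\<close> over
  \<open>\<epsilon>\<close> times \<open>\<pi>\<close> on the set \<open>B\<close>.\<close>

lemma minorised_step:
  assumes P: "P \<in> \<pi> \<rightarrow>\<^sub>M prob_algebra \<pi>" and \<pi>: "prob_space \<pi>"
    and inv: "\<And>f. f \<in> borel_measurable \<pi> \<Longrightarrow> (\<integral>\<^sup>+x. \<integral>\<^sup>+y. f y \<partial>P x \<partial>\<pi>) = (\<integral>\<^sup>+x. f x \<partial>\<pi>)"
    and Q: "prob_space Q" "sets Q = sets \<pi>" and c: "0 \<le> c" "0 \<le> \<epsilon>"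
    and minQ: "minorised \<pi> c Q"
    and aeQ: "AE y in Q. minorised \<pi> \<epsilon> (P y)" and ae\<pi>: "AE y in \<pi>. minorised \<pi> \<epsilon> (P y)"
  shows "minorised \<pi> (1 - (1 - c) * (1 - \<epsilon>)) (bind Q P)"
  unfolding minorised_def
proof
  interpret Q: prob_space Q by fact
  interpret \<pi>: prob_space \<pi> by fact
  have PQ: "P \<in> Q \<rightarrow>\<^sub>M prob_algebra \<pi>" using P Q by (simp cong: measurable_cong_sets)
  interpret mp\<pi>: mp_kernel \<pi> P \<pi> by unfold_locales (use P inv \<pi> in auto)
  interpret mpQ: mp_kernel Q P "bind Q P"
  proof (rule mp_kernel.intro)
    have s: "sets (bind Q P) = sets \<pi>" using Q P by (intro sets_bind') (auto simp: space_prob_algebra)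
    show "P \<in> Q \<rightarrow>\<^sub>M prob_algebra (bind Q P)" using PQ by (simp add: prob_algebra_cong[OF s])
    show "prob_space (bind Q P)" using Q P by (intro prob_space_bind') (auto simp: space_prob_algebra)
    fix f :: "'a \<Rightarrow> ennreal" assume "f \<in> borel_measurable (bind Q P)"
    then show "(\<integral>\<^sup>+s. \<integral>\<^sup>+x. f x \<partial>P s \<partial>Q) = (\<integral>\<^sup>+x. f x \<partial>bind Q P)"
      using s by (intro nn_integral_bind_kernel[OF PQ, symmetric]) (auto cong: measurable_cong_sets)
  qed
  interpret QP: prob_space "bind Q P" by (rule mpQ.pi_prob)
  fix B assume B [measurable]: "B \<in> sets \<pi>"
  have s: "sets (bind Q P) = sets \<pi>" using Q P by (intro sets_bind') (auto simp: space_prob_algebra)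
  define g where "g y = measure (P y) B" for y
  \<comment> \<open>The maximum makes \<open>u\<close> nonnegative everywhere, although the
    minorisation of \<open>P y\<close> holds only almost everywhere.\<close>
  define u where "u y = max 0 (g y - \<epsilon> * measure \<pi> B)" for y
  have g_int: "g y = (\<integral>z. indicator B z \<partial>P y)" if "y \<in> space \<pi>" for y
    using prob_kernelD[OF P that] B by (simp add: g_def)
  have i\<pi>: "integrable \<pi> g" "(\<integral>y. g y \<partial>\<pi>) = measure \<pi> B"
  proof -
    have "integrable \<pi> (indicator B :: _ \<Rightarrow> real)" using B by (simp add: \<pi>.emeasure_eq_measure)
    from mp\<pi>.K_preserves_integral[OF this] show "integrable \<pi> g" "(\<integral>y. g y \<partial>\<pi>) = measure \<pi> B"
      using B by (auto simp: g_int cong: Bochner_Integration.integral_cong Bochner_Integration.integrable_cong)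
  qed
  have spQ: "space Q = space \<pi>" using Q(2) by (rule sets_eq_imp_space_eq)
  have iQ: "integrable Q g" "(\<integral>y. g y \<partial>Q) = measure (bind Q P) B"
  proof -
    have e: "g y = (\<integral>z. indicator B z \<partial>P y)" if "y \<in> space Q" for y using g_int that spQ by simp
    have "integrable (bind Q P) (indicator B :: _ \<Rightarrow> real)" using B s by (simp add: QP.emeasure_eq_measure)
    note k = mpQ.K_preserves_integral[OF this]
    show "integrable Q g" using k(2) by (subst Bochner_Integration.integrable_cong[OF refl e])
    have "(\<integral>y. g y \<partial>Q) = (\<integral>y. \<integral>z. indicator B z \<partial>P y \<partial>Q)"
      by (rule Bochner_Integration.integral_cong[OF refl e])
    also have "\<dots> = (\<integral>x. indicator B x \<partial>bind Q P)" by (rule k(1))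
    also have "\<dots> = measure (bind Q P) B" using B s by simp
    finally show "(\<integral>y. g y \<partial>Q) = measure (bind Q P) B" .
  qed
  have u: "AE y in Q. g y = u y + \<epsilon> * measure \<pi> B" "AE y in \<pi>. g y = u y + \<epsilon> * measure \<pi> B"
    using aeQ ae\<pi> B by (auto simp: u_def g_def minorised_def elim!: eventually_mono)
  have iu: "integrable \<pi> u" "integrable Q u" using i\<pi> iQ by (auto simp: u_def[abs_def])
  have u0: "0 \<le> u y" for y by (simp add: u_def)
  have "c * (\<integral>y. u y \<partial>\<pi>) \<le> (\<integral>y. u y \<partial>Q)"
    by (rule minor_integral)
      (use iu c minQ Q(2) u0 in \<open>auto simp: minorised_def Q.finite_measure_axioms \<pi>.finite_measure_axioms\<close>)
  moreover have "(\<integral>y. g y \<partial>Q) = (\<integral>y. u y + \<epsilon> * measure \<pi> B \<partial>Q)"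
    using u iu iQ by (intro integral_cong_AE) auto
  then have "measure (bind Q P) B = (\<integral>y. u y \<partial>Q) + \<epsilon> * measure \<pi> B"
    using iu iQ by (simp add: Q.prob_space)
  moreover have "(\<integral>y. g y \<partial>\<pi>) = (\<integral>y. u y + \<epsilon> * measure \<pi> B \<partial>\<pi>)"
    using u iu i\<pi> by (intro integral_cong_AE) auto
  then have "(\<integral>y. u y \<partial>\<pi>) = measure \<pi> B - \<epsilon> * measure \<pi> B"
    using iu i\<pi> by (simp add: \<pi>.prob_space)
  ultimately have "c * (measure \<pi> B - \<epsilon> * measure \<pi> B) + \<epsilon> * measure \<pi> B \<le> measure (bind Q P) B" by simp
  then show "(1 - (1 - c) * (1 - \<epsilon>)) * measure \<pi> B \<le> measure (bind Q P) B" by (simp add: algebra_simps)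
qed

lemma minorised_return: "minorised \<pi> 0 Q"
  by (simp add: minorised_def)

context factored_kernel
begin

text \<open>The chain started at a particular \<open>x\<close> may charge a null set of
  \<open>\<pi>\<close>, so the minorisation is required almost everywhere under each
  \<open>Pn j x\<close>. \<open>AE_minorised_pow\<close> provides this for almost every
  \<open>x\<close>.\<close>

lemma minorised_pow:
  assumes x: "x \<in> space \<pi>" and \<epsilon>: "0 \<le> \<epsilon>" "\<epsilon> \<le> 1"
    and ae: "\<And>j. AE y in Pn j x. minorised \<pi> \<epsilon> (P y)" and ae\<pi>: "AE y in \<pi>. minorised \<pi> \<epsilon> (P y)"
  shows "minorised \<pi> (1 - (1 - \<epsilon>) ^ k) (Pn k x)"
proof (induction k)
  case 0 then show ?case using minorised_return by simp
next
  case (Suc k)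
  have "minorised \<pi> (1 - (1 - (1 - (1 - \<epsilon>) ^ k)) * (1 - \<epsilon>)) (bind (Pn k x) P)"
    using prob_kernelD[OF Pn_kernel x] Suc \<epsilon> ae ae\<pi> P.K_preserves
    by (intro minorised_step) (auto simp: P_kernel power_le_one prob_space_axioms)
  then show ?case by (simp add: mult.commute)
qed

lemma AE_minorised_pow:
  assumes \<epsilon>: "0 \<le> \<epsilon>" "\<epsilon> \<le> 1" and ae: "AE y in \<pi>. minorised \<pi> \<epsilon> (P y)"
  shows "AE x in \<pi>. \<forall>k. minorised \<pi> (1 - (1 - \<epsilon>) ^ k) (Pn k x)"
proof -
  have "AE x in \<pi>. \<forall>j. AE y in Pn j x. minorised \<pi> \<epsilon> (P y)"
    by (subst AE_all_countable) (intro allI mp_kernel.K_AE[OF Pn_mp ae])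
  then show ?thesis using AE_space
    by eventually_elim (use minorised_pow[OF _ \<epsilon> _ ae] in auto)
qed

end

text \<open>The positive part \<open>K x - c \<pi>\<close> has mass \<open>1 - c\<close> and, as
  \<open>g\<close> is centred, gives \<open>g\<close> the same integral as \<open>K x\<close>.
  Cauchy-Schwarz for it yields one factor \<open>1 - c\<close>; the integral of its second moment
  over \<open>x\<close> yields the other.\<close>

lemma minorised_contraction:
  assumes K: "mp_kernel \<pi> K \<pi>" and c: "0 \<le> c" "c < 1" and ae: "AE x in \<pi>. minorised \<pi> c (K x)"
    and g: "g \<in> L2 \<pi>" and mean: "(\<integral>x. g x \<partial>\<pi>) = 0"
  shows "(\<integral>x. (\<integral>y. g y \<partial>K x)\<^sup>2 \<partial>\<pi>) \<le> (1 - c)\<^sup>2 * (\<integral>x. (g x)\<^sup>2 \<partial>\<pi>)"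
proof -
  interpret mp_kernel \<pi> K \<pi> by fact
  interpret \<pi>: prob_space \<pi> by (rule pi_prob)
  let ?p = "\<integral>x. (g x)\<^sup>2 \<partial>\<pi>"
  have g1: "integrable \<pi> g" using g by (rule \<pi>.L2_integrable)
  have g2: "integrable \<pi> (\<lambda>x. (g x)\<^sup>2)" using g by (rule L2_D)
  have "AE x in \<pi>. (\<integral>y. g y \<partial>K x)\<^sup>2 \<le> (1 - c) * ((\<integral>y. (g y)\<^sup>2 \<partial>K x) - c * ?p)"
    using ae K_integrable[OF g1] K_integrable[OF g2] AE_space
  proof eventually_elim
    case (elim x)
    interpret Q: prob_space "K x" using prob_kernelD(1)[OF K_kernel, of x] elim by simp
    define q where "q = (\<integral>y. g y \<partial>K x)"
    \<comment> \<open>The optimal shift: minorisation applied to the square of \<open>g - l\<close>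
      is the Cauchy-Schwarz inequality for \<open>K x - c \<pi>\<close>, without forming that
      measure.\<close>
    define l where "l = q / (1 - c)"
    have e: "(g y - l)\<^sup>2 = (g y)\<^sup>2 - 2 * l * g y + l\<^sup>2" for y by (simp add: power2_diff)
    have "c * (\<integral>y. (g y - l)\<^sup>2 \<partial>\<pi>) \<le> (\<integral>y. (g y - l)\<^sup>2 \<partial>K x)"
    proof (rule minor_integral)
      show "integrable \<pi> (\<lambda>y. (g y - l)\<^sup>2)" "integrable (K x) (\<lambda>y. (g y - l)\<^sup>2)"
        unfolding e using g1 g2 elim by auto
      show "sets (K x) = sets \<pi>" using prob_kernelD(2)[OF K_kernel, of x] elim by simp
      show "\<And>B. B \<in> sets \<pi> \<Longrightarrow> c * measure \<pi> B \<le> measure (K x) B" using elim by (simp add: minorised_def)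
    qed (use c in \<open>auto intro: Q.finite_measure_axioms \<pi>.finite_measure_axioms\<close>)
    then have "c * (?p + l\<^sup>2) \<le> (\<integral>y. (g y)\<^sup>2 \<partial>K x) - 2 * l * q + l\<^sup>2"
      unfolding e using g1 g2 elim mean by (simp add: \<pi>.prob_space Q.prob_space q_def)
    then have "2 * l * q - (1 - c) * l\<^sup>2 \<le> (\<integral>y. (g y)\<^sup>2 \<partial>K x) - c * ?p" by (simp add: algebra_simps)
    moreover have "2 * l * q - (1 - c) * l\<^sup>2 = q\<^sup>2 / (1 - c)"
    proof -
      have "(1 - c) * l = q" using c by (simp add: l_def)
      then have "(1 - c) * l\<^sup>2 = q * l" by (simp add: power2_eq_square mult.assoc[symmetric])
      moreover have "l * q = q\<^sup>2 / (1 - c)" by (simp add: l_def power2_eq_square)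
      ultimately show ?thesis by (simp add: algebra_simps)
    qed
    ultimately have "q\<^sup>2 / (1 - c) \<le> (\<integral>y. (g y)\<^sup>2 \<partial>K x) - c * ?p" by simp
    then have "q\<^sup>2 \<le> (1 - c) * ((\<integral>y. (g y)\<^sup>2 \<partial>K x) - c * ?p)"
      using c by (simp add: divide_le_eq mult.commute)
    then show ?case by (simp add: q_def)
  qed
  moreover have "integrable \<pi> (\<lambda>x. (\<integral>y. g y \<partial>K x)\<^sup>2)" using L2_D(2)[OF K_L2[OF g]] by simp
  moreover have "integrable \<pi> (\<lambda>x. (1 - c) * ((\<integral>y. (g y)\<^sup>2 \<partial>K x) - c * ?p))"
    using K_preserves_integral(2)[OF g2] by simp
  ultimately have "(\<integral>x. (\<integral>y. g y \<partial>K x)\<^sup>2 \<partial>\<pi>) \<le> (\<integral>x. (1 - c) * ((\<integral>y. (g y)\<^sup>2 \<partial>K x) - c * ?p) \<partial>\<pi>)"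
    by (intro integral_mono_AE)
  also have "\<dots> = (1 - c) * (?p - c * ?p)"
    using K_preserves_integral[OF g2] by (simp add: \<pi>.prob_space)
  finally show ?thesis by (simp add: power2_eq_square algebra_simps)
qed

lemma AE_RN_deriv_eq_1:
  assumes "prob_space \<pi>" shows "AE x in \<pi>. RN_deriv \<pi> \<pi> x = 1"
proof -
  interpret prob_space \<pi> by fact
  have "AE x in \<pi>. 1 = RN_deriv \<pi> \<pi> x" by (rule RN_deriv_unique) (auto simp: density_1)
  then show ?thesis by auto
qed

lemma sqrt_ennreal_mono: assumes "a \<le> b" shows "sqrt_ennreal a \<le> sqrt_ennreal b"
proof (cases "b = \<infinity>")
  case False
  then have "a \<noteq> \<infinity>" using assms by (auto simp: top_unique)
  then show ?thesis using False assms
    by (auto simp: sqrt_ennreal_def less_top intro!: ennreal_leI real_sqrt_le_mono enn2real_mono)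
qed (simp add: sqrt_ennreal_def)

lemma sqrt_ennreal_mult:
  assumes "0 < c" shows "sqrt_ennreal (ennreal (c\<^sup>2) * a) = sqrt_ennreal a * ennreal c"
proof (cases "a = \<infinity>")
  case True
  then show ?thesis using assms by (simp add: sqrt_ennreal_def ennreal_mult_top ennreal_top_mult)
next
  case False
  then have "ennreal (c\<^sup>2) * a \<noteq> \<infinity>" by (simp add: ennreal_mult_eq_top_iff)
  then show ?thesis using False assms
    by (simp add: sqrt_ennreal_def enn2real_mult real_sqrt_mult mult.commute[of c] ennreal_mult)
qed

context factored_kernel
begin

text \<open>By symmetry of \<open>Pn k\<close>, moving a measure along the kernel means applying the
  kernel to its density.\<close>

lemma bind_Pn_density:
  assumes h: "h \<in> borel_measurable \<pi>" and \<nu>: "\<rho> = density \<pi> h"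
  shows "bind \<rho> (Pn k) = density \<pi> (\<lambda>x. \<integral>\<^sup>+y. h y \<partial>Pn k x)"
proof (rule measure_eqI)
  note m = nn_integral_kernel_measurable[OF Pn_kernel h, of k]
  have sp: "space \<rho> \<noteq> {}" and s: "sets \<rho> = sets \<pi>" using not_empty \<nu> by auto
  have K: "Pn k \<in> \<rho> \<rightarrow>\<^sub>M subprob_algebra \<pi>"
    using measurable_prob_algebraD[OF Pn_kernel] s by (simp cong: measurable_cong_sets)
  show 1: "sets (bind \<rho> (Pn k)) = sets (density \<pi> (\<lambda>x. \<integral>\<^sup>+y. h y \<partial>Pn k x))"
    using sets_bind[OF _ sp, of "Pn k" \<pi>] prob_kernelD(2)[OF Pn_kernel] \<nu> by simp
  fix B assume "B \<in> sets (bind \<rho> (Pn k))"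
  then have B [measurable]: "B \<in> sets \<pi>" using 1 by simp
  have "emeasure (bind \<rho> (Pn k)) B = (\<integral>\<^sup>+x. emeasure (Pn k x) B \<partial>\<rho>)" by (rule emeasure_bind[OF sp K B])
  also have "\<dots> = (\<integral>\<^sup>+x. h x * emeasure (Pn k x) B \<partial>\<pi>)" unfolding \<nu>
    using h by (intro nn_integral_density) (auto intro!: measurable_emeasure_kernel[OF measurable_prob_algebraD[OF Pn_kernel]])
  also have "\<dots> = (\<integral>\<^sup>+x. h x * (\<integral>\<^sup>+y. indicator B y \<partial>Pn k x) \<partial>\<pi>)"
    using prob_kernelD(2)[OF Pn_kernel] by (intro nn_integral_cong) auto
  also have "\<dots> = (\<integral>\<^sup>+x. indicator B x * (\<integral>\<^sup>+y. h y \<partial>Pn k x) \<partial>\<pi>)" by (rule Pn_nn_symmetric[OF h]) auto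
  also have "\<dots> = emeasure (density \<pi> (\<lambda>x. \<integral>\<^sup>+y. h y \<partial>Pn k x)) B"
    using m B by (subst emeasure_density) (auto simp: mult.commute)
  finally show "emeasure (bind \<rho> (Pn k)) B = emeasure (density \<pi> (\<lambda>x. \<integral>\<^sup>+y. h y \<partial>Pn k x)) B" .
qed

text \<open>Both distances are \<open>L2\<close> norms of density minus 1, and the second density is
  the image of the first, so \<open>minorised_contraction\<close> applies to the centred function
  \<open>hr - 1\<close>. For an infinite initial distance the right-hand side is infinite, since
  \<open>1 - c\<close> is positive.\<close>

lemma L2_dist_contraction:
  assumes c: "0 \<le> c" "c < 1" and ae: "AE x in \<pi>. minorised \<pi> c (Pn k x)"
    and \<rho>: "prob_space \<rho>" "sets \<rho> = sets \<pi>" "absolutely_continuous \<pi> \<rho>"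
  shows "L2_dist \<pi> (bind \<rho> (Pn k)) \<pi> \<le> L2_dist \<pi> \<rho> \<pi> * ennreal (1 - c)"
proof -
  interpret Pn: mp_kernel \<pi> "Pn k" \<pi> by (rule Pn_mp)
  define h where "h = RN_deriv \<pi> \<rho>"
  define hr where "hr x = enn2real (h x)" for x
  have h [measurable]: "h \<in> borel_measurable \<pi>" by (simp add: h_def)
  have dens: "density \<pi> h = \<rho>" unfolding h_def using \<rho> by (intro density_RN_deriv) auto
  have "emeasure (density \<pi> h) (space \<pi>) = 1"
    using prob_space.emeasure_space_1[OF \<rho>(1)] sets_eq_imp_space_eq[OF \<rho>(2)] dens by simp
  then have h1: "(\<integral>\<^sup>+x. h x \<partial>\<pi>) = 1" by (subst (asm) emeasure_density) (auto simp: nn_integral_set_ennreal[symmetric] cong: nn_integral_cong)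
  have fin: "AE x in \<pi>. h x \<noteq> \<infinity>" by (rule nn_integral_noteq_infinite) (auto simp: h1)
  have hr: "AE x in \<pi>. ennreal (hr x) = h x" using fin by eventually_elim (auto simp: hr_def less_top)
  have m: "(\<lambda>x. \<integral>\<^sup>+y. h y \<partial>Pn k x) \<in> borel_measurable \<pi>" by (rule nn_integral_kernel_measurable[OF Pn_kernel h])
  have RN: "AE x in \<pi>. (\<integral>\<^sup>+y. h y \<partial>Pn k x) = RN_deriv \<pi> (bind \<rho> (Pn k)) x"
    by (rule RN_deriv_unique[OF m]) (rule bind_Pn_density[OF h dens[symmetric], symmetric])
  have [measurable]: "hr \<in> borel_measurable \<pi>" by (simp add: hr_def[abs_def])
  have hrP: "AE x in \<pi>. enn2real (\<integral>\<^sup>+y. h y \<partial>Pn k x) = (\<integral>y. hr y \<partial>Pn k x)"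
    using Pn.K_AE[OF hr] AE_space
  proof eventually_elim
    case (elim x)
    then have "(\<integral>\<^sup>+y. h y \<partial>Pn k x) = (\<integral>\<^sup>+y. ennreal (hr y) \<partial>Pn k x)"
      by (intro nn_integral_cong_AE) auto
    then show ?case using Pn.K_meas[of hr x] elim
      by (subst integral_eq_nn_integral) (auto simp: hr_def)
  qed
  let ?a = "\<integral>\<^sup>+x. ennreal ((hr x - 1)\<^sup>2) \<partial>\<pi>"
  have R: "L2_dist \<pi> \<rho> \<pi> = sqrt_ennreal ?a"
    unfolding L2_dist_def using AE_RN_deriv_eq_1[OF prob_space_axioms]
    by (intro arg_cong[where f=sqrt_ennreal] nn_integral_cong_AE) (auto simp: h_def hr_def)
  have L: "L2_dist \<pi> (bind \<rho> (Pn k)) \<pi> = sqrt_ennreal (\<integral>\<^sup>+x. ennreal (((\<integral>y. hr y \<partial>Pn k x) - 1)\<^sup>2) \<partial>\<pi>)"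
    unfolding L2_dist_def using AE_RN_deriv_eq_1[OF prob_space_axioms] RN hrP
  proof (intro arg_cong[where f=sqrt_ennreal] nn_integral_cong_AE, eventually_elim)
    case (elim x)
    then show ?case by (metis enn2real_1 power2_abs)
  qed
  show ?thesis
  proof (cases "?a = \<infinity>")
    case True
    then show ?thesis unfolding R using c by (simp add: sqrt_ennreal_def ennreal_top_mult)
  next
    case False
    define g where "g x = hr x - 1" for x
    have g: "g \<in> L2 \<pi>" using False by (auto simp: L2_nn_iff g_def[abs_def] less_top)
    have "integrable \<pi> g" by (rule L2_integrable[OF g])
    then have "integrable \<pi> (\<lambda>x. g x + 1)" by simp
    then have i: "integrable \<pi> hr" by (simp add: g_def)
    have "ennreal (\<integral>x. hr x \<partial>\<pi>) = (\<integral>\<^sup>+x. ennreal (hr x) \<partial>\<pi>)"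
      by (rule nn_integral_eq_integral[OF i, symmetric]) (simp add: hr_def)
    also have "\<dots> = 1" using hr h1 by (simp cong: nn_integral_cong_AE)
    finally have "(\<integral>x. hr x \<partial>\<pi>) = 1" by simp
    then have mean: "(\<integral>x. g x \<partial>\<pi>) = 0" using i by (simp add: g_def[abs_def] prob_space)
    have Pg: "AE x in \<pi>. (\<integral>y. hr y \<partial>Pn k x) - 1 = (\<integral>y. g y \<partial>Pn k x)"
      using Pn.K_integrable[OF i] AE_space
    proof eventually_elim
      case (elim x)
      interpret x: prob_space "Pn k x" using prob_kernelD(1)[OF Pn_kernel elim(2)] .
      show ?case using elim by (simp add: g_def[abs_def] x.prob_space)
    qed
    have "(\<integral>\<^sup>+x. ennreal (((\<integral>y. hr y \<partial>Pn k x) - 1)\<^sup>2) \<partial>\<pi>) = (\<integral>\<^sup>+x. ennreal ((\<integral>y. g y \<partial>Pn k x)\<^sup>2) \<partial>\<pi>)"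
      using Pg by (intro nn_integral_cong_AE) auto
    also have "\<dots> = ennreal (\<integral>x. (\<integral>y. g y \<partial>Pn k x)\<^sup>2 \<partial>\<pi>)"
      using L2_D(2)[OF Pn.K_L2[OF g]] by (simp add: nn_integral_eq_integral)
    also have "\<dots> \<le> ennreal ((1 - c)\<^sup>2 * (\<integral>x. (g x)\<^sup>2 \<partial>\<pi>))"
      by (intro ennreal_leI minorised_contraction[OF Pn_mp c ae g mean])
    also have "\<dots> = ennreal ((1 - c)\<^sup>2) * ?a"
      using L2_D(2)[OF g] by (simp add: ennreal_mult nn_integral_eq_integral Bochner_Integration.integral_nonneg g_def)
    finally have "L2_dist \<pi> (bind \<rho> (Pn k)) \<pi> \<le> sqrt_ennreal (ennreal ((1 - c)\<^sup>2) * ?a)"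
      unfolding L by (rule sqrt_ennreal_mono)
    also have "\<dots> = L2_dist \<pi> \<rho> \<pi> * ennreal (1 - c)" unfolding R using c by (intro sqrt_ennreal_mult) simp
    finally show ?thesis .
  qed
qed

end

section \<open>Laws of Markov chains\<close>

text \<open>The recursion step of \<open>markov_law\<close> as a kernel between path spaces. Laws of
  chains and mutations of particles are both expressed by it.\<close>

definition path_ext :: "'a measure \<Rightarrow> 'a measure \<Rightarrow> (nat \<Rightarrow> 'a \<Rightarrow> 'a measure) \<Rightarrow> nat \<Rightarrow> (nat \<Rightarrow> 'a) \<Rightarrow> (nat \<Rightarrow> 'a) measure" where
  "path_ext S \<mu> K n y = distr (if n = 0 then \<mu> else K (Suc n) (y n)) (PiM {1..Suc n} (\<lambda>_. S)) (\<lambda>w. y(Suc n := w))"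

lemma markov_law_Suc: "markov_law S \<mu> K (Suc n) = bind (markov_law S \<mu> K n) (path_ext S \<mu> K n)"
  by (simp add: path_ext_def[abs_def] markov_law.simps)

lemma measurable_path_update:
  "(\<lambda>(y, w). y(Suc n := w)) \<in> PiM {1..n} (\<lambda>_. S) \<Otimes>\<^sub>M S \<rightarrow>\<^sub>M PiM {1..Suc n} (\<lambda>_. S)"
proof -
  have "{1..Suc n} = insert (Suc n) {1..n}" by auto
  then show ?thesis using measurable_add_dim[of "Suc n" "{1..n}" "\<lambda>_. S"] by simp
qed

lemma path_ext_kernel:
  assumes \<mu>: "\<mu> \<in> space (prob_algebra S)" and K: "n \<noteq> 0 \<Longrightarrow> K (Suc n) \<in> S \<rightarrow>\<^sub>M prob_algebra S"
  shows "path_ext S \<mu> K n \<in> PiM {1..n} (\<lambda>_. S) \<rightarrow>\<^sub>M prob_algebra (PiM {1..Suc n} (\<lambda>_. S))"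
  unfolding path_ext_def[abs_def]
proof (rule measurable_distr_prob_space2[OF _ measurable_path_update])
  show "(\<lambda>y. if n = 0 then \<mu> else K (Suc n) (y n)) \<in> PiM {1..n} (\<lambda>_. S) \<rightarrow>\<^sub>M prob_algebra S"
  proof (cases "n = 0")
    case False
    then have "(\<lambda>y. y n) \<in> PiM {1..n} (\<lambda>_. S) \<rightarrow>\<^sub>M S" by (intro measurable_component_singleton) auto
    then show ?thesis using measurable_compose[OF \<open>(\<lambda>y. y n) \<in> PiM {1..n} (\<lambda>_. S) \<rightarrow>\<^sub>M S\<close> K[OF False]] False by simp
  qed (use \<mu> in simp)
qed

lemma nn_integral_path_ext:
  assumes \<mu>: "\<mu> \<in> space (prob_algebra S)" and K: "n \<noteq> 0 \<Longrightarrow> K (Suc n) \<in> S \<rightarrow>\<^sub>M prob_algebra S"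
    and y: "y \<in> space (PiM {1..n} (\<lambda>_. S))" and f: "f \<in> borel_measurable (PiM {1..Suc n} (\<lambda>_. S))"
  shows "(\<integral>\<^sup>+z. f z \<partial>path_ext S \<mu> K n y) = (\<integral>\<^sup>+w. f (y(Suc n := w)) \<partial>(if n = 0 then \<mu> else K (Suc n) (y n)))"
proof -
  have s: "sets (if n = 0 then \<mu> else K (Suc n) (y n)) = sets S"
  proof (cases "n = 0")
    case False
    then have "y n \<in> space S" using y by (auto simp: space_PiM)
    then show ?thesis using prob_kernelD(2)[OF K[OF False]] False by simp
  qed (use \<mu> in \<open>simp add: space_prob_algebra\<close>)
  have "(\<lambda>w. y(Suc n := w)) \<in> S \<rightarrow>\<^sub>M PiM {1..Suc n} (\<lambda>_. S)"
    using measurable_Pair2[OF measurable_path_update y] by simp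
  then have u: "(\<lambda>w. y(Suc n := w)) \<in> (if n = 0 then \<mu> else K (Suc n) (y n)) \<rightarrow>\<^sub>M PiM {1..Suc n} (\<lambda>_. S)"
    using s by (simp cong: measurable_cong_sets)
  show ?thesis unfolding path_ext_def by (subst nn_integral_distr[OF u]) (use f in auto)
qed

lemma markov_law_prob:
  assumes \<mu>: "\<mu> \<in> space (prob_algebra S)" and K: "\<And>t. t \<in> {2..n} \<Longrightarrow> K t \<in> S \<rightarrow>\<^sub>M prob_algebra S"
  shows "markov_law S \<mu> K n \<in> space (prob_algebra (PiM {1..n} (\<lambda>_. S)))"
  using K
proof (induction n)
  case 0
  show ?case using prob_space_return[of "\<lambda>_. undefined" "PiM {1..0::nat} (\<lambda>_. S)"]
    by (simp add: space_prob_algebra space_PiM markov_law.simps)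
next
  case (Suc n)
  show ?case unfolding markov_law_Suc
    by (rule bind_in_prob_algebra[OF Suc.IH path_ext_kernel[OF \<mu>]]) (use Suc.prems in auto)
qed

lemma nn_integral_markov_law_Suc:
  assumes \<mu>: "\<mu> \<in> space (prob_algebra S)" and K: "\<And>t. t \<in> {2..Suc n} \<Longrightarrow> K t \<in> S \<rightarrow>\<^sub>M prob_algebra S"
    and f: "f \<in> borel_measurable (PiM {1..Suc n} (\<lambda>_. S))"
  shows "(\<integral>\<^sup>+y. f y \<partial>markov_law S \<mu> K (Suc n)) = (\<integral>\<^sup>+y. \<integral>\<^sup>+z. f z \<partial>path_ext S \<mu> K n y \<partial>markov_law S \<mu> K n)"
  unfolding markov_law_Suc
  using markov_law_prob[of \<mu> S n K] \<mu> K
  by (intro nn_integral_bind_kernel[OF path_ext_kernel[OF \<mu>] _ f]) (auto simp: space_prob_algebra)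

section \<open>Asymptotic variance\<close>

context factored_kernel
begin

abbreviation "law n \<equiv> markov_law \<pi> \<pi> (\<lambda>_. P) n"
abbreviation "EL n \<equiv> path_ext \<pi> \<pi> (\<lambda>_. P) n"

lemma pi_in: "\<pi> \<in> space (prob_algebra \<pi>)" by (simp add: space_prob_algebra prob_space_axioms)

lemma law_prob: "prob_space (law n)" "sets (law n) = sets (PiM {1..n} (\<lambda>_. \<pi>))" "space (law n) = space (PiM {1..n} (\<lambda>_. \<pi>))"
proof -
  have "law n \<in> space (prob_algebra (PiM {1..n} (\<lambda>_. \<pi>)))" by (rule markov_law_prob[OF pi_in P_kernel])
  then show "prob_space (law n)" and s: "sets (law n) = sets (PiM {1..n} (\<lambda>_. \<pi>))" by (auto simp: space_prob_algebra)
  from s show "space (law n) = space (PiM {1..n} (\<lambda>_. \<pi>))" by (rule sets_eq_imp_space_eq)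
qed

lemma law_measurable: "borel_measurable (law n) = borel_measurable (PiM {1..n} (\<lambda>_. \<pi>))"
  by (simp cong: measurable_cong_sets add: law_prob)

lemma law_step: "mp_kernel (law n) (EL n) (law (Suc n))"
proof (rule mp_kernel.intro)
  have "EL n \<in> PiM {1..n} (\<lambda>_. \<pi>) \<rightarrow>\<^sub>M prob_algebra (PiM {1..Suc n} (\<lambda>_. \<pi>))" by (rule path_ext_kernel[OF pi_in P_kernel])
  then show "EL n \<in> law n \<rightarrow>\<^sub>M prob_algebra (law (Suc n))"
    by (simp cong: measurable_cong_sets add: law_prob prob_algebra_cong[OF law_prob(2)])
  show "prob_space (law (Suc n))" by (rule law_prob)
  fix f :: "(nat \<Rightarrow> 'a) \<Rightarrow> ennreal" assume "f \<in> borel_measurable (law (Suc n))"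
  then show "(\<integral>\<^sup>+s. \<integral>\<^sup>+x. f x \<partial>EL n s \<partial>law n) = (\<integral>\<^sup>+x. f x \<partial>law (Suc n))"
    by (intro nn_integral_markov_law_Suc[OF pi_in P_kernel, symmetric]) (simp add: law_measurable)
qed

lemma law_coord: "i \<in> {1..n} \<Longrightarrow> f \<in> borel_measurable \<pi> \<Longrightarrow> (\<integral>\<^sup>+y. f (y i) \<partial>law n) = (\<integral>\<^sup>+x. f x \<partial>\<pi>)"
proof (induction n arbitrary: i f)
  case (Suc n)
  have [measurable]: "(\<lambda>y. f (y i)) \<in> borel_measurable (PiM {1..Suc n} (\<lambda>_. \<pi>))"
    by (rule measurable_compose[OF measurable_component_singleton[OF Suc.prems(1)] Suc.prems(2)])
  have "(\<integral>\<^sup>+y. f (y i) \<partial>law (Suc n)) = (\<integral>\<^sup>+y. \<integral>\<^sup>+w. f ((y(Suc n := w)) i) \<partial>(if n = 0 then \<pi> else P (y n)) \<partial>law n)"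
  proof (subst nn_integral_markov_law_Suc[OF pi_in P_kernel], measurable, intro nn_integral_cong)
    fix y assume "y \<in> space (law n)"
    then show "(\<integral>\<^sup>+z. f (z i) \<partial>EL n y) = (\<integral>\<^sup>+w. f ((y(Suc n := w)) i) \<partial>(if n = 0 then \<pi> else P (y n)))"
      by (intro nn_integral_path_ext pi_in P_kernel) (auto simp: law_prob)
  qed
  also have "\<dots> = (\<integral>\<^sup>+x. f x \<partial>\<pi>)"
  proof (cases "i = Suc n")
    case True
    show ?thesis
    proof (cases "n = 0")
      case n: True
      interpret L: prob_space "law 0" by (rule law_prob)
      show ?thesis using n True L.emeasure_space_1 by simp
    next
      case n: False
      have "(\<integral>\<^sup>+y. \<integral>\<^sup>+w. f w \<partial>P (y n) \<partial>law n) = (\<integral>\<^sup>+x. \<integral>\<^sup>+w. f w \<partial>P x \<partial>\<pi>)"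
        using n by (intro Suc.IH nn_integral_kernel_measurable[OF P_kernel Suc.prems(2)]) auto
      then show ?thesis using n True P.K_preserves[OF Suc.prems(2)] by simp
    qed
  next
    case False
    then have i: "i \<in> {1..n}" using Suc.prems by auto
    have "(\<integral>\<^sup>+y. \<integral>\<^sup>+w. f ((y(Suc n := w)) i) \<partial>(if n = 0 then \<pi> else P (y n)) \<partial>law n) = (\<integral>\<^sup>+y. f (y i) \<partial>law n)"
    proof (intro nn_integral_cong)
      fix y assume y: "y \<in> space (law n)"
      then have "y n \<in> space \<pi>" if "n \<noteq> 0" using that by (auto simp: law_prob space_PiM)
      then show "(\<integral>\<^sup>+w. f ((y(Suc n := w)) i) \<partial>(if n = 0 then \<pi> else P (y n))) = f (y i)"
        using False i nn_integral_kernel_const[OF P_kernel] by (auto simp: emeasure_space_1)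
    qed
    then show ?thesis using Suc.IH[OF i Suc.prems(2)] by simp
  qed
  finally show ?case .
qed simp

lemma law_coord_mp: "i \<in> {1..n} \<Longrightarrow> mp_kernel (law n) (\<lambda>y. return \<pi> (y i)) \<pi>"
proof (rule mp_kernel.intro)
  assume i: "i \<in> {1..n}"
  show "(\<lambda>y. return \<pi> (y i)) \<in> law n \<rightarrow>\<^sub>M prob_algebra \<pi>"
    using measurable_compose[OF measurable_component_singleton[OF i] measurable_return_prob_space]
    by (simp cong: measurable_cong_sets add: law_prob)
  fix f :: "'a \<Rightarrow> ennreal" assume f: "f \<in> borel_measurable \<pi>"
  have "(\<integral>\<^sup>+s. \<integral>\<^sup>+x. f x \<partial>return \<pi> (s i) \<partial>law n) = (\<integral>\<^sup>+s. f (s i) \<partial>law n)"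
    using i f by (intro nn_integral_cong nn_integral_return) (auto simp: law_prob space_PiM)
  then show "(\<integral>\<^sup>+s. \<integral>\<^sup>+x. f x \<partial>return \<pi> (s i) \<partial>law n) = (\<integral>\<^sup>+x. f x \<partial>\<pi>)" using law_coord[OF i f] by simp
qed (rule prob_space_axioms)

lemma law_coord_L2:
  assumes i: "i \<in> {1..n}" and f: "f \<in> L2 \<pi>"
  shows "(\<lambda>y. f (y i)) \<in> L2 (law n)"
proof -
  have "(\<lambda>y. f (y i)) \<in> borel_measurable (law n)"
    unfolding law_measurable by (rule measurable_compose[OF measurable_component_singleton[OF i] L2_D(1)[OF f]])
  then show ?thesis
    using law_coord[OF i, of "\<lambda>x. ennreal ((f x)\<^sup>2)"] L2_D(1)[OF f] f by (simp add: L2_nn_iff)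
qed

lemma law_coord_integral:
  fixes f :: "'a \<Rightarrow> real"
  assumes i: "i \<in> {1..n}" and f: "integrable \<pi> f"
  shows "(\<integral>y. f (y i) \<partial>law n) = (\<integral>x. f x \<partial>\<pi>)"
proof -
  have "(\<integral>y. f (y i) \<partial>law n) = (\<integral>y. \<integral>x. f x \<partial>return \<pi> (y i) \<partial>law n)"
    using i f by (intro Bochner_Integration.integral_cong refl integral_return[symmetric]) (auto simp: law_prob space_PiM)
  then show ?thesis using mp_kernel.K_preserves_integral(1)[OF law_coord_mp[OF i] f] by simp
qed

text \<open>The Markov property, obtained by integrating out the last coordinate, which
  \<open>\<phi>\<close> does not see.\<close>

lemma law_Suc_product:
  fixes \<phi> :: "(nat \<Rightarrow> 'a) \<Rightarrow> real"
  assumes \<phi>: "\<And>y w. \<phi> (y(Suc n := w)) = \<phi> y" "\<phi> \<in> L2 (law (Suc n))" and g: "g \<in> L2 \<pi>" and n: "n \<ge> 1"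
  shows "(\<integral>y. \<phi> y * g (y (Suc n)) \<partial>law (Suc n)) = (\<integral>y. \<phi> y * kernel_op P g (y n) \<partial>law n)"
proof -
  interpret s: mp_kernel "law n" "EL n" "law (Suc n)" by (rule law_step)
  have L: "integrable (law (Suc n)) (\<lambda>y. \<phi> y * g (y (Suc n)))"
    by (intro L2_prod_integrable \<phi> law_coord_L2 g) auto
  have "(\<integral>y. \<phi> y * g (y (Suc n)) \<partial>law (Suc n)) = (\<integral>y. \<integral>z. \<phi> z * g (z (Suc n)) \<partial>EL n y \<partial>law n)"
    by (rule s.K_preserves_integral(1)[OF L, symmetric])
  also have "\<dots> = (\<integral>y. \<phi> y * kernel_op P g (y n) \<partial>law n)"
  proof (intro Bochner_Integration.integral_cong refl)
    fix y assume "y \<in> space (law n)"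
    then have y: "y \<in> space (PiM {1..n} (\<lambda>_. \<pi>))" by (simp add: law_prob)
    then have "y n \<in> space \<pi>" using n by (auto simp: space_PiM)
    then have s: "sets (P (y n)) = sets \<pi>" using prob_kernelD[OF P_kernel] by simp
    have u: "(\<lambda>w. y(Suc n := w)) \<in> P (y n) \<rightarrow>\<^sub>M PiM {1..Suc n} (\<lambda>_. \<pi>)"
      using measurable_Pair2[OF measurable_path_update y] s by (simp cong: measurable_cong_sets)
    have m: "(\<lambda>z. \<phi> z * g (z (Suc n))) \<in> borel_measurable (PiM {1..Suc n} (\<lambda>_. \<pi>))"
      using L law_measurable[of "Suc n"] by auto
    have "(\<integral>z. \<phi> z * g (z (Suc n)) \<partial>EL n y) = (\<integral>w. \<phi> (y(Suc n := w)) * g ((y(Suc n := w)) (Suc n)) \<partial>P (y n))"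
      using n integral_distr[OF u m] by (simp add: path_ext_def)
    then show "(\<integral>z. \<phi> z * g (z (Suc n)) \<partial>EL n y) = \<phi> y * kernel_op P g (y n)"
      by (simp add: \<phi> kernel_op_def)
  qed
  finally show ?thesis .
qed

context
  fixes f assumes f: "f \<in> L2 \<pi>"
begin

definition "psum n y = (\<Sum>i\<in>{1..n}. f (y i))"

lemma psum_L2: "m \<le> n \<Longrightarrow> psum m \<in> L2 (law n)"
proof (induction m)
  case 0
  interpret L: prob_space "law n" by (rule law_prob)
  show ?case using L.L2_bounded[of "\<lambda>_. 0" 0] by (simp add: psum_def[abs_def])
next
  case (Suc m)
  then show ?case using L2_add[OF _ law_coord_L2[of "Suc m" n, OF _ f]] by (simp add: psum_def[abs_def])
qed

lemma psum_upd: "psum n (y(Suc n := w)) = psum n y"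
  by (simp add: psum_def)

text \<open>Splitting off the last summand leaves the same expression with
  \<open>kernel_op P g\<close> in place of \<open>g\<close>, hence \<open>g\<close> varies in the
  induction.\<close>

lemma psum_cross: "n \<ge> 1 \<Longrightarrow> g \<in> L2 \<pi> \<Longrightarrow>
  (\<integral>y. psum n y * g (y n) \<partial>law n) = (\<Sum>j<n. \<integral>x. f x * opn j g x \<partial>\<pi>)"
proof (induction n arbitrary: g rule: nat_induct_at_least)
  case base
  have "(\<integral>y. psum 1 y * g (y 1) \<partial>law 1) = (\<integral>y. (\<lambda>x. f x * g x) (y 1) \<partial>law 1)" by (simp add: psum_def)
  also have "\<dots> = (\<integral>x. f x * g x \<partial>\<pi>)" by (rule law_coord_integral) (use L2_prod_integrable[OF f base] in auto)
  finally show ?case by simp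
next
  case (Suc n)
  have g: "g \<in> L2 \<pi>" by fact
  have i: "integrable (law (Suc n)) (\<lambda>y. psum n y * g (y (Suc n)))"
    "integrable (law (Suc n)) (\<lambda>y. f (y (Suc n)) * g (y (Suc n)))"
    by (intro L2_prod_integrable psum_L2 law_coord_L2 f g; simp)+
  have "(\<integral>y. psum (Suc n) y * g (y (Suc n)) \<partial>law (Suc n)) =
      (\<integral>y. psum n y * g (y (Suc n)) + f (y (Suc n)) * g (y (Suc n)) \<partial>law (Suc n))"
    by (simp add: psum_def algebra_simps)
  also have "\<dots> = (\<integral>y. psum n y * g (y (Suc n)) \<partial>law (Suc n)) + (\<integral>y. f (y (Suc n)) * g (y (Suc n)) \<partial>law (Suc n))"
    by (rule Bochner_Integration.integral_add[OF i])
  also have "(\<integral>y. psum n y * g (y (Suc n)) \<partial>law (Suc n)) = (\<integral>y. psum n y * kernel_op P g (y n) \<partial>law n)"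
    by (rule law_Suc_product) (use Suc psum_L2[of n "Suc n"] psum_upd in auto)
  also have "\<dots> = (\<Sum>j<n. \<integral>x. f x * opn j (kernel_op P g) x \<partial>\<pi>)" by (rule Suc.IH[OF op_L2[OF g]])
  also have "(\<integral>y. f (y (Suc n)) * g (y (Suc n)) \<partial>law (Suc n)) = (\<integral>x. f x * g x \<partial>\<pi>)"
    using law_coord_integral[OF _ L2_prod_integrable[OF f g], of "Suc n" "Suc n"] by (simp)
  finally show ?case unfolding sum.lessThan_Suc_shift by (simp add: funpow_swap1)
qed

definition "autocov j = (\<integral>x. f x * opn j f x \<partial>\<pi>)"

text \<open>The term of index \<open>m\<close> adds its second moment and twice its covariances with
  the earlier terms, which depend on the lags only.\<close>

lemma psum_square: "(\<integral>y. (psum n y)\<^sup>2 \<partial>law n) = (\<Sum>m<n. autocov 0 + 2 * (\<Sum>j<m. autocov (Suc j)))"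
proof (induction n)
  case 0 then show ?case by (simp add: psum_def)
next
  case (Suc n)
  interpret s: mp_kernel "law n" "EL n" "law (Suc n)" by (rule law_step)
  have i: "integrable (law (Suc n)) (\<lambda>y. (psum n y)\<^sup>2)" "integrable (law (Suc n)) (\<lambda>y. psum n y * f (y (Suc n)))"
    "integrable (law (Suc n)) (\<lambda>y. f (y (Suc n)) * f (y (Suc n)))"
    by (rule L2_D(2)[OF psum_L2], simp) (intro L2_prod_integrable psum_L2 law_coord_L2 f; simp)+
  have "(\<integral>y. (psum (Suc n) y)\<^sup>2 \<partial>law (Suc n)) =
      (\<integral>y. (psum n y)\<^sup>2 + 2 * (psum n y * f (y (Suc n))) + f (y (Suc n)) * f (y (Suc n)) \<partial>law (Suc n))"
    by (simp add: psum_def power2_sum algebra_simps) (simp add: power2_eq_square algebra_simps)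
  also have "\<dots> = (\<integral>y. (psum n y)\<^sup>2 \<partial>law (Suc n)) + 2 * (\<integral>y. psum n y * f (y (Suc n)) \<partial>law (Suc n))
      + (\<integral>y. f (y (Suc n)) * f (y (Suc n)) \<partial>law (Suc n))"
    using i by (simp)
  also have "(\<integral>y. f (y (Suc n)) * f (y (Suc n)) \<partial>law (Suc n)) = autocov 0"
    using law_coord_integral[OF _ L2_prod_integrable[OF f f], of "Suc n" "Suc n"] by (simp add: autocov_def)
  also have "(\<integral>y. psum n y * f (y (Suc n)) \<partial>law (Suc n)) = (\<Sum>j<n. autocov (Suc j))"
  proof (cases "n = 0")
    case False
    then have n: "n \<ge> 1" by simp
    have "(\<integral>y. psum n y * f (y (Suc n)) \<partial>law (Suc n)) = (\<integral>y. psum n y * kernel_op P f (y n) \<partial>law n)"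
      by (rule law_Suc_product) (use f n psum_L2[of n "Suc n"] psum_upd in auto)
    also have "\<dots> = (\<Sum>j<n. \<integral>x. f x * opn j (kernel_op P f) x \<partial>\<pi>)" by (rule psum_cross[OF n op_L2[OF f]])
    finally show ?thesis by (simp add: autocov_def funpow_swap1)
  qed (simp add: psum_def)
  also have "(\<integral>y. (psum n y)\<^sup>2 \<partial>law (Suc n)) = (\<integral>y. (psum n y)\<^sup>2 \<partial>law n)"
  proof -
    have "(\<integral>y. (psum n y)\<^sup>2 \<partial>law (Suc n)) = (\<integral>y. \<integral>z. (psum n z)\<^sup>2 \<partial>EL n y \<partial>law n)"
      by (rule s.K_preserves_integral(1)[OF i(1), symmetric])
    also have "\<dots> = (\<integral>y. (psum n y)\<^sup>2 \<partial>law n)"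
    proof (intro Bochner_Integration.integral_cong refl)
      fix y assume "y \<in> space (law n)"
      then have y: "y \<in> space (PiM {1..n} (\<lambda>_. \<pi>))" by (simp add: law_prob)
      let ?K = "if n = 0 then \<pi> else P (y n)"
      have K: "prob_space ?K" "sets ?K = sets \<pi>"
        using prob_kernelD[OF P_kernel, of "y n"] y
        by (cases "n = 0"; simp add: space_PiM prob_space_axioms PiE_iff)+
      interpret K: prob_space ?K by fact
      have u: "(\<lambda>w. y(Suc n := w)) \<in> ?K \<rightarrow>\<^sub>M PiM {1..Suc n} (\<lambda>_. \<pi>)"
        using measurable_Pair2[OF measurable_path_update y] K(2) by (simp cong: measurable_cong_sets)
      have m: "(\<lambda>z. (psum n z)\<^sup>2) \<in> borel_measurable (PiM {1..Suc n} (\<lambda>_. \<pi>))"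
        using i(1) law_measurable[of "Suc n"] by auto
      have "(\<integral>z. (psum n z)\<^sup>2 \<partial>EL n y) = (\<integral>w. (psum n (y(Suc n := w)))\<^sup>2 \<partial>?K)"
        unfolding path_ext_def by (rule integral_distr[OF u m])
      then show "(\<integral>z. (psum n z)\<^sup>2 \<partial>EL n y) = (psum n y)\<^sup>2"
        unfolding psum_upd using K.prob_space by simp
    qed
    finally show ?thesis .
  qed
  finally show ?case using Suc.IH by simp
qed

end

end

context factored_kernel
begin

lemma opn_contraction:
  assumes contr: "\<And>g. g \<in> L2 \<pi> \<Longrightarrow> (\<integral>x. g x \<partial>\<pi>) = 0 \<Longrightarrow>
      (\<integral>x. (kernel_op P g x)\<^sup>2 \<partial>\<pi>) \<le> r\<^sup>2 * (\<integral>x. (g x)\<^sup>2 \<partial>\<pi>)"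
    and g: "g \<in> L2 \<pi>" "(\<integral>x. g x \<partial>\<pi>) = 0"
  shows "(\<integral>x. (opn k g x)\<^sup>2 \<partial>\<pi>) \<le> (r ^ k)\<^sup>2 * (\<integral>x. (g x)\<^sup>2 \<partial>\<pi>)"
proof (induction k)
  case (Suc k)
  have "(\<integral>x. (opn (Suc k) g x)\<^sup>2 \<partial>\<pi>) \<le> r\<^sup>2 * (\<integral>x. (opn k g x)\<^sup>2 \<partial>\<pi>)"
    using contr[OF opn_L2[OF g(1)], of k] opn_integral[OF g(1)] g(2) by simp
  also have "\<dots> \<le> r\<^sup>2 * ((r ^ k)\<^sup>2 * (\<integral>x. (g x)\<^sup>2 \<partial>\<pi>))" by (intro mult_left_mono Suc.IH) simp
  finally show ?case by (simp add: power_mult_distrib mult.assoc)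
qed simp

text \<open>The lower bound is where positivity of the operator enters the variance estimate; the
  upper one is Cauchy-Schwarz and iterated contraction.\<close>

lemma autocov_bounds:
  assumes contr: "\<And>g. g \<in> L2 \<pi> \<Longrightarrow> (\<integral>x. g x \<partial>\<pi>) = 0 \<Longrightarrow>
      (\<integral>x. (kernel_op P g x)\<^sup>2 \<partial>\<pi>) \<le> r\<^sup>2 * (\<integral>x. (g x)\<^sup>2 \<partial>\<pi>)"
    and r: "0 \<le> r" and g: "g \<in> L2 \<pi>" "(\<integral>x. g x \<partial>\<pi>) = 0"
  shows "0 \<le> autocov g k" "autocov g k \<le> r ^ k * autocov g 0"
proof -
  show "0 \<le> autocov g k" using opn_nonneg[OF g(1), of k] g by (simp add: autocov_def)
  have a0: "autocov g 0 = (\<integral>x. (g x)\<^sup>2 \<partial>\<pi>)" using g by (simp add: autocov_def power2_eq_square)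
  then have a0': "0 \<le> autocov g 0" by (simp add: Bochner_Integration.integral_nonneg)
  have "(autocov g k)\<^sup>2 \<le> (\<integral>x. (g x)\<^sup>2 \<partial>\<pi>) * (\<integral>x. (opn k g x)\<^sup>2 \<partial>\<pi>)"
    using L2_Cauchy_Schwarz[OF g(1) opn_L2[OF g(1)], of k] g by (simp add: autocov_def)
  also have "\<dots> \<le> autocov g 0 * ((r ^ k)\<^sup>2 * autocov g 0)"
    using opn_contraction[OF contr g] a0 a0' by (intro mult_mono) (auto simp: Bochner_Integration.integral_nonneg)
  also have "\<dots> = (r ^ k * autocov g 0)\<^sup>2" by (simp add: power2_eq_square)
  finally show "autocov g k \<le> r ^ k * autocov g 0" by (rule power2_le_imp_le) (use a0' r in simp)
qed

lemma scaled_sum_var_eq: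
  assumes f: "f \<in> L2 \<pi>"
  defines "g \<equiv> \<lambda>x. f x - (\<integral>x. f x \<partial>\<pi>)"
  shows "scaled_sum_var \<pi> P f n = (\<Sum>m<n. autocov g 0 + 2 * (\<Sum>j<m. autocov g (Suc j))) / real n"
proof -
  have g: "g \<in> L2 \<pi>" unfolding g_def by (rule L2_diff[OF f L2_bounded]) auto
  interpret L: prob_space "law n" by (rule law_prob)
  have ig: "integrable \<pi> g" by (rule L2_integrable[OF g])
  have mean: "(\<integral>x. g x \<partial>\<pi>) = 0" using L2_integrable[OF f] by (simp add: g_def prob_space)
  have co: "integrable (law n) (\<lambda>y. g (y i))" if "i \<in> {1..n}" for i by (rule L.L2_integrable[OF law_coord_L2[OF that g]])
  have "(\<integral>\<xi>. psum g n \<xi> \<partial>law n) = (\<Sum>i\<in>{1..n}. \<integral>\<xi>. g (\<xi> i) \<partial>law n)"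
    unfolding psum_def[OF g] by (rule Bochner_Integration.integral_sum) (use co in auto)
  also have "\<dots> = 0" using law_coord_integral[OF _ ig] mean by simp
  finally have 0: "(\<integral>\<xi>. psum g n \<xi> \<partial>law n) = 0" .
  have "scaled_sum_var \<pi> P f n = var_of (law n) (\<lambda>\<xi>. (1 / sqrt (real n)) * psum g n \<xi>)"
    unfolding scaled_sum_var_def psum_def[OF g] by (simp add: g_def)
  also have "\<dots> = (\<integral>\<xi>. (psum g n \<xi>)\<^sup>2 \<partial>law n) / real n"
    using 0 by (simp add: var_of_def power_divide)
  finally show ?thesis by (simp add: psum_square[OF g])
qed

text \<open>The scaled variances are Cesaro means of the partial sums \<open>b\<close>. As the
  autocovariances are nonnegative, \<open>b\<close> increases from the variance \<open>a 0\<close>,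
  and so do its means; the geometric series bounds \<open>b\<close> by
  \<open>a 0 * (1 + 2 * (1 - \<epsilon>) / \<epsilon>)\<close>.\<close>

lemma asymptotic_var_bounds:
  assumes contr: "\<And>g. g \<in> L2 \<pi> \<Longrightarrow> (\<integral>x. g x \<partial>\<pi>) = 0 \<Longrightarrow>
      (\<integral>x. (kernel_op P g x)\<^sup>2 \<partial>\<pi>) \<le> (1 - \<epsilon>)\<^sup>2 * (\<integral>x. (g x)\<^sup>2 \<partial>\<pi>)"
    and \<epsilon>: "0 < \<epsilon>" "\<epsilon> < 1" and f: "f \<in> L2 \<pi>"
  shows "convergent (scaled_sum_var \<pi> P f)" "var_of \<pi> f \<le> asymptotic_var \<pi> P f"
    "asymptotic_var \<pi> P f \<le> (2 * inverse \<epsilon> - 1) * var_of \<pi> f"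
proof -
  define g where "g x = f x - (\<integral>x. f x \<partial>\<pi>)" for x
  have g: "g \<in> L2 \<pi>" unfolding g_def[abs_def] by (rule L2_diff[OF f L2_bounded]) auto
  have mean: "(\<integral>x. g x \<partial>\<pi>) = 0" using L2_integrable[OF f] by (simp add: g_def prob_space)
  define a where "a = autocov g"
  define b where "b m = a 0 + 2 * (\<Sum>j<m. a (Suc j))" for m
  have a: "0 \<le> a k" "a k \<le> (1 - \<epsilon>) ^ k * a 0" for k
    unfolding a_def using autocov_bounds[OF contr _ g mean, of k] \<epsilon> by auto
  have var: "var_of \<pi> f = a 0"
  proof -
    have "a 0 = (\<integral>x. (f x)\<^sup>2 - 2 * (\<integral>x. f x \<partial>\<pi>) * f x + (\<integral>x. f x \<partial>\<pi>)\<^sup>2 \<partial>\<pi>)"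
      using g by (simp add: a_def autocov_def g_def power2_eq_square algebra_simps)
    also have "\<dots> = var_of \<pi> f"
      using L2_integrable[OF f] L2_D(2)[OF f] by (simp add: var_of_def prob_space power2_eq_square)
    finally show ?thesis by simp
  qed
  have s: "scaled_sum_var \<pi> P f n = (\<Sum>m<n. b m) / real n" for n
    using scaled_sum_var_eq[OF f, of n] by (simp add: b_def a_def g_def[abs_def])
  have b_mono: "b m \<le> b n" if "m \<le> n" for m n
    using that a by (auto simp: b_def intro!: sum_mono2)
  have b_low: "a 0 \<le> b m" for m using a(1) by (simp add: b_def sum_nonneg)
  have b_up: "b m \<le> (2 * inverse \<epsilon> - 1) * a 0" for m
  proof -
    have "(\<Sum>j<m. (1 - \<epsilon>) ^ j) \<le> (\<Sum>j. (1 - \<epsilon>) ^ j)"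
      using \<epsilon> by (intro sum_le_suminf summable_geometric) auto
    also have "\<dots> = 1 / \<epsilon>" using \<epsilon> by (subst suminf_geometric) auto
    finally have geo: "(\<Sum>j<m. (1 - \<epsilon>) ^ j) \<le> 1 / \<epsilon>" .
    have "(\<Sum>j<m. a (Suc j)) \<le> (\<Sum>j<m. (1 - \<epsilon>) ^ Suc j * a 0)" by (intro sum_mono a)
    also have "\<dots> = (1 - \<epsilon>) * a 0 * (\<Sum>j<m. (1 - \<epsilon>) ^ j)"
      by (simp add: sum_distrib_left mult.commute mult.left_commute)
    also have "\<dots> \<le> (1 - \<epsilon>) * a 0 * (1 / \<epsilon>)" using geo \<epsilon> a(1)[of 0] by (intro mult_left_mono) auto
    finally have "b m \<le> a 0 + 2 * ((1 - \<epsilon>) * a 0 * (1 / \<epsilon>))" by (simp add: b_def)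
    also have "\<dots> = (2 * inverse \<epsilon> - 1) * a 0" using \<epsilon> by (simp add: field_simps)
    finally show ?thesis .
  qed
  have low: "a 0 \<le> scaled_sum_var \<pi> P f n" if "n \<ge> 1" for n
    unfolding s using that sum_mono[of "{..<n}" "\<lambda>_. a 0" b] b_low by (simp add: field_simps)
  have up: "scaled_sum_var \<pi> P f n \<le> (2 * inverse \<epsilon> - 1) * a 0" for n
  proof (cases "n = 0")
    case True then show ?thesis unfolding s using \<epsilon> a(1)[of 0] b_up[of 0] by (simp add: b_def)
  next
    case False
    have "(\<Sum>m<n. b m) \<le> (\<Sum>m<n. (2 * inverse \<epsilon> - 1) * a 0)" by (intro sum_mono b_up)
    then show ?thesis unfolding s using False by (simp add: divide_le_eq mult.commute)
  qed
  have "incseq (scaled_sum_var \<pi> P f)"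
  proof (rule incseq_SucI)
    fix n
    have "(\<Sum>m<n. b m) \<le> (\<Sum>m<n. b n)" by (intro sum_mono b_mono) auto
    then have le: "(\<Sum>m<n. b m) \<le> real n * b n" by simp
    have "0 \<le> b n" using b_low[of n] a(1)[of 0] by simp
    show "scaled_sum_var \<pi> P f n \<le> scaled_sum_var \<pi> P f (Suc n)"
      unfolding s using le \<open>0 \<le> b n\<close> by (cases "n = 0") (simp_all add: field_simps)
  qed
  then obtain L where L: "scaled_sum_var \<pi> P f \<longlonglongrightarrow> L"
    using incseq_convergent[of _ "(2 * inverse \<epsilon> - 1) * a 0"] up by blast
  then show "convergent (scaled_sum_var \<pi> P f)" by (auto simp: convergent_def)
  have lim: "asymptotic_var \<pi> P f = L" unfolding asymptotic_var_def using L by (rule limI)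
  show "var_of \<pi> f \<le> asymptotic_var \<pi> P f"
    unfolding lim var by (rule LIMSEQ_le_const[OF L]) (use low in auto)
  show "asymptotic_var \<pi> P f \<le> (2 * inverse \<epsilon> - 1) * var_of \<pi> f"
    unfolding lim var by (rule LIMSEQ_le_const2[OF L]) (use up in auto)
qed

lemma minorised_op_contraction:
  assumes "AE x in \<pi>. minorised \<pi> \<epsilon> (P x)" "0 \<le> \<epsilon>" "\<epsilon> < 1" "g \<in> L2 \<pi>" "(\<integral>x. g x \<partial>\<pi>) = 0"
  shows "(\<integral>x. (kernel_op P g x)\<^sup>2 \<partial>\<pi>) \<le> (1 - \<epsilon>)\<^sup>2 * (\<integral>x. (g x)\<^sup>2 \<partial>\<pi>)"
  unfolding kernel_op_def by (rule minorised_contraction) (use assms P.mp_kernel_axioms in auto)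

end

section \<open>Sticky sets\<close>

text \<open>A decreasing family of levels is descended one level per step; a constant family gives
  the estimate for a single sticky set.\<close>

lemma kernel_pow_sticky:
  assumes P: "P \<in> S \<rightarrow>\<^sub>M prob_algebra S" and A: "\<And>j. A j \<in> sets S" and \<eta>: "0 \<le> (q :: real)"
    and sticky: "\<And>j x. x \<in> A (Suc j) \<Longrightarrow> q \<le> measure (P x) (A j)"
    and x: "x \<in> A (j + n)"
  shows "q ^ n \<le> measure (kernel_pow S P n x) (A j)"
  using x
proof (induction n arbitrary: j)
  case 0
  then show ?case using A by (simp add: measure_return)
next
  case (Suc n)
  have xS: "x \<in> space S" using Suc.prems sets.sets_into_space[OF A] by blast
  interpret Pn: prob_space "kernel_pow S P n x" using kernel_pow_kernel[OF P] xS by (rule prob_kernelD)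
  interpret PSn: prob_space "kernel_pow S P (Suc n) x" using kernel_pow_kernel[OF P] xS by (rule prob_kernelD)
  have s: "sets (kernel_pow S P n x) = sets S" using kernel_pow_kernel[OF P] xS by (rule prob_kernelD)
  have s': "sets (kernel_pow S P (Suc n) x) = sets S" using kernel_pow_kernel[OF P] xS by (rule prob_kernelD)
  have "ennreal (q * measure (kernel_pow S P n x) (A (Suc j))) = (\<integral>\<^sup>+y. ennreal q * indicator (A (Suc j)) y \<partial>kernel_pow S P n x)"
    using A s \<eta> by (subst nn_integral_cmult) (auto simp: Pn.emeasure_eq_measure ennreal_mult)
  also have "\<dots> \<le> (\<integral>\<^sup>+y. \<integral>\<^sup>+z. indicator (A j) z \<partial>P y \<partial>kernel_pow S P n x)"
  proof (rule nn_integral_mono)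
    fix y assume "y \<in> space (kernel_pow S P n x)"
    then have y: "y \<in> space S" using sets_eq_imp_space_eq[OF s] by simp
    interpret Py: prob_space "P y" using P y by (rule prob_kernelD)
    have "(\<integral>\<^sup>+z. indicator (A j) z \<partial>P y) = ennreal (measure (P y) (A j))"
      using A prob_kernelD(2)[OF P y] by (simp add: Py.emeasure_eq_measure)
    then show "ennreal q * indicator (A (Suc j)) y \<le> (\<integral>\<^sup>+z. indicator (A j) z \<partial>P y)"
      using sticky[of y j] by (auto simp: indicator_def intro!: ennreal_leI)
  qed
  also have "\<dots> = (\<integral>\<^sup>+z. indicator (A j) z \<partial>kernel_pow S P (Suc n) x)"
    by (rule nn_integral_kernel_pow_Suc[OF P xS, symmetric]) (use A in auto)
  also have "\<dots> = ennreal (measure (kernel_pow S P (Suc n) x) (A j))"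
    using A s' by (simp add: PSn.emeasure_eq_measure del: kernel_pow.simps)
  finally have le: "q * measure (kernel_pow S P n x) (A (Suc j)) \<le> measure (kernel_pow S P (Suc n) x) (A j)"
    by (simp del: kernel_pow.simps)
  have "q ^ n \<le> measure (kernel_pow S P n x) (A (Suc j))" by (rule Suc.IH) (use Suc.prems in simp)
  then have "q * q ^ n \<le> q * measure (kernel_pow S P n x) (A (Suc j))" using \<eta> by (intro mult_left_mono) auto
  then show ?case using le by (simp del: kernel_pow.simps)
qed

lemma geometric_dominated_le:
  fixes a K q \<rho> :: real
  assumes "0 < a" "0 \<le> q" "0 < \<rho>" "\<And>n. a * q ^ n \<le> K * \<rho> ^ n"
  shows "q \<le> \<rho>"
proof (rule ccontr)
  assume "\<not> q \<le> \<rho>"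
  then have 1: "1 < q / \<rho>" using assms by (simp add: field_simps)
  obtain n where n: "K / a < (q / \<rho>) ^ n" using real_arch_pow[OF 1] by blast
  have "a * q ^ n \<le> K * \<rho> ^ n" by (rule assms)
  then have "(q / \<rho>) ^ n \<le> K / a" using assms by (simp add: power_divide field_simps)
  with n show False by simp
qed

context factored_kernel
begin

lemma opn_indicator:
  assumes F: "F \<in> sets \<pi>" and x: "x \<in> space \<pi>"
  shows "opn n (\<lambda>y. indicator F y - c) x = measure (Pn n x) F - c"
  using x
proof (induction n arbitrary: x)
  case 0 then show ?case using F by (simp add: measure_return)
next
  case (Suc n)
  interpret Px: prob_space "P x" using P_kernel Suc.prems by (rule prob_kernelD)
  interpret Pn: prob_space "Pn (Suc n) x" using Pn_kernel Suc.prems by (rule prob_kernelD)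
  have s: "sets (P x) = sets \<pi>" "space (P x) = space \<pi>" using prob_kernelD[OF P_kernel Suc.prems] by auto
  have s': "sets (Pn (Suc n) x) = sets \<pi>" using prob_kernelD[OF Pn_kernel Suc.prems] by blast
  have m: "(\<lambda>y. measure (Pn n y) F) \<in> borel_measurable (P x)"
    using F s by (simp cong: measurable_cong_sets add: measurable_compose[OF Pn_kernel measurable_measure_prob_algebra])
  have bd: "AE y in P x. norm (measure (Pn n y) F) \<le> 1"
    using s by (intro AE_I2) (auto intro!: prob_space.prob_le_1 prob_kernelD[OF Pn_kernel])
  have i: "integrable (P x) (\<lambda>y. measure (Pn n y) F)" by (rule Px.integrable_const_bound[OF bd m])
  have "opn (Suc n) (\<lambda>y. indicator F y - c) x = (\<integral>y. measure (Pn n y) F - c \<partial>P x)"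
    unfolding funpow.simps o_apply kernel_op_def
    using s Suc.IH by (intro Bochner_Integration.integral_cong) (auto simp: kernel_op_def[abs_def])
  also have "\<dots> = (\<integral>y. measure (Pn n y) F \<partial>P x) - c" using i by (simp add: Px.prob_space)
  also have "(\<integral>y. measure (Pn n y) F \<partial>P x) = measure (Pn (Suc n) x) F"
  proof -
    have "ennreal (\<integral>y. measure (Pn n y) F \<partial>P x) = (\<integral>\<^sup>+y. ennreal (measure (Pn n y) F) \<partial>P x)"
      by (rule nn_integral_eq_integral[OF i, symmetric]) simp
    also have "\<dots> = (\<integral>\<^sup>+y. \<integral>\<^sup>+z. indicator F z \<partial>Pn n y \<partial>P x)"
    proof (rule nn_integral_cong)
      fix y assume "y \<in> space (P x)"
      then have y: "y \<in> space \<pi>" using s by simp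
      interpret Py: prob_space "Pn n y" using Pn_kernel y by (rule prob_kernelD)
      show "ennreal (measure (Pn n y) F) = (\<integral>\<^sup>+z. indicator F z \<partial>Pn n y)"
        using F prob_kernelD(2)[OF Pn_kernel y] by (simp add: Py.emeasure_eq_measure)
    qed
    also have "\<dots> = (\<integral>\<^sup>+z. indicator F z \<partial>Pn (Suc n) x)"
      by (rule nn_integral_kernel_pow_Suc'[OF P_kernel Suc.prems, symmetric]) (use F in auto)
    also have "\<dots> = ennreal (measure (Pn (Suc n) x) F)"
      using F s' by (simp add: Pn.emeasure_eq_measure del: kernel_pow.simps)
    finally show ?thesis by (simp del: kernel_pow.simps add: Bochner_Integration.integral_nonneg)
  qed
  finally show ?case .
qed

text \<open>Detailed balance for the stationary flow between two sets.\<close>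

lemma overlap_integral:
  assumes F: "F \<in> sets \<pi>" "A \<in> sets \<pi>"
  shows "(\<integral>x. indicator F x * measure (P x) A \<partial>\<pi>) = (\<integral>x. indicator A x * measure (P x) F \<partial>\<pi>)"
    "integrable \<pi> (\<lambda>x. indicator F x * measure (P x) A)"
proof -
  have L: "(\<lambda>x. indicator F x :: real) \<in> L2 \<pi>" if "F \<in> sets \<pi>" for F
    using that by (intro L2_bounded[where c=1]) (auto simp: indicator_def)
  have e: "kernel_op P (indicator A :: _ \<Rightarrow> real) x = measure (P x) A" if "A \<in> sets \<pi>" "x \<in> space \<pi>" for A x
    using prob_kernelD[OF P_kernel that(2)] that by (simp add: kernel_op_def)
  have "(\<integral>x. indicator F x * kernel_op P (indicator A :: _ \<Rightarrow> real) x \<partial>\<pi>) = (\<integral>x. kernel_op P (indicator F :: _ \<Rightarrow> real) x * indicator A x \<partial>\<pi>)"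
    by (rule op_symmetric[OF L L]) (use F in auto)
  also have "(\<integral>x. indicator F x * kernel_op P (indicator A :: _ \<Rightarrow> real) x \<partial>\<pi>) = (\<integral>x. indicator F x * measure (P x) A \<partial>\<pi>)"
    using F by (intro Bochner_Integration.integral_cong) (auto simp: e)
  also have "(\<integral>x. kernel_op P (indicator F :: _ \<Rightarrow> real) x * indicator A x \<partial>\<pi>) = (\<integral>x. indicator A x * measure (P x) F \<partial>\<pi>)"
    using F by (intro Bochner_Integration.integral_cong) (auto simp: e)
  finally show "(\<integral>x. indicator F x * measure (P x) A \<partial>\<pi>) = (\<integral>x. indicator A x * measure (P x) F \<partial>\<pi>)" .
  have "integrable \<pi> (\<lambda>x. indicator F x * kernel_op P (indicator A :: _ \<Rightarrow> real) x)"
    by (rule L2_prod_integrable[OF L op_L2[OF L]]) (use F in auto)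
  then show "integrable \<pi> (\<lambda>x. indicator F x * measure (P x) A)"
    by (rule Bochner_Integration.integrable_cong[THEN iffD1, rotated 2]) (use F in \<open>auto simp: e\<close>)
qed

text \<open>Since \<open>A\<close> has positive mass, remaining in it does not by itself contradict
  convergence. The centred indicator of \<open>F\<close> has a Rayleigh quotient of at least
  \<open>1 - 6 * \<delta>\<close>, which bounds its moments from below; on the finite set
  \<open>F\<close> the numbers \<open>C x\<close> have a maximum, which bounds the same moments from
  above by a multiple of \<open>\<rho> ^ n\<close>.\<close>

lemma finite_sticky_rate:
  assumes A: "A \<in> sets \<pi>" "0 < measure \<pi> A" "measure \<pi> A \<le> 1/2" and \<delta>: "0 < \<delta>" "\<delta> \<le> 1/6"
    and sticky: "\<And>x. x \<in> A \<Longrightarrow> 1 - \<delta> \<le> measure (P x) A"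
    and F: "F \<in> sets \<pi>" "finite F" "F \<subseteq> A" "(1 - \<delta>) * measure \<pi> A \<le> measure \<pi> F"
    and \<rho>: "0 < \<rho>" and rate: "\<And>x n. x \<in> F \<Longrightarrow> tv_dist (Pn n x) \<pi> \<le> C x * \<rho> ^ n"
  shows "1 - 6 * \<delta> \<le> \<rho>"
proof -
  let ?p = "measure \<pi> F"
  have pA: "?p \<le> measure \<pi> A" using A F by (intro finite_measure_mono) auto
  have p_half: "measure \<pi> A \<le> 2 * ?p"
  proof -
    have "1/2 * measure \<pi> A \<le> (1 - \<delta>) * measure \<pi> A" using \<delta> by (intro mult_right_mono) auto
    then show ?thesis using F(4) by simp
  qed
  then have p: "0 < ?p" "?p \<le> 1/2" using A pA by auto
  have Fsp: "F \<subseteq> space \<pi>" "A \<subseteq> space \<pi>" using F A sets.sets_into_space by auto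
  define f where "f y = indicator F y - ?p" for y
  have f: "f \<in> L2 \<pi>" unfolding f_def[abs_def]
    using F p by (intro L2_bounded[where c=1]) (auto simp: indicator_def)
  have AF: "A - F \<in> sets \<pi>" using A F by auto
  have iF: "integrable \<pi> (indicator F :: _ \<Rightarrow> real)" "integrable \<pi> (indicator A :: _ \<Rightarrow> real)" "integrable \<pi> (indicator (A - F) :: _ \<Rightarrow> real)"
    using F A by (auto simp: emeasure_eq_measure)
  have F2: "indicator F x * indicator F x = (indicator F x :: real)" for x by (simp add: indicator_def)
  have ff: "(\<integral>x. f x * f x \<partial>\<pi>) = ?p * (1 - ?p)"
  proof -
    have "(\<integral>x. f x * f x \<partial>\<pi>) = (\<integral>x. (1 - 2 * ?p) * indicator F x + ?p * ?p \<partial>\<pi>)"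
      by (intro Bochner_Integration.integral_cong) (auto simp: f_def indicator_def algebra_simps)
    also have "\<dots> = (1 - 2 * ?p) * ?p + ?p * ?p" using iF F by (simp add: prob_space)
    finally show ?thesis by (simp add: algebra_simps)
  qed
  have m: "(\<integral>x. f x * opn n f x \<partial>\<pi>) = (\<integral>x. indicator F x * (measure (Pn n x) F - ?p) \<partial>\<pi>)" for n
  proof -
    have L: "opn n f \<in> L2 \<pi>" by (rule opn_L2[OF f])
    have LF: "(indicator F :: _ \<Rightarrow> real) \<in> L2 \<pi>" using F by (intro L2_bounded[where c=1]) (auto simp: indicator_def)
    have z: "(\<integral>x. opn n f x \<partial>\<pi>) = 0"
      using opn_integral[OF f, of n] iF F by (simp add: f_def prob_space)
    have "(\<integral>x. f x * opn n f x \<partial>\<pi>) = (\<integral>x. indicator F x * opn n f x - ?p * opn n f x \<partial>\<pi>)"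
      by (simp add: f_def algebra_simps)
    also have "\<dots> = (\<integral>x. indicator F x * opn n f x \<partial>\<pi>)"
      using L2_prod_integrable[OF LF L] L2_integrable[OF L] z by simp
    also have "\<dots> = (\<integral>x. indicator F x * (measure (Pn n x) F - ?p) \<partial>\<pi>)"
      unfolding f_def[abs_def] using F by (intro Bochner_Integration.integral_cong) (auto simp: opn_indicator)
    finally show ?thesis .
  qed
  have m1: "(1 - 3 * \<delta>) * ?p - ?p * ?p \<le> (\<integral>x. f x * kernel_op P f x \<partial>\<pi>)"
  proof -
    have Pn1: "measure (Pn 1 x) F = measure (P x) F" if "x \<in> space \<pi>" for x
      using opn_indicator[OF F(1) that, of "Suc 0" 0] prob_kernelD[OF P_kernel that] F
      by (simp add: kernel_op_def One_nat_def del: kernel_pow.simps)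
    have split: "measure (P x) A = measure (P x) F + measure (P x) (A - F)" if "x \<in> space \<pi>" for x
    proof -
      interpret Px: prob_space "P x" using P_kernel that by (rule prob_kernelD)
      show ?thesis using Px.finite_measure_Union[of F "A - F"] prob_kernelD(2)[OF P_kernel that] F A AF
        by (simp add: Un_absorb1)
    qed
    \<comment> \<open>The chain may be in \<open>A\<close> but outside \<open>F\<close>. By detailed
      balance this flow equals the reverse one, which is at most the mass of \<open>A - F\<close>,
      hence at most \<open>2 * \<delta> * ?p\<close>.\<close>
    have b: "(\<integral>x. indicator F x * measure (P x) (A - F) \<partial>\<pi>) \<le> measure \<pi> A - ?p"
    proof -
      have "(\<integral>x. indicator F x * measure (P x) (A - F) \<partial>\<pi>) = (\<integral>x. indicator (A - F) x * measure (P x) F \<partial>\<pi>)"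
        by (rule overlap_integral(1)[OF F(1) AF])
      also have "\<dots> \<le> (\<integral>x. indicator (A - F) x \<partial>\<pi>)"
      proof (rule integral_mono[OF overlap_integral(2)[OF AF F(1)] iF(3)])
        fix x assume "x \<in> space \<pi>"
        then show "indicator (A - F) x * measure (P x) F \<le> (indicator (A - F) x :: real)"
          using prob_space.prob_le_1[OF prob_kernelD(1)[OF P_kernel]] by (auto simp: indicator_def)
      qed
      also have "\<dots> = measure \<pi> A - ?p" using AF finite_measure_Diff[OF A(1) F(1) F(3)] by simp
      finally show ?thesis .
    qed
    have "(1 - \<delta>) * ?p = (\<integral>x. (1 - \<delta>) * indicator F x \<partial>\<pi>)" using F iF by simp
    also have "\<dots> \<le> (\<integral>x. indicator F x * measure (P x) A \<partial>\<pi>)"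
    proof (rule integral_mono[OF _ overlap_integral(2)[OF F(1) A(1)]])
      fix x show "(1 - \<delta>) * indicator F x \<le> indicator F x * measure (P x) A"
        using sticky[of x] F(3) by (auto simp: indicator_def)
    qed (use iF in auto)
    also have "\<dots> = (\<integral>x. indicator F x * measure (P x) F + indicator F x * measure (P x) (A - F) \<partial>\<pi>)"
      by (intro Bochner_Integration.integral_cong) (auto simp: split algebra_simps)
    also have "\<dots> = (\<integral>x. indicator F x * measure (P x) F \<partial>\<pi>) + (\<integral>x. indicator F x * measure (P x) (A - F) \<partial>\<pi>)"
      by (rule Bochner_Integration.integral_add[OF overlap_integral(2)[OF F(1) F(1)] overlap_integral(2)[OF F(1) AF]])
    finally have "(1 - \<delta>) * ?p - (measure \<pi> A - ?p) \<le> (\<integral>x. indicator F x * measure (P x) F \<partial>\<pi>)" using b by linarith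
    moreover have "measure \<pi> A - ?p \<le> \<delta> * measure \<pi> A" using F(4) by (simp add: algebra_simps)
    moreover have "\<delta> * measure \<pi> A \<le> \<delta> * (2 * ?p)" using \<delta> p_half by (intro mult_left_mono) auto
    ultimately have "(1 - 3 * \<delta>) * ?p \<le> (\<integral>x. indicator F x * measure (P x) F \<partial>\<pi>)" by (simp add: algebra_simps)
    moreover have "(\<integral>x. f x * kernel_op P f x \<partial>\<pi>) = (\<integral>x. indicator F x * (measure (P x) F - ?p) \<partial>\<pi>)"
      using m[of 1] Pn1 by (simp add: One_nat_def cong: Bochner_Integration.integral_cong)
    moreover have "\<dots> = (\<integral>x. indicator F x * measure (P x) F \<partial>\<pi>) - ?p * ?p"
      using overlap_integral(2)[OF F(1) F(1)] iF F by (simp add: right_diff_distrib mult.commute)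
    ultimately show ?thesis by simp
  qed
  define K where "K = (MAX x\<in>F. C x)"
  have Fne: "F \<noteq> {}" using p by auto
  have up: "(\<integral>x. f x * opn n f x \<partial>\<pi>) \<le> K * \<rho> ^ n" for n
  proof -
    have K0: "0 \<le> K"
    proof -
      obtain x where x: "x \<in> F" using Fne by blast
      have "x \<in> space \<pi>" using x Fsp by auto
      \<comment> \<open>Testing with the empty set shows that \<open>tv_dist\<close> is
        nonnegative.\<close>
      then have "measure (Pn 0 x) {} - measure \<pi> {} \<le> tv_dist (Pn 0 x) \<pi>"
        using prob_kernelD[OF Pn_kernel, of x 0] by (intro tv_dist_set prob_space_axioms) (auto simp del: kernel_pow.simps)
      then have "0 \<le> C x * \<rho> ^ 0" using rate[OF x, of 0] by simp
      moreover have "C x \<le> K" unfolding K_def using x F by (intro Max_ge) auto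
      ultimately show ?thesis by simp
    qed
    have "(\<integral>x. indicator F x * (measure (Pn n x) F - ?p) \<partial>\<pi>) \<le> (\<integral>x. K * \<rho> ^ n * indicator F x \<partial>\<pi>)"
    proof (rule integral_mono')
      show "integrable \<pi> (\<lambda>x. K * \<rho> ^ n * indicator F x)" using iF by auto
      show "0 \<le> K * \<rho> ^ n * indicator F x" for x using K0 \<rho> by (simp add: indicator_def)
      fix x assume x: "x \<in> space \<pi>"
      show "indicator F x * (measure (Pn n x) F - ?p) \<le> K * \<rho> ^ n * indicator F x"
      proof (cases "x \<in> F")
        case True
        have "measure (Pn n x) F - ?p \<le> tv_dist (Pn n x) \<pi>"
          using prob_kernelD[OF Pn_kernel x] F by (intro tv_dist_set prob_space_axioms) auto
        also have "\<dots> \<le> C x * \<rho> ^ n" by (rule rate[OF True])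
        also have "\<dots> \<le> K * \<rho> ^ n" unfolding K_def using True F \<rho> by (intro mult_right_mono Max_ge) auto
        finally show ?thesis using True by simp
      qed simp
    qed
    also have "\<dots> = K * \<rho> ^ n * ?p" using iF F by simp
    also have "\<dots> \<le> K * \<rho> ^ n * 1" using K0 \<rho> p by (intro mult_left_mono) auto
    finally show ?thesis unfolding m by simp
  qed
  let ?q = "(\<integral>x. f x * kernel_op P f x \<partial>\<pi>) / (\<integral>x. f x * f x \<partial>\<pi>)"
  have pos: "0 < ?p * (1 - ?p)" using p by simp
  have "1 - 6 * \<delta> \<le> ?q"
  proof -
    have "(1 - 6 * \<delta>) * (?p * (1 - ?p)) \<le> (1 - 3 * \<delta>) * ?p - ?p * ?p"
    proof -
      \<comment> \<open>The division by \<open>1 - ?p\<close>, which is at least 1/2, at most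
        doubles the loss \<open>3 * \<delta>\<close>.\<close>
      have "3 * \<delta> * ?p \<le> 6 * \<delta> * ?p * (1 - ?p)" using p \<delta> by (simp add: field_simps)
      then show ?thesis by (simp add: algebra_simps)
    qed
    also note m1
    finally show ?thesis unfolding ff using pos by (simp add: le_divide_eq)
  qed
  also have "?q \<le> \<rho>"
  proof (rule geometric_dominated_le[OF pos _ \<rho>])
    show "0 \<le> ?q" using op_positive[OF f] pos unfolding ff by (rule divide_nonneg_pos)
    show "?p * (1 - ?p) * ?q ^ n \<le> K * \<rho> ^ n" for n
      using moments_lower_bound[OF f, of n] up[of n] pos unfolding ff by linarith
  qed
  finally show ?thesis .
qed

end

section \<open>The particle system of ancestral paths\<close>

definition sel_prob :: "nat \<Rightarrow> (nat \<Rightarrow> real) \<Rightarrow> nat \<Rightarrow> ennreal" where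
  "sel_prob N w k = (if (\<Sum>j\<in>{1..N}. w j) = 0 then indicator {1} k else ennreal (w k / (\<Sum>j\<in>{1..N}. w j)))"

lemma select_index_eq: "select_index N w = point_measure {1..N} (sel_prob N w)"
  by (simp add: select_index_def sel_prob_def[abs_def])

lemma nn_integral_select_index: "(\<integral>\<^sup>+k. f k \<partial>select_index N w) = (\<Sum>k\<in>{1..N}. sel_prob N w k * f k)"
  by (simp add: select_index_eq nn_integral_point_measure_finite)

lemma sets_select_index: "sets (select_index N w) = sets (count_space {1..N})"
  by (simp add: select_index_eq sets_point_measure)

lemma space_select_index: "space (select_index N w) = {1..N}"
  by (simp add: select_index_eq space_point_measure)

lemma sel_prob_cong:
  assumes "\<And>k. k \<in> {1..N} \<Longrightarrow> w k = w' k" "k \<in> {1..N}"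
  shows "sel_prob N w k = sel_prob N w' k"
proof -
  have "(\<Sum>j\<in>{1..N}. w j) = (\<Sum>j\<in>{1..N}. w' j)" using assms(1) by (intro sum.cong) auto
  then show ?thesis using assms by (simp add: sel_prob_def)
qed

lemma select_index_cong:
  assumes "\<And>k. k \<in> {1..N} \<Longrightarrow> w k = w' k"
  shows "select_index N w = select_index N w'"
  unfolding select_index_eq point_measure_def
  by (rule density_cong) (use sel_prob_cong[OF assms] in \<open>auto intro!: AE_I2\<close>)

lemma sum_sel_prob:
  assumes "1 \<le> N" "\<And>k. k \<in> {1..N} \<Longrightarrow> 0 \<le> w k"
  shows "(\<Sum>k\<in>{1..N}. sel_prob N w k) = 1"
proof (cases "(\<Sum>j\<in>{1..N}. w j) = 0")
  case True
  then have "(\<Sum>k\<in>{1..N}. sel_prob N w k) = (\<Sum>k\<in>{1..N}. if k = 1 then 1 else 0)"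
    by (intro sum.cong) (auto simp: sel_prob_def indicator_def)
  then show ?thesis using assms(1) by simp
next
  case False
  have "(\<Sum>k\<in>{1..N}. sel_prob N w k) = (\<Sum>k\<in>{1..N}. ennreal (w k / (\<Sum>j\<in>{1..N}. w j)))"
    using False by (simp add: sel_prob_def)
  also have "\<dots> = ennreal (\<Sum>k\<in>{1..N}. w k / (\<Sum>j\<in>{1..N}. w j))"
    by (rule sum_ennreal) (intro divide_nonneg_nonneg sum_nonneg assms)
  also have "\<dots> = 1" using False by (simp flip: sum_divide_distrib)
  finally show ?thesis .
qed

lemma prob_space_select_index:
  assumes "1 \<le> N" "\<And>k. k \<in> {1..N} \<Longrightarrow> 0 \<le> w k"
  shows "prob_space (select_index N w)"
proof
  show "emeasure (select_index N w) (space (select_index N w)) = 1"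
    using sum_sel_prob[OF assms] by (simp add: space_select_index) (simp add: select_index_eq emeasure_point_measure_finite)
qed

lemma select_index_kernel:
  assumes N: "1 \<le> N" and w: "\<And>k. k \<in> {1..N} \<Longrightarrow> (\<lambda>\<zeta>. w \<zeta> k) \<in> borel_measurable L"
    "\<And>\<zeta> k. \<zeta> \<in> space L \<Longrightarrow> k \<in> {1..N} \<Longrightarrow> 0 \<le> w \<zeta> k"
  shows "(\<lambda>\<zeta>. select_index N (w \<zeta>)) \<in> L \<rightarrow>\<^sub>M prob_algebra (count_space {1..N})"
proof (rule measurable_prob_algebraI)
  show ps: "prob_space (select_index N (w \<zeta>))" if "\<zeta> \<in> space L" for \<zeta>
    by (rule prob_space_select_index[OF N w(2)[OF that]])
  show "(\<lambda>\<zeta>. select_index N (w \<zeta>)) \<in> L \<rightarrow>\<^sub>M subprob_algebra (count_space {1..N})"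
  proof (rule measurable_subprob_algebra)
    fix A assume A: "A \<in> sets (count_space {1..N})"
    have [measurable]: "(\<lambda>\<zeta>. \<Sum>j\<in>{1..N}. w \<zeta> j) \<in> borel_measurable L" by (intro borel_measurable_sum w)
    have "(\<lambda>\<zeta>. \<Sum>k\<in>A. sel_prob N (w \<zeta>) k) \<in> borel_measurable L"
    proof (intro borel_measurable_sum)
      fix k assume "k \<in> A"
      then have [measurable]: "(\<lambda>\<zeta>. w \<zeta> k) \<in> borel_measurable L" using A by (intro w) auto
      show "(\<lambda>\<zeta>. sel_prob N (w \<zeta>) k) \<in> borel_measurable L" unfolding sel_prob_def by measurable
    qed
    then show "(\<lambda>\<zeta>. emeasure (select_index N (w \<zeta>)) A) \<in> borel_measurable L"
      using A by (simp add: select_index_eq emeasure_point_measure_finite)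
  qed (use ps in \<open>auto simp: sets_select_index prob_space_imp_subprob_space\<close>)
qed

lemma measurable_index_apply:
  assumes "finite I" shows "(\<lambda>(\<zeta>, k). \<zeta> k) \<in> PiM I (\<lambda>_. S) \<Otimes>\<^sub>M count_space I \<rightarrow>\<^sub>M S"
proof -
  have "(\<lambda>\<omega>. (fst \<omega>) (snd \<omega>)) \<in> PiM I (\<lambda>_. S) \<Otimes>\<^sub>M count_space I \<rightarrow>\<^sub>M S"
  proof (rule measurable_compose_countable'[where I=I])
    fix i assume "i \<in> I"
    then show "(\<lambda>\<omega>. fst \<omega> i) \<in> PiM I (\<lambda>_. S) \<Otimes>\<^sub>M count_space I \<rightarrow>\<^sub>M S"
      by (intro measurable_compose[OF measurable_fst measurable_component_singleton])
  qed (use assms in \<open>auto intro: countable_finite\<close>)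
  then show ?thesis by (simp add: case_prod_beta)
qed

lemma product_prob_space_const: "prob_space \<mu> \<Longrightarrow> product_prob_space (\<lambda>_. \<mu>)"
  by (intro product_prob_spaceI)

lemma nn_integral_PiM_single:
  assumes \<mu>: "prob_space \<mu>" and I: "i \<in> I" and f: "f \<in> borel_measurable \<mu>"
  shows "(\<integral>\<^sup>+\<xi>. f (\<xi> i) \<partial>PiM I (\<lambda>_. \<mu>)) = (\<integral>\<^sup>+p. f p \<partial>\<mu>)"
proof -
  have "(\<integral>\<^sup>+p. f p \<partial>distr (PiM I (\<lambda>_. \<mu>)) \<mu> (\<lambda>\<xi>. \<xi> i)) = (\<integral>\<^sup>+\<xi>. f (\<xi> i) \<partial>PiM I (\<lambda>_. \<mu>))"
    by (rule nn_integral_distr) (use I f in auto)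
  then show ?thesis using distr_PiM_component[of I "\<lambda>_. \<mu>" i] \<mu> I by simp
qed

lemma distr_PiM_compose:
  assumes I: "finite I" and L: "\<And>i. i \<in> I \<Longrightarrow> prob_space (L i)" "\<And>i. i \<in> I \<Longrightarrow> sets (L i) = sets A"
    and g: "g \<in> A \<rightarrow>\<^sub>M S"
  shows "distr (PiM I L) (PiM I (\<lambda>_. S)) (compose I g) = PiM I (\<lambda>i. distr (L i) S g)"
proof -
  have gL: "g \<in> L i \<rightarrow>\<^sub>M S" if "i \<in> I" for i using g by (simp add: measurable_cong_sets[OF L(2)[OF that] refl])
  have "distr (PiM I L) (PiM I (\<lambda>_. S)) (compose I g) = distr (PiM I L) (PiM I (\<lambda>i. distr (L i) S g)) (compose I g)"
    by (rule distr_cong[OF refl sets_PiM_cong]) auto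
  also have "\<dots> = PiM I (\<lambda>i. distr (L i) (distr (L i) S g) g)"
    by (rule distr_PiM_finite_prob_space') (use I L gL in \<open>auto intro: prob_space.prob_space_distr\<close>)
  also have "\<dots> = PiM I (\<lambda>i. distr (L i) S g)"
    by (intro PiM_cong refl distr_cong) auto
  finally show ?thesis .
qed

text \<open>\<open>csmc_step\<close> has a point mass in the reference slot of its product, whereas
  the analysis draws the free particles and then writes the reference in.\<close>

lemma PiM_return_insert:
  assumes I: "finite I" "j \<notin> I" and \<mu>: "prob_space \<mu>" "sets \<mu> = sets S" and p: "p \<in> space S"
  shows "PiM (insert j I) (\<lambda>i. if i = j then return S p else \<mu>) =
    distr (PiM I (\<lambda>_. \<mu>)) (PiM (insert j I) (\<lambda>_. S)) (\<lambda>\<xi>. \<xi>(j := p))"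
proof -
  define K where "K = (\<lambda>i. if i = j then return S p else \<mu>)"
  have sp: "space \<mu> = space S" using \<mu>(2) by (rule sets_eq_imp_space_eq)
  have pK: "prob_space (K i)" for i using \<mu> prob_space_return[OF p] by (auto simp: K_def)
  then interpret K: product_prob_space K by (rule product_prob_spaceI)
  interpret m: product_prob_space "\<lambda>_. \<mu>" by (rule product_prob_space_const[OF \<mu>(1)])
  have sK: "sets (K i) = sets S" for i using \<mu> by (simp add: K_def)
  have sI: "sets (PiM I (\<lambda>_. \<mu>)) = sets (PiM I (\<lambda>_. S))" by (intro sets_PiM_cong refl \<mu>)
  have u: "(\<lambda>\<xi>. \<xi>(j := p)) \<in> PiM I (\<lambda>_. \<mu>) \<rightarrow>\<^sub>M PiM (insert j I) (\<lambda>_. S)"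
    unfolding measurable_cong_sets[OF sI refl] using p by measurable
  have "distr (PiM I (\<lambda>_. \<mu>)) (PiM (insert j I) (\<lambda>_. S)) (\<lambda>\<xi>. \<xi>(j := p)) = PiM (insert j I) K"
  proof (rule K.PiM_eqI)
    show "sets (distr (PiM I (\<lambda>_. \<mu>)) (PiM (insert j I) (\<lambda>_. S)) (\<lambda>\<xi>. \<xi>(j := p))) = sets (PiM (insert j I) K)"
      using sets_PiM_cong[OF refl, of "insert j I" "\<lambda>_. S" K] sK by simp
    fix A assume A: "\<And>i. i \<in> insert j I \<Longrightarrow> A i \<in> sets (K i)"
    have AS: "A i \<in> sets S" if "i \<in> insert j I" for i using A[OF that] sK by simp
    have B: "Pi\<^sub>E (insert j I) A \<in> sets (PiM (insert j I) (\<lambda>_. S))" by (intro sets_PiM_I_finite) (use I AS in auto)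
    have e: "(\<lambda>\<xi>. \<xi>(j := p)) -` (Pi\<^sub>E (insert j I) A) \<inter> space (PiM I (\<lambda>_. \<mu>)) = (if p \<in> A j then Pi\<^sub>E I A else {})"
    proof (intro set_eqI iffI)
      fix \<xi> assume "\<xi> \<in> (\<lambda>\<xi>. \<xi>(j := p)) -` (Pi\<^sub>E (insert j I) A) \<inter> space (PiM I (\<lambda>_. \<mu>))"
      then have 1: "\<xi>(j := p) \<in> Pi\<^sub>E (insert j I) A" and 2: "\<xi> \<in> extensional I" by (auto simp: space_PiM PiE_iff)
      have "p \<in> A j" using PiE_mem[OF 1, of j] by simp
      moreover have "\<xi> i \<in> A i" if "i \<in> I" for i
        using PiE_mem[OF 1, of i] that I by (cases "i = j") auto
      ultimately show "\<xi> \<in> (if p \<in> A j then Pi\<^sub>E I A else {})" using 2 by (auto simp: PiE_iff)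
    next
      fix \<xi> assume "\<xi> \<in> (if p \<in> A j then Pi\<^sub>E I A else {})"
      then have 1: "p \<in> A j" and 2: "\<xi> \<in> Pi\<^sub>E I A" by (auto split: if_splits)
      have "\<xi>(j := p) \<in> Pi\<^sub>E (insert j I) A" using PiE_fun_upd[of p A j \<xi> I] 1 2 by simp
      moreover have "\<xi> \<in> space (PiM I (\<lambda>_. \<mu>))"
        using 2 AS[THEN sets.sets_into_space] sp by (auto simp: space_PiM PiE_iff)
      ultimately show "\<xi> \<in> (\<lambda>\<xi>. \<xi>(j := p)) -` (Pi\<^sub>E (insert j I) A) \<inter> space (PiM I (\<lambda>_. \<mu>))" by simp
    qed
    have "emeasure (distr (PiM I (\<lambda>_. \<mu>)) (PiM (insert j I) (\<lambda>_. S)) (\<lambda>\<xi>. \<xi>(j := p))) (Pi\<^sub>E (insert j I) A) =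
        (if p \<in> A j then emeasure (PiM I (\<lambda>_. \<mu>)) (Pi\<^sub>E I A) else 0)"
      by (simp add: emeasure_distr[OF u B] e)
    also have "\<dots> = indicator (A j) p * (\<Prod>i\<in>I. emeasure \<mu> (A i))"
      using I AS \<mu> by (subst m.emeasure_PiM) auto
    also have "\<dots> = (\<Prod>i\<in>insert j I. emeasure (K i) (A i))"
    proof -
      have "(\<Prod>i\<in>I. emeasure (K i) (A i)) = (\<Prod>i\<in>I. emeasure \<mu> (A i))"
        using I by (intro prod.cong) (auto simp: K_def)
      then show ?thesis using I AS by (simp add: K_def)
    qed
    finally show "emeasure (distr (PiM I (\<lambda>_. \<mu>)) (PiM (insert j I) (\<lambda>_. S)) (\<lambda>\<xi>. \<xi>(j := p))) (Pi\<^sub>E (insert j I) A) =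
        (\<Prod>i\<in>insert j I. emeasure (K i) (A i))" .
  qed (use I in auto)
  then show ?thesis by (simp add: K_def)
qed

locale csmc_model = smc_model Z T M1 M G
  for Z :: "'z measure" and T M1 M and G :: "nat \<Rightarrow> 'z \<Rightarrow> real" +
  fixes N :: nat
  assumes N_ge_1: "1 \<le> N"
begin

abbreviation "E n \<equiv> path_space Z n"
abbreviation "S n \<equiv> PiM {1..N} (\<lambda>_. E n)"
abbreviation "ext n \<equiv> path_ext Z M1 M n"

text \<open>Level 0 consists of the empty path with potential 1, so that drawing from the initial
  distribution is an instance of the general selection and mutation step.\<close>

definition "pot n p = (if n = 0 then 1 else G n (p n))"
abbreviation "selp n \<zeta> \<equiv> sel_prob N (\<lambda>k. pot n (\<zeta> k))"
definition "sel n \<zeta> = select_index N (\<lambda>k. pot n (\<zeta> k))"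
definition "mut n \<zeta> = bind (sel n \<zeta>) (\<lambda>k. ext n (\<zeta> k))"
text \<open>Slot 1 receives the initial segment of \<open>x\<close> itself rather than an extension
  of \<open>\<zeta> 1\<close>. The two agree along \<open>psys x\<close>, and in this form the step
  depends on \<open>\<zeta>\<close> only through \<open>mut\<close>.\<close>

definition "cstep x n \<zeta> = distr (PiM {2..N} (\<lambda>_. mut n \<zeta>)) (S (Suc n)) (\<lambda>\<xi>. \<xi>(1 := restrict x {1..Suc n}))"
definition "out \<zeta> = distr (sel T \<zeta>) (E T) \<zeta>"
definition "sys0 = (\<lambda>i\<in>{1..N}. \<lambda>_::nat. undefined :: 'z)"

text \<open>Conditional SMC as a Markov chain of path systems. Each slot carries its whole ancestral
  line, so no ancestor indices remain.\<close>

primrec psys where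
  "psys x 0 = return (S 0) sys0"
| "psys x (Suc n) = bind (psys x n) (cstep x n)"

lemma M1_in: "M1 \<in> space (prob_algebra Z)"
  using init_prob by (simp add: space_prob_algebra)

lemma insert_particles: "{1..N} = insert 1 {2..N}"
  using N_ge_1 by auto

lemma ext_kernel: "n < T \<Longrightarrow> ext n \<in> E n \<rightarrow>\<^sub>M prob_algebra (E (Suc n))"
  by (rule path_ext_kernel[OF M1_in]) (use kernel in auto)

lemma pot_measurable: "n \<le> T \<Longrightarrow> pot n \<in> borel_measurable (E n)"
proof (cases "n = 0")
  case False
  assume "n \<le> T"
  then have "G n \<in> borel_measurable Z" "(\<lambda>p. p n) \<in> E n \<rightarrow>\<^sub>M Z"
    using False by (auto intro!: G_measurable measurable_component_singleton)
  then show ?thesis using False measurable_compose by (auto simp: pot_def[abs_def])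
qed (simp add: pot_def[abs_def])

lemma pot_nonneg: "n \<le> T \<Longrightarrow> p \<in> space (E n) \<Longrightarrow> 0 \<le> pot n p"
  by (auto simp: pot_def space_PiM intro!: G_nonneg)

lemma sys_component: "\<zeta> \<in> space (S n) \<Longrightarrow> k \<in> {1..N} \<Longrightarrow> \<zeta> k \<in> space (E n)"
  by (auto simp: space_PiM)

lemma component_measurable: "k \<in> {1..N} \<Longrightarrow> (\<lambda>\<zeta>. \<zeta> k) \<in> S n \<rightarrow>\<^sub>M E n"
  by (rule measurable_component_singleton)

lemma pot_component: "n \<le> T \<Longrightarrow> k \<in> {1..N} \<Longrightarrow> (\<lambda>\<zeta>. pot n (\<zeta> k)) \<in> borel_measurable (S n)"
  by (rule measurable_compose[OF component_measurable pot_measurable])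

lemma sel_kernel: "n \<le> T \<Longrightarrow> sel n \<in> S n \<rightarrow>\<^sub>M prob_algebra (count_space {1..N})"
  unfolding sel_def[abs_def]
  by (rule select_index_kernel[OF N_ge_1]) (erule (1) pot_component, rule pot_nonneg[OF _ sys_component])

lemma sets_sel: "sets (sel n \<zeta>) = sets (count_space {1..N})" and space_sel: "space (sel n \<zeta>) = {1..N}"
  by (auto simp: sel_def sets_select_index space_select_index)

lemma mut_kernel:
  assumes "n < T" shows "mut n \<in> S n \<rightarrow>\<^sub>M prob_algebra (E (Suc n))"
  unfolding mut_def[abs_def]
proof (rule measurable_bind_prob_space2)
  show "sel n \<in> S n \<rightarrow>\<^sub>M prob_algebra (count_space {1..N})" using assms by (intro sel_kernel) auto
  show "(\<lambda>(\<zeta>, k). ext n (\<zeta> k)) \<in> S n \<Otimes>\<^sub>M count_space {1..N} \<rightarrow>\<^sub>M prob_algebra (E (Suc n))"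
    using measurable_compose[OF measurable_index_apply ext_kernel[OF assms], of "{1..N}"] by (simp add: case_prod_beta)
qed

lemma out_kernel: "out \<in> S T \<rightarrow>\<^sub>M prob_algebra (E T)"
  unfolding out_def[abs_def]
  by (rule measurable_distr_prob_space2[OF sel_kernel[OF order_refl] measurable_index_apply]) simp

lemma nn_integral_sel: "(\<integral>\<^sup>+k. f k \<partial>sel n \<zeta>) = (\<Sum>k\<in>{1..N}. selp n \<zeta> k * f k)"
  by (simp add: sel_def nn_integral_select_index)

lemma nn_integral_mut:
  assumes n: "n < T" and \<zeta>: "\<zeta> \<in> space (S n)" and f: "f \<in> borel_measurable (E (Suc n))"
  shows "(\<integral>\<^sup>+p. f p \<partial>mut n \<zeta>) = (\<Sum>k\<in>{1..N}. selp n \<zeta> k * (\<integral>\<^sup>+p. f p \<partial>ext n (\<zeta> k)))"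
proof -
  have "(\<lambda>k. ext n (\<zeta> k)) \<in> count_space {1..N} \<rightarrow>\<^sub>M prob_algebra (E (Suc n))"
    using \<zeta> by (auto intro!: measurable_space[OF ext_kernel[OF n]] sys_component)
  then show ?thesis unfolding mut_def
    by (subst nn_integral_bind_kernel[OF _ sets_sel f]) (auto simp: nn_integral_sel)
qed

lemma nn_integral_out:
  assumes \<zeta>: "\<zeta> \<in> space (S T)" and f: "f \<in> borel_measurable (E T)"
  shows "(\<integral>\<^sup>+p. f p \<partial>out \<zeta>) = (\<Sum>k\<in>{1..N}. selp T \<zeta> k * f (\<zeta> k))"
proof -
  have "\<zeta> \<in> sel T \<zeta> \<rightarrow>\<^sub>M E T" using \<zeta> by (auto simp: measurable_cong_sets[OF sets_sel refl] sys_component)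
  then show ?thesis unfolding out_def using f by (subst nn_integral_distr) (auto simp: nn_integral_sel)
qed

lemma restrict_path: "n \<le> m \<Longrightarrow> (\<lambda>x. restrict x {1..n}) \<in> E m \<rightarrow>\<^sub>M E n"
  by (rule measurable_restrict_subset) auto

lemma insert_ref_measurable:
  "(\<lambda>(p, \<xi>). \<xi>(1 := p)) \<in> E n \<Otimes>\<^sub>M PiM {2..N} (\<lambda>_. E n) \<rightarrow>\<^sub>M S n"
proof -
  have "(\<lambda>z. (\<lambda>(f, y). f(1 := y)) (snd z, fst z)) \<in> E n \<Otimes>\<^sub>M PiM {2..N} (\<lambda>_. E n) \<rightarrow>\<^sub>M PiM (insert 1 {2..N}) (\<lambda>_. E n)"
    by (rule measurable_compose[OF _ measurable_add_dim]) measurable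
  then show ?thesis by (simp add: insert_particles case_prod_beta)
qed

lemma free_kernel: "n < T \<Longrightarrow> (\<lambda>\<zeta>. PiM {2..N} (\<lambda>_. mut n \<zeta>)) \<in> S n \<rightarrow>\<^sub>M prob_algebra (PiM {2..N} (\<lambda>_. E (Suc n)))"
  by (rule measurable_PiM_kernel) (auto intro: mut_kernel)

lemma cstep_kernel2:
  assumes "n < m" "m \<le> T"
  shows "(\<lambda>(x, \<zeta>). cstep x n \<zeta>) \<in> E m \<Otimes>\<^sub>M S n \<rightarrow>\<^sub>M prob_algebra (S (Suc n))"
  unfolding cstep_def case_prod_beta
proof (rule measurable_distr_prob_space2)
  show "(\<lambda>z. PiM {2..N} (\<lambda>_. mut n (snd z))) \<in> E m \<Otimes>\<^sub>M S n \<rightarrow>\<^sub>M prob_algebra (PiM {2..N} (\<lambda>_. E (Suc n)))"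
    using assms by (intro measurable_compose[OF measurable_snd free_kernel]) auto
  have r: "(\<lambda>x. restrict x {1..Suc n}) \<in> E m \<rightarrow>\<^sub>M E (Suc n)" using assms by (intro restrict_path) auto
  have "(\<lambda>z. (\<lambda>(p, \<xi>). \<xi>(1 := p)) (restrict (fst (fst z)) {1..Suc n}, snd z))
      \<in> (E m \<Otimes>\<^sub>M S n) \<Otimes>\<^sub>M PiM {2..N} (\<lambda>_. E (Suc n)) \<rightarrow>\<^sub>M S (Suc n)"
    by (rule measurable_compose[OF measurable_Pair insert_ref_measurable])
      (rule measurable_compose[OF _ r], measurable)
  then show "(\<lambda>(z, \<xi>). \<xi>(1 := restrict (fst z) {1..Suc n})) \<in> (E m \<Otimes>\<^sub>M S n) \<Otimes>\<^sub>M PiM {2..N} (\<lambda>_. E (Suc n)) \<rightarrow>\<^sub>M S (Suc n)"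
    by (simp add: case_prod_beta)
qed

lemma sys0_in: "sys0 \<in> space (S 0)"
  by (auto simp: sys0_def space_PiM)

lemma psys_kernel: "n \<le> m \<Longrightarrow> m \<le> T \<Longrightarrow> (\<lambda>x. psys x n) \<in> E m \<rightarrow>\<^sub>M prob_algebra (S n)"
proof (induction n)
  case 0
  have "return (S 0) sys0 \<in> space (prob_algebra (S 0))"
    using prob_space_return[OF sys0_in] by (simp add: space_prob_algebra)
  then show ?case by simp
next
  case (Suc n)
  then have 1: "(\<lambda>x. psys x n) \<in> E m \<rightarrow>\<^sub>M prob_algebra (S n)"
    and 2: "(\<lambda>(x, \<zeta>). cstep x n \<zeta>) \<in> E m \<Otimes>\<^sub>M S n \<rightarrow>\<^sub>M prob_algebra (S (Suc n))"
    by (auto intro: cstep_kernel2)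
  show ?case using measurable_bind_prob_space2[OF 1 2] by simp
qed

lemma cstep_kernel:
  assumes "n < m" "m \<le> T" "x \<in> space (E m)"
  shows "cstep x n \<in> S n \<rightarrow>\<^sub>M prob_algebra (S (Suc n))"
  using measurable_compose[OF measurable_Pair1'[OF assms(3)] cstep_kernel2[OF assms(1,2)]] by simp

lemma psys_prob:
  assumes "n \<le> m" "m \<le> T" "x \<in> space (E m)"
  shows "prob_space (psys x n)" "sets (psys x n) = sets (S n)" "space (psys x n) = space (S n)"
  using prob_kernelD[OF psys_kernel[OF assms(1,2)] assms(3)] by auto

lemma psys_cong: "(\<And>i. i \<in> {1..n} \<Longrightarrow> x i = y i) \<Longrightarrow> psys x n = psys y n"
proof (induction n)
  case (Suc n)
  then have "psys x n = psys y n" by (intro Suc.IH) auto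
  moreover have "restrict x {1..Suc n} = restrict y {1..Suc n}" using Suc.prems by auto
  ultimately show ?case by (simp add: cstep_def[abs_def])
qed simp

lemma nn_integral_psys_Suc:
  assumes n: "n < m" "m \<le> T" and x: "x \<in> space (E m)" and f: "f \<in> borel_measurable (S (Suc n))"
  shows "(\<integral>\<^sup>+\<zeta>. f \<zeta> \<partial>psys x (Suc n)) = (\<integral>\<^sup>+\<zeta>. \<integral>\<^sup>+\<zeta>'. f \<zeta>' \<partial>cstep x n \<zeta> \<partial>psys x n)"
  using nn_integral_bind_kernel[OF cstep_kernel[OF assms(1-3)] psys_prob(2)[OF _ n(2) x] f] n by simp

lemma mut_prob:
  assumes "n < T" "\<zeta> \<in> space (S n)"
  shows "prob_space (mut n \<zeta>)" "sets (mut n \<zeta>) = sets (E (Suc n))" "space (mut n \<zeta>) = space (E (Suc n))"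
  using prob_kernelD[OF mut_kernel[OF assms(1)] assms(2)] by auto

lemma restrict_in: "x \<in> space (E m) \<Longrightarrow> n \<le> m \<Longrightarrow> restrict x {1..n} \<in> space (E n)"
  using measurable_space[OF restrict_path] by blast

lemma nn_integral_cstep:
  assumes n: "n < m" "m \<le> T" and x: "x \<in> space (E m)" and \<zeta>: "\<zeta> \<in> space (S n)" and f: "f \<in> borel_measurable (S (Suc n))"
  shows "(\<integral>\<^sup>+\<zeta>'. f \<zeta>' \<partial>cstep x n \<zeta>) = (\<integral>\<^sup>+\<xi>. f (\<xi>(1 := restrict x {1..Suc n})) \<partial>PiM {2..N} (\<lambda>_. mut n \<zeta>))"
proof -
  have nT: "n < T" using n by simp
  have s: "sets (PiM {2..N} (\<lambda>_. mut n \<zeta>)) = sets (PiM {2..N} (\<lambda>_. E (Suc n)))"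
    by (intro sets_PiM_cong refl mut_prob[OF nT \<zeta>])
  have "restrict x {1..Suc n} \<in> space (E (Suc n))" using x n by (intro restrict_in) auto
  then have "(\<lambda>\<xi>. \<xi>(1 := restrict x {1..Suc n})) \<in> PiM {2..N} (\<lambda>_. mut n \<zeta>) \<rightarrow>\<^sub>M S (Suc n)"
    using measurable_Pair2[OF insert_ref_measurable] by (simp add: measurable_cong_sets[OF s refl])
  then show ?thesis unfolding cstep_def by (subst nn_integral_distr) (use f in auto)
qed

end

section \<open>The conditional SMC law in terms of ancestral paths\<close>

text \<open>The first step back uses the new ancestor vector; every later one uses an index below
  \<open>n\<close>, where the update is invisible, so what remains is the lineage of the parent in
  the older system.\<close>

lemma lineage_step:
  assumes "d < n" "1 \<le> n"
  shows "lineage (Suc n) (a(n := \<alpha>)) k (Suc d) = lineage n a (\<alpha> k) d"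
  using assms
proof (induction d)
  case (Suc d)
  then have IH: "lineage (Suc n) (a(n := \<alpha>)) k (Suc d) = lineage n a (\<alpha> k) d" by linarith
  have i: "Suc n - Suc (Suc d) \<noteq> n" "Suc n - Suc (Suc d) = n - Suc d" using Suc.prems by auto
  have "lineage (Suc n) (a(n := \<alpha>)) k (Suc (Suc d)) =
      (a(n := \<alpha>)) (Suc n - Suc (Suc d)) (lineage (Suc n) (a(n := \<alpha>)) k (Suc d))" by (rule lineage.simps(2))
  also have "\<dots> = a (n - Suc d) (lineage n a (\<alpha> k) d)" unfolding IH using i by simp
  finally show ?case by (simp only: lineage.simps(2))
qed simp

context csmc_model
begin

abbreviation "C n \<equiv> csmc_space Z N n"
abbreviation "particles x n \<equiv> csmc_particles Z M1 M G N x n"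

definition "paths n za = (\<lambda>i\<in>{1..N}. \<lambda>t\<in>{1..n}. fst za t (lineage n (snd za) i (n - t)))"

definition "pstep x n za = (if n = 0 then
    distr (PiM {1..N} (\<lambda>i. if i = 1 then return Z (x 1) else M1)) (C (Suc n)) (\<lambda>z1. ((fst za)(1 := z1), snd za))
  else distr (csmc_step Z N (G n) (M (Suc n)) (x (Suc n)) (fst za n)) (C (Suc n))
    (\<lambda>m. ((fst za)(Suc n := (\<lambda>i\<in>{1..N}. snd (m i))), (snd za)(n := (\<lambda>i\<in>{1..N}. fst (m i))))))"

text \<open>The variant of \<open>cstep\<close> that extends the path already held in slot 1; this
  is what tracing ancestors produces.\<close>

definition "cstep' x n \<zeta> = distr (PiM {2..N} (\<lambda>_. mut n \<zeta>)) (S (Suc n)) (\<lambda>\<xi>. \<xi>(1 := (\<zeta> 1)(Suc n := x (Suc n))))"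

lemma particles_Suc: "particles x (Suc n) = bind (particles x n) (pstep x n)"
  by (simp add: pstep_def[abs_def] case_prod_beta')

lemma C_space:
  assumes "za \<in> space (C n)"
  shows "t \<in> {1..n} \<Longrightarrow> fst za t \<in> space (PiM {1..N} (\<lambda>_. Z))"
    "t \<in> {1..n} \<Longrightarrow> i \<in> {1..N} \<Longrightarrow> fst za t i \<in> space Z"
    "t \<in> {1..<n} \<Longrightarrow> i \<in> {1..N} \<Longrightarrow> snd za t i \<in> {1..N}"
  using assms by (auto simp: csmc_space_def space_pair_measure space_PiM PiE_iff)

lemma fst_component: "t \<in> {1..n} \<Longrightarrow> (\<lambda>za. fst za t) \<in> C n \<rightarrow>\<^sub>M PiM {1..N} (\<lambda>_. Z)"
  unfolding csmc_space_def by (rule measurable_compose[OF measurable_fst measurable_component_singleton])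

lemma fst_component2: "t \<in> {1..n} \<Longrightarrow> i \<in> {1..N} \<Longrightarrow> (\<lambda>za. fst za t i) \<in> C n \<rightarrow>\<^sub>M Z"
  by (rule measurable_compose[OF fst_component measurable_component_singleton])

lemma snd_component2: "t \<in> {1..<n} \<Longrightarrow> i \<in> {1..N} \<Longrightarrow> (\<lambda>za. snd za t i) \<in> C n \<rightarrow>\<^sub>M count_space {1..N}"
proof -
  assume "t \<in> {1..<n}" and i: "i \<in> {1..N}"
  then have "(\<lambda>za. snd za t) \<in> C n \<rightarrow>\<^sub>M PiM {1..N} (\<lambda>_. count_space {1..N})"
    unfolding csmc_space_def by (intro measurable_compose[OF measurable_snd measurable_component_singleton])
  from measurable_compose[OF this measurable_component_singleton[OF i]] show ?thesis .
qed

lemma lineage_measurable: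
  assumes k: "k \<in> {1..N}" and d: "d < n"
  shows "(\<lambda>za. lineage n (snd za) k d) \<in> C n \<rightarrow>\<^sub>M count_space {1..N}"
  using d
proof (induction d)
  case (Suc d)
  have "(\<lambda>za. snd za (n - Suc d) (lineage n (snd za) k d)) \<in> C n \<rightarrow>\<^sub>M count_space {1..N}"
  proof (rule measurable_compose_countable'[where I="{1..N}" and f="\<lambda>i za. snd za (n - Suc d) i"])
    show "(\<lambda>za. snd za (n - Suc d) i) \<in> C n \<rightarrow>\<^sub>M count_space {1..N}" if "i \<in> {1..N}" for i
      using Suc.prems that by (intro snd_component2) auto
  qed (use Suc in auto)
  then show ?case by simp
qed (use k in simp)

lemma path_measurable:
  assumes k: "k \<in> {1..N}"
  shows "(\<lambda>za. \<lambda>t\<in>{1..n}. fst za t (lineage n (snd za) k (n - t))) \<in> C n \<rightarrow>\<^sub>M E n"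
proof (rule measurable_restrict)
  fix t assume t: "t \<in> {1..n}"
  show "(\<lambda>za. fst za t (lineage n (snd za) k (n - t))) \<in> C n \<rightarrow>\<^sub>M Z"
    by (rule measurable_compose_countable'[where I="{1..N}" and f="\<lambda>i za. fst za t i"])
      (use t k in \<open>auto intro!: fst_component2 lineage_measurable\<close>)
qed

lemma paths_measurable: "paths n \<in> C n \<rightarrow>\<^sub>M S n"
  unfolding paths_def[abs_def] by (rule measurable_restrict) (rule path_measurable)

abbreviation "AZ \<equiv> count_space {1..N} \<Otimes>\<^sub>M Z"
abbreviation "particle_law n x z i \<equiv> (if i = 1 then return AZ (1, x (Suc n))
     else bind (select_index N (\<lambda>k. G n (z k))) (\<lambda>k. distr (M (Suc n) (z k)) AZ (\<lambda>y. (k, y))))"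

lemma particle_kernel:
  assumes n: "n \<noteq> 0" "n < T" and x: "x \<in> space (E T)"
  shows "(\<lambda>z. particle_law n x z i) \<in> PiM {1..N} (\<lambda>_. Z) \<rightarrow>\<^sub>M prob_algebra AZ"
proof (cases "i = 1")
  case True
  have "(1, x (Suc n)) \<in> space AZ" using x n N_ge_1 by (auto simp: space_pair_measure space_PiM PiE_iff)
  then have "return AZ (1, x (Suc n)) \<in> space (prob_algebra AZ)"
    using prob_space_return by (auto simp: space_prob_algebra)
  then show ?thesis using True by simp
next
  case False
  have "(\<lambda>z. bind (select_index N (\<lambda>k. G n (z k))) (\<lambda>k. distr (M (Suc n) (z k)) AZ (\<lambda>y. (k, y)))) \<in> PiM {1..N} (\<lambda>_. Z) \<rightarrow>\<^sub>M prob_algebra AZ"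
  proof (rule measurable_bind_prob_space2)
    show "(\<lambda>z. select_index N (\<lambda>k. G n (z k))) \<in> PiM {1..N} (\<lambda>_. Z) \<rightarrow>\<^sub>M prob_algebra (count_space {1..N})"
    proof (rule select_index_kernel[OF N_ge_1])
      fix k assume k: "k \<in> {1..N}"
      show "(\<lambda>z. G n (z k)) \<in> borel_measurable (PiM {1..N} (\<lambda>_. Z))"
        using n by (intro measurable_compose[OF measurable_component_singleton[OF k] G_measurable]) auto
      show "\<zeta> \<in> space (PiM {1..N} (\<lambda>_. Z)) \<Longrightarrow> 0 \<le> G n (\<zeta> k)" for \<zeta>
        using n k by (intro G_nonneg) (auto simp: space_PiM PiE_iff)
    qed
    have "(\<lambda>p. distr (M (Suc n) ((fst p) (snd p))) AZ (\<lambda>y. (snd p, y))) \<in> PiM {1..N} (\<lambda>_. Z) \<Otimes>\<^sub>M count_space {1..N} \<rightarrow>\<^sub>M prob_algebra AZ"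
    proof (rule measurable_distr_prob_space2)
      show "(\<lambda>p. M (Suc n) ((fst p) (snd p))) \<in> PiM {1..N} (\<lambda>_. Z) \<Otimes>\<^sub>M count_space {1..N} \<rightarrow>\<^sub>M prob_algebra Z"
        using measurable_compose[OF measurable_index_apply[of "{1..N}" Z] kernel[of "Suc n"]] n
        by (simp add: case_prod_beta)
    qed (simp add: case_prod_beta)
    then show "(\<lambda>(z, k). distr (M (Suc n) (z k)) AZ (\<lambda>y. (k, y))) \<in> PiM {1..N} (\<lambda>_. Z) \<Otimes>\<^sub>M count_space {1..N} \<rightarrow>\<^sub>M prob_algebra AZ"
      by (simp add: case_prod_beta)
  qed
  then show ?thesis using False by simp
qed

lemma csmc_step_eq: "csmc_step Z N (G n) (M (Suc n)) (x (Suc n)) z = PiM {1..N} (particle_law n x z)"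
  by (simp add: csmc_step_def)

lemma update_measurable:
  assumes "n \<noteq> 0"
  shows "(\<lambda>(za, m). ((fst za)(Suc n := (\<lambda>i\<in>{1..N}. snd (m i))), (snd za)(n := (\<lambda>i\<in>{1..N}. fst (m i)))))
     \<in> C n \<Otimes>\<^sub>M PiM {1..N} (\<lambda>_. AZ) \<rightarrow>\<^sub>M C (Suc n)"
proof -
  let ?B = "C n \<Otimes>\<^sub>M PiM {1..N} (\<lambda>_. AZ)"
  have s: "{1..Suc n} = insert (Suc n) {1..n}" "{1..<Suc n} = insert n {1..<n}" using assms by auto
  have m1: "(\<lambda>p. fst (fst p)) \<in> ?B \<rightarrow>\<^sub>M PiM {1..n} (\<lambda>_. PiM {1..N} (\<lambda>_. Z))"
    and m2: "(\<lambda>p. snd (fst p)) \<in> ?B \<rightarrow>\<^sub>M PiM {1..<n} (\<lambda>_. PiM {1..N} (\<lambda>_. count_space {1..N}))"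
    unfolding csmc_space_def by measurable
  have c: "(\<lambda>p. snd p i) \<in> ?B \<rightarrow>\<^sub>M AZ" if "i \<in> {1..N}" for i
    by (rule measurable_compose[OF measurable_snd measurable_component_singleton[OF that]])
  have m3: "(\<lambda>p. \<lambda>i\<in>{1..N}. snd (snd p i)) \<in> ?B \<rightarrow>\<^sub>M PiM {1..N} (\<lambda>_. Z)"
    by (rule measurable_restrict) (rule measurable_compose[OF c measurable_snd])
  have m4: "(\<lambda>p. \<lambda>i\<in>{1..N}. fst (snd p i)) \<in> ?B \<rightarrow>\<^sub>M PiM {1..N} (\<lambda>_. count_space {1..N})"
    by (rule measurable_restrict) (rule measurable_compose[OF c measurable_fst])
  have "(\<lambda>p. (\<lambda>(f, y). f(Suc n := y)) (fst (fst p), \<lambda>i\<in>{1..N}. snd (snd p i)))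
      \<in> ?B \<rightarrow>\<^sub>M PiM (insert (Suc n) {1..n}) (\<lambda>_. PiM {1..N} (\<lambda>_. Z))"
    by (rule measurable_compose[OF measurable_Pair[OF m1 m3] measurable_add_dim])
  moreover have "(\<lambda>p. (\<lambda>(f, y). f(n := y)) (snd (fst p), \<lambda>i\<in>{1..N}. fst (snd p i)))
      \<in> ?B \<rightarrow>\<^sub>M PiM (insert n {1..<n}) (\<lambda>_. PiM {1..N} (\<lambda>_. count_space {1..N}))"
    by (rule measurable_compose[OF measurable_Pair[OF m2 m4] measurable_add_dim])
  ultimately show ?thesis
    unfolding csmc_space_def[of Z N "Suc n"] s case_prod_beta by (intro measurable_Pair) simp_all
qed

lemma init_prob_PiM:
  assumes x: "x \<in> space (E T)"
  shows "PiM {1..N} (\<lambda>i. if i = 1 then return Z (x 1) else M1) \<in> space (prob_algebra (PiM {1..N} (\<lambda>_. Z)))"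
proof -
  have x1: "x 1 \<in> space Z" using x T_ge_1 by (auto simp: space_PiM PiE_iff)
  have "(\<lambda>\<omega>::unit. PiM {1..N} (\<lambda>i. if i = 1 then return Z (x 1) else M1)) \<in> count_space UNIV \<rightarrow>\<^sub>M prob_algebra (PiM {1..N} (\<lambda>_. Z))"
    by (rule measurable_PiM_kernel) (use x1 init_prob prob_space_return[OF x1] in \<open>auto simp: space_prob_algebra\<close>)
  from measurable_space[OF this, of "()"] show ?thesis by simp
qed

lemma update0_measurable:
  "(\<lambda>(za, z1). ((fst za)(1 := z1), snd za)) \<in> C 0 \<Otimes>\<^sub>M PiM {1..N} (\<lambda>_. Z) \<rightarrow>\<^sub>M C (Suc 0)"
proof -
  have s: "{1..Suc 0} = insert 1 {1..0::nat}" "{1..<Suc 0} = {1..<0::nat}" by auto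
  have m1: "(\<lambda>p. fst (fst p)) \<in> C 0 \<Otimes>\<^sub>M PiM {1..N} (\<lambda>_. Z) \<rightarrow>\<^sub>M PiM {1..0} (\<lambda>_. PiM {1..N} (\<lambda>_. Z))"
    and m2: "(\<lambda>p. snd (fst p)) \<in> C 0 \<Otimes>\<^sub>M PiM {1..N} (\<lambda>_. Z) \<rightarrow>\<^sub>M PiM {1..<0} (\<lambda>_. PiM {1..N} (\<lambda>_. count_space {1..N}))"
    unfolding csmc_space_def by measurable
  have "(\<lambda>p. (\<lambda>(f, y). f(1 := y)) (fst (fst p), snd p)) \<in> C 0 \<Otimes>\<^sub>M PiM {1..N} (\<lambda>_. Z) \<rightarrow>\<^sub>M PiM (insert 1 {1..0}) (\<lambda>_. PiM {1..N} (\<lambda>_. Z))"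
    by (rule measurable_compose[OF measurable_Pair[OF m1 measurable_snd] measurable_add_dim])
  then show ?thesis
    unfolding csmc_space_def[of Z N "Suc 0"] s case_prod_beta using m2 by (intro measurable_Pair) simp_all
qed

lemma pstep_kernel:
  assumes n: "n < T" and x: "x \<in> space (E T)"
  shows "pstep x n \<in> C n \<rightarrow>\<^sub>M prob_algebra (C (Suc n))"
proof (cases "n = 0")
  case True
  have "(\<lambda>za. distr (PiM {1..N} (\<lambda>i. if i = 1 then return Z (x 1) else M1)) (C (Suc 0)) (\<lambda>z1. ((fst za)(1 := z1), snd za)))
      \<in> C 0 \<rightarrow>\<^sub>M prob_algebra (C (Suc 0))"
    by (rule measurable_distr_prob_space2[OF _ update0_measurable]) (use init_prob_PiM[OF x] in simp)
  then show ?thesis using True by (simp add: pstep_def[abs_def])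
next
  case False
  have "(\<lambda>za. distr (PiM {1..N} (particle_law n x (fst za n))) (C (Suc n))
      (\<lambda>m. ((fst za)(Suc n := (\<lambda>i\<in>{1..N}. snd (m i))), (snd za)(n := (\<lambda>i\<in>{1..N}. fst (m i)))))) \<in> C n \<rightarrow>\<^sub>M prob_algebra (C (Suc n))"
  proof (rule measurable_distr_prob_space2[OF _ update_measurable[OF False]])
    have "(\<lambda>z. PiM {1..N} (particle_law n x z)) \<in> PiM {1..N} (\<lambda>_. Z) \<rightarrow>\<^sub>M prob_algebra (PiM {1..N} (\<lambda>_. AZ))"
      by (rule measurable_PiM_kernel) (auto intro: particle_kernel[OF False n x])
    then show "(\<lambda>za. PiM {1..N} (particle_law n x (fst za n))) \<in> C n \<rightarrow>\<^sub>M prob_algebra (PiM {1..N} (\<lambda>_. AZ))"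
      using False by (intro measurable_compose[OF fst_component]) auto
  qed
  then show ?thesis using False by (simp add: pstep_def[abs_def] csmc_step_eq)
qed

lemma particles_prob:
  assumes x: "x \<in> space (E T)"
  shows "n \<le> T \<Longrightarrow> particles x n \<in> space (prob_algebra (C n))"
proof (induction n)
  case 0
  have "(\<lambda>_. undefined, \<lambda>_. undefined) \<in> space (C 0)" by (simp add: csmc_space_def space_pair_measure space_PiM)
  then show ?case using prob_space_return by (simp add: space_prob_algebra)
next
  case (Suc n)
  then show ?case unfolding particles_Suc by (intro bind_in_prob_algebra[OF _ pstep_kernel[OF _ x]]) auto
qed

lemma paths_update:
  assumes "n \<noteq> 0" "\<And>i. i \<in> {1..N} \<Longrightarrow> fst (m i) \<in> {1..N}"
  shows "paths (Suc n) ((fst za)(Suc n := (\<lambda>i\<in>{1..N}. snd (m i))), (snd za)(n := (\<lambda>i\<in>{1..N}. fst (m i)))) =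
    (\<lambda>i\<in>{1..N}. (paths n za (fst (m i)))(Suc n := snd (m i)))"
proof (rule ext)
  fix i
  show "paths (Suc n) ((fst za)(Suc n := (\<lambda>i\<in>{1..N}. snd (m i))), (snd za)(n := (\<lambda>i\<in>{1..N}. fst (m i)))) i =
    (\<lambda>i\<in>{1..N}. (paths n za (fst (m i)))(Suc n := snd (m i))) i"
  proof (cases "i \<in> {1..N}")
    case i: True
    have fm: "fst (m i) \<in> {1..N}" using assms(2)[OF i] .
    show ?thesis
    proof (rule ext)
      fix t
      consider "t = Suc n" | "t \<in> {1..n}" | "t \<notin> {1..Suc n}" by fastforce
      then show "paths (Suc n) ((fst za)(Suc n := (\<lambda>i\<in>{1..N}. snd (m i))), (snd za)(n := (\<lambda>i\<in>{1..N}. fst (m i)))) i t =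
        (\<lambda>i\<in>{1..N}. (paths n za (fst (m i)))(Suc n := snd (m i))) i t"
      proof cases
        case 1
        then show ?thesis using i by (simp add: paths_def)
      next
        case 2
        then have d: "Suc n - t = Suc (n - t)" "n - t < n" "1 \<le> n" "t \<noteq> Suc n" "t \<in> {1..Suc n}" by auto
        show ?thesis using i fm 2 d lineage_step[OF d(2,3), of "snd za" "\<lambda>i\<in>{1..N}. fst (m i)" i]
          by (simp add: paths_def del: lineage.simps)
      next
        case 3
        then show ?thesis using i fm by (auto simp: paths_def)
      qed
    qed
  next
    case False
    then show ?thesis by (auto simp: paths_def restrict_def)
  qed
qed

lemma update_path_measurable:
  assumes \<zeta>: "\<zeta> \<in> space (S n)"
  shows "(\<lambda>m. (\<zeta> (fst m))(Suc n := snd m)) \<in> AZ \<rightarrow>\<^sub>M E (Suc n)"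
proof -
  have "\<zeta> \<in> count_space {1..N} \<rightarrow>\<^sub>M E n" using sys_component[OF \<zeta>] by auto
  then have "(\<lambda>m. (\<zeta> (fst m), snd m)) \<in> AZ \<rightarrow>\<^sub>M E n \<Otimes>\<^sub>M Z" by measurable
  from measurable_compose[OF this measurable_path_update] show ?thesis by simp
qed

lemma path_pushforward:
  assumes n: "n \<noteq> 0" "n < T" and x: "x \<in> space (E T)" and za: "za \<in> space (C n)"
  shows "distr (particle_law n x (fst za n) i) (E (Suc n)) (\<lambda>m. (paths n za (fst m))(Suc n := snd m)) =
    (if i = 1 then return (E (Suc n)) ((paths n za 1)(Suc n := x (Suc n))) else mut n (paths n za))"
proof -
  let ?g = "\<lambda>m. (paths n za (fst m))(Suc n := snd m)"
  have \<zeta>: "paths n za \<in> space (S n)" using measurable_space[OF paths_measurable za] .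
  have g: "?g \<in> AZ \<rightarrow>\<^sub>M E (Suc n)" by (rule update_path_measurable[OF \<zeta>])
  have n': "n \<in> {1..n}" using n by simp
  have zk: "fst za n k = paths n za k n" if "k \<in> {1..N}" for k using that n by (simp add: paths_def)
  show ?thesis
  proof (cases "i = 1")
    case True
    have "(1, x (Suc n)) \<in> space AZ" using x n N_ge_1 by (auto simp: space_pair_measure space_PiM PiE_iff)
    then show ?thesis using True by (simp add: distr_return[OF g])
  next
    case False
    have w: "select_index N (\<lambda>k. G n (fst za n k)) = sel n (paths n za)"
      unfolding sel_def by (rule select_index_cong) (use n zk in \<open>auto simp: pot_def\<close>)
    have K: "(\<lambda>k. distr (M (Suc n) (fst za n k)) AZ (\<lambda>y. (k, y))) \<in> sel n (paths n za) \<rightarrow>\<^sub>M subprob_algebra AZ"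
    proof -
      have "(\<lambda>k. distr (M (Suc n) (fst za n k)) AZ (\<lambda>y. (k, y))) \<in> count_space {1..N} \<rightarrow>\<^sub>M subprob_algebra AZ"
        unfolding measurable_count_space_eq1
      proof (rule Pi_I)
        fix k assume k: "k \<in> {1..N}"
        have zs: "fst za n k \<in> space Z" using C_space(2)[OF za n' k] .
        note Mk = prob_kernelD[OF kernel[of "Suc n"] zs]
        have "(\<lambda>y. (k, y)) \<in> M (Suc n) (fst za n k) \<rightarrow>\<^sub>M AZ"
          using Mk n k by (simp add: measurable_cong_sets[OF Mk(2) refl])
        then show "distr (M (Suc n) (fst za n k)) AZ (\<lambda>y. (k, y)) \<in> space (subprob_algebra AZ)"
          using Mk n by (auto simp: space_subprob_algebra intro!: prob_space_imp_subprob_space prob_space.prob_space_distr)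
      qed
      then show ?thesis by (simp add: measurable_cong_sets[OF sets_sel refl])
    qed
    have "distr (particle_law n x (fst za n) i) (E (Suc n)) ?g =
        bind (sel n (paths n za)) (\<lambda>k. distr (distr (M (Suc n) (fst za n k)) AZ (\<lambda>y. (k, y))) (E (Suc n)) ?g)"
      using False distr_bind[OF K _ g] N_ge_1 by (simp add: w space_sel)
    also have "\<dots> = bind (sel n (paths n za)) (\<lambda>k. ext n (paths n za k))"
    proof (rule bind_cong[OF refl])
      fix k assume "k \<in> space (sel n (paths n za))"
      then have k: "k \<in> {1..N}" by (simp add: space_sel)
      have zs: "fst za n k \<in> space Z" using C_space(2)[OF za n' k] .
      note Mk = prob_kernelD[OF kernel[of "Suc n"] zs]
      have "(\<lambda>y. (k, y)) \<in> M (Suc n) (fst za n k) \<rightarrow>\<^sub>M AZ"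
        using Mk n k by (simp add: measurable_cong_sets[OF Mk(2) refl])
      then show "distr (distr (M (Suc n) (fst za n k)) AZ (\<lambda>y. (k, y))) (E (Suc n)) ?g = ext n (paths n za k)"
        using n by (subst distr_distr[OF g]) (simp_all add: path_ext_def comp_def zk[OF k])
    qed
    finally show ?thesis using False by (simp add: mut_def)
  qed
qed

lemma PiM_return_insert_particles:
  assumes "prob_space \<mu>" "sets \<mu> = sets S'" "p \<in> space S'"
  shows "PiM {1..N} (\<lambda>i. if i = 1 then return S' p else \<mu>) = distr (PiM {2..N} (\<lambda>_. \<mu>)) (PiM {1..N} (\<lambda>_. S')) (\<lambda>\<xi>. \<xi>(1 := p))"
  unfolding insert_particles by (rule PiM_return_insert) (use assms in auto)

lemma pstep_pushforward:
  assumes n: "n < T" and x: "x \<in> space (E T)" and za: "za \<in> space (C n)"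
  shows "distr (pstep x n za) (S (Suc n)) (paths (Suc n)) = cstep' x n (paths n za)"
proof -
  have \<zeta>: "paths n za \<in> space (S n)" using measurable_space[OF paths_measurable za] .
  have p: "(paths n za 1)(Suc n := x (Suc n)) \<in> space (E (Suc n))"
  proof -
    have "paths n za 1 \<in> space (E n)" using sys_component[OF \<zeta>, of 1] N_ge_1 by simp
    moreover have "x (Suc n) \<in> space Z" using x n by (auto simp: space_PiM PiE_iff)
    ultimately have "(paths n za 1, x (Suc n)) \<in> space (E n \<Otimes>\<^sub>M Z)" by (simp add: space_pair_measure)
    from measurable_space[OF measurable_path_update this] show ?thesis by simp
  qed
  have R: "cstep' x n (paths n za) =
      PiM {1..N} (\<lambda>i. if i = 1 then return (E (Suc n)) ((paths n za 1)(Suc n := x (Suc n))) else mut n (paths n za))"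
    unfolding cstep'_def by (rule PiM_return_insert_particles[OF mut_prob(1,2)[OF n \<zeta>] p, symmetric])
  show ?thesis
  proof (cases "n = 0")
    case True
    let ?g = "\<lambda>w. (\<lambda>_::nat. undefined::'z)(1 := w)"
    define L where "L = (\<lambda>i::nat. if i = 1 then return Z (x 1) else M1)"
    have x1: "x 1 \<in> space Z" using x T_ge_1 by (auto simp: space_PiM PiE_iff)
    have L: "prob_space (L i)" "sets (L i) = sets Z" for i using init_prob prob_space_return[OF x1] by (auto simp: L_def)
    have sL: "sets (PiM {1..N} L) = sets (PiM {1..N} (\<lambda>_. Z))" by (intro sets_PiM_cong refl L)
    have u: "(\<lambda>z1. ((fst za)(1 := z1), snd za)) \<in> PiM {1..N} L \<rightarrow>\<^sub>M C (Suc 0)"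
      using measurable_Pair2[OF update0_measurable] za True by (simp add: measurable_cong_sets[OF sL refl])
    have e0: "(\<lambda>_::nat. undefined::'z) \<in> space (E 0)" by (simp add: space_PiM)
    have gm: "?g \<in> Z \<rightarrow>\<^sub>M E (Suc 0)" using measurable_Pair2[OF measurable_path_update e0] by (simp add: One_nat_def)
    have "distr (pstep x n za) (S (Suc n)) (paths (Suc n)) =
        distr (PiM {1..N} L) (S (Suc 0)) (paths (Suc 0) \<circ> (\<lambda>z1. ((fst za)(1 := z1), snd za)))"
      using True by (simp add: pstep_def distr_distr[OF paths_measurable u, unfolded L_def] L_def)
    also have "\<dots> = distr (PiM {1..N} L) (S (Suc 0)) (compose {1..N} ?g)"
      by (rule distr_cong) (auto simp: paths_def compose_def fun_eq_iff One_nat_def)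
    also have "\<dots> = PiM {1..N} (\<lambda>i. distr (L i) (E (Suc 0)) ?g)"
      by (rule distr_PiM_compose) (use L gm in auto)
    also have "\<dots> = PiM {1..N} (\<lambda>i. if i = 1 then return (E (Suc n)) ((paths n za 1)(Suc n := x (Suc n))) else mut n (paths n za))"
    proof (rule PiM_cong[OF refl])
      fix i assume i: "i \<in> {1..N}"
      have p0: "paths 0 za k = (\<lambda>_. undefined)" if "k \<in> {1..N}" for k using that by (auto simp: paths_def)
      \<comment> \<open>At level 0 all candidate parents are the empty path, so the selection has no
        effect.\<close>
      have "mut 0 (paths 0 za) = bind (sel 0 (paths 0 za)) (\<lambda>k. ext 0 (\<lambda>_. undefined))"
        unfolding mut_def by (rule bind_cong[OF refl]) (simp add: space_sel p0)
      also have "\<dots> = ext 0 (\<lambda>_. undefined)"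
      proof (rule bind_const')
        show "prob_space (sel 0 (paths 0 za))" using prob_kernelD(1)[OF sel_kernel[of 0]] \<zeta> True by simp
        show "subprob_space (ext 0 (\<lambda>_. undefined))"
          using prob_kernelD(1)[OF ext_kernel[of 0] e0] T_ge_1 by (auto intro: prob_space_imp_subprob_space)
      qed
      finally have m0: "mut 0 (paths 0 za) = distr M1 (E (Suc 0)) ?g" by (simp add: path_ext_def One_nat_def)
      show "distr (L i) (E (Suc 0)) ?g =
          (if i = 1 then return (E (Suc n)) ((paths n za 1)(Suc n := x (Suc n))) else mut n (paths n za))"
        using True m0 p0[of 1] N_ge_1 distr_return[OF gm x1] by (simp add: One_nat_def L_def)
    qed
    finally show ?thesis unfolding R .
  next
    case False
    let ?g = "\<lambda>m. (paths n za (fst m))(Suc n := snd m)"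
    define L where "L = (\<lambda>i::nat. particle_law n x (fst za n) i)"
    let ?u = "\<lambda>m. ((fst za)(Suc n := (\<lambda>i\<in>{1..N}. snd (m i))), (snd za)(n := (\<lambda>i\<in>{1..N}. fst (m i))))"
    have zn: "fst za n \<in> space (PiM {1..N} (\<lambda>_. Z))" using C_space(1)[OF za, of n] False by simp
    have L: "prob_space (L i)" "sets (L i) = sets AZ" for i
      unfolding L_def by (rule prob_kernelD[OF particle_kernel[OF False n x] zn])+
    have sL: "sets (PiM {1..N} L) = sets (PiM {1..N} (\<lambda>_. AZ))" by (intro sets_PiM_cong refl L)
    have u: "?u \<in> PiM {1..N} L \<rightarrow>\<^sub>M C (Suc n)"
      using measurable_Pair2[OF update_measurable[OF False] za] by (simp add: measurable_cong_sets[OF sL refl])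
    have gm: "?g \<in> AZ \<rightarrow>\<^sub>M E (Suc n)" by (rule update_path_measurable[OF \<zeta>])
    have "distr (pstep x n za) (S (Suc n)) (paths (Suc n)) = distr (PiM {1..N} L) (S (Suc n)) (paths (Suc n) \<circ> ?u)"
      using False by (simp add: pstep_def csmc_step_eq distr_distr[OF paths_measurable u, unfolded L_def] L_def)
    also have "\<dots> = distr (PiM {1..N} L) (S (Suc n)) (compose {1..N} ?g)"
    proof (rule distr_cong[OF refl refl])
      fix m assume "m \<in> space (PiM {1..N} L)"
      then have "m \<in> space (PiM {1..N} (\<lambda>_. AZ))" using sets_eq_imp_space_eq[OF sL] by simp
      then have "fst (m i) \<in> {1..N}" if "i \<in> {1..N}" for i
        using that by (auto simp: space_PiM PiE_iff space_pair_measure mem_Times_iff)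
      from paths_update[OF False this] show "(paths (Suc n) \<circ> ?u) m = compose {1..N} ?g m"
        by (simp only: compose_def o_apply)
    qed
    also have "\<dots> = PiM {1..N} (\<lambda>i. distr (L i) (E (Suc n)) ?g)"
      by (rule distr_PiM_compose) (use L gm in auto)
    also have "\<dots> = cstep' x n (paths n za)" unfolding R L_def path_pushforward[OF False n x za] ..
    finally show ?thesis .
  qed
qed

lemma cstep'_eq:
  assumes "\<zeta> 1 = restrict x {1..n}" shows "cstep' x n \<zeta> = cstep x n \<zeta>"
proof -
  have "(restrict x {1..n})(Suc n := x (Suc n)) = restrict x {1..Suc n}" by (auto simp: fun_eq_iff)
  then show ?thesis by (simp add: cstep'_def cstep_def assms)
qed

lemma cstep'_kernel:
  assumes n: "n < T" and x: "x \<in> space (E T)"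
  shows "cstep' x n \<in> S n \<rightarrow>\<^sub>M prob_algebra (S (Suc n))"
  unfolding cstep'_def[abs_def]
proof (rule measurable_distr_prob_space2[OF free_kernel[OF n]])
  have c: "x (Suc n) \<in> space Z" using x n by (auto simp: space_PiM PiE_iff)
  have 1: "1 \<in> {1..N}" using N_ge_1 by simp
  have "(\<lambda>p. (\<lambda>(y, w). y(Suc n := w)) (fst p 1, x (Suc n))) \<in> S n \<Otimes>\<^sub>M PiM {2..N} (\<lambda>_. E (Suc n)) \<rightarrow>\<^sub>M E (Suc n)"
    using c by (intro measurable_compose[OF measurable_Pair measurable_path_update]
      measurable_compose[OF measurable_fst component_measurable[OF 1]]) simp
  then have "(\<lambda>p. (\<lambda>(p, \<xi>). \<xi>(1 := p)) ((fst p 1)(Suc n := x (Suc n)), snd p)) \<in> S n \<Otimes>\<^sub>M PiM {2..N} (\<lambda>_. E (Suc n)) \<rightarrow>\<^sub>M S (Suc n)"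
    by (intro measurable_compose[OF measurable_Pair insert_ref_measurable]) simp_all
  then show "(\<lambda>(\<zeta>, \<xi>). \<xi>(1 := (\<zeta> 1)(Suc n := x (Suc n)))) \<in> S n \<Otimes>\<^sub>M PiM {2..N} (\<lambda>_. E (Suc n)) \<rightarrow>\<^sub>M S (Suc n)"
    by (simp add: case_prod_beta)
qed

text \<open>Slot 1 holds the reference path with certainty. As points of \<open>Z\<close> need not
  be measurable, this is stated for integrals and read off \<open>nn_integral_cstep\<close>, which
  writes the reference into slot 1 explicitly.\<close>

lemma psys_nn_cong:
  assumes n: "n \<le> m" "m \<le> T" and x: "x \<in> space (E m)"
    and f: "f \<in> borel_measurable (S n)" and g: "g \<in> borel_measurable (S n)"
    and eq: "\<And>\<zeta>. \<zeta> \<in> space (S n) \<Longrightarrow> \<zeta> 1 = restrict x {1..n} \<Longrightarrow> f \<zeta> = g \<zeta>"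
  shows "(\<integral>\<^sup>+\<zeta>. f \<zeta> \<partial>psys x n) = (\<integral>\<^sup>+\<zeta>. g \<zeta> \<partial>psys x n)"
proof (cases n)
  case 0
  have "sys0 1 = restrict x {1..0}" using N_ge_1 by (auto simp: sys0_def)
  then show ?thesis using 0 f g eq[of sys0] sys0_in by (simp add: nn_integral_return)
next
  case (Suc l)
  then have l: "l < m" "l < T" using n by auto
  have r: "restrict x {1..Suc l} \<in> space (E (Suc l))" using x l by (intro restrict_in) auto
  have "(\<integral>\<^sup>+\<zeta>. f \<zeta> \<partial>psys x (Suc l)) = (\<integral>\<^sup>+\<zeta>. \<integral>\<^sup>+\<zeta>'. f \<zeta>' \<partial>cstep x l \<zeta> \<partial>psys x l)"
    using f Suc by (intro nn_integral_psys_Suc[OF l(1) n(2) x]) auto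
  also have "\<dots> = (\<integral>\<^sup>+\<zeta>. \<integral>\<^sup>+\<zeta>'. g \<zeta>' \<partial>cstep x l \<zeta> \<partial>psys x l)"
  proof (rule nn_integral_cong)
    fix \<zeta> assume "\<zeta> \<in> space (psys x l)"
    then have \<zeta>: "\<zeta> \<in> space (S l)" using psys_prob(3)[OF _ n(2) x, of l] l by simp
    have "(\<integral>\<^sup>+\<zeta>'. f \<zeta>' \<partial>cstep x l \<zeta>) = (\<integral>\<^sup>+\<xi>. f (\<xi>(1 := restrict x {1..Suc l})) \<partial>PiM {2..N} (\<lambda>_. mut l \<zeta>))"
      using f Suc by (intro nn_integral_cstep[OF l(1) n(2) x \<zeta>]) auto
    also have "\<dots> = (\<integral>\<^sup>+\<xi>. g (\<xi>(1 := restrict x {1..Suc l})) \<partial>PiM {2..N} (\<lambda>_. mut l \<zeta>))"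
    proof (rule nn_integral_cong)
      fix \<xi> assume "\<xi> \<in> space (PiM {2..N} (\<lambda>_. mut l \<zeta>))"
      then have "\<xi> \<in> space (PiM {2..N} (\<lambda>_. E (Suc l)))" using mut_prob(3)[OF l(2) \<zeta>] by (simp add: space_PiM)
      then have "(restrict x {1..Suc l}, \<xi>) \<in> space (E (Suc l) \<Otimes>\<^sub>M PiM {2..N} (\<lambda>_. E (Suc l)))"
        using r by (simp add: space_pair_measure)
      from measurable_space[OF insert_ref_measurable this]
      show "f (\<xi>(1 := restrict x {1..Suc l})) = g (\<xi>(1 := restrict x {1..Suc l}))"
        using Suc by (intro eq) auto
    qed
    also have "\<dots> = (\<integral>\<^sup>+\<zeta>'. g \<zeta>' \<partial>cstep x l \<zeta>)"
      using g Suc by (intro nn_integral_cstep[OF l(1) n(2) x \<zeta>, symmetric]) auto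
    finally show "(\<integral>\<^sup>+\<zeta>'. f \<zeta>' \<partial>cstep x l \<zeta>) = (\<integral>\<^sup>+\<zeta>'. g \<zeta>' \<partial>cstep x l \<zeta>)" .
  qed
  also have "\<dots> = (\<integral>\<^sup>+\<zeta>. g \<zeta> \<partial>psys x (Suc l))"
    using g Suc by (intro nn_integral_psys_Suc[OF l(1) n(2) x, symmetric]) auto
  finally show ?thesis using Suc by simp
qed

lemma psys_in: "n \<le> m \<Longrightarrow> m \<le> T \<Longrightarrow> x \<in> space (E m) \<Longrightarrow> psys x n \<in> space (prob_algebra (S n))"
  using psys_prob by (simp add: space_prob_algebra)

lemma bind_psys_cstep':
  assumes n: "n < T" and x: "x \<in> space (E T)"
  shows "bind (psys x n) (cstep' x n) = bind (psys x n) (cstep x n)"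
proof (rule measure_eqI)
  note P = psys_in[OF less_imp_le[OF n] order_refl x]
  note K' = cstep'_kernel[OF n x] and K = cstep_kernel[OF n order_refl x]
  show "sets (bind (psys x n) (cstep' x n)) = sets (bind (psys x n) (cstep x n))"
    using sets_bind'[OF P K'] sets_bind'[OF P K] by simp
  fix B assume "B \<in> sets (bind (psys x n) (cstep' x n))"
  then have B: "B \<in> sets (S (Suc n))" using sets_bind'[OF P K'] by simp
  have "(\<integral>\<^sup>+\<zeta>. emeasure (cstep' x n \<zeta>) B \<partial>psys x n) = (\<integral>\<^sup>+\<zeta>. emeasure (cstep x n \<zeta>) B \<partial>psys x n)"
    by (rule psys_nn_cong[OF less_imp_le[OF n] order_refl x])
      (use B K K' cstep'_eq in \<open>auto intro!: measurable_emeasure_kernel measurable_prob_algebraD\<close>)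
  then show "emeasure (bind (psys x n) (cstep' x n)) B = emeasure (bind (psys x n) (cstep x n)) B"
    by (simp add: emeasure_bind_prob_algebra[OF P K' B] emeasure_bind_prob_algebra[OF P K B])
qed

text \<open>Reading off ancestral paths commutes with a step of the particle system: the image of
  the step under \<open>paths\<close> depends on the genealogy only through the paths already
  formed.\<close>

lemma particles_paths:
  assumes x: "x \<in> space (E T)"
  shows "n \<le> T \<Longrightarrow> distr (particles x n) (S n) (paths n) = psys x n"
proof (induction n)
  case 0
  have "(\<lambda>_. undefined, \<lambda>_. undefined) \<in> space (C 0)" by (simp add: csmc_space_def space_pair_measure space_PiM)
  then have "distr (particles x 0) (S 0) (paths 0) = return (S 0) (paths 0 (\<lambda>_. undefined, \<lambda>_. undefined))"
    unfolding csmc_particles.simps(1) by (rule distr_return[OF paths_measurable])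
  moreover have "paths 0 (\<lambda>_. undefined, \<lambda>_. undefined) = sys0" by (simp add: paths_def sys0_def restrict_def fun_eq_iff)
  ultimately show ?case by simp
next
  case (Suc n)
  then have n: "n < T" by simp
  note Pn = particles_prob[OF x less_imp_le[OF n]]
  have s: "sets (particles x n) = sets (C n)" using Pn by (simp add: space_prob_algebra)
  have sp: "space (particles x n) = space (C n)" by (rule sets_eq_imp_space_eq[OF s])
  have ne: "space (particles x n) \<noteq> {}" using Pn by (auto simp: space_prob_algebra dest: prob_space.not_empty)
  have K: "pstep x n \<in> particles x n \<rightarrow>\<^sub>M subprob_algebra (C (Suc n))"
    using measurable_prob_algebraD[OF pstep_kernel[OF n x]] by (simp add: measurable_cong_sets[OF s refl])
  have pm: "paths n \<in> particles x n \<rightarrow>\<^sub>M S n" using paths_measurable by (simp add: measurable_cong_sets[OF s refl])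
  have "distr (particles x (Suc n)) (S (Suc n)) (paths (Suc n)) = bind (particles x n) (\<lambda>za. distr (pstep x n za) (S (Suc n)) (paths (Suc n)))"
    unfolding particles_Suc by (rule distr_bind[OF K ne paths_measurable])
  also have "\<dots> = bind (particles x n) (\<lambda>za. cstep' x n (paths n za))"
    by (rule bind_cong[OF refl]) (simp add: sp pstep_pushforward[OF n x])
  also have "\<dots> = bind (distr (particles x n) (S n) (paths n)) (cstep' x n)"
    by (rule bind_distr[OF pm measurable_prob_algebraD[OF cstep'_kernel[OF n x]] ne, symmetric])
  also have "\<dots> = bind (psys x n) (cstep' x n)" using Suc by simp
  also have "\<dots> = psys x (Suc n)" using bind_psys_cstep'[OF n x] by simp
  finally show ?case .
qed

text \<open>Tracing the finally selected index backwards reads off one slot of \<open>paths\<close>,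
  so selecting and tracing together are \<open>out\<close>.\<close>

lemma icsmc_eq:
  assumes x: "x \<in> space (E T)"
  shows "icsmc Z T M1 M G N x = bind (psys x T) out"
proof -
  let ?h = "\<lambda>((z, a), k). \<lambda>t\<in>{1..T}. z t (lineage T a k (T - t))"
  let ?K = "\<lambda>(z, a). distr (select_index N (\<lambda>k. G T (z T k))) (C T \<Otimes>\<^sub>M count_space {1..N}) (\<lambda>k. ((z, a), k))"
  note PT = particles_prob[OF x order_refl]
  have s: "sets (particles x T) = sets (C T)" using PT by (simp add: space_prob_algebra)
  have sp: "space (particles x T) = space (C T)" by (rule sets_eq_imp_space_eq[OF s])
  have ne: "space (particles x T) \<noteq> {}" using PT by (auto simp: space_prob_algebra dest: prob_space.not_empty)
  have pm: "paths T \<in> particles x T \<rightarrow>\<^sub>M S T" using paths_measurable by (simp add: measurable_cong_sets[OF s refl])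
  have T: "T \<in> {1..T}" using T_ge_1 by simp
  have K: "?K \<in> C T \<rightarrow>\<^sub>M prob_algebra (C T \<Otimes>\<^sub>M count_space {1..N})"
    unfolding case_prod_beta
  proof (rule measurable_distr_prob_space2)
    show "(\<lambda>za. select_index N (\<lambda>k. G T (fst za T k))) \<in> C T \<rightarrow>\<^sub>M prob_algebra (count_space {1..N})"
    proof (rule select_index_kernel[OF N_ge_1])
      show "(\<lambda>za. G T (fst za T k)) \<in> borel_measurable (C T)" if "k \<in> {1..N}" for k
        by (rule measurable_compose[OF fst_component2[OF T that] G_measurable[OF T]])
      show "0 \<le> G T (fst za T k)" if "za \<in> space (C T)" "k \<in> {1..N}" for za k
        by (rule G_nonneg[OF T C_space(2)[OF that(1) T that(2)]])
    qed
  qed simp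
  have K': "?K \<in> particles x T \<rightarrow>\<^sub>M subprob_algebra (C T \<Otimes>\<^sub>M count_space {1..N})"
    using measurable_prob_algebraD[OF K] by (simp add: measurable_cong_sets[OF s refl])
  have h: "?h \<in> C T \<Otimes>\<^sub>M count_space {1..N} \<rightarrow>\<^sub>M E T"
  proof -
    have "(\<lambda>zk. (\<lambda>(\<zeta>, k). \<zeta> k) (paths T (fst zk), snd zk)) \<in> C T \<Otimes>\<^sub>M count_space {1..N} \<rightarrow>\<^sub>M E T"
      by (rule measurable_compose[OF measurable_Pair[OF measurable_compose[OF measurable_fst paths_measurable] measurable_snd] measurable_index_apply]) simp
    then show ?thesis
      by (rule measurable_cong[THEN iffD1, rotated]) (auto simp: paths_def space_pair_measure)
  qed
  have "icsmc Z T M1 M G N x = bind (particles x T) (\<lambda>za. distr (?K za) (E T) ?h)"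
    unfolding icsmc_def csmc_law_def by (rule distr_bind[OF K' ne h])
  also have "\<dots> = bind (particles x T) (\<lambda>za. out (paths T za))"
  proof (rule bind_cong[OF refl])
    fix za assume "za \<in> space (particles x T)"
    then have za: "za \<in> space (C T)" by (simp add: sp)
    have w: "select_index N (\<lambda>k. G T (fst za T k)) = sel T (paths T za)"
      unfolding sel_def by (rule select_index_cong) (use T_ge_1 in \<open>auto simp: pot_def paths_def\<close>)
    have "(\<lambda>k. (za, k)) \<in> sel T (paths T za) \<rightarrow>\<^sub>M C T \<Otimes>\<^sub>M count_space {1..N}"
      using za by (auto simp: measurable_cong_sets[OF sets_sel refl] space_pair_measure)
    then have "distr (?K za) (E T) ?h = distr (sel T (paths T za)) (E T) (\<lambda>k. ?h (za, k))"
      using w by (cases za) (simp add: distr_distr[OF h] comp_def)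
    also have "\<dots> = out (paths T za)"
      unfolding out_def by (rule distr_cong) (auto simp: space_sel paths_def case_prod_beta)
    finally show "distr (?K za) (E T) ?h = out (paths T za)" .
  qed
  also have "\<dots> = bind (distr (particles x T) (S T) (paths T)) out"
    by (rule bind_distr[OF pm measurable_prob_algebraD[OF out_kernel] ne, symmetric])
  finally show ?thesis by (simp add: particles_paths[OF x])
qed

lemma icsmc_kernel: "icsmc Z T M1 M G N \<in> E T \<rightarrow>\<^sub>M prob_algebra (E T)"
proof -
  have "(\<lambda>x. bind (psys x T) out) \<in> E T \<rightarrow>\<^sub>M prob_algebra (E T)"
    by (rule measurable_bind_prob_space[OF psys_kernel[OF order_refl order_refl] out_kernel])
  then show ?thesis by (rule measurable_cong[THEN iffD2, rotated]) (rule icsmc_eq)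
qed

lemma nn_integral_icsmc:
  assumes x: "x \<in> space (E T)" and f: "f \<in> borel_measurable (E T)"
  shows "(\<integral>\<^sup>+y. f y \<partial>icsmc Z T M1 M G N x) = (\<integral>\<^sup>+\<zeta>. \<integral>\<^sup>+y. f y \<partial>out \<zeta> \<partial>psys x T)"
  unfolding icsmc_eq[OF x]
  by (rule nn_integral_bind_kernel[OF out_kernel psys_prob(2)[OF order_refl order_refl x] f])

section \<open>Reversibility and positivity\<close>

abbreviation "swap i \<zeta> \<equiv> (\<lambda>j\<in>{1..N}. \<zeta> (Transposition.transpose 1 i j))"

lemma transpose_particles:
  assumes "i \<in> {1..N}"
  shows "j \<in> {1..N} \<Longrightarrow> Transposition.transpose 1 i j \<in> {1..N}" "bij_betw (Transposition.transpose 1 i) {1..N} {1..N}"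
proof -
  show 1: "j \<in> {1..N} \<Longrightarrow> Transposition.transpose 1 i j \<in> {1..N}" for j using assms by (auto simp: Transposition.transpose_def)
  show "bij_betw (Transposition.transpose 1 i) {1..N} {1..N}"
    by (rule bij_betw_byWitness[where f'="Transposition.transpose 1 i"]) (use 1 in auto)
qed

lemma swap_in: "i \<in> {1..N} \<Longrightarrow> \<zeta> \<in> space (S n) \<Longrightarrow> swap i \<zeta> \<in> space (S n)"
  using transpose_particles(1)[of i] by (auto simp: space_PiM PiE_iff)

lemma sum_swap:
  assumes "i \<in> {1..N}" shows "(\<Sum>k\<in>{1..N}. g (swap i \<zeta> k)) = (\<Sum>k\<in>{1..N}. g (\<zeta> k))"
proof -
  have "(\<Sum>k\<in>{1..N}. g (swap i \<zeta> k)) = (\<Sum>k\<in>{1..N}. g (\<zeta> (Transposition.transpose 1 i k)))" by (intro sum.cong) auto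
  also have "\<dots> = (\<Sum>k\<in>{1..N}. g (\<zeta> k))" by (rule sum.reindex_bij_betw[OF transpose_particles(2)[OF assms]])
  finally show ?thesis .
qed

abbreviation "wsum n \<zeta> \<equiv> (\<Sum>k\<in>{1..N}. pot n (\<zeta> k))"

lemma wsum_nonneg: "n \<le> T \<Longrightarrow> \<zeta> \<in> space (S n) \<Longrightarrow> 0 \<le> wsum n \<zeta>"
  by (intro sum_nonneg pot_nonneg sys_component)

lemma wsum_measurable: "n \<le> T \<Longrightarrow> (\<lambda>\<zeta>. wsum n \<zeta>) \<in> borel_measurable (S n)"
  by (intro borel_measurable_sum pot_component)

lemma pot_zero:
  assumes "n \<le> T" "\<zeta> \<in> space (S n)" "wsum n \<zeta> = 0" "k \<in> {1..N}" shows "pot n (\<zeta> k) = 0"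
  using assms sum_nonneg_eq_0_iff[of "{1..N}" "\<lambda>k. pot n (\<zeta> k)"] pot_nonneg sys_component by auto

text \<open>The total weight cancels the normalisation of the selection probabilities. If all
  weights vanish, both sides are 0 whatever the default index is.\<close>

lemma weighted_sel:
  assumes n: "n \<le> T" and \<zeta>: "\<zeta> \<in> space (S n)"
  shows "(\<Sum>k\<in>{1..N}. ennreal (pot n (\<zeta> k)) * a k) =
    ennreal (wsum n \<zeta>) * (\<Sum>k\<in>{1..N}. selp n \<zeta> k * a k)"
proof (cases "wsum n \<zeta> = 0")
  case True
  then show ?thesis using pot_zero[OF n \<zeta> True] by simp
next
  case False
  then have pos: "0 < wsum n \<zeta>" using wsum_nonneg[OF n \<zeta>] by simp
  show ?thesis unfolding sum_distrib_left
  proof (rule sum.cong[OF refl])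
    fix k assume k: "k \<in> {1..N}"
    have "ennreal (pot n (\<zeta> k)) = ennreal (wsum n \<zeta>) * ennreal (pot n (\<zeta> k) / wsum n \<zeta>)"
      using pos pot_nonneg[OF n sys_component[OF \<zeta> k]] by (simp flip: ennreal_mult)
    then show "ennreal (pot n (\<zeta> k)) * a k = ennreal (wsum n \<zeta>) * (selp n \<zeta> k * a k)"
      using False by (simp add: sel_prob_def mult.assoc)
  qed
qed

lemma weighted_mut:
  assumes n: "n < T" and \<zeta>: "\<zeta> \<in> space (S n)" and f: "f \<in> borel_measurable (E (Suc n))"
  shows "(\<Sum>k\<in>{1..N}. ennreal (pot n (\<zeta> k)) * (\<integral>\<^sup>+p. f p \<partial>ext n (\<zeta> k))) = ennreal (wsum n \<zeta>) * (\<integral>\<^sup>+p. f p \<partial>mut n \<zeta>)"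
  using weighted_sel[OF less_imp_le[OF n] \<zeta>] by (simp add: nn_integral_mut[OF n \<zeta> f])

lemma weighted_out:
  assumes \<zeta>: "\<zeta> \<in> space (S T)" and f: "f \<in> borel_measurable (E T)"
  shows "(\<Sum>k\<in>{1..N}. ennreal (pot T (\<zeta> k)) * f (\<zeta> k)) = ennreal (wsum T \<zeta>) * (\<integral>\<^sup>+p. f p \<partial>out \<zeta>)"
  using weighted_sel[OF order_refl \<zeta>] by (simp add: nn_integral_out[OF \<zeta> f])

text \<open>The default index 1 is not symmetric in the slots, hence the assumption that some weight
  is nonzero.\<close>

lemma sel_swap_sum:
  assumes n: "n \<le> T" and \<zeta>: "\<zeta> \<in> space (S n)" and i: "i \<in> {1..N}" and w: "wsum n \<zeta> \<noteq> 0"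
  shows "(\<Sum>k\<in>{1..N}. sel_prob N (\<lambda>k. pot n (swap i \<zeta> k)) k * a (swap i \<zeta> k)) =
    (\<Sum>k\<in>{1..N}. selp n \<zeta> k * (a (\<zeta> k) :: ennreal))"
proof -
  have w': "wsum n (swap i \<zeta>) = wsum n \<zeta>" using sum_swap[OF i, of "pot n" \<zeta>] by simp
  have "(\<Sum>k\<in>{1..N}. sel_prob N (\<lambda>k. pot n (swap i \<zeta> k)) k * a (swap i \<zeta> k)) =
      (\<Sum>k\<in>{1..N}. (\<lambda>p. ennreal (pot n p / wsum n \<zeta>) * a p) (swap i \<zeta> k))"
    using w by (simp only: sel_prob_def w' if_False)
  also have "\<dots> = (\<Sum>k\<in>{1..N}. (\<lambda>p. ennreal (pot n p / wsum n \<zeta>) * a p) (\<zeta> k))"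
    by (rule sum_swap[OF i, of "\<lambda>p. ennreal (pot n p / wsum n \<zeta>) * a p" \<zeta>])
  also have "\<dots> = (\<Sum>k\<in>{1..N}. selp n \<zeta> k * a (\<zeta> k))" using w by (simp add: sel_prob_def)
  finally show ?thesis .
qed

lemma mut_swap:
  assumes n: "n < T" and \<zeta>: "\<zeta> \<in> space (S n)" and i: "i \<in> {1..N}" and w: "wsum n \<zeta> \<noteq> 0"
  shows "mut n (swap i \<zeta>) = mut n \<zeta>"
proof (rule measure_eqI)
  note \<zeta>' = swap_in[OF i \<zeta>]
  show "sets (mut n (swap i \<zeta>)) = sets (mut n \<zeta>)" using mut_prob(2)[OF n] \<zeta> \<zeta>' by simp
  fix B assume "B \<in> sets (mut n (swap i \<zeta>))"
  then have B: "B \<in> sets (E (Suc n))" using mut_prob(2)[OF n \<zeta>'] by simp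
  have "(\<integral>\<^sup>+p. indicator B p \<partial>mut n (swap i \<zeta>)) = (\<integral>\<^sup>+p. indicator B p \<partial>mut n \<zeta>)"
    using B sel_swap_sum[OF less_imp_le[OF n] \<zeta> i w, of "\<lambda>q. \<integral>\<^sup>+p. indicator B p \<partial>ext n q"]
    by (simp add: nn_integral_mut[OF n \<zeta>] nn_integral_mut[OF n \<zeta>'] del: restrict_apply)
  then show "emeasure (mut n (swap i \<zeta>)) B = emeasure (mut n \<zeta>) B"
    using B mut_prob(2)[OF n \<zeta>] mut_prob(2)[OF n \<zeta>'] by simp
qed

lemma out_swap:
  assumes \<zeta>: "\<zeta> \<in> space (S T)" and i: "i \<in> {1..N}" and w: "wsum T \<zeta> \<noteq> 0" and f: "f \<in> borel_measurable (E T)"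
  shows "(\<integral>\<^sup>+p. f p \<partial>out (swap i \<zeta>)) = (\<integral>\<^sup>+p. f p \<partial>out \<zeta>)"
  using sel_swap_sum[OF order_refl \<zeta> i w, of f]
  by (simp add: nn_integral_out[OF \<zeta> f] nn_integral_out[OF swap_in[OF i \<zeta>] f] del: restrict_apply)

definition sym_fun :: "nat \<Rightarrow> ((nat \<Rightarrow> 'z) \<Rightarrow> (nat \<Rightarrow> nat \<Rightarrow> 'z) \<Rightarrow> ennreal) \<Rightarrow> bool" where
  "sym_fun n F \<longleftrightarrow> (\<forall>p\<in>space (E n). \<forall>\<zeta>\<in>space (S n). \<forall>i\<in>{1..N}. F p (swap i \<zeta>) = F p \<zeta>)"

lemma exchange:
  assumes \<mu>: "prob_space \<mu>" "sets \<mu> = sets (E n)" and i: "i \<in> {1..N}"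
    and F: "(\<lambda>(p, \<zeta>). F p \<zeta>) \<in> borel_measurable (E n \<Otimes>\<^sub>M S n)" and sym: "sym_fun n F"
  shows "(\<integral>\<^sup>+\<zeta>. F (\<zeta> i) \<zeta> \<partial>PiM {1..N} (\<lambda>_. \<mu>)) = (\<integral>\<^sup>+\<zeta>. F (\<zeta> 1) \<zeta> \<partial>PiM {1..N} (\<lambda>_. \<mu>))"
proof -
  let ?P = "PiM {1..N} (\<lambda>_. \<mu>)"
  have s: "sets ?P = sets (S n)" by (intro sets_PiM_cong refl \<mu>)
  have sp: "space ?P = space (S n)" by (rule sets_eq_imp_space_eq[OF s])
  have 1: "1 \<in> {1..N}" using N_ge_1 by simp
  have m: "(\<lambda>\<zeta>. F (\<zeta> k) \<zeta>) \<in> borel_measurable ?P" if "k \<in> {1..N}" for k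
    using measurable_compose[OF measurable_Pair[OF component_measurable[OF that] measurable_ident] F]
    by (simp add: measurable_cong_sets[OF s refl])
  have e: "distr ?P ?P (swap i) = ?P"
  proof (rule distr_PiM_reindex)
    show "inj_on (Transposition.transpose 1 i) {1..N}" using transpose_particles(2)[OF i] by (rule bij_betw_imp_inj_on)
    show "Transposition.transpose 1 i \<in> {1..N} \<rightarrow> {1..N}" using transpose_particles(1)[OF i] by auto
  qed (rule \<mu>)
  have "swap i \<in> ?P \<rightarrow>\<^sub>M ?P"
    by (rule measurable_restrict) (use transpose_particles(1)[OF i] in \<open>auto intro!: measurable_component_singleton\<close>)
  then have "(\<integral>\<^sup>+\<zeta>. F (\<zeta> 1) \<zeta> \<partial>distr ?P ?P (swap i)) = (\<integral>\<^sup>+\<zeta>. F (swap i \<zeta> 1) (swap i \<zeta>) \<partial>?P)"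
    using m[OF 1] by (subst nn_integral_distr) auto
  also have "\<dots> = (\<integral>\<^sup>+\<zeta>. F (\<zeta> i) \<zeta> \<partial>?P)"
  proof (rule nn_integral_cong)
    fix \<zeta> assume "\<zeta> \<in> space ?P"
    then have \<zeta>: "\<zeta> \<in> space (S n)" by (simp add: sp)
    have "swap i \<zeta> 1 = \<zeta> i" using 1 by simp
    then show "F (swap i \<zeta> 1) (swap i \<zeta>) = F (\<zeta> i) \<zeta>"
      using sym \<zeta> i sys_component[OF \<zeta> i] unfolding sym_fun_def by metis
  qed
  finally show ?thesis unfolding e by simp
qed

text \<open>In an independent, identically distributed system with a symmetric integrand, a
  uniformly chosen slot may be taken to be slot 1. Integrating over it separately shows the other
  slots as free particles around it.\<close>

lemma exchange_average:
  assumes \<mu>: "prob_space \<mu>" "sets \<mu> = sets (E n)"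
    and F: "(\<lambda>(p, \<zeta>). F p \<zeta>) \<in> borel_measurable (E n \<Otimes>\<^sub>M S n)" and sym: "sym_fun n F"
  shows "(\<integral>\<^sup>+\<zeta>. ennreal (1 / N) * (\<Sum>i\<in>{1..N}. F (\<zeta> i) \<zeta>) \<partial>PiM {1..N} (\<lambda>_. \<mu>)) =
    (\<integral>\<^sup>+p. \<integral>\<^sup>+\<xi>. F p (\<xi>(1 := p)) \<partial>PiM {2..N} (\<lambda>_. \<mu>) \<partial>\<mu>)"
proof -
  let ?P = "PiM {1..N} (\<lambda>_. \<mu>)"
  interpret product_prob_space "\<lambda>_::nat. \<mu>" by (rule product_prob_space_const[OF \<mu>(1)])
  have s: "sets ?P = sets (S n)" by (intro sets_PiM_cong refl \<mu>)
  have m: "(\<lambda>\<zeta>. F (\<zeta> k) \<zeta>) \<in> borel_measurable ?P" if "k \<in> {1..N}" for k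
    using measurable_compose[OF measurable_Pair[OF component_measurable[OF that] measurable_ident] F]
    by (simp add: measurable_cong_sets[OF s refl])
  have "(\<integral>\<^sup>+\<zeta>. ennreal (1 / N) * (\<Sum>i\<in>{1..N}. F (\<zeta> i) \<zeta>) \<partial>?P) = ennreal (1 / N) * (\<Sum>i\<in>{1..N}. \<integral>\<^sup>+\<zeta>. F (\<zeta> i) \<zeta> \<partial>?P)"
    using m by (subst nn_integral_cmult) (auto intro!: borel_measurable_sum nn_integral_sum arg_cong2[where f="(*)"])
  also have "(\<Sum>i\<in>{1..N}. \<integral>\<^sup>+\<zeta>. F (\<zeta> i) \<zeta> \<partial>?P) = (\<Sum>i\<in>{1..N}. \<integral>\<^sup>+\<zeta>. F (\<zeta> 1) \<zeta> \<partial>?P)"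
    by (intro sum.cong exchange[OF \<mu> _ F sym]) auto
  also have "ennreal (1 / N) * \<dots> = (\<integral>\<^sup>+\<zeta>. F (\<zeta> 1) \<zeta> \<partial>?P)"
    using N_ge_1 by (simp add: mult.assoc[symmetric] ennreal_of_nat_eq_real_of_nat flip: ennreal_mult)
  also have "\<dots> = (\<integral>\<^sup>+p. \<integral>\<^sup>+\<xi>. F ((\<xi>(1 := p)) 1) (\<xi>(1 := p)) \<partial>PiM {2..N} (\<lambda>_. \<mu>) \<partial>\<mu>)"
    unfolding insert_particles by (rule product_nn_integral_insert_rev) (use m[of 1] N_ge_1 in \<open>auto simp: insert_particles\<close>)
  finally show ?thesis by simp
qed

text \<open>The unconditional particle system, tilted by the product of its average potentials at
  all earlier times. \<open>nu'\<close> adds the factor of time \<open>T\<close> and normalises by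
  \<open>gam\<close>.\<close>

primrec nu where
  "nu 0 = return (S 0) sys0"
| "nu (Suc n) = bind (density (nu n) (\<lambda>\<zeta>. ennreal (wsum n \<zeta> / N))) (\<lambda>\<zeta>. PiM {1..N} (\<lambda>_. mut n \<zeta>))"

lemma unc_kernel: "n < T \<Longrightarrow> (\<lambda>\<zeta>. PiM {1..N} (\<lambda>_. mut n \<zeta>)) \<in> S n \<rightarrow>\<^sub>M prob_algebra (S (Suc n))"
  by (rule measurable_PiM_kernel) (auto intro: mut_kernel)

lemma sets_nu: "n \<le> T \<Longrightarrow> sets (nu n) = sets (S n) \<and> space (nu n) \<noteq> {}"
proof (induction n)
  case 0 then show ?case using sys0_in by auto
next
  case (Suc n)
  then have IH: "sets (nu n) = sets (S n)" "space (nu n) \<noteq> {}" and n: "n < T" by auto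
  have sp: "space (nu n) = space (S n)" by (rule sets_eq_imp_space_eq[OF IH(1)])
  have "sets (nu (Suc n)) = sets (S (Suc n))"
    unfolding nu.simps using IH prob_kernelD(2)[OF unc_kernel[OF n]] by (intro sets_bind) (auto simp: sp)
  moreover have "space (S (Suc n)) \<noteq> {}"
  proof -
    obtain \<zeta> where \<zeta>: "\<zeta> \<in> space (S n)" using IH(2) sp by blast
    show ?thesis
      using prob_space.not_empty[OF prob_kernelD(1)[OF unc_kernel[OF n] \<zeta>]] unfolding prob_kernelD(3)[OF unc_kernel[OF n] \<zeta>] .
  qed
  ultimately show ?case using sets_eq_imp_space_eq by metis
qed

lemma nn_integral_nu_Suc:
  assumes n: "n < T" and f: "f \<in> borel_measurable (S (Suc n))"
  shows "(\<integral>\<^sup>+\<zeta>. f \<zeta> \<partial>nu (Suc n)) = (\<integral>\<^sup>+\<zeta>. ennreal (wsum n \<zeta> / N) * (\<integral>\<^sup>+\<zeta>'. f \<zeta>' \<partial>PiM {1..N} (\<lambda>_. mut n \<zeta>)) \<partial>nu n)"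
proof -
  have s: "sets (nu n) = sets (S n)" using sets_nu n by simp
  have m: "(\<lambda>\<zeta>. \<integral>\<^sup>+\<zeta>'. f \<zeta>' \<partial>PiM {1..N} (\<lambda>_. mut n \<zeta>)) \<in> borel_measurable (nu n)"
    using nn_integral_kernel_measurable[OF unc_kernel[OF n] f] by (simp add: measurable_cong_sets[OF s refl])
  have w: "(\<lambda>\<zeta>. wsum n \<zeta>) \<in> borel_measurable (nu n)"
    using wsum_measurable n by (simp add: measurable_cong_sets[OF s refl])
  show ?thesis unfolding nu.simps
    by (subst nn_integral_bind_kernel[OF unc_kernel[OF n] _ f]) (use s m w in \<open>auto intro!: nn_integral_density\<close>)
qed

abbreviation "law n \<equiv> markov_law Z M1 M n"
text \<open>The upper end is excluded, since the potential of time \<open>n\<close> enters with the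
  selection after time \<open>n\<close>. Thus \<open>weight (Suc T)\<close> is the unnormalised
  density of the target.\<close>

definition "weight n x = (\<Prod>t\<in>{1..<n}. G t (x t))"

lemma law_in: "n \<le> T \<Longrightarrow> law n \<in> space (prob_algebra (E n))"
  by (rule markov_law_prob[OF M1_in]) (use kernel in auto)

lemma law_sets: "n \<le> T \<Longrightarrow> sets (law n) = sets (E n)" "n \<le> T \<Longrightarrow> space (law n) = space (E n)"
  "n \<le> T \<Longrightarrow> prob_space (law n)"
  using law_in[of n] by (auto simp: space_prob_algebra dest: sets_eq_imp_space_eq)

lemma nn_integral_law_Suc:
  assumes "n < T" "f \<in> borel_measurable (E (Suc n))"
  shows "(\<integral>\<^sup>+x. f x \<partial>law (Suc n)) = (\<integral>\<^sup>+x. \<integral>\<^sup>+x'. f x' \<partial>ext n x \<partial>law n)"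
  by (rule nn_integral_markov_law_Suc[OF M1_in]) (use kernel assms in auto)

lemma weight_nonneg: "n \<le> Suc T \<Longrightarrow> x \<in> space (E m) \<Longrightarrow> n \<le> Suc m \<Longrightarrow> 0 \<le> weight n x"
  unfolding weight_def by (intro prod_nonneg ballI G_nonneg) (auto simp: space_PiM PiE_iff)

lemma weight_measurable: "n \<le> Suc T \<Longrightarrow> n \<le> Suc m \<Longrightarrow> weight n \<in> borel_measurable (E m)"
  unfolding weight_def[abs_def]
proof (intro borel_measurable_prod)
  fix t assume "n \<le> Suc T" "n \<le> Suc m" "t \<in> {1..<n}"
  then have t: "t \<in> {1..m}" "t \<in> {1..T}" by auto
  show "(\<lambda>x. G t (x t)) \<in> borel_measurable (E m)"
    by (rule measurable_compose[OF measurable_component_singleton[OF t(1)] G_measurable[OF t(2)]])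
qed

lemma weight_upd: "weight (Suc n) (x(Suc n := w)) = weight n x * pot n x"
proof (cases "n = 0")
  case False
  then have "{1..<Suc n} = insert n {1..<n}" by auto
  moreover have "(\<Prod>t\<in>{1..<n}. G t ((x(Suc n := w)) t)) = (\<Prod>t\<in>{1..<n}. G t (x t))" by (intro prod.cong) auto
  ultimately show ?thesis using False by (simp add: weight_def pot_def mult.commute)
qed (simp add: weight_def pot_def One_nat_def)

lemma ext_cong:
  assumes n: "n < T" and x: "x \<in> space (E n)"
    and f: "f \<in> borel_measurable (E (Suc n))" and g: "g \<in> borel_measurable (E (Suc n))"
    and eq: "\<And>w. w \<in> space Z \<Longrightarrow> f (x(Suc n := w)) = g (x(Suc n := w))"
  shows "(\<integral>\<^sup>+x'. f x' \<partial>ext n x) = (\<integral>\<^sup>+x'. g x' \<partial>ext n x)"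
proof -
  have K: "n \<noteq> 0 \<Longrightarrow> M (Suc n) \<in> Z \<rightarrow>\<^sub>M prob_algebra Z" using kernel n by auto
  have "space (if n = 0 then M1 else M (Suc n) (x n)) = space Z"
    using prob_kernelD(3)[OF K, of "x n"] x sets_eq_imp_space_eq[OF init_prob(2)]
    by (cases "n = 0") (auto simp: space_PiM PiE_iff)
  then have "(\<integral>\<^sup>+w. f (x(Suc n := w)) \<partial>(if n = 0 then M1 else M (Suc n) (x n))) =
      (\<integral>\<^sup>+w. g (x(Suc n := w)) \<partial>(if n = 0 then M1 else M (Suc n) (x n)))"
    by (intro nn_integral_cong eq) simp
  moreover have "(\<integral>\<^sup>+x'. h x' \<partial>ext n x) = (\<integral>\<^sup>+w. h (x(Suc n := w)) \<partial>(if n = 0 then M1 else M (Suc n) (x n)))"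
    if "h \<in> borel_measurable (E (Suc n))" for h :: "_ \<Rightarrow> ennreal"
    by (rule nn_integral_path_ext[OF M1_in]) (use K x that in auto)
  ultimately show ?thesis using f g by simp
qed

lemma restrict_self: "x \<in> space (E n) \<Longrightarrow> restrict x {1..n} = x"
  by (auto simp: space_PiM PiE_iff)

lemma upd_in: "n < T \<Longrightarrow> x \<in> space (E n) \<Longrightarrow> w \<in> space Z \<Longrightarrow> x(Suc n := w) \<in> space (E (Suc n))"
  using measurable_space[OF measurable_path_update, of "(x, w)" n Z] by (simp add: space_pair_measure)

lemma J_measurable:
  assumes n: "n < T" and F: "(\<lambda>(p, \<zeta>). F p \<zeta>) \<in> borel_measurable (E (Suc n) \<Otimes>\<^sub>M S (Suc n))"
  shows "(\<lambda>(x', \<zeta>). \<integral>\<^sup>+\<xi>. F x' (\<xi>(1 := x')) \<partial>PiM {2..N} (\<lambda>_. mut n \<zeta>)) \<in> borel_measurable (E (Suc n) \<Otimes>\<^sub>M S n)"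
  unfolding case_prod_beta
proof (rule nn_integral_measurable_subprob_algebra2)
  show "(\<lambda>z. PiM {2..N} (\<lambda>_. mut n (snd z))) \<in> E (Suc n) \<Otimes>\<^sub>M S n \<rightarrow>\<^sub>M subprob_algebra (PiM {2..N} (\<lambda>_. E (Suc n)))"
    by (rule measurable_compose[OF measurable_snd measurable_prob_algebraD[OF free_kernel[OF n]]])
  have 1: "(\<lambda>z. fst (fst z)) \<in> (E (Suc n) \<Otimes>\<^sub>M S n) \<Otimes>\<^sub>M PiM {2..N} (\<lambda>_. E (Suc n)) \<rightarrow>\<^sub>M E (Suc n)" by measurable
  have 2: "(\<lambda>z. (\<lambda>(p, \<xi>). \<xi>(1 := p)) (fst (fst z), snd z)) \<in> (E (Suc n) \<Otimes>\<^sub>M S n) \<Otimes>\<^sub>M PiM {2..N} (\<lambda>_. E (Suc n)) \<rightarrow>\<^sub>M S (Suc n)"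
    by (rule measurable_compose[OF measurable_Pair[OF 1 measurable_snd] insert_ref_measurable])
  show "(\<lambda>(x, y). F (fst x) (y(1 := fst x))) \<in> borel_measurable ((E (Suc n) \<Otimes>\<^sub>M S n) \<Otimes>\<^sub>M PiM {2..N} (\<lambda>_. E (Suc n)))"
    using measurable_compose[OF measurable_Pair[OF 1 2] F] by (simp add: case_prod_beta)
qed

text \<open>A weighted reference path together with its conditional system looks like a uniformly
  chosen slot of the tilted unconditional system. In the induction step the hypothesis makes the
  reference of time \<open>n\<close> a uniformly chosen slot; the sum over slots of potential times
  extension is a multiple of \<open>mut\<close>, so the extended reference is distributed like one
  more free particle, and \<open>exchange_average\<close> applies.\<close>

lemma symmetrisation:
  "n \<le> T \<Longrightarrow> (\<lambda>(p, \<zeta>). F p \<zeta>) \<in> borel_measurable (E n \<Otimes>\<^sub>M S n) \<Longrightarrow> sym_fun n F \<Longrightarrow>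
   (\<integral>\<^sup>+x. ennreal (weight n x) * (\<integral>\<^sup>+\<zeta>. F x \<zeta> \<partial>psys x n) \<partial>law n) =
   (\<integral>\<^sup>+\<zeta>. ennreal (1 / N) * (\<Sum>i\<in>{1..N}. F (\<zeta> i) \<zeta>) \<partial>nu n)"
proof (induction n arbitrary: F)
  case 0
  let ?u = "\<lambda>_::nat. undefined :: 'z"
  have u: "?u \<in> space (E 0)" by (simp add: space_PiM)
  have m0: "F ?u \<in> borel_measurable (S 0)" using measurable_Pair2[OF 0(2) u] by simp
  have m: "(\<lambda>\<zeta>. F (\<zeta> k) \<zeta>) \<in> borel_measurable (S 0)" if "k \<in> {1..N}" for k
    using measurable_compose[OF measurable_Pair[OF component_measurable[OF that] measurable_ident] 0(2)] by simp
  have "(\<lambda>x. \<integral>\<^sup>+\<zeta>. F x \<zeta> \<partial>psys x 0) \<in> borel_measurable (E 0)"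
    by (rule nn_integral_measurable_subprob_algebra2[OF 0(2) measurable_prob_algebraD[OF psys_kernel]]) auto
  then have "(\<integral>\<^sup>+x. ennreal (weight 0 x) * (\<integral>\<^sup>+\<zeta>. F x \<zeta> \<partial>psys x 0) \<partial>law 0) = F ?u sys0"
    unfolding markov_law.simps(1)
    by (subst nn_integral_return[OF u]) (use m0 sys0_in in \<open>auto simp: weight_def nn_integral_return\<close>)
  also have "F ?u sys0 = ennreal (1 / N) * (\<Sum>i\<in>{1..N}. F (sys0 i) sys0)"
    using N_ge_1 by (simp add: sys0_def mult.assoc[symmetric] ennreal_of_nat_eq_real_of_nat flip: ennreal_mult)
  also have "\<dots> = (\<integral>\<^sup>+\<zeta>. ennreal (1 / N) * (\<Sum>i\<in>{1..N}. F (\<zeta> i) \<zeta>) \<partial>nu 0)"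
    unfolding nu.simps(1) by (subst nn_integral_return[OF sys0_in]) (use m in \<open>auto intro!: borel_measurable_sum\<close>)
  finally show ?case .
next
  case (Suc n)
  then have n: "n < T" "n \<le> T" by auto
  note F = Suc.prems(2) and sym = Suc.prems(3)
  \<comment> \<open>The free particles of time \<open>Suc n\<close> are integrated out, given the
    extended reference \<open>x'\<close>.\<close>
  define J where "J x' \<zeta> = (\<integral>\<^sup>+\<xi>. F x' (\<xi>(1 := x')) \<partial>PiM {2..N} (\<lambda>_. mut n \<zeta>))" for x' \<zeta>
  \<comment> \<open>The value 0 for vanishing total weight restores the symmetry spoilt by the
    default index. It changes nothing along \<open>psys x n\<close>, where the reference then has
    potential 0.\<close>
  define H where "H x \<zeta> = (if wsum n \<zeta> = 0 then 0 else ennreal (pot n x) * (\<integral>\<^sup>+x'. J x' \<zeta> \<partial>ext n x))" for x \<zeta>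
  have J: "(\<lambda>(x', \<zeta>). J x' \<zeta>) \<in> borel_measurable (E (Suc n) \<Otimes>\<^sub>M S n)"
    unfolding J_def[abs_def] by (rule J_measurable[OF n(1) F])
  have I: "(\<lambda>(x, \<zeta>). \<integral>\<^sup>+x'. J x' \<zeta> \<partial>ext n x) \<in> borel_measurable (E n \<Otimes>\<^sub>M S n)"
    unfolding case_prod_beta
  proof (rule nn_integral_measurable_subprob_algebra2)
    show "(\<lambda>z. ext n (fst z)) \<in> E n \<Otimes>\<^sub>M S n \<rightarrow>\<^sub>M subprob_algebra (E (Suc n))"
      by (rule measurable_compose[OF measurable_fst measurable_prob_algebraD[OF ext_kernel[OF n(1)]]])
    have "(\<lambda>z. (\<lambda>(x', \<zeta>). J x' \<zeta>) (snd z, snd (fst z))) \<in> borel_measurable ((E n \<Otimes>\<^sub>M S n) \<Otimes>\<^sub>M E (Suc n))"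
      by (rule measurable_compose[OF _ J]) measurable
    then show "(\<lambda>(z, x'). J x' (snd z)) \<in> borel_measurable ((E n \<Otimes>\<^sub>M S n) \<Otimes>\<^sub>M E (Suc n))" by (simp add: case_prod_beta)
  qed
  have H: "(\<lambda>(x, \<zeta>). H x \<zeta>) \<in> borel_measurable (E n \<Otimes>\<^sub>M S n)"
  proof -
    note [measurable] = I[unfolded case_prod_beta] measurable_compose[OF measurable_fst pot_measurable[OF n(2)]]
      measurable_compose[OF measurable_snd wsum_measurable[OF n(2)]]
    show ?thesis unfolding H_def[abs_def] case_prod_beta by measurable
  qed
  have Hsym: "sym_fun n H"
    unfolding sym_fun_def
  proof (intro ballI)
    fix p \<zeta> i assume \<zeta>: "\<zeta> \<in> space (S n)" and i: "i \<in> {1..N}"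
    have w: "wsum n (swap i \<zeta>) = wsum n \<zeta>" using sum_swap[OF i, of "pot n" \<zeta>] by simp
    show "H p (swap i \<zeta>) = H p \<zeta>"
    proof (cases "wsum n \<zeta> = 0")
      case True then show ?thesis unfolding H_def w by simp
    next
      case False
      show ?thesis unfolding H_def J_def w mut_swap[OF n(1) \<zeta> i False] ..
    qed
  qed
  define B where "B x' = ennreal (weight (Suc n) x') * (\<integral>\<^sup>+\<zeta>. F x' \<zeta> \<partial>psys x' (Suc n))" for x'
  have B: "B \<in> borel_measurable (E (Suc n))"
  proof -
    have "(\<lambda>x. \<integral>\<^sup>+\<zeta>. F x \<zeta> \<partial>psys x (Suc n)) \<in> borel_measurable (E (Suc n))"
      by (rule nn_integral_measurable_subprob_algebra2[OF F measurable_prob_algebraD[OF psys_kernel]]) (use n in auto)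
    moreover have "weight (Suc n) \<in> borel_measurable (E (Suc n))" using n by (intro weight_measurable) auto
    ultimately show ?thesis unfolding B_def[abs_def] by measurable
  qed
  have inner: "(\<integral>\<^sup>+x'. B x' \<partial>ext n x) = ennreal (weight n x) * (\<integral>\<^sup>+\<zeta>. H x \<zeta> \<partial>psys x n)" if x: "x \<in> space (E n)" for x
  proof -
    interpret px: prob_space "psys x n" by (rule psys_prob[OF order_refl n(2) x])
    have ps: "sets (psys x n) = sets (S n)" by (rule psys_prob[OF order_refl n(2) x])
    interpret ex: prob_space "ext n x" by (rule prob_kernelD[OF ext_kernel[OF n(1)] x])
    have es: "sets (ext n x) = sets (E (Suc n))" by (rule prob_kernelD[OF ext_kernel[OF n(1)] x])
    interpret pair_sigma_finite "ext n x" "psys x n" by unfold_locales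
    have Jp: "(\<lambda>(x', \<zeta>). J x' \<zeta>) \<in> borel_measurable (ext n x \<Otimes>\<^sub>M psys x n)"
      using J by (simp add: measurable_cong_sets[OF sets_pair_measure_cong[OF es ps] refl])
    have Jm: "(\<lambda>x'. \<integral>\<^sup>+\<zeta>. J x' \<zeta> \<partial>psys x n) \<in> borel_measurable (E (Suc n))"
      using J ps px.subprob_space_axioms
      by (intro nn_integral_measurable_subprob_algebra2[where N="S n"]) (auto simp: space_subprob_algebra)
    have "(\<integral>\<^sup>+x'. B x' \<partial>ext n x) = (\<integral>\<^sup>+x'. ennreal (weight n x * pot n x) * (\<integral>\<^sup>+\<zeta>. J x' \<zeta> \<partial>psys x n) \<partial>ext n x)"
    proof (rule ext_cong[OF n(1) x B])
      show "(\<lambda>x'. ennreal (weight n x * pot n x) * (\<integral>\<^sup>+\<zeta>. J x' \<zeta> \<partial>psys x n)) \<in> borel_measurable (E (Suc n))"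
        using Jm by measurable
      fix w assume w: "w \<in> space Z"
      let ?x = "x(Suc n := w)"
      have x': "?x \<in> space (E (Suc n))" by (rule upd_in[OF n(1) x w])
      have Fx: "F ?x \<in> borel_measurable (S (Suc n))" using measurable_Pair2[OF F x'] by simp
      have nS: "n < Suc n" "Suc n \<le> T" using n by auto
      have eq: "psys ?x n = psys x n" by (rule psys_cong) auto
      have "(\<integral>\<^sup>+\<zeta>. F ?x \<zeta> \<partial>psys ?x (Suc n)) = (\<integral>\<^sup>+\<zeta>. \<integral>\<^sup>+\<zeta>'. F ?x \<zeta>' \<partial>cstep ?x n \<zeta> \<partial>psys ?x n)"
        by (rule nn_integral_psys_Suc[OF nS x' Fx])
      also have "\<dots> = (\<integral>\<^sup>+\<zeta>. J ?x \<zeta> \<partial>psys ?x n)"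
        unfolding J_def using psys_prob(3)[OF order_refl n(2) x] eq
        by (intro nn_integral_cong) (simp add: nn_integral_cstep[OF nS x' _ Fx] restrict_self[OF x'])
      finally show "B ?x = ennreal (weight n x * pot n x) * (\<integral>\<^sup>+\<zeta>. J ?x \<zeta> \<partial>psys x n)"
        by (simp add: B_def weight_upd eq del: psys.simps)
    qed
    also have "\<dots> = ennreal (weight n x * pot n x) * (\<integral>\<^sup>+x'. \<integral>\<^sup>+\<zeta>. J x' \<zeta> \<partial>psys x n \<partial>ext n x)"
      using Jm es by (intro nn_integral_cmult) (simp add: measurable_cong_sets[OF es refl])
    \<comment> \<open>The coordinate appended to the reference is independent of the system of time
      \<open>n\<close>, because \<open>psys\<close> looks at the first \<open>n\<close> coordinates
      only.\<close>
    also have "(\<integral>\<^sup>+x'. \<integral>\<^sup>+\<zeta>. J x' \<zeta> \<partial>psys x n \<partial>ext n x) = (\<integral>\<^sup>+\<zeta>. \<integral>\<^sup>+x'. J x' \<zeta> \<partial>ext n x \<partial>psys x n)"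
      by (rule Fubini'[OF Jp, symmetric])
    also have "ennreal (weight n x * pot n x) * \<dots> = ennreal (weight n x) * (ennreal (pot n x) * \<dots>)"
      using pot_nonneg[OF n(2) x] weight_nonneg[of n x n] x n by (simp add: ennreal_mult mult.assoc)
    also have "ennreal (pot n x) * (\<integral>\<^sup>+\<zeta>. \<integral>\<^sup>+x'. J x' \<zeta> \<partial>ext n x \<partial>psys x n) = (\<integral>\<^sup>+\<zeta>. ennreal (pot n x) * (\<integral>\<^sup>+x'. J x' \<zeta> \<partial>ext n x) \<partial>psys x n)"
      using measurable_Pair2[OF I x] by (intro nn_integral_cmult[symmetric]) (simp add: measurable_cong_sets[OF ps refl])
    also have "\<dots> = (\<integral>\<^sup>+\<zeta>. H x \<zeta> \<partial>psys x n)"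
    proof (rule psys_nn_cong[OF order_refl n(2) x])
      show "(\<lambda>\<zeta>. ennreal (pot n x) * (\<integral>\<^sup>+x'. J x' \<zeta> \<partial>ext n x)) \<in> borel_measurable (S n)"
        using measurable_Pair2[OF I x] by auto
      show "H x \<in> borel_measurable (S n)" using measurable_Pair2[OF H x] by simp
      fix \<zeta> assume \<zeta>: "\<zeta> \<in> space (S n)" "\<zeta> 1 = restrict x {1..n}"
      then have "\<zeta> 1 = x" by (simp add: restrict_self[OF x])
      then show "ennreal (pot n x) * (\<integral>\<^sup>+x'. J x' \<zeta> \<partial>ext n x) = H x \<zeta>"
        using pot_zero[OF n(2) \<zeta>(1), of 1] N_ge_1 by (auto simp: H_def)
    qed
    finally show ?thesis .
  qed
  have "(\<integral>\<^sup>+x'. B x' \<partial>law (Suc n)) = (\<integral>\<^sup>+x. \<integral>\<^sup>+x'. B x' \<partial>ext n x \<partial>law n)"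
    by (rule nn_integral_law_Suc[OF n(1) B])
  also have "\<dots> = (\<integral>\<^sup>+x. ennreal (weight n x) * (\<integral>\<^sup>+\<zeta>. H x \<zeta> \<partial>psys x n) \<partial>law n)"
    by (rule nn_integral_cong) (simp add: inner law_sets(2)[OF n(2)])
  also have "\<dots> = (\<integral>\<^sup>+\<zeta>. ennreal (1 / N) * (\<Sum>i\<in>{1..N}. H (\<zeta> i) \<zeta>) \<partial>nu n)" by (rule Suc.IH[OF n(2) H Hsym])
  also have "\<dots> = (\<integral>\<^sup>+\<zeta>. ennreal (wsum n \<zeta> / N) *
      (\<integral>\<^sup>+\<zeta>'. ennreal (1 / N) * (\<Sum>i\<in>{1..N}. F (\<zeta>' i) \<zeta>') \<partial>PiM {1..N} (\<lambda>_. mut n \<zeta>)) \<partial>nu n)"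
  proof (rule nn_integral_cong)
    fix \<zeta> assume "\<zeta> \<in> space (nu n)"
    then have \<zeta>: "\<zeta> \<in> space (S n)" using sets_nu[OF n(2)] sets_eq_imp_space_eq by blast
    have Jz: "(\<lambda>x'. J x' \<zeta>) \<in> borel_measurable (E (Suc n))" using measurable_Pair1[OF J \<zeta>] by simp
    have "(\<Sum>i\<in>{1..N}. H (\<zeta> i) \<zeta>) = (\<Sum>i\<in>{1..N}. ennreal (pot n (\<zeta> i)) * (\<integral>\<^sup>+x'. J x' \<zeta> \<partial>ext n (\<zeta> i)))"
      by (intro sum.cong refl) (use pot_zero[OF n(2) \<zeta>] in \<open>auto simp: H_def\<close>)
    also have "\<dots> = ennreal (wsum n \<zeta>) * (\<integral>\<^sup>+x'. J x' \<zeta> \<partial>mut n \<zeta>)" by (rule weighted_mut[OF n(1) \<zeta> Jz])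
    also have "(\<integral>\<^sup>+x'. J x' \<zeta> \<partial>mut n \<zeta>) =
        (\<integral>\<^sup>+\<zeta>'. ennreal (1 / N) * (\<Sum>i\<in>{1..N}. F (\<zeta>' i) \<zeta>') \<partial>PiM {1..N} (\<lambda>_. mut n \<zeta>))"
      unfolding J_def by (rule exchange_average[OF mut_prob(1,2)[OF n(1) \<zeta>] F sym, symmetric])
    finally show "ennreal (1 / N) * (\<Sum>i\<in>{1..N}. H (\<zeta> i) \<zeta>) = ennreal (wsum n \<zeta> / N) *
        (\<integral>\<^sup>+\<zeta>'. ennreal (1 / N) * (\<Sum>i\<in>{1..N}. F (\<zeta>' i) \<zeta>') \<partial>PiM {1..N} (\<lambda>_. mut n \<zeta>))"
      using wsum_nonneg[OF n(2) \<zeta>] by (simp add: mult.assoc[symmetric] flip: ennreal_mult)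
  qed
  also have "\<dots> = (\<integral>\<^sup>+\<zeta>'. ennreal (1 / N) * (\<Sum>i\<in>{1..N}. F (\<zeta>' i) \<zeta>') \<partial>nu (Suc n))"
  proof (rule nn_integral_nu_Suc[OF n(1), symmetric])
    have "(\<lambda>\<zeta>. F (\<zeta> k) \<zeta>) \<in> borel_measurable (S (Suc n))" if "k \<in> {1..N}" for k
      using measurable_compose[OF measurable_Pair[OF component_measurable[OF that] measurable_ident] F] by simp
    then show "(\<lambda>\<zeta>'. ennreal (1 / N) * (\<Sum>i\<in>{1..N}. F (\<zeta>' i) \<zeta>')) \<in> borel_measurable (S (Suc n))"
      by (intro borel_measurable_times_ennreal borel_measurable_sum) auto
  qed
  finally show ?case unfolding B_def .
qed

section \<open>The target distribution and the factorisation of the i-cSMC kernel\<close>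

abbreviation "gam \<equiv> normalising_constant Z T M1 M G"
abbreviation "tgt \<equiv> target Z T M1 M G"
abbreviation "PN \<equiv> icsmc Z T M1 M G N"

lemma prod_weight: "(\<Prod>t\<in>{1..T}. G t (x t)) = weight (Suc T) x"
  by (simp add: weight_def atLeastLessThanSuc_atLeastAtMost)

lemma weight_Suc: "weight (Suc n) x = weight n x * pot n x"
proof (cases "n = 0")
  case False
  then have "{1..<Suc n} = insert n {1..<n}" by auto
  then show ?thesis using False by (simp add: weight_def pot_def mult.commute)
qed (simp add: weight_def pot_def One_nat_def)

lemma gam_eq: "gam = (\<integral>\<^sup>+x. ennreal (weight (Suc T) x) \<partial>law T)"
  by (simp add: normalising_constant_def prod_weight)

lemma weight_law: "weight (Suc T) \<in> borel_measurable (law T)"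
  using weight_measurable[of "Suc T" T] by (simp add: measurable_cong_sets[OF law_sets(1) refl])

lemma sets_pi: "sets tgt = sets (E T)" and space_pi: "space tgt = space (E T)"
  using law_sets[OF order_refl] by (auto simp: target_def)

lemma nn_integral_pi:
  assumes "f \<in> borel_measurable (E T)"
  shows "(\<integral>\<^sup>+x. f x \<partial>tgt) = (\<integral>\<^sup>+x. ennreal (weight (Suc T) x) * f x \<partial>law T) / gam"
proof -
  have f: "f \<in> borel_measurable (law T)" using assms by (simp add: measurable_cong_sets[OF law_sets(1) refl])
  note [measurable] = weight_law f
  have "(\<integral>\<^sup>+x. f x \<partial>tgt) = (\<integral>\<^sup>+x. ennreal (weight (Suc T) x) / gam * f x \<partial>law T)"
    unfolding target_def prod_weight by (rule nn_integral_density) measurable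
  also have "\<dots> = (\<integral>\<^sup>+x. ennreal (weight (Suc T) x) * f x / gam \<partial>law T)"
    by (simp add: divide_ennreal_def mult_ac)
  also have "\<dots> = (\<integral>\<^sup>+x. ennreal (weight (Suc T) x) * f x \<partial>law T) / gam"
    by (rule nn_integral_divide) measurable
  finally show ?thesis .
qed

lemma gam_nz: "gam \<noteq> 0" "gam \<noteq> \<infinity>"
  using normalising_constant_pos normalising_constant_finite by auto

lemma prob_pi: "prob_space tgt"
proof
  have "emeasure tgt (space tgt) = (\<integral>\<^sup>+x. 1 \<partial>tgt)" by simp
  also have "\<dots> = gam / gam" by (subst nn_integral_pi) (simp_all add: gam_eq)
  also have "\<dots> = 1" using gam_nz by (simp add: ennreal_divide_self less_top)
  finally show "emeasure tgt (space tgt) = 1" .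
qed

definition "nu' = density (nu T) (\<lambda>\<zeta>. ennreal (wsum T \<zeta> / N) / gam)"

lemma out_nn_measurable: "g \<in> borel_measurable (E T) \<Longrightarrow> (\<lambda>\<zeta>. \<integral>\<^sup>+y. g y \<partial>out \<zeta>) \<in> borel_measurable (S T)"
  by (rule nn_integral_kernel_measurable[OF out_kernel])

text \<open>\<open>symmetrisation\<close> at time \<open>T\<close>: the value of \<open>g\<close> is
  read off by \<open>out\<close>, and summing potential times \<open>f\<close> over the slots
  produces a second, independent output with value \<open>f\<close>.\<close>

lemma icsmc_factor:
  assumes f: "f \<in> borel_measurable (E T)" and g: "g \<in> borel_measurable (E T)"
  shows "(\<integral>\<^sup>+x. f x * (\<integral>\<^sup>+y. g y \<partial>PN x) \<partial>tgt) = (\<integral>\<^sup>+\<zeta>. (\<integral>\<^sup>+x. f x \<partial>out \<zeta>) * (\<integral>\<^sup>+x. g x \<partial>out \<zeta>) \<partial>nu')"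
proof -
  define Ob where "Ob h \<zeta> = (\<integral>\<^sup>+y. h y \<partial>out \<zeta>)" for h :: "(nat \<Rightarrow> 'z) \<Rightarrow> ennreal" and \<zeta>
  have Of: "Ob f \<in> borel_measurable (S T)" and Og: "Ob g \<in> borel_measurable (S T)"
    unfolding Ob_def[abs_def] by (rule out_nn_measurable, fact)+
  define F where "F x \<zeta> = (if wsum T \<zeta> = 0 then 0 else ennreal (pot T x) * f x * Ob g \<zeta>)" for x \<zeta>
  have F: "(\<lambda>(x, \<zeta>). F x \<zeta>) \<in> borel_measurable (E T \<Otimes>\<^sub>M S T)"
  proof -
    note [measurable] = measurable_compose[OF measurable_fst f] measurable_compose[OF measurable_snd Og]
      measurable_compose[OF measurable_fst pot_measurable[OF order_refl]]
      measurable_compose[OF measurable_snd wsum_measurable[OF order_refl]]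
    show ?thesis unfolding F_def[abs_def] case_prod_beta by measurable
  qed
  have Fsym: "sym_fun T F"
    unfolding sym_fun_def
  proof (intro ballI)
    fix p \<zeta> i assume \<zeta>: "\<zeta> \<in> space (S T)" and i: "i \<in> {1..N}"
    have w: "wsum T (swap i \<zeta>) = wsum T \<zeta>" using sum_swap[OF i, of "pot T" \<zeta>] by simp
    show "F p (swap i \<zeta>) = F p \<zeta>"
    proof (cases "wsum T \<zeta> = 0")
      case True then show ?thesis unfolding F_def w by simp
    next
      case False
      show ?thesis unfolding F_def Ob_def w out_swap[OF \<zeta> i False g] ..
    qed
  qed
  have Pg: "(\<lambda>x. \<integral>\<^sup>+y. g y \<partial>PN x) \<in> borel_measurable (E T)" by (rule nn_integral_kernel_measurable[OF icsmc_kernel g])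
  have fPg: "(\<lambda>x. f x * (\<integral>\<^sup>+y. g y \<partial>PN x)) \<in> borel_measurable (E T)" using f Pg by measurable
  have sn: "sets (nu T) = sets (S T)" using sets_nu by simp
  have "(\<integral>\<^sup>+x. ennreal (weight (Suc T) x) * (f x * (\<integral>\<^sup>+y. g y \<partial>PN x)) \<partial>law T) =
      (\<integral>\<^sup>+x. ennreal (weight T x) * (\<integral>\<^sup>+\<zeta>. F x \<zeta> \<partial>psys x T) \<partial>law T)"
  proof (rule nn_integral_cong)
    fix x assume "x \<in> space (law T)"
    then have x: "x \<in> space (E T)" using law_sets(2)[OF order_refl] by simp
    have ps: "sets (psys x T) = sets (S T)" by (rule psys_prob[OF order_refl order_refl x])
    have "(\<integral>\<^sup>+\<zeta>. F x \<zeta> \<partial>psys x T) = (\<integral>\<^sup>+\<zeta>. ennreal (pot T x) * f x * Ob g \<zeta> \<partial>psys x T)"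
    proof (rule psys_nn_cong[OF order_refl order_refl x])
      show "F x \<in> borel_measurable (S T)" using measurable_Pair2[OF F x] by simp
      show "(\<lambda>\<zeta>. ennreal (pot T x) * f x * Ob g \<zeta>) \<in> borel_measurable (S T)" using Og by measurable
      fix \<zeta> assume \<zeta>: "\<zeta> \<in> space (S T)" "\<zeta> 1 = restrict x {1..T}"
      then have "\<zeta> 1 = x" by (simp add: restrict_self[OF x])
      then show "F x \<zeta> = ennreal (pot T x) * f x * Ob g \<zeta>"
        using pot_zero[OF order_refl \<zeta>(1), of 1] N_ge_1 by (auto simp: F_def)
    qed
    also have "\<dots> = ennreal (pot T x) * f x * (\<integral>\<^sup>+\<zeta>. Ob g \<zeta> \<partial>psys x T)"
      using Og by (intro nn_integral_cmult) (simp add: measurable_cong_sets[OF ps refl])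
    also have "(\<integral>\<^sup>+\<zeta>. Ob g \<zeta> \<partial>psys x T) = (\<integral>\<^sup>+y. g y \<partial>PN x)" unfolding Ob_def by (rule nn_integral_icsmc[OF x g, symmetric])
    finally show "ennreal (weight (Suc T) x) * (f x * (\<integral>\<^sup>+y. g y \<partial>PN x)) = ennreal (weight T x) * (\<integral>\<^sup>+\<zeta>. F x \<zeta> \<partial>psys x T)"
      using pot_nonneg[OF order_refl x] weight_nonneg[of T x T] x by (simp add: weight_Suc ennreal_mult mult.assoc)
  qed
  also have "\<dots> = (\<integral>\<^sup>+\<zeta>. ennreal (1 / N) * (\<Sum>i\<in>{1..N}. F (\<zeta> i) \<zeta>) \<partial>nu T)" by (rule symmetrisation[OF order_refl F Fsym])
  also have "\<dots> = (\<integral>\<^sup>+\<zeta>. ennreal (wsum T \<zeta> / N) * (Ob f \<zeta> * Ob g \<zeta>) \<partial>nu T)"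
  proof (rule nn_integral_cong)
    fix \<zeta> assume "\<zeta> \<in> space (nu T)"
    then have \<zeta>: "\<zeta> \<in> space (S T)" using sn sets_eq_imp_space_eq by blast
    have "(\<Sum>i\<in>{1..N}. F (\<zeta> i) \<zeta>) = (\<Sum>i\<in>{1..N}. ennreal (pot T (\<zeta> i)) * f (\<zeta> i)) * Ob g \<zeta>"
      unfolding sum_distrib_right by (intro sum.cong refl) (use pot_zero[OF order_refl \<zeta>] in \<open>auto simp: F_def\<close>)
    also have "\<dots> = ennreal (wsum T \<zeta>) * Ob f \<zeta> * Ob g \<zeta>" unfolding Ob_def by (subst weighted_out[OF \<zeta> f]) simp
    finally show "ennreal (1 / N) * (\<Sum>i\<in>{1..N}. F (\<zeta> i) \<zeta>) = ennreal (wsum T \<zeta> / N) * (Ob f \<zeta> * Ob g \<zeta>)"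
      using wsum_nonneg[OF order_refl \<zeta>] by (simp add: mult.assoc[symmetric] flip: ennreal_mult)
  qed
  finally have "(\<integral>\<^sup>+x. f x * (\<integral>\<^sup>+y. g y \<partial>PN x) \<partial>tgt) = (\<integral>\<^sup>+\<zeta>. ennreal (wsum T \<zeta> / N) * (Ob f \<zeta> * Ob g \<zeta>) \<partial>nu T) / gam"
    by (simp add: nn_integral_pi[OF fPg])
  also have "\<dots> = (\<integral>\<^sup>+\<zeta>. Ob f \<zeta> * Ob g \<zeta> \<partial>nu')"
  proof -
    have m: "(\<lambda>\<zeta>. wsum T \<zeta>) \<in> borel_measurable (nu T)" "Ob f \<in> borel_measurable (nu T)" "Ob g \<in> borel_measurable (nu T)"
      using Of Og wsum_measurable[OF order_refl] by (simp_all add: measurable_cong_sets[OF sn refl])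
    note [measurable] = m
    have "(\<integral>\<^sup>+\<zeta>. Ob f \<zeta> * Ob g \<zeta> \<partial>nu') = (\<integral>\<^sup>+\<zeta>. ennreal (wsum T \<zeta> / N) / gam * (Ob f \<zeta> * Ob g \<zeta>) \<partial>nu T)"
      unfolding nu'_def by (rule nn_integral_density) measurable
    also have "\<dots> = (\<integral>\<^sup>+\<zeta>. ennreal (wsum T \<zeta> / N) * (Ob f \<zeta> * Ob g \<zeta>) / gam \<partial>nu T)" by (simp add: divide_ennreal_def mult_ac)
    also have "\<dots> = (\<integral>\<^sup>+\<zeta>. ennreal (wsum T \<zeta> / N) * (Ob f \<zeta> * Ob g \<zeta>) \<partial>nu T) / gam" by (rule nn_integral_divide) measurable
    finally show ?thesis by simp
  qed
  finally show ?thesis unfolding Ob_def .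
qed

lemma factored: "factored_kernel tgt PN nu' out"
proof -
  interpret prob_space tgt by (rule prob_pi)
  show ?thesis
  proof
    show "PN \<in> tgt \<rightarrow>\<^sub>M prob_algebra tgt"
      using icsmc_kernel by (simp add: measurable_cong_sets[OF sets_pi refl] prob_algebra_cong[OF sets_pi])
    have "sets nu' = sets (S T)" using sets_nu by (simp add: nu'_def)
    then show "out \<in> nu' \<rightarrow>\<^sub>M prob_algebra tgt"
      using out_kernel by (simp add: measurable_cong_sets[of nu' "S T"] prob_algebra_cong[OF sets_pi])
  qed (rule icsmc_factor; simp add: measurable_cong_sets[OF sets_pi refl])
qed

section \<open>Particles that do not descend from the reference path\<close>

lemma nn_integral_free_component:
  assumes n: "n < T" and \<zeta>: "\<zeta> \<in> space (S n)" and k: "k \<in> {2..N}" and f: "f \<in> borel_measurable (E (Suc n))"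
  shows "(\<integral>\<^sup>+\<xi>. f (\<xi> k) \<partial>PiM {2..N} (\<lambda>_. mut n \<zeta>)) = (\<integral>\<^sup>+p. f p \<partial>mut n \<zeta>)"
  using nn_integral_PiM_single[OF mut_prob(1)[OF n \<zeta>] k, of f] f
  by (simp add: measurable_cong_sets[OF mut_prob(2)[OF n \<zeta>] refl])

lemma psys_nn_mono:
  assumes n: "n \<le> m" "m \<le> T" and x: "x \<in> space (E m)"
    and f: "f \<in> borel_measurable (S n)" and g: "g \<in> borel_measurable (S n)"
    and le: "\<And>\<zeta>. \<zeta> \<in> space (S n) \<Longrightarrow> \<zeta> 1 = restrict x {1..n} \<Longrightarrow> f \<zeta> \<le> (g \<zeta> :: ennreal)"
  shows "(\<integral>\<^sup>+\<zeta>. f \<zeta> \<partial>psys x n) \<le> (\<integral>\<^sup>+\<zeta>. g \<zeta> \<partial>psys x n)"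
proof -
  \<comment> \<open>Passing to the minimum turns the inequality into an equality of integrands on
    the relevant systems, which \<open>psys_nn_cong\<close> handles.\<close>
  have "(\<integral>\<^sup>+\<zeta>. f \<zeta> \<partial>psys x n) = (\<integral>\<^sup>+\<zeta>. min (f \<zeta>) (g \<zeta>) \<partial>psys x n)"
    using f g by (intro psys_nn_cong[OF n x]) (auto simp: min_def le)
  also have "\<dots> \<le> (\<integral>\<^sup>+\<zeta>. g \<zeta> \<partial>psys x n)" by (intro nn_integral_mono) simp
  finally show ?thesis .
qed

definition "free_sum f \<zeta> = (\<Sum>k\<in>{2..N}. f (\<zeta> k) :: ennreal)"

lemma free_sum_measurable: "f \<in> borel_measurable (E n) \<Longrightarrow> free_sum f \<in> borel_measurable (S n)"
  unfolding free_sum_def[abs_def]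
  by (intro borel_measurable_sum measurable_compose[OF component_measurable]) auto

lemma nn_integral_cstep_free_sum:
  assumes n: "n < T" and x: "x \<in> space (E T)" and \<zeta>: "\<zeta> \<in> space (S n)" and f: "f \<in> borel_measurable (E (Suc n))"
  shows "(\<integral>\<^sup>+\<zeta>'. free_sum f \<zeta>' \<partial>cstep x n \<zeta>) = of_nat (N - 1) * (\<integral>\<^sup>+p. f p \<partial>mut n \<zeta>)"
proof -
  have s: "sets (PiM {2..N} (\<lambda>_. mut n \<zeta>)) = sets (PiM {2..N} (\<lambda>_. E (Suc n)))"
    by (intro sets_PiM_cong refl mut_prob[OF n \<zeta>])
  have "(\<integral>\<^sup>+\<zeta>'. free_sum f \<zeta>' \<partial>cstep x n \<zeta>) = (\<integral>\<^sup>+\<xi>. (\<Sum>k\<in>{2..N}. f (\<xi> k)) \<partial>PiM {2..N} (\<lambda>_. mut n \<zeta>))"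
    by (subst nn_integral_cstep[OF n order_refl x \<zeta> free_sum_measurable[OF f]]) (simp add: free_sum_def)
  also have "\<dots> = (\<Sum>k\<in>{2..N}. \<integral>\<^sup>+\<xi>. f (\<xi> k) \<partial>PiM {2..N} (\<lambda>_. mut n \<zeta>))"
    by (rule nn_integral_sum) (use f in \<open>auto simp: measurable_cong_sets[OF s refl] intro!: measurable_compose[OF measurable_component_singleton]\<close>)
  also have "\<dots> = (\<Sum>k\<in>{2..N}. \<integral>\<^sup>+p. f p \<partial>mut n \<zeta>)" by (intro sum.cong refl nn_integral_free_component n \<zeta> f)
  finally show ?thesis by simp
qed

lemma sum_particles: "(\<Sum>k\<in>{1..N}. h k) = h 1 + (\<Sum>k\<in>{2..N}. h k)" for h :: "nat \<Rightarrow> 'b :: comm_monoid_add"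
  unfolding insert_particles by (rule sum.insert) auto

lemma sel_prob_le_1:
  assumes "n \<le> T" "\<zeta> \<in> space (S n)" "k \<in> {1..N}" shows "selp n \<zeta> k \<le> 1"
proof -
  have "selp n \<zeta> k \<le> (\<Sum>k\<in>{1..N}. selp n \<zeta> k)"
    using assms by (intro member_le_sum) auto
  then show ?thesis using sum_sel_prob[OF N_ge_1, of "\<lambda>k. pot n (\<zeta> k)"] pot_nonneg[OF assms(1) sys_component[OF assms(2)]] by simp
qed

text \<open>Every selection probability is estimated by 1. This loses factors \<open>N\<close>,
  which is harmless because \<open>N\<close> is fixed in the non-ergodicity results.\<close>

lemma sel_sum_le:
  assumes n: "n \<le> T" and \<zeta>: "\<zeta> \<in> space (S n)" and a: "a (\<zeta> 1) \<le> e"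
  shows "(\<Sum>k\<in>{1..N}. selp n \<zeta> k * a (\<zeta> k)) \<le> e + free_sum a \<zeta>"
proof -
  have 1: "1 \<in> {1..N}" using N_ge_1 by simp
  have "(\<Sum>k\<in>{1..N}. selp n \<zeta> k * a (\<zeta> k)) =
      selp n \<zeta> 1 * a (\<zeta> 1) + (\<Sum>k\<in>{2..N}. selp n \<zeta> k * a (\<zeta> k))"
    by (rule sum_particles)
  also have "\<dots> \<le> 1 * e + (\<Sum>k\<in>{2..N}. 1 * a (\<zeta> k))"
    using sel_prob_le_1[OF n \<zeta>] 1 a by (intro add_mono sum_mono mult_mono) auto
  finally show ?thesis by (simp add: free_sum_def)
qed

text \<open>The parent of a free particle is either the reference, which contributes at most
  \<open>e\<close>, or a free particle, which contributes at most a term of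
  \<open>free_sum g\<close>.\<close>

lemma psys_step_free_sum:
  assumes n: "n < T" and x: "x \<in> space (E T)" and f: "f \<in> borel_measurable (E (Suc n))"
    and g: "g \<in> borel_measurable (E n)"
    and le: "\<And>p. p \<in> space (E n) \<Longrightarrow> (\<integral>\<^sup>+q. f q \<partial>ext n p) \<le> g p"
    and e: "(\<integral>\<^sup>+q. f q \<partial>ext n (restrict x {1..n})) \<le> e"
  shows "(\<integral>\<^sup>+\<zeta>. free_sum f \<zeta> \<partial>psys x (Suc n)) \<le> of_nat N * (e + (\<integral>\<^sup>+\<zeta>. free_sum g \<zeta> \<partial>psys x n))"
proof -
  interpret px: prob_space "psys x n" using psys_prob(1)[OF _ order_refl x] n by simp
  have ps: "sets (psys x n) = sets (S n)" "space (psys x n) = space (S n)" using psys_prob(2,3)[OF _ order_refl x] n by auto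
  have nT: "n \<le> T" using n by simp
  have mm: "(\<lambda>\<zeta>. \<integral>\<^sup>+p. f p \<partial>mut n \<zeta>) \<in> borel_measurable (S n)" by (rule nn_integral_kernel_measurable[OF mut_kernel[OF n] f])
  have gm: "free_sum g \<in> borel_measurable (S n)" by (rule free_sum_measurable[OF g])
  have "(\<integral>\<^sup>+\<zeta>. free_sum f \<zeta> \<partial>psys x (Suc n)) = (\<integral>\<^sup>+\<zeta>. of_nat (N - 1) * (\<integral>\<^sup>+p. f p \<partial>mut n \<zeta>) \<partial>psys x n)"
    by (subst nn_integral_psys_Suc[OF n order_refl x free_sum_measurable[OF f]])
      (intro nn_integral_cong, simp add: ps nn_integral_cstep_free_sum[OF n x _ f])
  also have "\<dots> \<le> (\<integral>\<^sup>+\<zeta>. of_nat N * (\<integral>\<^sup>+p. f p \<partial>mut n \<zeta>) \<partial>psys x n)"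
    by (intro nn_integral_mono mult_right_mono) auto
  also have "\<dots> \<le> (\<integral>\<^sup>+\<zeta>. of_nat N * (e + free_sum g \<zeta>) \<partial>psys x n)"
  proof (rule psys_nn_mono[OF nT order_refl x])
    show "(\<lambda>\<zeta>. of_nat N * (\<integral>\<^sup>+p. f p \<partial>mut n \<zeta>)) \<in> borel_measurable (S n)" using mm by measurable
    show "(\<lambda>\<zeta>. of_nat N * (e + free_sum g \<zeta>)) \<in> borel_measurable (S n)" using gm by measurable
    fix \<zeta> assume \<zeta>: "\<zeta> \<in> space (S n)" "\<zeta> 1 = restrict x {1..n}"
    have "(\<integral>\<^sup>+p. f p \<partial>mut n \<zeta>) \<le> e + free_sum (\<lambda>p. \<integral>\<^sup>+q. f q \<partial>ext n p) \<zeta>"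
      unfolding nn_integral_mut[OF n \<zeta>(1) f] by (rule sel_sum_le[OF nT \<zeta>(1)]) (use e \<zeta> in simp)
    also have "\<dots> \<le> e + free_sum g \<zeta>"
      unfolding free_sum_def using \<zeta>(1) by (intro add_mono sum_mono order_refl le sys_component) auto
    finally show "of_nat N * (\<integral>\<^sup>+p. f p \<partial>mut n \<zeta>) \<le> of_nat N * (e + free_sum g \<zeta>)" by (intro mult_left_mono) auto
  qed
  also have "\<dots> = of_nat N * (\<integral>\<^sup>+\<zeta>. e + free_sum g \<zeta> \<partial>psys x n)"
    using gm by (intro nn_integral_cmult) (simp add: measurable_cong_sets[OF ps(1) refl])
  also have "(\<integral>\<^sup>+\<zeta>. e + free_sum g \<zeta> \<partial>psys x n) = e + (\<integral>\<^sup>+\<zeta>. free_sum g \<zeta> \<partial>psys x n)"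
    using gm by (subst nn_integral_add) (simp_all add: measurable_cong_sets[OF ps(1) refl] px.emeasure_space_1)
  finally show ?thesis .
qed

text \<open>A free particle at time \<open>t\<close> branched off the reference path at some time \<open>s < t\<close>; from then on
  its path is dominated by a multiple of the law of the Markov chain started at \<open>x s\<close>.\<close>

lemma free_sum_domination:
  assumes x: "x \<in> space (E T)" and t: "t \<le> T"
    and \<psi>: "\<And>n. n \<le> t \<Longrightarrow> \<psi> n \<in> borel_measurable (E n)"
    and super: "\<And>n p. 1 \<le> n \<Longrightarrow> n < t \<Longrightarrow> p \<in> space (E n) \<Longrightarrow> (\<integral>\<^sup>+q. \<psi> (Suc n) q \<partial>ext n p) \<le> \<psi> n p"
    and e: "\<And>n. n < t \<Longrightarrow> (\<integral>\<^sup>+q. \<psi> (Suc n) q \<partial>ext n (restrict x {1..n})) \<le> e n"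
  shows "n < t \<Longrightarrow> (\<integral>\<^sup>+\<zeta>. free_sum (\<psi> (Suc n)) \<zeta> \<partial>psys x (Suc n)) \<le> (\<Sum>s\<le>n. of_nat N ^ (Suc n - s) * e s)"
proof (induction n)
  case 0
  have u: "restrict x {1..0} = (\<lambda>_. undefined)" by auto
  have p0: "p = (\<lambda>_. undefined)" if "p \<in> space (E 0)" for p using that by (simp add: space_PiM)
  have 0: "0 < T" using 0 t by simp
  let ?g = "\<lambda>_. 0 :: ennreal"
  have fm: "\<psi> (Suc 0) \<in> borel_measurable (E (Suc 0))" using 0 by (intro \<psi>) (use \<open>0 < t\<close> in auto)
  have mm: "(\<integral>\<^sup>+p. \<psi> (Suc 0) p \<partial>mut 0 sys0) \<le> e 0"
  proof -
    have "(\<integral>\<^sup>+p. \<psi> (Suc 0) p \<partial>mut 0 sys0) = (\<Sum>k\<in>{1..N}. selp 0 sys0 k * (\<integral>\<^sup>+p. \<psi> (Suc 0) p \<partial>ext 0 (sys0 k)))"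
      by (rule nn_integral_mut[OF 0 sys0_in fm])
    also have "\<dots> \<le> (\<Sum>k\<in>{1..N}. selp 0 sys0 k * e 0)"
      using e[of 0] \<open>0 < t\<close> u by (intro sum_mono mult_left_mono) (auto simp: sys0_def)
    also have "\<dots> = e 0"
      using sum_sel_prob[OF N_ge_1, of "\<lambda>k. pot 0 (sys0 k)"] by (simp add: pot_def flip: sum_distrib_right)
    finally show ?thesis .
  qed
  have "(\<integral>\<^sup>+\<zeta>. free_sum (\<psi> (Suc 0)) \<zeta> \<partial>psys x (Suc 0)) = (\<integral>\<^sup>+\<zeta>. of_nat (N - 1) * (\<integral>\<^sup>+p. \<psi> (Suc 0) p \<partial>mut 0 \<zeta>) \<partial>psys x 0)"
    by (subst nn_integral_psys_Suc[OF 0 order_refl x free_sum_measurable[OF fm]])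
      (intro nn_integral_cong, simp add: nn_integral_cstep_free_sum[OF 0 x _ fm])
  also have "\<dots> = of_nat (N - 1) * (\<integral>\<^sup>+p. \<psi> (Suc 0) p \<partial>mut 0 sys0)"
    using nn_integral_kernel_measurable[OF mut_kernel[OF 0] fm] sys0_in by (simp add: nn_integral_return)
  also have "\<dots> \<le> of_nat N * e 0" using mm by (intro mult_mono) auto
  finally show ?case by simp
next
  case (Suc n)
  have "(\<integral>\<^sup>+\<zeta>. free_sum (\<psi> (Suc (Suc n))) \<zeta> \<partial>psys x (Suc (Suc n))) \<le>
      of_nat N * (e (Suc n) + (\<integral>\<^sup>+\<zeta>. free_sum (\<psi> (Suc n)) \<zeta> \<partial>psys x (Suc n)))"
    by (rule psys_step_free_sum) (use Suc.prems t x \<psi> super e in auto)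
  also have "\<dots> \<le> of_nat N * (e (Suc n) + (\<Sum>s\<le>n. of_nat N ^ (Suc n - s) * e s))"
    using Suc by (intro mult_left_mono add_mono) auto
  also have "\<dots> = (\<Sum>s\<le>Suc n. of_nat N ^ (Suc (Suc n) - s) * e s)"
    by (simp add: distrib_left sum_distrib_left Suc_diff_le mult.assoc[symmetric] add.commute)
  finally show ?case .
qed

section \<open>Escape probabilities\<close>

lemma ext_const:
  assumes n: "n < T" and p: "p \<in> space (E n)" and f: "f \<in> borel_measurable (E (Suc n))"
    and c: "\<And>w. w \<in> space Z \<Longrightarrow> f (p(Suc n := w)) = c"
  shows "(\<integral>\<^sup>+q. f q \<partial>ext n p) = (c :: ennreal)"
proof -
  have "(\<integral>\<^sup>+q. f q \<partial>ext n p) = (\<integral>\<^sup>+q. c \<partial>ext n p)" by (rule ext_cong[OF n p f]) (use c in auto)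
  then show ?thesis using nn_integral_kernel_const[OF ext_kernel[OF n] p] by simp
qed

lemma restrict_upd: "m \<le> n \<Longrightarrow> restrict (p(Suc n := w)) {1..m} = restrict p {1..m}"
  by auto

lemma sel_sum_measurable:
  assumes "n \<le> T" "a \<in> borel_measurable (E n)"
  shows "(\<lambda>\<zeta>. \<Sum>k\<in>{1..N}. selp n \<zeta> k * a (\<zeta> k)) \<in> borel_measurable (S n)"
proof -
  have "(\<lambda>\<zeta>. \<integral>\<^sup>+k. (\<lambda>(\<zeta>, k). a (\<zeta> k)) (\<zeta>, k) \<partial>sel n \<zeta>) \<in> borel_measurable (S n)"
    by (rule nn_integral_measurable_subprob_algebra2[OF _ measurable_prob_algebraD[OF sel_kernel[OF assms(1)]]])
      (use measurable_compose[OF measurable_index_apply assms(2), of "{1..N}"] in \<open>simp add: case_prod_beta\<close>)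
  then show ?thesis by (simp add: nn_integral_sel)
qed

text \<open>Membership in \<open>B\<close> is settled at time \<open>t\<close> and then inherited,
  and the reference does not belong to it. So a first descendant in \<open>B\<close> must arise from
  a selection at time \<open>t\<close>, and each later generation multiplies the expected number of
  descendants by at most \<open>N\<close>.\<close>

lemma icsmc_path_prob:
  assumes t: "t \<le> T" and x: "x \<in> space (E T)" and B: "B \<in> sets (E t)" and xB: "restrict x {1..t} \<notin> B"
  shows "emeasure (PN x) {y \<in> space (E T). restrict y {1..t} \<in> B} \<le>
    of_nat N ^ (T - t) * (\<integral>\<^sup>+\<zeta>. (\<Sum>k\<in>{1..N}. selp t \<zeta> k * indicator B (\<zeta> k)) \<partial>psys x t)"
proof -
  define \<psi> :: "(nat \<Rightarrow> 'z) \<Rightarrow> ennreal" where "\<psi> p = indicator B (restrict p {1..t})" for p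
  have \<psi>: "\<psi> \<in> borel_measurable (E n)" if "t \<le> n" for n
    unfolding \<psi>_def[abs_def] using B by (intro measurable_compose[OF restrict_path[OF that]]) auto
  have \<psi>x: "\<psi> (restrict x {1..n}) = 0" if "t \<le> n" for n
  proof -
    have "restrict (restrict x {1..n}) {1..t} = restrict x {1..t}" using that by (auto simp: restrict_def fun_eq_iff)
    then show ?thesis using xB by (simp add: \<psi>_def)
  qed
  have \<psi>e: "(\<integral>\<^sup>+q. \<psi> q \<partial>ext n p) = \<psi> p" if "t \<le> n" "n < T" "p \<in> space (E n)" for n p
    by (rule ext_const[OF that(2,3) \<psi>[OF le_SucI[OF that(1)]]]) (simp only: \<psi>_def restrict_upd[OF that(1)])
  define U where "U = (\<integral>\<^sup>+\<zeta>. (\<Sum>k\<in>{1..N}. selp t \<zeta> k * \<psi> (\<zeta> k)) \<partial>psys x t)"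
  have ps: "space (psys x t) = space (S t)" "sets (psys x t) = sets (S t)" using psys_prob[OF t order_refl x] by auto
  have U: "U = (\<integral>\<^sup>+\<zeta>. (\<Sum>k\<in>{1..N}. selp t \<zeta> k * indicator B (\<zeta> k)) \<partial>psys x t)"
    unfolding U_def
    by (intro nn_integral_cong sum.cong refl) (use ps sys_component in \<open>simp add: \<psi>_def restrict_self\<close>)
  have free: "t \<le> s \<Longrightarrow> s < T \<Longrightarrow> (\<integral>\<^sup>+\<zeta>. free_sum \<psi> \<zeta> \<partial>psys x (Suc s)) \<le> of_nat N ^ (Suc s - t) * U" for s
  proof (induction s rule: dec_induct)
    case base
    then have tT: "t < T" by simp
    have m: "(\<lambda>\<zeta>. \<integral>\<^sup>+p. \<psi> p \<partial>mut t \<zeta>) \<in> borel_measurable (psys x t)"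
      using nn_integral_kernel_measurable[OF mut_kernel[OF tT] \<psi>[of "Suc t"]] by (simp add: measurable_cong_sets[OF ps(2) refl])
    have "(\<integral>\<^sup>+\<zeta>. free_sum \<psi> \<zeta> \<partial>psys x (Suc t)) = (\<integral>\<^sup>+\<zeta>. of_nat (N - 1) * (\<integral>\<^sup>+p. \<psi> p \<partial>mut t \<zeta>) \<partial>psys x t)"
      by (subst nn_integral_psys_Suc[OF tT order_refl x free_sum_measurable[OF \<psi>]])
        (auto intro!: nn_integral_cong simp: ps nn_integral_cstep_free_sum[OF tT x _ \<psi>])
    also have "\<dots> = of_nat (N - 1) * (\<integral>\<^sup>+\<zeta>. (\<integral>\<^sup>+p. \<psi> p \<partial>mut t \<zeta>) \<partial>psys x t)" by (rule nn_integral_cmult[OF m])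
    also have "(\<integral>\<^sup>+\<zeta>. (\<integral>\<^sup>+p. \<psi> p \<partial>mut t \<zeta>) \<partial>psys x t) = U"
      unfolding U_def
    proof (rule nn_integral_cong)
      fix \<zeta> assume "\<zeta> \<in> space (psys x t)"
      then have \<zeta>: "\<zeta> \<in> space (S t)" by (simp add: ps)
      show "(\<integral>\<^sup>+p. \<psi> p \<partial>mut t \<zeta>) = (\<Sum>k\<in>{1..N}. selp t \<zeta> k * \<psi> (\<zeta> k))"
        unfolding nn_integral_mut[OF tT \<zeta> \<psi>[OF le_SucI[OF order_refl]]]
        by (intro sum.cong refl) (simp add: \<psi>e[OF order_refl tT sys_component[OF \<zeta>]])
    qed
    also have "of_nat (N - 1) * U \<le> of_nat N * U" by (intro mult_right_mono) auto
    finally show ?case by simp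
  next
    case (step s)
    have "(\<integral>\<^sup>+\<zeta>. free_sum \<psi> \<zeta> \<partial>psys x (Suc (Suc s))) \<le> of_nat N * (0 + (\<integral>\<^sup>+\<zeta>. free_sum \<psi> \<zeta> \<partial>psys x (Suc s)))"
      by (rule psys_step_free_sum[OF step.prems x]) (use step \<psi> \<psi>e \<psi>x restrict_in[OF x] in auto)
    also have "\<dots> \<le> of_nat N * (of_nat N ^ (Suc s - t) * U)" using step by (auto intro!: mult_left_mono)
    finally show ?case using step by (simp add: Suc_diff_le mult.assoc)
  qed
  have \<psi>T: "\<psi> \<in> borel_measurable (E T)" by (rule \<psi>[OF t])
  have Pk: "sets (PN x) = sets (E T)" using prob_kernelD[OF icsmc_kernel x] by simp
  have set: "{y \<in> space (E T). restrict y {1..t} \<in> B} \<in> sets (E T)"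
    using measurable_sets[OF restrict_path[OF t] B] by (simp add: vimage_def Int_def conj_commute)
  have "emeasure (PN x) {y \<in> space (E T). restrict y {1..t} \<in> B} = (\<integral>\<^sup>+y. indicator {y \<in> space (E T). restrict y {1..t} \<in> B} y \<partial>PN x)"
    using set Pk by (intro nn_integral_indicator[symmetric]) simp
  also have "\<dots> = (\<integral>\<^sup>+y. \<psi> y \<partial>PN x)"
    using prob_kernelD(3)[OF icsmc_kernel x] by (intro nn_integral_cong) (auto simp: \<psi>_def indicator_def)
  also have "\<dots> = (\<integral>\<^sup>+\<zeta>. (\<Sum>k\<in>{1..N}. selp T \<zeta> k * \<psi> (\<zeta> k)) \<partial>psys x T)"
    unfolding nn_integral_icsmc[OF x \<psi>T]
    by (intro nn_integral_cong nn_integral_out[OF _ \<psi>T]) (simp add: psys_prob[OF order_refl order_refl x])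
  also have "\<dots> \<le> of_nat N ^ (T - t) * U"
  proof (cases "t = T")
    case True then show ?thesis by (simp add: U_def)
  next
    case False
    then obtain s where s: "T = Suc s" "t \<le> s" using t by (cases T) auto
    have "(\<integral>\<^sup>+\<zeta>. (\<Sum>k\<in>{1..N}. selp T \<zeta> k * \<psi> (\<zeta> k)) \<partial>psys x T) \<le> (\<integral>\<^sup>+\<zeta>. free_sum \<psi> \<zeta> \<partial>psys x T)"
    proof (rule psys_nn_mono[OF order_refl order_refl x sel_sum_measurable[OF order_refl \<psi>T] free_sum_measurable[OF \<psi>T]])
      fix \<zeta> assume "\<zeta> \<in> space (S T)" "\<zeta> 1 = restrict x {1..T}"
      then show "(\<Sum>k\<in>{1..N}. selp T \<zeta> k * \<psi> (\<zeta> k)) \<le> free_sum \<psi> \<zeta>"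
        using sel_sum_le[OF order_refl, of \<zeta> \<psi> 0] \<psi>x[OF t] by simp
    qed
    also have "\<dots> \<le> of_nat N ^ (T - t) * U" using free[OF s(2)] s by simp
    finally show ?thesis .
  qed
  finally show ?thesis unfolding U .
qed

text \<open>The reference contributes its own potential to the total weight, so a competitor is
  selected with probability at most the ratio of the two potentials, and at most 1.\<close>

lemma sel_bound:
  assumes t: "t \<le> T" and x: "x \<in> space (E T)" and B: "B \<in> sets (E t)" and xB: "restrict x {1..t} \<notin> B"
    and pos: "0 < pot t (restrict x {1..t})" and u: "u \<in> borel_measurable (E t)"
    and le: "\<And>p. p \<in> B \<Longrightarrow> min 1 (ennreal (pot t p / pot t (restrict x {1..t}))) \<le> u p"
  shows "(\<integral>\<^sup>+\<zeta>. (\<Sum>k\<in>{1..N}. selp t \<zeta> k * indicator B (\<zeta> k)) \<partial>psys x t) \<le> (\<integral>\<^sup>+\<zeta>. free_sum u \<zeta> \<partial>psys x t)"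
proof (rule psys_nn_mono[OF t order_refl x sel_sum_measurable[OF t] free_sum_measurable[OF u]])
  show "indicator B \<in> borel_measurable (E t)" using B by simp
  fix \<zeta> assume \<zeta>: "\<zeta> \<in> space (S t)" "\<zeta> 1 = restrict x {1..t}"
  have w: "pot t (restrict x {1..t}) \<le> wsum t \<zeta>"
    unfolding \<zeta>(2)[symmetric] using N_ge_1 \<zeta>(1) t by (intro member_le_sum) (auto intro!: pot_nonneg sys_component)
  have "(\<Sum>k\<in>{1..N}. selp t \<zeta> k * indicator B (\<zeta> k)) =
      (\<Sum>k\<in>{2..N}. selp t \<zeta> k * indicator B (\<zeta> k))"
    unfolding sum_particles using xB \<zeta>(2) by simp
  also have "\<dots> \<le> (\<Sum>k\<in>{2..N}. u (\<zeta> k))"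
  proof (rule sum_mono)
    fix k assume "k \<in> {2..N}"
    then have k: "k \<in> {1..N}" by simp
    show "selp t \<zeta> k * indicator B (\<zeta> k) \<le> u (\<zeta> k)"
    proof (cases "\<zeta> k \<in> B")
      case True
      have "pot t (\<zeta> k) / wsum t \<zeta> \<le> pot t (\<zeta> k) / pot t (restrict x {1..t})"
        using pos w pot_nonneg[OF t sys_component[OF \<zeta>(1) k]] by (intro divide_left_mono) auto
      then have "selp t \<zeta> k \<le> ennreal (pot t (\<zeta> k) / pot t (restrict x {1..t}))"
        using pos w by (auto simp: sel_prob_def intro!: ennreal_leI)
      then have "selp t \<zeta> k \<le> min 1 (ennreal (pot t (\<zeta> k) / pot t (restrict x {1..t})))"
        using sel_prob_le_1[OF t \<zeta>(1) k] by simp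
      also have "\<dots> \<le> u (\<zeta> k)" by (rule le[OF True])
      finally show ?thesis using True by simp
    qed simp
  qed
  finally show "(\<Sum>k\<in>{1..N}. selp t \<zeta> k * indicator B (\<zeta> k)) \<le> free_sum u \<zeta>" by (simp add: free_sum_def)
qed

lemma compl_prob:
  assumes x: "x \<in> space (E T)" and A: "A \<in> sets (E T)" and le: "emeasure (PN x) (space (E T) - A) \<le> ennreal d" and d: "0 \<le> d"
  shows "1 - d \<le> measure (PN x) A"
proof -
  interpret prob_space "PN x" by (rule prob_kernelD[OF icsmc_kernel x])
  have s: "sets (PN x) = sets (E T)" "space (PN x) = space (E T)" using prob_kernelD[OF icsmc_kernel x] by auto
  have "measure (PN x) (space (E T) - A) \<le> d" using le d by (simp add: emeasure_eq_measure)
  then show ?thesis using prob_compl[of A] A s by simp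
qed

definition "level t K = {y \<in> space (E T). K \<le> G t (y t)}"

lemma level_sets: "t \<in> {1..T} \<Longrightarrow> level t K \<in> sets (E T)"
proof -
  assume t: "t \<in> {1..T}"
  have "(\<lambda>y. G t (y t)) \<in> borel_measurable (E T)"
    by (rule measurable_compose[OF measurable_component_singleton[OF t] G_measurable[OF t]])
  then show ?thesis unfolding level_def by measurable
qed

text \<open>A path that leaves the level has at most \<open>1 / L\<close> times the potential of the
  reference at time \<open>t\<close>. There are fewer than \<open>N\<close> competitors, and later
  generations contribute \<open>N ^ (T - t)\<close>; the exponent \<open>Suc T\<close> covers every
  \<open>t\<close>.\<close>

lemma level_escape:
  assumes t: "t \<in> {1..T}" and K: "0 < K" and L: "1 \<le> L" and x: "x \<in> level t (K * L)"
  shows "1 - real N ^ Suc T / L \<le> measure (PN x) (level t K)"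
proof -
  have xE: "x \<in> space (E T)" and xG: "K * L \<le> G t (x t)" using x by (auto simp: level_def)
  have tT: "t \<le> T" and t0: "t \<noteq> 0" using t by auto
  have rx: "pot t (restrict x {1..t}) = G t (x t)" using t by (simp add: pot_def)
  have KL: "K \<le> K * L" using K L by simp
  define B where "B = {p \<in> space (E t). pot t p < K}"
  have [measurable]: "pot t \<in> borel_measurable (E t)" by (rule pot_measurable[OF tT])
  have B: "B \<in> sets (E t)" unfolding B_def by measurable
  have xB: "restrict x {1..t} \<notin> B" using rx xG KL by (simp add: B_def)
  have "0 < K * L" using K L by simp
  then have pos: "0 < pot t (restrict x {1..t})" using rx xG by simp
  interpret px: prob_space "psys x t" by (rule psys_prob(1)[OF tT order_refl xE])
  have "emeasure (PN x) {y \<in> space (E T). restrict y {1..t} \<in> B} \<le>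
    of_nat N ^ (T - t) * (\<integral>\<^sup>+\<zeta>. (\<Sum>k\<in>{1..N}. selp t \<zeta> k * indicator B (\<zeta> k)) \<partial>psys x t)"
    by (rule icsmc_path_prob[OF tT xE B xB])
  also have "\<dots> \<le> of_nat N ^ (T - t) * (\<integral>\<^sup>+\<zeta>. free_sum (\<lambda>_. ennreal (1 / L)) \<zeta> \<partial>psys x t)"
  proof (intro mult_left_mono sel_bound[OF tT xE B xB pos])
    fix p assume "p \<in> B"
    then have p: "p \<in> space (E t)" "pot t p < K" by (auto simp: B_def)
    have "pot t p / G t (x t) \<le> K / (K * L)"
      using p pot_nonneg[OF tT p(1)] xG \<open>0 < K * L\<close> K by (intro frac_le) auto
    then show "min 1 (ennreal (pot t p / pot t (restrict x {1..t}))) \<le> ennreal (1 / L)"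
      unfolding rx using K by (intro min.coboundedI2 ennreal_leI) simp
  qed auto
  also have "\<dots> = of_nat N ^ (T - t) * (of_nat (N - 1) * ennreal (1 / L))"
    by (simp add: free_sum_def px.emeasure_space_1)
  also have "\<dots> \<le> of_nat N ^ T * (of_nat N * ennreal (1 / L))"
  proof (intro mult_mono power_increasing)
    show "(1::ennreal) \<le> of_nat N" using N_ge_1 by (metis of_nat_1 of_nat_mono)
  qed auto
  also have "\<dots> = ennreal (real N ^ Suc T / L)"
  proof -
    have "ennreal (real N ^ Suc T / L) = ennreal (real N ^ T * (real N * (1 / L)))" by (simp add: mult.commute)
    also have "\<dots> = ennreal (real N ^ T) * (ennreal (real N) * ennreal (1 / L))" using L ennreal_mult[of "real N" "1 / L"] by (subst ennreal_mult) auto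
    finally show ?thesis by (simp add: ennreal_of_nat_eq_real_of_nat ennreal_power)
  qed
  finally have le: "emeasure (PN x) {y \<in> space (E T). restrict y {1..t} \<in> B} \<le> ennreal (real N ^ Suc T / L)" .
  have "{y \<in> space (E T). restrict y {1..t} \<in> B} = space (E T) - level t K"
    using restrict_in[OF _ tT] t by (auto simp: B_def level_def pot_def)
  with le show ?thesis using L by (intro compl_prob[OF xE level_sets[OF t]]) auto
qed

end

section \<open>Dyadic scales and good paths\<close>

lemma (in finite_measure) measure_upper_level_small:
  fixes f :: "'a \<Rightarrow> real"
  assumes f: "f \<in> borel_measurable M" and \<epsilon>: "0 < \<epsilon>"
  shows "\<exists>a0. \<forall>a\<ge>a0. measure M {x\<in>space M. a \<le> f x} \<le> \<epsilon>"
proof -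
  define A where "A k = {x\<in>space M. real k \<le> f x}" for k :: nat
  note [measurable] = f
  have A: "A k \<in> sets M" for k unfolding A_def by measurable
  have "(\<lambda>k. measure M (A k)) \<longlonglongrightarrow> measure M (\<Inter>k. A k)"
  proof (rule finite_Lim_measure_decseq)
    show "range A \<subseteq> sets M" using A by auto
    show "decseq A" unfolding decseq_def A_def by auto
  qed
  moreover have "(\<Inter>k. A k) = {}"
  proof -
    have "x \<notin> (\<Inter>k. A k)" for x
    proof
      assume "x \<in> (\<Inter>k. A k)"
      moreover obtain k :: nat where "f x < real k" using reals_Archimedean2 by blast
      ultimately have "real k \<le> f x" by (auto simp: A_def)
      with \<open>f x < real k\<close> show False by simp
    qed
    then show ?thesis by blast
  qed
  ultimately have "(\<lambda>k. measure M (A k)) \<longlonglongrightarrow> 0" by simp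
  then obtain k where k: "measure M (A k) < \<epsilon>"
    using \<epsilon> by (metis (mono_tags) order_tendstoD(2) eventually_sequentially order_refl)
  have "measure M {x\<in>space M. a \<le> f x} \<le> \<epsilon>" if "real k \<le> a" for a
  proof -
    have "measure M {x\<in>space M. a \<le> f x} \<le> measure M (A k)"
      using that by (intro finite_measure_mono A) (auto simp: A_def)
    with k show ?thesis by simp
  qed
  then show ?thesis by blast
qed

lemma dyadic_sum_le_2:
  fixes \<phi> :: real
  assumes "0 \<le> \<phi>"
  shows "(\<Sum>a\<le>b. if \<phi> < 2 ^ a then \<phi> / 2 ^ a else 0) \<le> 2"
proof -
  \<comment> \<open>The nonzero terms start below 1 and halve; the induction keeps the last term in
    reserve.\<close>
  have "(\<Sum>a\<le>b. if \<phi> < 2 ^ a then \<phi> / 2 ^ a else 0) \<le> (if \<phi> < 2 ^ b then 2 - \<phi> / 2 ^ b else 0)"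
  proof (induction b)
    case (Suc b)
    define q where "q = \<phi> / 2 ^ b"
    have q: "\<phi> / 2 ^ Suc b = q / 2" by (simp add: q_def)
    show ?case
    proof (cases "\<phi> < 2 ^ Suc b")
      case True
      then have "\<phi> / 2 ^ b < 2" by (subst pos_divide_less_eq) auto
      then have "q < 2" by (simp add: q_def)
      moreover have "(if \<phi> < 2 ^ b then 2 - q else 0) \<le> 2 - q" using \<open>q < 2\<close> by simp
      ultimately show ?thesis using Suc True unfolding sum.atMost_Suc q q_def[symmetric] by simp
    next
      case False
      have "(2::real) ^ b \<le> 2 ^ Suc b" by simp
      then have "\<not> \<phi> < 2 ^ b" using False by linarith
      then show ?thesis using Suc False by simp
    qed
  qed (use assms in auto)
  also have "\<dots> \<le> 2" using assms by simp
  finally show ?thesis .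
qed

context csmc_model
begin

primrec bw :: "nat \<Rightarrow> ((nat \<Rightarrow> 'z) \<Rightarrow> ennreal) \<Rightarrow> nat \<Rightarrow> (nat \<Rightarrow> 'z) \<Rightarrow> ennreal" where
  "bw t f 0 = f"
| "bw t f (Suc j) = (\<lambda>p. \<integral>\<^sup>+q. bw t f j q \<partial>ext (t - Suc j) p)"

text \<open>The conditional mean, under the Markov chain, of \<open>f\<close> at time
  \<open>t\<close> given the path up to time \<open>n\<close>. This version is defined at every
  path, so it can be evaluated at the reference.\<close>

definition "cond_exp t f n = bw t f (t - n)"

lemma cond_exp_self: "cond_exp t f t = f"
  by (simp add: cond_exp_def)

lemma cond_exp_step: "n < t \<Longrightarrow> cond_exp t f n p = (\<integral>\<^sup>+q. cond_exp t f (Suc n) q \<partial>ext n p)"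
proof -
  assume "n < t"
  then obtain j where j: "t - n = Suc j" "t - Suc n = j" "n = t - Suc j" by (metis Suc_diff_Suc diff_diff_cancel less_imp_le_nat)
  then show ?thesis by (simp add: cond_exp_def)
qed

lemma bw_measurable:
  assumes t: "t \<le> T" and f: "f \<in> borel_measurable (E t)"
  shows "j \<le> t \<Longrightarrow> bw t f j \<in> borel_measurable (E (t - j))"
proof (induction j)
  case (Suc j)
  then have e: "Suc (t - Suc j) = t - j" and l: "t - Suc j < T" using t by auto
  have "bw t f j \<in> borel_measurable (E (Suc (t - Suc j)))" using Suc e by simp
  then show ?case using nn_integral_kernel_measurable[OF ext_kernel[OF l]] by simp
qed (use f in simp)

lemma cond_exp_measurable:
  assumes "t \<le> T" "f \<in> borel_measurable (E t)" "n \<le> t"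
  shows "cond_exp t f n \<in> borel_measurable (E n)"
  using bw_measurable[OF assms(1,2), of "t - n"] assms(3) by (simp add: cond_exp_def)

lemma cond_exp_sum_le:
  assumes t: "t \<le> T" and I: "finite I" and f: "\<And>a. a \<in> I \<Longrightarrow> f a \<in> borel_measurable (E t)"
    and le: "\<And>p. p \<in> space (E t) \<Longrightarrow> (\<Sum>a\<in>I. f a p) \<le> c"
  shows "n \<le> t \<Longrightarrow> p \<in> space (E n) \<Longrightarrow> (\<Sum>a\<in>I. cond_exp t (f a) n p) \<le> c"
proof (induction n arbitrary: p rule: inc_induct)
  case base then show ?case using le by (simp add: cond_exp_self)
next
  case (step n)
  then have n: "n < t" "n < T" using t by auto
  have K: "sets (ext n p) = sets (E (Suc n))" "space (ext n p) = space (E (Suc n))"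
    using prob_kernelD[OF ext_kernel[OF n(2)] step.prems] by auto
  have "(\<Sum>a\<in>I. cond_exp t (f a) n p) = (\<integral>\<^sup>+q. (\<Sum>a\<in>I. cond_exp t (f a) (Suc n) q) \<partial>ext n p)"
    unfolding cond_exp_step[OF n(1)]
    by (rule nn_integral_sum[symmetric]) (use cond_exp_measurable[OF t f] n in \<open>auto simp: measurable_cong_sets[OF K(1) refl]\<close>)
  also have "\<dots> \<le> (\<integral>\<^sup>+q. c \<partial>ext n p)" by (intro nn_integral_mono step.IH) (simp add: K)
  also have "\<dots> = c" by (rule nn_integral_kernel_const[OF ext_kernel[OF n(2)] step.prems])
  finally show ?case .
qed

lemma cond_exp_law:
  assumes t: "t \<le> T" and f: "f \<in> borel_measurable (E t)"
  shows "n \<le> t \<Longrightarrow> (\<integral>\<^sup>+p. cond_exp t f n p \<partial>law n) = (\<integral>\<^sup>+p. f p \<partial>law t)"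
proof (induction n rule: inc_induct)
  case base
  then show ?case by (simp add: cond_exp_self)
next
  case (step n)
  then have n: "n < t" "n < T" "Suc n \<le> t" using t by auto
  have "(\<integral>\<^sup>+p. cond_exp t f n p \<partial>law n) = (\<integral>\<^sup>+p. cond_exp t f (Suc n) p \<partial>law (Suc n))"
    unfolding nn_integral_law_Suc[OF n(2) cond_exp_measurable[OF t f n(3)]] cond_exp_step[OF n(1)] ..
  then show ?case using step by simp
qed

lemma cond_exp_0:
  assumes t: "t \<le> T" and f: "f \<in> borel_measurable (E t)"
  shows "cond_exp t f 0 (\<lambda>_. undefined) = (\<integral>\<^sup>+p. f p \<partial>law t)"
proof -
  have u: "(\<lambda>_. undefined) \<in> space (E 0)" by (simp add: space_PiM)
  have "(\<integral>\<^sup>+p. cond_exp t f 0 p \<partial>law 0) = cond_exp t f 0 (\<lambda>_. undefined)"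
    unfolding markov_law.simps(1) by (rule nn_integral_return[OF u cond_exp_measurable[OF t f]]) simp
  then show ?thesis using cond_exp_law[OF t f, of 0] by simp
qed

text \<open>The mean, given the path up to time \<open>n\<close>, of the potential at time \<open>t\<close> relative to \<open>2 ^ a\<close> and
  restricted to its values below \<open>2 ^ a\<close>. Summed over all scales \<open>a\<close> it is at most 2, hence it is
  small at most scales.\<close>

definition "low t a p = (if pot t p < 2 ^ a then ennreal (pot t p / 2 ^ a) else 0)"
definition "xi t a = cond_exp t (low t a)"
text \<open>The powers of \<open>\<theta>\<close> are matched to Markov's inequality:
  \<open>xi t a\<close> is a martingale along the chain, so from a path satisfying the condition at
  time \<open>m\<close> the condition at a later time \<open>n\<close> fails with probability at
  most \<open>\<theta> ^ (n - m)\<close>.\<close>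

definition "good \<theta> t a p \<longleftrightarrow> 2 ^ a \<le> pot t p \<and> (\<forall>n\<in>{1..<t}. xi t a n (restrict p {1..n}) \<le> ennreal (\<theta> ^ (t - n)))"
definition "good_set \<theta> t a = {p \<in> space (E t). good \<theta> t a p}"
definition "lift t B = {y \<in> space (E T). restrict y {1..t} \<in> B}"

lemma low_measurable: "t \<le> T \<Longrightarrow> low t a \<in> borel_measurable (E t)"
proof -
  assume "t \<le> T"
  then have [measurable]: "pot t \<in> borel_measurable (E t)" by (rule pot_measurable)
  show ?thesis unfolding low_def[abs_def] by measurable
qed

lemma xi_measurable: "t \<le> T \<Longrightarrow> n \<le> t \<Longrightarrow> xi t a n \<in> borel_measurable (E n)"
  unfolding xi_def by (intro cond_exp_measurable low_measurable)

lemma sum_xi_le_2: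
  assumes "t \<le> T" "n \<le> t" "p \<in> space (E n)" "finite I"
  shows "(\<Sum>a\<in>I. xi t a n p) \<le> 2"
  unfolding xi_def
proof (rule cond_exp_sum_le[OF assms(1,4) _ _ assms(2,3)])
  fix p assume p: "p \<in> space (E t)"
  have "(\<Sum>a\<in>I. low t a p) \<le> (\<Sum>a\<le>Max (insert 0 I). low t a p)"
    using assms(4) by (intro sum_mono2) auto
  also have "\<dots> = (\<Sum>a\<le>Max (insert 0 I). ennreal (if pot t p < 2 ^ a then pot t p / 2 ^ a else 0))"
    by (intro sum.cong) (auto simp: low_def)
  also have "\<dots> = ennreal (\<Sum>a\<le>Max (insert 0 I). if pot t p < 2 ^ a then pot t p / 2 ^ a else 0)"
    using pot_nonneg[OF assms(1) p] by (intro sum_ennreal) auto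
  also have "\<dots> \<le> ennreal 2" by (intro ennreal_leI dyadic_sum_le_2 pot_nonneg[OF assms(1) p])
  finally show "(\<Sum>a\<in>I. low t a p) \<le> 2" by simp
qed (use low_measurable assms in auto)

lemma good_sets: "t \<le> T \<Longrightarrow> good_set \<theta> t a \<in> sets (E t)"
proof -
  assume t: "t \<le> T"
  have [measurable]: "pot t \<in> borel_measurable (E t)" by (rule pot_measurable[OF t])
  have [measurable]: "(\<lambda>p. xi t a n (restrict p {1..n})) \<in> borel_measurable (E t)" if "n \<in> {1..<t}" for n
    using that t by (intro measurable_compose[OF restrict_path xi_measurable]) auto
  show ?thesis unfolding good_set_def good_def by measurable
qed

lemma lift_sets: "t \<le> T \<Longrightarrow> B \<in> sets (E t) \<Longrightarrow> lift t B \<in> sets (E T)"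
  unfolding lift_def using measurable_sets[OF restrict_path] by (simp add: vimage_def Int_def conj_commute)

text \<open>A competitor outside the trap either has potential below \<open>2 ^ a\<close> at time
  \<open>t\<close>, or violates the condition on \<open>xi\<close> at an intermediate time, or does
  not start in \<open>z\<close>. The first two are controlled by \<open>xi\<close> at the time of
  branching off. The third requires a particle that is free from time 1 on, and then the tail bound
  limits its chance of reaching the level. \<open>\<psi>\<close> bounds all three at once and
  decreases in mean along a free path.\<close>

lemma good_escape:
  assumes t: "t \<in> {1..T}" and \<theta>: "0 < \<theta>" "\<theta> \<le> 1 / 2"
    and z: "{z} \<in> sets Z"
    and xi0: "xi t a 0 (\<lambda>_. undefined) \<le> ennreal (\<theta> ^ t)"
    and tail: "emeasure (law t) {p \<in> space (E t). 2 ^ a \<le> pot t p} \<le> ennreal \<theta>"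
    and x: "x \<in> lift t {p \<in> good_set \<theta> t a. p 1 = z}"
  shows "1 - real N ^ (2 * T) * (3 * real T * \<theta>) \<le> measure (PN x) (lift t {p \<in> good_set \<theta> t a. p 1 = z})"
proof -
  have tT: "t \<le> T" and t1: "1 \<le> t" using t by auto
  have t1': "1 \<in> {1..t}" using t1 by simp
  let ?A = "{p \<in> good_set \<theta> t a. p 1 = z}"
  have c1: "(\<lambda>p. p 1) \<in> E n \<rightarrow>\<^sub>M Z" if "1 \<le> n" for n using that by (intro measurable_component_singleton) auto
  have A: "?A \<in> sets (E t)"
  proof -
    have "{p \<in> space (E t). p 1 = z} \<in> sets (E t)"
      using measurable_sets[OF c1[OF t1] z] by (simp add: vimage_def Int_def conj_commute)
    moreover have "?A = good_set \<theta> t a \<inter> {p \<in> space (E t). p 1 = z}" by (auto simp: good_set_def)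
    ultimately show ?thesis using good_sets[OF tT] by auto
  qed
  define B where "B = space (E t) - ?A"
  have B: "B \<in> sets (E t)" unfolding B_def using A by auto
  have xE: "x \<in> space (E T)" and xA: "restrict x {1..t} \<in> ?A" using x by (auto simp: lift_def)
  have xB: "restrict x {1..t} \<notin> B" using xA by (simp add: B_def)
  have x1: "x 1 = z" using xA t1 by simp
  have gx: "good \<theta> t a (restrict x {1..t})" using xA by (simp add: good_set_def)
  have px: "2 ^ a \<le> pot t (restrict x {1..t})" using gx by (simp add: good_def)
  have pos: "0 < pot t (restrict x {1..t})" by (rule less_le_trans[OF _ px]) simp
  have rr: "n \<le> m \<Longrightarrow> restrict (restrict p {1..m}) {1..n} = restrict p {1..n}" for n m and p :: "nat \<Rightarrow> 'z"
    by (auto simp: restrict_def fun_eq_iff)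
  have xxi: "xi t a n (restrict x {1..n}) \<le> ennreal (\<theta> ^ (t - n))" if "n \<in> {1..<t}" for n
    using gx that by (auto simp: good_def rr)
  define bb where "bb = cond_exp t (indicator {p \<in> space (E t). 2 ^ a \<le> pot t p})"
  have hl: "{p \<in> space (E t). 2 ^ a \<le> pot t p} \<in> sets (E t)"
  proof -
    have [measurable]: "pot t \<in> borel_measurable (E t)" by (rule pot_measurable[OF tT])
    show ?thesis by measurable
  qed
  have bb: "bb n \<in> borel_measurable (E n)" if "n \<le> t" for n
    unfolding bb_def using hl that by (intro cond_exp_measurable[OF tT]) auto
  \<comment> \<open>Chosen to satisfy \<open>1 / \<theta> ^ (t - m) + c (Suc m) \<le> c m\<close>,
    which uses \<open>\<theta> \<le> 1 / 2\<close>. The first summand pays, by Markov's inequality,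
    for a violation at time \<open>m\<close>.\<close>
  define c where "c n = ennreal (2 / \<theta> ^ (t - n))" for n
  \<comment> \<open>The violations already committed, a bound for those still to come and for the
    near miss at time \<open>t\<close>, and, for a path that does not start in \<open>z\<close>, the
    conditional probability of reaching the level.\<close>
  define \<psi> where "\<psi> m p = (\<Sum>n\<in>{1..<m}. of_bool (\<not> xi t a n (restrict p {1..n}) \<le> ennreal (\<theta> ^ (t - n)))) +
      c m * xi t a m p + of_bool (p 1 \<noteq> z) * bb m p" for m p
  have \<psi>: "\<psi> m \<in> borel_measurable (E m)" if "m \<le> t" for m
  proof (cases "m = 0")
    case True
    have "E 0 = count_space {\<lambda>_. undefined}" by (simp add: PiM_empty)
    then show ?thesis using True by simp
  next
    case False
    have [measurable]: "(\<lambda>p. xi t a n (restrict p {1..n})) \<in> borel_measurable (E m)" if "n \<in> {1..<m}" for n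
      using that \<open>m \<le> t\<close> tT by (intro measurable_compose[OF restrict_path xi_measurable]) auto
    have [measurable]: "xi t a m \<in> borel_measurable (E m)" "bb m \<in> borel_measurable (E m)"
      using that tT bb by (auto intro: xi_measurable)
    have [measurable]: "Measurable.pred (E m) (\<lambda>p. p 1 = z)"
      using measurable_sets[OF c1 z, of m] False by (simp add: pred_def vimage_def Int_def conj_commute)
    show ?thesis unfolding \<psi>_def[abs_def] of_bool_def by measurable
  qed
  have step: "(\<integral>\<^sup>+q. \<psi> (Suc m) q \<partial>ext m p) =
      (\<Sum>n\<in>{1..<Suc m}. of_bool (\<not> xi t a n (restrict p {1..n}) \<le> ennreal (\<theta> ^ (t - n)))) +
      c (Suc m) * xi t a m p + of_bool (p 1 \<noteq> z) * bb m p"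
    if m: "1 \<le> m" "m < t" and p: "p \<in> space (E m)" for m p
  proof -
    have mT: "m < T" using m tT by simp
    let ?s = "\<Sum>n\<in>{1..<Suc m}. of_bool (\<not> xi t a n (restrict p {1..n}) \<le> ennreal (\<theta> ^ (t - n))) :: ennreal"
    have K: "sets (ext m p) = sets (E (Suc m))" by (rule prob_kernelD[OF ext_kernel[OF mT] p])
    have xm: "xi t a (Suc m) \<in> borel_measurable (E (Suc m))" "bb (Suc m) \<in> borel_measurable (E (Suc m))"
      using m tT bb by (auto intro: xi_measurable)
    have "(\<integral>\<^sup>+q. \<psi> (Suc m) q \<partial>ext m p) = (\<integral>\<^sup>+q. ?s + c (Suc m) * xi t a (Suc m) q + of_bool (p 1 \<noteq> z) * bb (Suc m) q \<partial>ext m p)"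
    proof (rule ext_cong[OF mT p \<psi>])
      show "(\<lambda>q. ?s + c (Suc m) * xi t a (Suc m) q + of_bool (p 1 \<noteq> z) * bb (Suc m) q) \<in> borel_measurable (E (Suc m))"
        using xm by measurable
      fix w
      have "(p(Suc m := w)) 1 = p 1" using m by simp
      moreover have "(\<Sum>n\<in>{1..<Suc m}. of_bool (\<not> xi t a n (restrict (p(Suc m := w)) {1..n}) \<le> ennreal (\<theta> ^ (t - n)))) = ?s"
        by (intro sum.cong refl) (simp only: atLeastLessThan_iff less_Suc_eq_le restrict_upd)
      ultimately show "\<psi> (Suc m) (p(Suc m := w)) = ?s + c (Suc m) * xi t a (Suc m) (p(Suc m := w)) + of_bool (p 1 \<noteq> z) * bb (Suc m) (p(Suc m := w))"
        unfolding \<psi>_def by simp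
    qed (use m in auto)
    also have "\<dots> = ?s + c (Suc m) * (\<integral>\<^sup>+q. xi t a (Suc m) q \<partial>ext m p) + of_bool (p 1 \<noteq> z) * (\<integral>\<^sup>+q. bb (Suc m) q \<partial>ext m p)"
      using xm nn_integral_kernel_const[OF ext_kernel[OF mT] p]
      by (simp add: nn_integral_add nn_integral_cmult measurable_cong_sets[OF K refl])
    finally show ?thesis using m by (simp add: xi_def bb_def cond_exp_step)
  qed
  have super: "(\<integral>\<^sup>+q. \<psi> (Suc m) q \<partial>ext m p) \<le> \<psi> m p" if m: "1 \<le> m" "m < t" and p: "p \<in> space (E m)" for m p
  proof -
    have ins: "{1..<Suc m} = insert m {1..<m}" using m by auto
    have th: "0 < \<theta> ^ (t - m)" using \<theta> by simp
    have "of_bool (\<not> xi t a m p \<le> ennreal (\<theta> ^ (t - m))) + c (Suc m) * xi t a m p \<le> c m * xi t a m p"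
    proof -
      have i: "ennreal (1 / \<theta> ^ (t - m)) + c (Suc m) \<le> c m"
      proof -
        have e: "t - m = Suc (t - Suc m)" using m by simp
        have "1 / \<theta> ^ (t - m) + 2 / \<theta> ^ (t - Suc m) \<le> 2 / \<theta> ^ (t - m)"
          unfolding e using \<theta> by (simp add: field_simps)
        then show ?thesis using \<theta> by (simp add: c_def ennreal_leI flip: ennreal_plus)
      qed
      have "of_bool (\<not> xi t a m p \<le> ennreal (\<theta> ^ (t - m))) \<le> ennreal (1 / \<theta> ^ (t - m)) * xi t a m p"
      proof (cases "xi t a m p \<le> ennreal (\<theta> ^ (t - m))")
        case False
        then have "ennreal (1 / \<theta> ^ (t - m)) * ennreal (\<theta> ^ (t - m)) \<le> ennreal (1 / \<theta> ^ (t - m)) * xi t a m p"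
          by (intro mult_left_mono) auto
        then show ?thesis using False th \<theta> by (simp flip: ennreal_mult)
      qed simp
      then have "of_bool (\<not> xi t a m p \<le> ennreal (\<theta> ^ (t - m))) + c (Suc m) * xi t a m p \<le> (ennreal (1 / \<theta> ^ (t - m)) + c (Suc m)) * xi t a m p"
        by (simp add: distrib_right add_right_mono)
      also have "\<dots> \<le> c m * xi t a m p" using i by (rule mult_right_mono) simp
      finally show ?thesis .
    qed
    then have "s + of_bool (\<not> xi t a m p \<le> ennreal (\<theta> ^ (t - m))) + c (Suc m) * xi t a m p \<le> s + c m * xi t a m p" for s
      by (simp add: add.assoc add_left_mono)
    note le = add_right_mono[OF this]
    have "(\<integral>\<^sup>+q. \<psi> (Suc m) q \<partial>ext m p) = (\<Sum>n\<in>{1..<m}. of_bool (\<not> xi t a n (restrict p {1..n}) \<le> ennreal (\<theta> ^ (t - n)))) +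
        of_bool (\<not> xi t a m p \<le> ennreal (\<theta> ^ (t - m))) + c (Suc m) * xi t a m p + of_bool (p 1 \<noteq> z) * bb m p"
      unfolding step[OF m p] ins by (subst sum.insert) (auto simp: restrict_self[OF p] add.commute simp del: sum_of_bool_eq)
    also have "\<dots> \<le> \<psi> m p" unfolding \<psi>_def[of m p] by (rule le)
    finally show ?thesis .
  qed
  \<comment> \<open>The cost of branching off the reference at time \<open>m\<close>. At
    \<open>m = 0\<close> the first coordinate is still open, so the tail term \<open>bb\<close>
    appears; a later branch inherits the first coordinate \<open>z\<close>.\<close>
  define e where "e m = (if m = 0 then c 1 * xi t a 0 (\<lambda>_. undefined) + bb 0 (\<lambda>_. undefined) else c (Suc m) * ennreal (\<theta> ^ (t - m)))" for m
  have e: "(\<integral>\<^sup>+q. \<psi> (Suc m) q \<partial>ext m (restrict x {1..m})) \<le> e m" if m: "m < t" for m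
  proof (cases "m = 0")
    case True
    have T0: "0 < T" using T_ge_1 by simp
    have u: "(\<lambda>_::nat. undefined::'z) \<in> space (E 0)" by (simp add: space_PiM)
    have r: "restrict x {1..0} = (\<lambda>_. undefined)" by auto
    have K: "sets (ext 0 (\<lambda>_. undefined)) = sets (E (Suc 0))" by (rule prob_kernelD[OF ext_kernel[OF T0] u])
    have xm: "xi t a (Suc 0) \<in> borel_measurable (E (Suc 0))" "bb (Suc 0) \<in> borel_measurable (E (Suc 0))"
      using m True tT bb by (auto intro: xi_measurable)
    have "(\<integral>\<^sup>+q. \<psi> (Suc 0) q \<partial>ext 0 (\<lambda>_. undefined)) \<le> (\<integral>\<^sup>+q. c (Suc 0) * xi t a (Suc 0) q + bb (Suc 0) q \<partial>ext 0 (\<lambda>_. undefined))"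
      by (intro nn_integral_mono) (auto simp: \<psi>_def One_nat_def of_bool_def intro!: add_mono)
    also have "\<dots> = c (Suc 0) * (\<integral>\<^sup>+q. xi t a (Suc 0) q \<partial>ext 0 (\<lambda>_. undefined)) + (\<integral>\<^sup>+q. bb (Suc 0) q \<partial>ext 0 (\<lambda>_. undefined))"
      using xm by (simp add: nn_integral_add nn_integral_cmult measurable_cong_sets[OF K refl])
    finally show ?thesis using True m r by (simp add: e_def xi_def bb_def cond_exp_step One_nat_def)
  next
    case False
    then have m1: "1 \<le> m" by simp
    have rin: "restrict x {1..m} \<in> space (E m)" using m tT by (intro restrict_in[OF xE]) auto
    have "(restrict x {1..m}) 1 = z" using m1 x1 by simp
    moreover have "(\<Sum>n\<in>{1..<Suc m}. of_bool (\<not> xi t a n (restrict (restrict x {1..m}) {1..n}) \<le> ennreal (\<theta> ^ (t - n)))) = (0 :: ennreal)"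
      by (intro sum.neutral ballI) (use xxi m in \<open>auto simp: rr\<close>)
    ultimately have "(\<integral>\<^sup>+q. \<psi> (Suc m) q \<partial>ext m (restrict x {1..m})) = c (Suc m) * xi t a m (restrict x {1..m})"
      unfolding step[OF m1 m rin] by simp
    also have "\<dots> \<le> e m" using False xxi[of m] m m1 by (auto simp: e_def intro!: mult_left_mono)
    finally show ?thesis .
  qed
  have c\<theta>: "c (Suc m) * ennreal (\<theta> ^ (t - m)) = ennreal (2 * \<theta>)" if "m < t" for m
  proof -
    have s: "t - m = Suc (t - Suc m)" using that by simp
    have "2 / \<theta> ^ (t - Suc m) * \<theta> ^ (t - m) = 2 * \<theta>" unfolding s using \<theta> by simp
    then show ?thesis using \<theta> by (simp add: c_def flip: ennreal_mult)
  qed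
  have e3: "e m \<le> ennreal (3 * \<theta>)" if m: "m < t" for m
  proof (cases "m = 0")
    case True
    have "bb 0 (\<lambda>_. undefined) = emeasure (law t) {p \<in> space (E t). 2 ^ a \<le> pot t p}"
      unfolding bb_def using cond_exp_0[OF tT] hl law_sets(1)[OF tT] by simp
    then have b: "bb 0 (\<lambda>_. undefined) \<le> ennreal \<theta>" using tail by simp
    have "c 1 * xi t a 0 (\<lambda>_. undefined) \<le> c (Suc 0) * ennreal (\<theta> ^ (t - 0))"
      using xi0 by (simp add: One_nat_def mult_left_mono)
    also have "\<dots> = ennreal (2 * \<theta>)" by (rule c\<theta>) (use m True in simp)
    finally have "e 0 \<le> ennreal (2 * \<theta>) + ennreal \<theta>" using b by (simp add: e_def add_mono)
    then show ?thesis using True \<theta> by (simp flip: ennreal_plus)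
  next
    case False
    then have "e m = ennreal (2 * \<theta>)" using c\<theta>[OF m] by (simp add: e_def)
    then show ?thesis using \<theta> by (simp add: ennreal_leI)
  qed
  obtain s where s: "t = Suc s" using t1 by (cases t) auto
  have Nge: "(1::ennreal) \<le> of_nat N" using N_ge_1 by (metis of_nat_1 of_nat_mono)
  have free: "(\<integral>\<^sup>+\<zeta>. free_sum (\<psi> t) \<zeta> \<partial>psys x t) \<le> of_nat N ^ T * ennreal (3 * real T * \<theta>)"
  proof -
    have "(\<integral>\<^sup>+\<zeta>. free_sum (\<psi> (Suc s)) \<zeta> \<partial>psys x (Suc s)) \<le> (\<Sum>m\<le>s. of_nat N ^ (Suc s - m) * e m)"
      by (rule free_sum_domination[OF xE tT \<psi> super e]) (use s in auto)
    also have "\<dots> \<le> (\<Sum>m\<le>s. of_nat N ^ T * ennreal (3 * \<theta>))"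
      using e3 s tT Nge by (intro sum_mono mult_mono power_increasing) auto
    also have "\<dots> = of_nat (Suc s) * (of_nat N ^ T * ennreal (3 * \<theta>))" by simp
    also have "\<dots> \<le> of_nat T * (of_nat N ^ T * ennreal (3 * \<theta>))" using s tT by (intro mult_right_mono of_nat_mono) auto
    also have "\<dots> = of_nat N ^ T * ennreal (3 * real T * \<theta>)"
    proof -
      have "of_nat T * ennreal (3 * \<theta>) = ennreal (3 * real T * \<theta>)"
        using \<theta> by (simp add: ennreal_of_nat_eq_real_of_nat mult.commute mult.left_commute flip: ennreal_mult)
      then show ?thesis by (metis mult.left_commute)
    qed
    finally show ?thesis using s by simp
  qed
  have low_xi: "xi t a t p = low t a p" for p by (simp add: xi_def cond_exp_self)
  have bbt: "bb t p = indicator {p \<in> space (E t). 2 ^ a \<le> pot t p} p" for p by (simp add: bb_def cond_exp_self)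
  have "emeasure (PN x) (lift t B) \<le>
    of_nat N ^ (T - t) * (\<integral>\<^sup>+\<zeta>. (\<Sum>k\<in>{1..N}. selp t \<zeta> k * indicator B (\<zeta> k)) \<partial>psys x t)"
    unfolding lift_def by (rule icsmc_path_prob[OF tT xE B xB])
  also have "\<dots> \<le> of_nat N ^ (T - t) * (\<integral>\<^sup>+\<zeta>. free_sum (\<psi> t) \<zeta> \<partial>psys x t)"
  proof (intro mult_left_mono sel_bound[OF tT xE B xB pos \<psi>[OF order_refl]])
    fix p assume "p \<in> B"
    then have p: "p \<in> space (E t)" and nA: "p \<notin> ?A" by (auto simp: B_def)
    consider "pot t p < 2 ^ a" | n where "n \<in> {1..<t}" "\<not> xi t a n (restrict p {1..n}) \<le> ennreal (\<theta> ^ (t - n))"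
      | "2 ^ a \<le> pot t p" "p 1 \<noteq> z"
      using nA p unfolding good_set_def good_def by fastforce
    then show "min 1 (ennreal (pot t p / pot t (restrict x {1..t}))) \<le> \<psi> t p"
    proof cases
      case 1
      have "pot t p / pot t (restrict x {1..t}) \<le> pot t p / 2 ^ a"
        using px pos pot_nonneg[OF tT p] by (intro divide_left_mono) auto
      then have "min 1 (ennreal (pot t p / pot t (restrict x {1..t}))) \<le> xi t a t p"
        using 1 by (simp add: low_xi low_def min.coboundedI2 ennreal_leI)
      also have "\<dots> \<le> c t * xi t a t p"
      proof -
        have "1 * xi t a t p \<le> c t * xi t a t p" by (intro mult_right_mono) (auto simp: c_def)
        then show ?thesis by simp
      qed
      also have "\<dots> \<le> \<psi> t p" by (simp add: \<psi>_def add_increasing add_increasing2)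
      finally show ?thesis .
    next
      case 2
      have "(1 :: ennreal) = of_bool (\<not> xi t a n (restrict p {1..n}) \<le> ennreal (\<theta> ^ (t - n)))" using 2 by simp
      also have "\<dots> \<le> (\<Sum>n\<in>{1..<t}. of_bool (\<not> xi t a n (restrict p {1..n}) \<le> ennreal (\<theta> ^ (t - n))))"
        using 2 by (intro member_le_sum) auto
      also have "\<dots> \<le> \<psi> t p" by (simp add: \<psi>_def add_increasing2 add.assoc)
      finally show ?thesis by (rule min.coboundedI1)
    next
      case 3
      then have "1 \<le> \<psi> t p" using p by (simp add: \<psi>_def bbt add_increasing)
      then show ?thesis by (rule min.coboundedI1)
    qed
  qed simp
  also have "\<dots> \<le> of_nat N ^ T * (of_nat N ^ T * ennreal (3 * real T * \<theta>))"
    using free Nge by (intro mult_mono power_increasing) auto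
  also have "\<dots> = ennreal (real N ^ (2 * T) * (3 * real T * \<theta>))"
    using \<theta> by (simp add: ennreal_of_nat_eq_real_of_nat ennreal_power ennreal_mult mult_2 power_add mult.assoc)
  finally have le: "emeasure (PN x) (lift t B) \<le> ennreal (real N ^ (2 * T) * (3 * real T * \<theta>))" .
  have "lift t B = space (E T) - lift t ?A"
    using restrict_in[OF _ tT] by (auto simp: lift_def B_def)
  with le show ?thesis using \<theta> by (intro compl_prob[OF xE lift_sets[OF tT A]]) auto
qed

text \<open>A pigeonhole argument over scales. By \<open>sum_xi_le_2\<close> the condition at time
  \<open>n\<close> fails at no more than \<open>2 / \<theta> ^ (t - n)\<close> scales. If the range
  from \<open>a0\<close> to \<open>b\<close> contains more scales than all these failures together,
  every path with potential at least \<open>2 ^ b\<close> is good at one of them; as the scales are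
  finitely many, one of them has positive mass.\<close>

lemma exists_good_scale:
  assumes t: "t \<in> {1..T}" and \<theta>: "0 < \<theta>" "\<theta> \<le> 1 / 2"
    and unb: "\<And>K. 0 < measure tgt (level t K)"
  shows "\<exists>a\<ge>a0. xi t a 0 (\<lambda>_. undefined) \<le> ennreal (\<theta> ^ t) \<and> 0 < measure tgt (lift t (good_set \<theta> t a))"
proof -
  have tT: "t \<le> T" using t by simp
  interpret prob_space tgt by (rule prob_pi)
  define w where "w n = 1 / \<theta> ^ (t - n)" for n
  obtain b :: nat where b: "a0 \<le> b" "(\<Sum>n<t. w n * 2) < real (Suc b - a0)"
  proof -
    obtain k :: nat where "(\<Sum>n<t. w n * 2) < real k" using reals_Archimedean2 by blast
    then show ?thesis by (intro that[of "a0 + k"]) auto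
  qed
  have cover: "\<exists>a\<in>{a0..b}. xi t a 0 (\<lambda>_. undefined) \<le> ennreal (\<theta> ^ t) \<and> x \<in> lift t (good_set \<theta> t a)"
    if x: "x \<in> level t (2 ^ b)" for x
  proof (rule ccontr)
    assume neg: "\<not> ?thesis"
    have xE: "x \<in> space (E T)" and xG: "2 ^ b \<le> G t (x t)" using x by (auto simp: level_def)
    have r0: "restrict x {1..0} = (\<lambda>_. undefined)" by auto
    have bad: "\<exists>n<t. \<not> xi t a n (restrict x {1..n}) \<le> ennreal (\<theta> ^ (t - n))" if a: "a \<in> {a0..b}" for a
    proof (rule ccontr)
      assume "\<not> ?thesis"
      then have all: "\<And>n. n < t \<Longrightarrow> xi t a n (restrict x {1..n}) \<le> ennreal (\<theta> ^ (t - n))" by blast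
      have "(2::real) ^ a \<le> 2 ^ b" using a by simp
      also have "\<dots> \<le> pot t (restrict x {1..t})" using xG t by (simp add: pot_def)
      finally have "2 ^ a \<le> pot t (restrict x {1..t})" .
      moreover have "restrict (restrict x {1..t}) {1..n} = restrict x {1..n}" if "n < t" for n
        using that by (auto simp: restrict_def fun_eq_iff)
      ultimately have "good \<theta> t a (restrict x {1..t})" unfolding good_def using all by simp
      then have "x \<in> lift t (good_set \<theta> t a)"
        using restrict_in[OF xE tT] xE by (simp add: lift_def good_set_def)
      moreover have "xi t a 0 (\<lambda>_. undefined) \<le> ennreal (\<theta> ^ t)" using all[of 0] t r0 by simp
      ultimately show False using neg a by blast
    qed
    have "(of_nat (Suc b - a0) :: ennreal) = (\<Sum>a\<in>{a0..b}. 1)" by simp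
    also have "\<dots> \<le> (\<Sum>a\<in>{a0..b}. \<Sum>n<t. ennreal (w n) * xi t a n (restrict x {1..n}))"
    proof (rule sum_mono)
      fix a assume "a \<in> {a0..b}"
      then obtain n where n: "n < t" "\<not> xi t a n (restrict x {1..n}) \<le> ennreal (\<theta> ^ (t - n))" using bad by blast
      have "1 = ennreal (w n) * ennreal (\<theta> ^ (t - n))" using \<theta> by (simp add: w_def flip: ennreal_mult)
      also have "\<dots> \<le> ennreal (w n) * xi t a n (restrict x {1..n})" using n by (intro mult_left_mono) auto
      also have "\<dots> \<le> (\<Sum>n<t. ennreal (w n) * xi t a n (restrict x {1..n}))" using n by (intro member_le_sum) auto
      finally show "1 \<le> (\<Sum>n<t. ennreal (w n) * xi t a n (restrict x {1..n}))" .
    qed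
    also have "\<dots> = (\<Sum>n<t. ennreal (w n) * (\<Sum>a\<in>{a0..b}. xi t a n (restrict x {1..n})))"
      by (subst sum.swap) (simp add: sum_distrib_left)
    also have "\<dots> \<le> (\<Sum>n<t. ennreal (w n) * 2)"
      using tT by (intro sum_mono mult_left_mono sum_xi_le_2 restrict_in[OF xE]) auto
    also have "\<dots> = ennreal (\<Sum>n<t. w n * 2)"
    proof -
      have "ennreal (w n) * 2 = ennreal (w n * 2)" for n
        using \<theta> ennreal_mult[of "w n" 2] by (simp add: w_def)
      moreover have "0 \<le> w n * 2" for n using \<theta> by (simp add: w_def)
      ultimately show ?thesis by simp
    qed
    finally have "ennreal (real (Suc b - a0)) \<le> ennreal (\<Sum>n<t. w n * 2)" by (simp add: ennreal_of_nat_eq_real_of_nat)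
    then have "real (Suc b - a0) \<le> (\<Sum>n<t. w n * 2)" using \<theta> by (subst (asm) ennreal_le_iff) (auto simp: w_def intro!: sum_nonneg)
    with b(2) show False by simp
  qed
  define I where "I = {a \<in> {a0..b}. xi t a 0 (\<lambda>_. undefined) \<le> ennreal (\<theta> ^ t)}"
  have m: "lift t (good_set \<theta> t a) \<in> sets tgt" for a
    using lift_sets[OF tT good_sets[OF tT]] by (simp add: sets_pi)
  have "level t (2 ^ b) \<subseteq> (\<Union>a\<in>I. lift t (good_set \<theta> t a))" using cover unfolding I_def by blast
  then have "measure tgt (level t (2 ^ b)) \<le> measure tgt (\<Union>a\<in>I. lift t (good_set \<theta> t a))"
    using m by (intro finite_measure_mono) (auto simp: I_def)
  also have "\<dots> \<le> (\<Sum>a\<in>I. measure tgt (lift t (good_set \<theta> t a)))"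
    using m by (intro finite_measure_subadditive_finite) (auto simp: I_def)
  finally have "0 < (\<Sum>a\<in>I. measure tgt (lift t (good_set \<theta> t a)))" using unb[of "2 ^ b"] by simp
  then have "(\<Sum>a\<in>I. measure tgt (lift t (good_set \<theta> t a))) \<noteq> 0" by simp
  then obtain a where "a \<in> I" "measure tgt (lift t (good_set \<theta> t a)) \<noteq> 0" by (rule sum.not_neutral_contains_not_neutral)
  then have "a \<ge> a0 \<and> xi t a 0 (\<lambda>_. undefined) \<le> ennreal (\<theta> ^ t) \<and> 0 < measure tgt (lift t (good_set \<theta> t a))"
    by (auto simp: I_def zero_less_measure_iff)
  then show ?thesis by blast
qed

end

section \<open>Minorisation\<close>

lemma ennreal_amgm:
  fixes s :: ennreal
  assumes b: "0 < b" "b < \<infinity>"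
  shows "1 / b + 1 / b \<le> 1 / s + s / b / b"
proof -
  obtain b' where b': "b = ennreal b'" "0 < b'" using b by (cases b) auto
  show ?thesis
  proof (cases s)
    case (real r)
    show ?thesis
    proof (cases "r = 0")
      case False
      then have r: "0 < r" using real by simp
      have "1 / b' + 1 / b' \<le> 1 / r + r / b' / b'"
      proof -
        have "0 \<le> (b' - r)\<^sup>2 / (r * (b' * b'))" using r by simp
        also have "\<dots> = 1 / r + r / b' / b' - (1 / b' + 1 / b')"
          using r b' by (simp add: field_simps power2_eq_square)
        finally show ?thesis by simp
      qed
      moreover have "1 / b = ennreal (1 / b')" "1 / s = ennreal (1 / r)" "s / b / b = ennreal (r / b' / b')"
        using real r b' by (simp_all add: divide_ennreal flip: ennreal_1)
      ultimately show ?thesis using r b' by (simp flip: ennreal_plus)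
    qed (use real in \<open>simp add: ennreal_divide_zero\<close>)
  qed (use b' in \<open>simp add: divide_ennreal_def ennreal_top_mult\<close>)
qed

lemma ennreal_divide_leI: "a \<le> r * y \<Longrightarrow> a / y \<le> (r :: ennreal)"
  by (cases "y = 0"; cases "y = \<infinity>") (auto intro!: divide_le_posI_ennreal simp: mult.commute zero_less_iff_neq_zero)

lemma nn_integral_PiM_pair:
  assumes \<mu>: "prob_space \<mu>" and I: "finite I" "i \<in> I" "j \<in> I" "i \<noteq> j"
    and f: "f \<in> borel_measurable \<mu>" and g: "g \<in> borel_measurable \<mu>"
  shows "(\<integral>\<^sup>+\<xi>. f (\<xi> i) * g (\<xi> j) \<partial>PiM I (\<lambda>_. \<mu>)) = (\<integral>\<^sup>+p. f p \<partial>\<mu>) * (\<integral>\<^sup>+p. g p \<partial>\<mu>)"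
proof -
  interpret \<mu>: prob_space \<mu> by fact
  interpret product_prob_space "\<lambda>_. \<mu>" by (rule product_prob_space_const[OF \<mu>])
  define h where "h k = (if k = i then f else if k = j then g else (\<lambda>_. 1))" for k
  have p: "(\<Prod>k\<in>I. a k) = a i * a j" if "\<And>k. k \<notin> {i, j} \<Longrightarrow> a k = 1" for a :: "_ \<Rightarrow> ennreal"
  proof -
    have "(\<Prod>k\<in>I. a k) = (\<Prod>k\<in>{i, j}. a k)" using I that by (intro prod.mono_neutral_right) auto
    then show ?thesis using I by simp
  qed
  have "(\<integral>\<^sup>+\<xi>. f (\<xi> i) * g (\<xi> j) \<partial>PiM I (\<lambda>_. \<mu>)) = (\<integral>\<^sup>+\<xi>. (\<Prod>k\<in>I. h k (\<xi> k)) \<partial>PiM I (\<lambda>_. \<mu>))"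
    by (subst p) (use I in \<open>auto simp: h_def\<close>)
  also have "\<dots> = (\<Prod>k\<in>I. integral\<^sup>N \<mu> (h k))"
    by (rule product_nn_integral_prod) (use I f g in \<open>auto simp: h_def\<close>)
  also have "\<dots> = (\<integral>\<^sup>+p. f p \<partial>\<mu>) * (\<integral>\<^sup>+p. g p \<partial>\<mu>)"
    by (subst p) (use I in \<open>auto simp: h_def \<mu>.emeasure_space_1\<close>)
  finally show ?thesis .
qed

text \<open>Since $1/s + s/b^2 \ge 2/b$, the mean of a ratio is bounded below by means of numerator and
  denominator; independence of the components keeps their product under control.\<close>

lemma mean_ratio_ge:
  fixes A D :: "'a \<Rightarrow> ennreal"
  assumes \<mu>: "prob_space \<mu>" and I: "finite I" "I \<noteq> {}"
    and A: "A \<in> borel_measurable \<mu>" and D: "D \<in> borel_measurable \<mu>"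
    and d: "0 < d" "d < \<infinity>" "r \<le> d" and Dd: "AE p in \<mu>. D p \<le> d" and Af: "(\<integral>\<^sup>+p. A p \<partial>\<mu>) < \<infinity>"
  shows "of_nat (card I) * ((\<integral>\<^sup>+p. A p \<partial>\<mu>) / (d + d + of_nat (card I - 1) * (\<integral>\<^sup>+p. D p \<partial>\<mu>))) \<le>
    (\<integral>\<^sup>+\<xi>. (\<Sum>k\<in>I. A (\<xi> k)) / (r + (\<Sum>k\<in>I. D (\<xi> k))) \<partial>PiM I (\<lambda>_. \<mu>))"
proof -
  interpret \<mu>: prob_space \<mu> by fact
  let ?P = "PiM I (\<lambda>_. \<mu>)"
  have Am: "(\<lambda>\<xi>. A (\<xi> k)) \<in> borel_measurable ?P" and Dm: "(\<lambda>\<xi>. D (\<xi> k)) \<in> borel_measurable ?P" if "k \<in> I" for k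
    using A D that by (auto intro: measurable_compose[OF measurable_component_singleton])
  \<comment> \<open>A bound for the mean of the denominator given component \<open>k\<close>: one
    \<open>d\<close> covers \<open>r\<close>, another covers \<open>D (\<xi> k)\<close>, and the
    remaining components are independent of component \<open>k\<close>.\<close>
  define b where "b = d + d + of_nat (card I - 1) * (\<integral>\<^sup>+p. D p \<partial>\<mu>)"
  have "(\<integral>\<^sup>+p. D p \<partial>\<mu>) \<le> (\<integral>\<^sup>+p. d \<partial>\<mu>)" using Dd by (rule nn_integral_mono_AE)
  also have "\<dots> = d" by (simp add: \<mu>.emeasure_space_1)
  finally have Di: "(\<integral>\<^sup>+p. D p \<partial>\<mu>) < \<infinity>" using d by (simp add: order.strict_trans1)
  have b: "0 < b" "b < \<infinity>"
    using d Di by (auto simp: b_def add_pos_nonneg ennreal_mult_less_top of_nat_less_top)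
  define S where "S \<xi> = r + (\<Sum>k\<in>I. D (\<xi> k))" for \<xi>
  have Sm[measurable]: "S \<in> borel_measurable ?P" unfolding S_def[abs_def] using Dm by measurable
  have one: "(\<integral>\<^sup>+p. A p \<partial>\<mu>) / b \<le> (\<integral>\<^sup>+\<xi>. A (\<xi> k) / S \<xi> \<partial>?P)" if k: "k \<in> I" for k
  proof -
    note [measurable] = Am[OF k]
    have card: "card (I - {k}) = card I - 1" using I k by simp
    have "(\<integral>\<^sup>+\<xi>. A (\<xi> k) * S \<xi> \<partial>?P) \<le> (\<integral>\<^sup>+\<xi>. A (\<xi> k) * (d + d) + (\<Sum>j\<in>I - {k}. A (\<xi> k) * D (\<xi> j)) \<partial>?P)"
    proof (rule nn_integral_mono_AE)
      have "AE \<xi> in ?P. D (\<xi> k) \<le> d" by (rule AE_PiM_component) (use \<mu> k Dd in auto)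
      then show "AE \<xi> in ?P. A (\<xi> k) * S \<xi> \<le> A (\<xi> k) * (d + d) + (\<Sum>j\<in>I - {k}. A (\<xi> k) * D (\<xi> j))"
      proof eventually_elim
        case (elim \<xi>)
        have "S \<xi> = r + (D (\<xi> k) + (\<Sum>j\<in>I - {k}. D (\<xi> j)))"
          unfolding S_def using I k by (subst sum.remove[of I k]) auto
        also have "\<dots> \<le> d + d + (\<Sum>j\<in>I - {k}. D (\<xi> j))"
          using d elim by (simp add: add.assoc[symmetric] add_mono)
        finally have "A (\<xi> k) * S \<xi> \<le> A (\<xi> k) * (d + d + (\<Sum>j\<in>I - {k}. D (\<xi> j)))" by (rule mult_left_mono) simp
        then show ?case by (simp add: distrib_left sum_distrib_left)
      qed
    qed
    also have "\<dots> = (\<integral>\<^sup>+\<xi>. A (\<xi> k) * (d + d) \<partial>?P) + (\<Sum>j\<in>I - {k}. \<integral>\<^sup>+\<xi>. A (\<xi> k) * D (\<xi> j) \<partial>?P)"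
      using Am[OF k] Dm by (subst nn_integral_add) (auto intro!: nn_integral_sum)
    also have "(\<integral>\<^sup>+\<xi>. A (\<xi> k) * (d + d) \<partial>?P) = (\<integral>\<^sup>+p. A p \<partial>\<mu>) * (d + d)"
      by (simp add: nn_integral_multc nn_integral_PiM_single[OF \<mu> k A])
    also have "(\<Sum>j\<in>I - {k}. \<integral>\<^sup>+\<xi>. A (\<xi> k) * D (\<xi> j) \<partial>?P) = (\<Sum>j\<in>I - {k}. (\<integral>\<^sup>+p. A p \<partial>\<mu>) * (\<integral>\<^sup>+p. D p \<partial>\<mu>))"
      by (intro sum.cong refl nn_integral_PiM_pair \<mu> A D) (use I k in auto)
    also have "(\<integral>\<^sup>+p. A p \<partial>\<mu>) * (d + d) + \<dots> = (\<integral>\<^sup>+p. A p \<partial>\<mu>) * b"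
      by (simp add: b_def card distrib_left mult.left_commute)
    finally have AS: "(\<integral>\<^sup>+\<xi>. A (\<xi> k) * S \<xi> \<partial>?P) / b / b \<le> (\<integral>\<^sup>+p. A p \<partial>\<mu>) * b / b / b"
      by (intro divide_right_mono_ennreal)
    have "(\<integral>\<^sup>+p. A p \<partial>\<mu>) / b + (\<integral>\<^sup>+p. A p \<partial>\<mu>) / b = (\<integral>\<^sup>+\<xi>. A (\<xi> k) / b + A (\<xi> k) / b \<partial>?P)"
      by (simp add: nn_integral_add nn_integral_divide nn_integral_PiM_single[OF \<mu> k A])
    also have "\<dots> \<le> (\<integral>\<^sup>+\<xi>. A (\<xi> k) / S \<xi> + A (\<xi> k) * S \<xi> / b / b \<partial>?P)"
    proof (rule nn_integral_mono)
      fix \<xi>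
      have "A (\<xi> k) * (1 / b + 1 / b) \<le> A (\<xi> k) * (1 / S \<xi> + S \<xi> / b / b)"
        by (intro mult_left_mono ennreal_amgm b) simp
      then show "A (\<xi> k) / b + A (\<xi> k) / b \<le> A (\<xi> k) / S \<xi> + A (\<xi> k) * S \<xi> / b / b"
        by (simp add: distrib_left ennreal_times_divide)
    qed
    also have "\<dots> = (\<integral>\<^sup>+\<xi>. A (\<xi> k) / S \<xi> \<partial>?P) + (\<integral>\<^sup>+\<xi>. A (\<xi> k) * S \<xi> \<partial>?P) / b / b"
      by (simp add: nn_integral_add nn_integral_divide)
    also have "\<dots> \<le> (\<integral>\<^sup>+\<xi>. A (\<xi> k) / S \<xi> \<partial>?P) + (\<integral>\<^sup>+p. A p \<partial>\<mu>) / b"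
      using AS b by (intro add_mono order_refl) (simp add: mult_divide_eq_ennreal less_top[symmetric])
    finally show ?thesis
      using Af b by (subst (asm) add.commute) (auto simp: ennreal_add_left_cancel_le add.commute ennreal_divide_eq_top_iff less_top[symmetric])
  qed
  have "of_nat (card I) * ((\<integral>\<^sup>+p. A p \<partial>\<mu>) / b) \<le> (\<Sum>k\<in>I. \<integral>\<^sup>+\<xi>. A (\<xi> k) / S \<xi> \<partial>?P)"
    using sum_mono[of I "\<lambda>_. (\<integral>\<^sup>+p. A p \<partial>\<mu>) / b"] one by simp
  also have "\<dots> = (\<integral>\<^sup>+\<xi>. (\<Sum>k\<in>I. A (\<xi> k) / S \<xi>) \<partial>?P)"
    by (rule nn_integral_sum[symmetric]) (rule borel_measurable_divide_ennreal[OF Am Sm])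
  also have "\<dots> = (\<integral>\<^sup>+\<xi>. (\<Sum>k\<in>I. A (\<xi> k)) / S \<xi> \<partial>?P)"
    by (simp add: divide_ennreal_def sum_distrib_right)
  finally show ?thesis unfolding b_def S_def .
qed

section \<open>Backward Feynman-Kac recursions\<close>

context csmc_model
begin

primrec wb :: "(nat \<Rightarrow> (nat \<Rightarrow> 'z) \<Rightarrow> ennreal) \<Rightarrow> ((nat \<Rightarrow> 'z) \<Rightarrow> ennreal) \<Rightarrow> nat \<Rightarrow> (nat \<Rightarrow> 'z) \<Rightarrow> ennreal" where
  "wb w h 0 = (\<lambda>p. w T p * h p)"
| "wb w h (Suc j) = (\<lambda>p. w (T - Suc j) p * (\<integral>\<^sup>+q. wb w h j q \<partial>ext (T - Suc j) p))"

text \<open>The conditional mean, given the path up to time \<open>n\<close>, of \<open>h\<close>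
  times the product of the weights \<open>w\<close> from time \<open>n\<close> on.\<close>

definition "fk w h n = wb w h (T - n)"

lemma fk_T: "fk w h T p = w T p * h p"
  by (simp add: fk_def)

lemma fk_step: "n < T \<Longrightarrow> fk w h n p = w n p * (\<integral>\<^sup>+q. fk w h (Suc n) q \<partial>ext n p)"
proof -
  assume "n < T"
  then obtain j where j: "T - n = Suc j" "T - Suc n = j" "n = T - Suc j" by (metis Suc_diff_Suc diff_diff_cancel less_imp_le_nat)
  then show ?thesis by (simp add: fk_def)
qed

lemma fk_measurable:
  assumes w: "\<And>n. n \<le> T \<Longrightarrow> w n \<in> borel_measurable (E n)" and h: "h \<in> borel_measurable (E T)"
  shows "n \<le> T \<Longrightarrow> fk w h n \<in> borel_measurable (E n)"
proof (induction n rule: inc_induct)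
  case base
  then show ?case unfolding fk_T[abs_def] using w[of T] h by measurable
next
  case (step n)
  have "fk w h n = (\<lambda>p. w n p * (\<integral>\<^sup>+q. fk w h (Suc n) q \<partial>ext n p))" using fk_step[OF step(2)] by auto
  moreover have "w n \<in> borel_measurable (E n)" using w step by simp
  ultimately show ?case using nn_integral_kernel_measurable[OF ext_kernel[OF step(2)] step.IH] by simp
qed

text \<open>The recursion is unrolled forwards in time: weights already applied depend on the past
  only and move out of the next integral.\<close>

lemma fk_0:
  assumes w: "\<And>n. n \<le> T \<Longrightarrow> w n \<in> borel_measurable (E n)" and h: "h \<in> borel_measurable (E T)"
  shows "fk w h 0 (\<lambda>_. undefined) = (\<integral>\<^sup>+x. (\<Prod>s\<le>T. w s (restrict x {1..s})) * h x \<partial>law T)"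
proof -
  have u: "(\<lambda>_. undefined) \<in> space (E 0)" by (simp add: space_PiM)
  have m: "fk w h n \<in> borel_measurable (E n)" if "n \<le> T" for n
    by (rule fk_measurable) (use w h that in auto)
  have W: "(\<lambda>x. \<Prod>s<n. w s (restrict x {1..s})) \<in> borel_measurable (E k)" if "n \<le> Suc k" "n \<le> Suc T" for n k
    by (intro borel_measurable_prod_ennreal measurable_compose[OF restrict_path w]) (use that in auto)
  have "n \<le> T \<Longrightarrow> (\<integral>\<^sup>+x. (\<Prod>s<n. w s (restrict x {1..s})) * fk w h n x \<partial>law n) = fk w h 0 (\<lambda>_. undefined)" for n
  proof (induction n)
    case 0
    show ?case unfolding markov_law.simps(1)
      by (subst nn_integral_return[OF u]) (use m[of 0] in auto)
  next
    case (Suc n)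
    then have n: "n < T" by simp
    note K = prob_kernelD[OF ext_kernel[OF n]]
    have "(\<integral>\<^sup>+x. (\<Prod>s<Suc n. w s (restrict x {1..s})) * fk w h (Suc n) x \<partial>law (Suc n)) =
        (\<integral>\<^sup>+x. \<integral>\<^sup>+y. (\<Prod>s<Suc n. w s (restrict y {1..s})) * fk w h (Suc n) y \<partial>ext n x \<partial>law n)"
      using W[of "Suc n" "Suc n"] m[OF Suc.prems] n by (intro nn_integral_law_Suc) auto
    also have "\<dots> = (\<integral>\<^sup>+x. (\<Prod>s<n. w s (restrict x {1..s})) * fk w h n x \<partial>law n)"
    proof (rule nn_integral_cong)
      fix x assume "x \<in> space (law n)"
      then have x: "x \<in> space (E n)" using law_sets(2)[of n] n by simp
      have "(\<integral>\<^sup>+y. (\<Prod>s<Suc n. w s (restrict y {1..s})) * fk w h (Suc n) y \<partial>ext n x) =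
          (\<integral>\<^sup>+y. (\<Prod>s<Suc n. w s (restrict x {1..s})) * fk w h (Suc n) y \<partial>ext n x)"
      proof (rule ext_cong[OF n x])
        fix z
        have "(\<Prod>s<Suc n. w s (restrict (x(Suc n := z)) {1..s})) = (\<Prod>s<Suc n. w s (restrict x {1..s}))"
          by (intro prod.cong refl) (simp only: lessThan_iff less_Suc_eq_le restrict_upd)
        then show "(\<Prod>s<Suc n. w s (restrict (x(Suc n := z)) {1..s})) * fk w h (Suc n) (x(Suc n := z)) =
          (\<Prod>s<Suc n. w s (restrict x {1..s})) * fk w h (Suc n) (x(Suc n := z))" by simp
      qed (use W[of "Suc n" "Suc n"] m[OF Suc.prems] n in auto)
      also have "\<dots> = (\<Prod>s<Suc n. w s (restrict x {1..s})) * (\<integral>\<^sup>+y. fk w h (Suc n) y \<partial>ext n x)"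
        using m[OF Suc.prems] by (intro nn_integral_cmult) (simp add: measurable_cong_sets[OF K(2)[OF x] refl])
      also have "\<dots> = (\<Prod>s<n. w s (restrict x {1..s})) * fk w h n x"
        by (simp add: fk_step[OF n] restrict_self[OF x] mult.assoc)
      finally show "(\<integral>\<^sup>+y. (\<Prod>s<Suc n. w s (restrict y {1..s})) * fk w h (Suc n) y \<partial>ext n x) = (\<Prod>s<n. w s (restrict x {1..s})) * fk w h n x" .
    qed
    also have "\<dots> = fk w h 0 (\<lambda>_. undefined)" using n by (intro Suc.IH) simp
    finally show ?case .
  qed
  from this[OF order_refl] have "fk w h 0 (\<lambda>_. undefined) = (\<integral>\<^sup>+x. (\<Prod>s<T. w s (restrict x {1..s})) * fk w h T x \<partial>law T)" ..
  also have "\<dots> = (\<integral>\<^sup>+x. (\<Prod>s\<le>T. w s (restrict x {1..s})) * h x \<partial>law T)"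
  proof (rule nn_integral_cong)
    fix x assume "x \<in> space (law T)"
    then have "restrict x {1..T} = x" using law_sets(2)[OF order_refl] by (simp add: restrict_self)
    then show "(\<Prod>s<T. w s (restrict x {1..s})) * fk w h T x = (\<Prod>s\<le>T. w s (restrict x {1..s})) * h x"
      by (simp add: fk_T lessThan_Suc_atMost[symmetric] mult.assoc)
  qed
  finally show ?thesis .
qed

lemma prod_pot:
  assumes x: "x \<in> space (E T)"
  shows "n \<le> Suc T \<Longrightarrow> (\<Prod>s<n. ennreal (pot s (restrict x {1..s}))) = ennreal (weight n x)"
proof (induction n)
  case (Suc n)
  have p: "pot n (restrict x {1..n}) = pot n x" by (auto simp: pot_def)
  have "0 \<le> weight n x" using weight_nonneg[of n x T] x Suc by simp
  then show ?case using Suc.IH Suc.prems unfolding prod.lessThan_Suc p weight_Suc by (simp only: Suc_leD ennreal_mult')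
qed (simp add: weight_def)

text \<open>This serves two families of weights: the potentials themselves, and rescaled potentials
  truncated at a bound. \<open>Q\<close> is the event on which the truncation is inactive, and
  \<open>c\<close> collects the scaling.\<close>

lemma fk_target:
  assumes w: "\<And>n. n \<le> T \<Longrightarrow> w n \<in> borel_measurable (E n)" and h: "h \<in> borel_measurable (E T)"
    and ae: "AE x in tgt. Q x" "Measurable.pred (E T) Q"
    and eq: "\<And>x. x \<in> space (E T) \<Longrightarrow> (\<Prod>s\<le>T. w s (restrict x {1..s})) = c * (if Q x then ennreal (weight (Suc T) x) else 0)"
  shows "fk w h 0 (\<lambda>_. undefined) = c * gam * (\<integral>\<^sup>+x. h x \<partial>tgt)"
proof -
  note [measurable] = ae(2) h weight_measurable[of "Suc T" T, OF order_refl order_refl]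
  note s = measurable_cong_sets[OF law_sets(1)[OF order_refl] refl]
  have "fk w h 0 (\<lambda>_. undefined) = (\<integral>\<^sup>+x. c * (ennreal (weight (Suc T) x) * (if Q x then h x else 0)) \<partial>law T)"
    by (subst fk_0) (use w h in \<open>auto intro!: nn_integral_cong simp: eq law_sets(2) mult.assoc\<close>)
  also have "\<dots> = c * (\<integral>\<^sup>+x. ennreal (weight (Suc T) x) * (if Q x then h x else 0) \<partial>law T)"
    by (rule nn_integral_cmult) (unfold s, measurable)
  also have "(\<integral>\<^sup>+x. ennreal (weight (Suc T) x) * (if Q x then h x else 0) \<partial>law T) = gam * (\<integral>\<^sup>+x. (if Q x then h x else 0) \<partial>tgt)"
    using gam_nz by (subst nn_integral_pi) (measurable, simp add: ennreal_mult_divide_eq ennreal_times_divide mult.commute[of gam])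
  also have "(\<integral>\<^sup>+x. (if Q x then h x else 0) \<partial>tgt) = (\<integral>\<^sup>+x. h x \<partial>tgt)"
    using ae(1) by (intro nn_integral_cong_AE) auto
  finally show ?thesis by (simp add: mult.assoc)
qed

end

lemma prod_mono_ennreal: "(\<And>i. i \<in> I \<Longrightarrow> f i \<le> g i) \<Longrightarrow> (\<Prod>i\<in>I. f i) \<le> (\<Prod>i\<in>I. g i :: ennreal)"
  by (induction I rule: infinite_finite_induct) (auto intro!: mult_mono)

section \<open>A minorisation from independent free particles\<close>

context csmc_model
begin

lemma sel_prob_ge:
  assumes n: "n \<le> T" and \<zeta>: "\<zeta> \<in> space (S n)" and c: "\<And>k. k \<in> {1..N} \<Longrightarrow> pot n (\<zeta> k) \<le> c"
    and j: "j \<in> {1..N}"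
  shows "ennreal (pot n (\<zeta> j) / (real N * c)) \<le> selp n \<zeta> j"
proof (cases "wsum n \<zeta> = 0")
  case True
  then show ?thesis using pot_zero[OF n \<zeta> True j] by simp
next
  case False
  then have pos: "0 < wsum n \<zeta>" using wsum_nonneg[OF n \<zeta>] by simp
  have "wsum n \<zeta> \<le> real N * c" using sum_mono[of "{1..N}" "\<lambda>k. pot n (\<zeta> k)" "\<lambda>_. c"] c by simp
  then have "pot n (\<zeta> j) / (real N * c) \<le> pot n (\<zeta> j) / wsum n \<zeta>"
    using pos pot_nonneg[OF n sys_component[OF \<zeta> j]] by (intro divide_left_mono) auto
  then show ?thesis using False by (simp add: sel_prob_def ennreal_leI)
qed

text \<open>On the event that every free particle keeps itself as its parent and keeps its potential
  below \<open>c\<close>, the free particles are independent copies of the Markov chain.\<close>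

lemma crude_minorisation:
  assumes N: "2 \<le> N" and x: "x \<in> space (E T)" and c: "1 \<le> c"
    and xc: "\<And>t. t \<in> {1..T} \<Longrightarrow> G t (x t) \<le> c"
    and ae: "AE y in tgt. \<forall>t\<in>{1..T}. G t (y t) \<le> c"
    and h: "h \<in> borel_measurable (E T)" "\<And>y. h y \<le> 1"
  shows "(ennreal (1 / (real N * c)) ^ Suc T * gam) ^ (N - 1) * (\<integral>\<^sup>+y. h y \<partial>tgt) \<le> (\<integral>\<^sup>+y. h y \<partial>PN x)"
proof -
  interpret prob_space tgt by (rule prob_pi)
  \<comment> \<open>As long as all potentials are at most \<open>c\<close>, the total weight is at
    most \<open>N * c\<close>, so \<open>w n\<close> bounds the probability that a particle selects
    itself as parent from below.\<close>
  define w where "w n p = (if pot n p \<le> c then ennreal (pot n p / (real N * c)) else 0)" for n p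
  have w: "w n \<in> borel_measurable (E n)" if "n \<le> T" for n
  proof -
    have [measurable]: "pot n \<in> borel_measurable (E n)" by (rule pot_measurable[OF that])
    show ?thesis unfolding w_def[abs_def] by measurable
  qed
  have Nc: "0 < real N * c" "c \<le> real N * c" using N c by auto
  have rx: "pot n (restrict x {1..n}) \<le> c" if "n \<le> T" for n using xc[of n] c that by (auto simp: pot_def)
  \<comment> \<open>Particle 2 is the one finally selected and carries \<open>h\<close>; the others
    only have to take part in the event.\<close>
  define hh where "hh j = (if j = 2 then h else (\<lambda>_. 1))" for j :: nat
  have hh: "hh j \<in> borel_measurable (E T)" for j using h by (simp add: hh_def)
  have fm: "fk w (hh j) n \<in> borel_measurable (E n)" if "n \<le> T" for j n
    by (rule fk_measurable) (use w hh that in auto)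
  define L where "L n \<zeta> = (\<Prod>j\<in>{2..N}. fk w (hh j) n (\<zeta> j))" for n \<zeta>
  have Lm: "L n \<in> borel_measurable (S n)" if "n \<le> T" for n
    unfolding L_def[abs_def] by (intro borel_measurable_prod_ennreal measurable_compose[OF component_measurable fm]) (use that in auto)
  have L0: "L n \<zeta> = 0" if "n \<le> T" "j \<in> {2..N}" "\<not> pot n (\<zeta> j) \<le> c" for n j \<zeta>
  proof -
    have "fk w (hh j) n (\<zeta> j) = 0" using that fk_step[of n w "hh j"] fk_T[of w "hh j"] by (cases "n = T") (auto simp: w_def)
    then show ?thesis unfolding L_def using that by (intro prod_zero) auto
  qed
  have claim: "(\<integral>\<^sup>+\<zeta>. L n \<zeta> \<partial>psys x n) \<le> (\<integral>\<^sup>+y. h y \<partial>PN x)" if "n \<le> T" for n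
    using that
  proof (induction n rule: inc_induct)
    case base
    show ?case unfolding nn_integral_icsmc[OF x h(1)]
    proof (rule psys_nn_mono[OF order_refl order_refl x Lm[OF order_refl] out_nn_measurable[OF h(1)]])
      fix \<zeta> assume \<zeta>: "\<zeta> \<in> space (S T)" "\<zeta> 1 = restrict x {1..T}"
      show "L T \<zeta> \<le> (\<integral>\<^sup>+y. h y \<partial>out \<zeta>)"
      proof (cases "\<forall>j\<in>{2..N}. pot T (\<zeta> j) \<le> c")
        case True
        then have cc: "pot T (\<zeta> k) \<le> c" if "k \<in> {1..N}" for k
          using rx[OF order_refl] \<zeta>(2) that by (cases "k = 1") auto
        have r: "{2..N} = insert 2 {3..N}" using N by auto
        have "L T \<zeta> = w T (\<zeta> 2) * h (\<zeta> 2) * (\<Prod>j\<in>{3..N}. w T (\<zeta> j))"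
          unfolding L_def r by (subst prod.insert) (auto simp: fk_T hh_def)
        \<comment> \<open>At time \<open>T\<close> only particle 2 needs a selection; the surplus
          factors of the other particles are at most 1.\<close>
        also have "\<dots> \<le> w T (\<zeta> 2) * h (\<zeta> 2) * 1"
        proof (rule mult_left_mono)
          have "(\<Prod>j\<in>{3..N}. w T (\<zeta> j)) \<le> (\<Prod>j\<in>{3..N}. 1)"
          proof (rule prod_mono_ennreal)
            fix j assume "j \<in> {3..N}"
            then have "pot T (\<zeta> j) \<le> real N * c" using cc[of j] Nc by simp
            then have "pot T (\<zeta> j) / (real N * c) \<le> 1" using Nc by simp
            then show "w T (\<zeta> j) \<le> 1" by (auto simp: w_def simp del: divide_le_eq_1_pos)
          qed
          then show "(\<Prod>j\<in>{3..N}. w T (\<zeta> j)) \<le> 1" by simp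
        qed simp
        also have "\<dots> \<le> selp T \<zeta> 2 * h (\<zeta> 2)"
          using sel_prob_ge[OF order_refl \<zeta>(1) cc, of 2] cc[of 2] N by (simp add: w_def mult_right_mono)
        also have "\<dots> \<le> (\<Sum>k\<in>{1..N}. selp T \<zeta> k * h (\<zeta> k))"
          using N by (intro member_le_sum[of 2 _ "\<lambda>k. selp T \<zeta> k * h (\<zeta> k)"]) auto
        finally show ?thesis by (simp add: nn_integral_out[OF \<zeta>(1) h(1)])
      next
        case False
        then obtain j where "j \<in> {2..N}" "\<not> pot T (\<zeta> j) \<le> c" by blast
        then show ?thesis using L0[OF order_refl] by simp
      qed
    qed
  next
    case (step n)
    then have n: "n < T" "n \<le> T" "Suc n \<le> T" by auto
    have km: "(\<lambda>\<zeta>. \<integral>\<^sup>+\<zeta>'. L (Suc n) \<zeta>' \<partial>cstep x n \<zeta>) \<in> borel_measurable (S n)"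
      by (rule nn_integral_kernel_measurable[OF cstep_kernel[OF n(1) order_refl x] Lm[OF n(3)]])
    have "(\<integral>\<^sup>+\<zeta>. L n \<zeta> \<partial>psys x n) \<le> (\<integral>\<^sup>+\<zeta>. \<integral>\<^sup>+\<zeta>'. L (Suc n) \<zeta>' \<partial>cstep x n \<zeta> \<partial>psys x n)"
    proof (rule psys_nn_mono[OF n(2) order_refl x Lm[OF n(2)] km])
      fix \<zeta> assume \<zeta>: "\<zeta> \<in> space (S n)" "\<zeta> 1 = restrict x {1..n}"
      note mp = mut_prob[OF n(1) \<zeta>(1)]
      show "L n \<zeta> \<le> (\<integral>\<^sup>+\<zeta>'. L (Suc n) \<zeta>' \<partial>cstep x n \<zeta>)"
      proof (cases "\<forall>j\<in>{2..N}. pot n (\<zeta> j) \<le> c")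
        case True
        then have cc: "pot n (\<zeta> k) \<le> c" if "k \<in> {1..N}" for k
          using rx[OF n(2)] \<zeta>(2) that by (cases "k = 1") auto
        interpret product_prob_space "\<lambda>_. mut n \<zeta>" by (rule product_prob_space_const[OF mp(1)])
        have "L n \<zeta> \<le> (\<Prod>j\<in>{2..N}. \<integral>\<^sup>+p. fk w (hh j) (Suc n) p \<partial>mut n \<zeta>)"
          unfolding L_def
        proof (rule prod_mono_ennreal)
          fix j assume j: "j \<in> {2..N}"
          then have j1: "j \<in> {1..N}" by simp
          have "fk w (hh j) n (\<zeta> j) \<le> selp n \<zeta> j * (\<integral>\<^sup>+p. fk w (hh j) (Suc n) p \<partial>ext n (\<zeta> j))"
            using sel_prob_ge[OF n(2) \<zeta>(1) cc j1] cc[OF j1] by (simp add: fk_step[OF n(1)] w_def mult_right_mono)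
          also have "\<dots> \<le> (\<Sum>k\<in>{1..N}. selp n \<zeta> k * (\<integral>\<^sup>+p. fk w (hh j) (Suc n) p \<partial>ext n (\<zeta> k)))"
            using j1 by (intro member_le_sum[of j _ "\<lambda>k. selp n \<zeta> k * (\<integral>\<^sup>+p. fk w (hh j) (Suc n) p \<partial>ext n (\<zeta> k))"]) auto
          also have "\<dots> = (\<integral>\<^sup>+p. fk w (hh j) (Suc n) p \<partial>mut n \<zeta>)" by (rule nn_integral_mut[OF n(1) \<zeta>(1) fm[OF n(3)], symmetric])
          finally show "fk w (hh j) n (\<zeta> j) \<le> (\<integral>\<^sup>+p. fk w (hh j) (Suc n) p \<partial>mut n \<zeta>)" .
        qed
        also have "\<dots> = (\<integral>\<^sup>+\<xi>. (\<Prod>j\<in>{2..N}. fk w (hh j) (Suc n) (\<xi> j)) \<partial>PiM {2..N} (\<lambda>_. mut n \<zeta>))"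
          using fm[OF n(3)] by (intro product_nn_integral_prod[symmetric]) (auto simp: measurable_cong_sets[OF mp(2) refl])
        also have "\<dots> = (\<integral>\<^sup>+\<zeta>'. L (Suc n) \<zeta>' \<partial>cstep x n \<zeta>)"
          by (subst nn_integral_cstep[OF n(1) order_refl x \<zeta>(1) Lm[OF n(3)]])
            (auto simp: L_def intro!: nn_integral_cong prod.cong)
        finally show ?thesis .
      next
        case False
        then obtain j where "j \<in> {2..N}" "\<not> pot n (\<zeta> j) \<le> c" by blast
        then show ?thesis using L0[OF n(2)] by simp
      qed
    qed
    also have "\<dots> = (\<integral>\<^sup>+\<zeta>. L (Suc n) \<zeta> \<partial>psys x (Suc n))"
      by (rule nn_integral_psys_Suc[OF n(1) order_refl x Lm[OF n(3)], symmetric])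
    also have "\<dots> \<le> (\<integral>\<^sup>+y. h y \<partial>PN x)" by (rule step.IH)
    finally show ?case .
  qed
  define Q where "Q y \<longleftrightarrow> (\<forall>t\<in>{1..T}. G t (y t) \<le> c)" for y
  have Q: "Measurable.pred (E T) Q"
  proof -
    have [measurable]: "(\<lambda>y. G t (y t)) \<in> borel_measurable (E T)" if "t \<in> {1..T}" for t
      by (rule measurable_compose[OF measurable_component_singleton[OF that] G_measurable[OF that]])
    show ?thesis unfolding Q_def[abs_def] by measurable
  qed
  have prodw: "(\<Prod>s\<le>T. w s (restrict y {1..s})) = ennreal (1 / (real N * c)) ^ Suc T * (if Q y then ennreal (weight (Suc T) y) else 0)"
    if y: "y \<in> space (E T)" for y
  proof (cases "Q y")
    case True
    have "(\<Prod>s\<le>T. w s (restrict y {1..s})) = (\<Prod>s\<le>T. ennreal (1 / (real N * c)) * ennreal (pot s (restrict y {1..s})))"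
    proof (rule prod.cong[OF refl])
      fix s assume s: "s \<in> {..T}"
      have "pot s (restrict y {1..s}) \<le> c" using True s c by (auto simp: Q_def pot_def)
      moreover have "0 \<le> pot s (restrict y {1..s})" using s by (intro pot_nonneg restrict_in[OF y]) auto
      ultimately show "w s (restrict y {1..s}) = ennreal (1 / (real N * c)) * ennreal (pot s (restrict y {1..s}))"
        using Nc by (simp add: w_def flip: ennreal_mult)
    qed
    also have "\<dots> = ennreal (1 / (real N * c)) ^ Suc T * (\<Prod>s\<le>T. ennreal (pot s (restrict y {1..s})))"
      by (simp only: prod.distrib prod_constant card_atMost)
    also have "(\<Prod>s\<le>T. ennreal (pot s (restrict y {1..s}))) = ennreal (weight (Suc T) y)"
      using prod_pot[OF y order_refl] by (simp add: lessThan_Suc_atMost)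
    finally show ?thesis using True by (simp only: if_True)
  next
    case False
    then obtain s where s: "s \<in> {1..T}" "\<not> G s (y s) \<le> c" by (auto simp: Q_def)
    then have "w s (restrict y {1..s}) = 0" by (simp add: w_def pot_def)
    then have "(\<Prod>s\<le>T. w s (restrict y {1..s})) = 0" using s by (intro prod_zero) auto
    then show ?thesis using False by simp
  qed
  have f0: "fk w (hh j) 0 (\<lambda>_. undefined) = ennreal (1 / (real N * c)) ^ Suc T * gam * (\<integral>\<^sup>+y. hh j y \<partial>tgt)" for j
    by (rule fk_target) (use w hh ae Q prodw in \<open>auto simp: Q_def[abs_def]\<close>)
  have r: "{2..N} = insert 2 {3..N}" using N by auto
  have "L 0 sys0 = (\<Prod>j\<in>{2..N}. fk w (hh j) 0 (\<lambda>_. undefined))"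
    unfolding L_def by (intro prod.cong) (auto simp: sys0_def)
  also have "\<dots> = (ennreal (1 / (real N * c)) ^ Suc T * gam) ^ (N - 1) * (\<Prod>j\<in>{2..N}. \<integral>\<^sup>+y. hh j y \<partial>tgt)"
    by (simp only: f0 prod.distrib prod_constant card_atLeastAtMost numeral_2_eq_2 diff_Suc_Suc One_nat_def power_mult_distrib)
  also have "(\<Prod>j\<in>{2..N}. \<integral>\<^sup>+y. hh j y \<partial>tgt) = (\<integral>\<^sup>+y. h y \<partial>tgt)"
    unfolding r by (subst prod.insert) (auto simp: hh_def emeasure_space_1 intro!: prod.neutral)
  finally have "L 0 sys0 = (ennreal (1 / (real N * c)) ^ Suc T * gam) ^ (N - 1) * (\<integral>\<^sup>+y. h y \<partial>tgt)" .
  moreover have "(\<integral>\<^sup>+\<zeta>. L 0 \<zeta> \<partial>psys x 0) = L 0 sys0" unfolding psys.simps by (rule nn_integral_return[OF sys0_in Lm]) simp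
  ultimately show ?thesis using claim[of 0] by simp
qed

end

lemma ennreal_divide_cancel: "b \<noteq> 0 \<Longrightarrow> b \<noteq> \<infinity> \<Longrightarrow> a / b * b = (a :: ennreal)"
  by (simp add: ennreal_divide_times ennreal_divide_self less_top)

section \<open>Tame paths and the ratio of backward recursions\<close>

context csmc_model
begin

definition above :: "real \<Rightarrow> nat \<Rightarrow> (nat \<Rightarrow> 'z) \<Rightarrow> ennreal" where
  "above c t = indicator {p \<in> space (E t). c < pot t p}"

text \<open>The potential at time \<open>n\<close> and those of almost every continuation under the
  chain are at most \<open>c\<close>. This turns an essential bound under the chain into a property
  of single paths that mutation preserves almost surely.\<close>

definition "tame c n p \<longleftrightarrow> (\<forall>s\<in>{n..T}. cond_exp s (above c s) n p = 0)"

lemma above_measurable: "t \<le> T \<Longrightarrow> above c t \<in> borel_measurable (E t)"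
proof -
  assume "t \<le> T"
  then have [measurable]: "pot t \<in> borel_measurable (E t)" by (rule pot_measurable)
  show ?thesis unfolding above_def by measurable
qed

lemma tame_measurable: "n \<le> T \<Longrightarrow> Measurable.pred (E n) (tame c n)"
proof -
  assume "n \<le> T"
  then have [measurable]: "cond_exp s (above c s) n \<in> borel_measurable (E n)" if "s \<in> {n..T}" for s
    using that by (intro cond_exp_measurable above_measurable) auto
  show ?thesis unfolding tame_def[abs_def] by measurable
qed

lemma tame_pot: "n \<le> T \<Longrightarrow> p \<in> space (E n) \<Longrightarrow> tame c n p \<Longrightarrow> pot n p \<le> c"
  unfolding tame_def by (drule bspec[of _ _ n]) (auto simp: cond_exp_self above_def indicator_def split: if_splits)

lemma tame_ext:
  assumes n: "n < T" and p: "p \<in> space (E n)" and g: "tame c n p"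
  shows "AE q in ext n p. tame c (Suc n) q"
proof -
  have "AE q in ext n p. cond_exp s (above c s) (Suc n) q = 0" if s: "s \<in> {Suc n..T}" for s
  proof -
    have "cond_exp s (above c s) (Suc n) \<in> borel_measurable (E (Suc n))"
      using s by (intro cond_exp_measurable above_measurable) auto
    moreover have "(\<integral>\<^sup>+q. cond_exp s (above c s) (Suc n) q \<partial>ext n p) = 0"
      using g s cond_exp_step[of n s "above c s" p] by (auto simp: tame_def)
    ultimately show ?thesis
      by (subst (asm) nn_integral_0_iff_AE) (simp_all add: measurable_cong_sets[OF prob_kernelD(2)[OF ext_kernel[OF n] p] refl])
  qed
  then show ?thesis unfolding tame_def by (intro eventually_ball_finite) auto
qed

lemma tame_mut:
  assumes n: "n < T" and \<zeta>: "\<zeta> \<in> space (S n)" and g: "\<And>k. k \<in> {1..N} \<Longrightarrow> tame c n (\<zeta> k)"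
  shows "AE q in mut n \<zeta>. tame c (Suc n) q"
proof -
  have m: "Measurable.pred (E (Suc n)) (tame c (Suc n))" using n by (intro tame_measurable) simp
  then have [measurable]: "Measurable.pred (E (Suc n)) (\<lambda>q. \<not> tame c (Suc n) q)" by simp
  define f :: "_ \<Rightarrow> ennreal" where "f q = (if tame c (Suc n) q then 0 else 1)" for q
  have f: "f \<in> borel_measurable (E (Suc n))" unfolding f_def[abs_def] using m by measurable
  have "(\<integral>\<^sup>+q. f q \<partial>ext n (\<zeta> k)) = 0" if k: "k \<in> {1..N}" for k
  proof -
    have "(\<integral>\<^sup>+q. f q \<partial>ext n (\<zeta> k)) = (\<integral>\<^sup>+q. 0 \<partial>ext n (\<zeta> k))"
      by (rule nn_integral_cong_AE) (use tame_ext[OF n sys_component[OF \<zeta> k] g[OF k]] in \<open>auto simp: f_def\<close>)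
    then show ?thesis by simp
  qed
  then have "(\<integral>\<^sup>+q. f q \<partial>mut n \<zeta>) = 0" by (simp add: nn_integral_mut[OF n \<zeta> f])
  then have "AE q in mut n \<zeta>. f q = 0"
    using f by (subst (asm) nn_integral_0_iff_AE) (simp_all add: measurable_cong_sets[OF mut_prob(2)[OF n \<zeta>] refl])
  then show ?thesis by (auto simp: f_def split: if_splits)
qed

text \<open>With \<open>u = fk pot 1\<close> and \<open>a = fk pot h\<close>, the ratio of the sums of \<open>(N - 1) ^ (T - n) * a\<close> and of
  \<open>N ^ (T - n) * u + dconst (T - n)\<close> over the particles at time \<open>n\<close> is a submartingale as long as all
  particles are tame.\<close>

definition "dconst c j = (2 ^ Suc j - 2) * c * (c * real N) ^ j / real N"

text \<open>This recursion dictates the form of \<open>dconst\<close>. Multiplied by a potential of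
  at most \<open>c\<close>, the new constant must absorb two copies of the bound on \<open>D\<close>
  (the reference term and the own term in \<open>mean_ratio_ge\<close>) and \<open>N\<close> copies
  of the old constant. \<open>N \<ge> 2\<close> is used to replace \<open>1 / N\<close> by
  1/2.\<close>

lemma dconst_Suc:
  assumes "1 \<le> c" "2 \<le> N"
  shows "c * (2 * (c * (c * real N) ^ j + dconst c j) + real N * dconst c j) \<le> dconst c (Suc j)"
proof -
  have N: "2 \<le> real N" using assms by simp
  define u where "u = c * c * (c * real N) ^ j"
  have u: "0 \<le> u" using assms by (simp add: u_def)
  define y :: real where "y = 2 ^ Suc j - 2"
  have y: "0 \<le> y" using power_increasing[of 1 "Suc j" "2::real"] by (simp add: y_def)
  have "c * dconst c j = y * u / real N" by (simp add: dconst_def y_def u_def)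
  moreover have "c * real N * dconst c j = y * u" using N by (simp add: dconst_def y_def u_def)
  moreover have "dconst c (Suc j) = (2 * y + 2) * u" using N by (simp add: dconst_def y_def u_def)
  moreover have "y * u / real N \<le> y * u / 2" using N y u by (intro divide_left_mono) auto
  moreover have "c * (2 * (c * (c * real N) ^ j + dconst c j) + real N * dconst c j) = 2 * u + 2 * (c * dconst c j) + c * real N * dconst c j"
    by (simp add: u_def algebra_simps)
  moreover have "(2 * y + 2) * u = 2 * (y * u) + 2 * u" by (simp add: algebra_simps)
  ultimately show ?thesis by linarith
qed

text \<open>At time \<open>T\<close> the ratio is the mean of \<open>h\<close> under
  \<open>out\<close>; at time 0 it is the stated bound. The powers of \<open>N - 1\<close> above and
  of \<open>N\<close> below arise because the reference slot is kept in the denominator but its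
  contribution to the numerator is dropped at each step.\<close>

lemma tame_ratio:
  assumes N: "2 \<le> N" and x: "x \<in> space (E T)" and c: "1 \<le> c"
    and xt: "\<And>n. n \<le> T \<Longrightarrow> tame c n (restrict x {1..n})"
    and h: "h \<in> borel_measurable (E T)" "\<And>y. h y \<le> 1"
  shows "of_nat (N - 1) ^ T * gam * (\<integral>\<^sup>+y. h y \<partial>tgt) / (of_nat N ^ T * gam + ennreal (dconst c T)) \<le> (\<integral>\<^sup>+y. h y \<partial>PN x)"
proof -
  interpret prob_space tgt by (rule prob_pi)
  define w where "w n p = ennreal (pot n p)" for n p
  have w: "w n \<in> borel_measurable (E n)" if "n \<le> T" for n
    unfolding w_def[abs_def] using pot_measurable[OF that] by measurable
  have fm: "fk w f n \<in> borel_measurable (E n)" if "n \<le> T" "f \<in> borel_measurable (E T)" for f n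
    by (rule fk_measurable) (use w that in auto)
  define u where "u = fk w (\<lambda>_. 1)"
  define a where "a = fk w h"
  have um: "u n \<in> borel_measurable (E n)" and am: "a n \<in> borel_measurable (E n)" if "n \<le> T" for n
    using fm[OF that] h by (simp_all add: u_def a_def)
  define D where "D n p = of_nat N ^ (T - n) * u n p + ennreal (dconst c (T - n))" for n p
  define A where "A n p = of_nat (N - 1) ^ (T - n) * a n p" for n p
  have Dm: "D n \<in> borel_measurable (E n)" and Am: "A n \<in> borel_measurable (E n)" if "n \<le> T" for n
    unfolding D_def[abs_def] A_def[abs_def] using um[OF that] am[OF that] by measurable
  have dc: "0 \<le> dconst c j" for j
    unfolding dconst_def using c power_increasing[of 1 "Suc j" "2::real"] by (intro divide_nonneg_nonneg mult_nonneg_nonneg) auto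
  have ub: "tame c n p \<Longrightarrow> p \<in> space (E n) \<Longrightarrow> u n p \<le> ennreal (c ^ Suc (T - n)) \<and> a n p \<le> ennreal (c ^ Suc (T - n))" if "n \<le> T" for n p
    using that
  proof (induction n arbitrary: p rule: inc_induct)
    case base
    have "w T p \<le> ennreal c" using tame_pot[OF order_refl base(2,1)] by (simp add: w_def ennreal_leI)
    moreover have "w T p * h p \<le> w T p * 1" using h(2) by (intro mult_left_mono) auto
    ultimately show ?case by (simp add: u_def a_def fk_T)
  next
    case (step n)
    then have n: "n < T" "n \<le> T" by auto
    note K = prob_kernelD[OF ext_kernel[OF n(1)] step.prems(2)]
    interpret e: prob_space "ext n p" by (rule K)
    have "w n p \<le> ennreal c" using tame_pot[OF n(2) step.prems(2,1)] by (simp add: w_def ennreal_leI)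
    moreover have "(\<integral>\<^sup>+q. u (Suc n) q \<partial>ext n p) \<le> ennreal (c ^ Suc (T - Suc n))" "(\<integral>\<^sup>+q. a (Suc n) q \<partial>ext n p) \<le> ennreal (c ^ Suc (T - Suc n))"
    proof -
      have ae: "AE q in ext n p. tame c (Suc n) q \<and> q \<in> space (ext n p)"
        using tame_ext[OF n(1) step.prems(2,1)] by (auto intro: AE_conjI)
      have "(\<integral>\<^sup>+q. u (Suc n) q \<partial>ext n p) \<le> (\<integral>\<^sup>+q. ennreal (c ^ Suc (T - Suc n)) \<partial>ext n p)"
        by (rule nn_integral_mono_AE, use ae in eventually_elim) (use step.IH K(3) in auto)
      then show "(\<integral>\<^sup>+q. u (Suc n) q \<partial>ext n p) \<le> ennreal (c ^ Suc (T - Suc n))" by (simp add: e.emeasure_space_1)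
      have "(\<integral>\<^sup>+q. a (Suc n) q \<partial>ext n p) \<le> (\<integral>\<^sup>+q. ennreal (c ^ Suc (T - Suc n)) \<partial>ext n p)"
        by (rule nn_integral_mono_AE, use ae in eventually_elim) (use step.IH K(3) in auto)
      then show "(\<integral>\<^sup>+q. a (Suc n) q \<partial>ext n p) \<le> ennreal (c ^ Suc (T - Suc n))" by (simp add: e.emeasure_space_1)
    qed
    moreover have "ennreal (c ^ Suc (T - n)) = ennreal c * ennreal (c ^ Suc (T - Suc n))"
    proof -
      have "T - n = Suc (T - Suc n)" using n by simp
      then show ?thesis using c by (simp flip: ennreal_mult)
    qed
    ultimately show ?case unfolding u_def a_def fk_step[OF n(1)] by (auto intro: mult_mono)
  qed
  \<comment> \<open>A bound for \<open>D n\<close> on tame paths, where \<open>u n\<close> is at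
    most \<open>c ^ Suc (T - n)\<close>.\<close>
  define d where "d n = ennreal (c * (c * real N) ^ (T - n) + dconst c (T - n))" for n
  have d: "0 < d n" "d n < \<infinity>" for n using c N dc[of "T - n"] by (auto simp: d_def add_pos_nonneg)
  have Dd: "D n p \<le> d n" if "n \<le> T" "p \<in> space (E n)" "tame c n p" for n p
  proof -
    have "of_nat N ^ (T - n) * u n p \<le> of_nat N ^ (T - n) * ennreal (c ^ Suc (T - n))"
      using ub that by (intro mult_left_mono) auto
    also have "\<dots> = ennreal (c * (c * real N) ^ (T - n))"
      using c by (simp add: ennreal_of_nat_eq_real_of_nat ennreal_power power_mult_distrib mult_ac flip: ennreal_mult)
    finally show ?thesis using c dc by (simp add: D_def d_def add_right_mono ennreal_plus)
  qed
  \<comment> \<open>The value 0 on systems that are not tame makes the submartingale inequality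
    trivial there.\<close>
  define R where "R n \<zeta> = (if \<forall>k\<in>{1..N}. tame c n (\<zeta> k) then (\<Sum>k\<in>{1..N}. A n (\<zeta> k)) / (\<Sum>k\<in>{1..N}. D n (\<zeta> k)) else 0)" for n \<zeta>
  have Rm: "R n \<in> borel_measurable (S n)" if n: "n \<le> T" for n
  proof -
    have [measurable]: "Measurable.pred (S n) (\<lambda>\<zeta>. tame c n (\<zeta> k))" if "k \<in> {1..N}" for k
      by (rule measurable_compose[OF component_measurable[OF that] tame_measurable[OF n]])
    have [measurable]: "(\<lambda>\<zeta>. A n (\<zeta> k)) \<in> borel_measurable (S n)" "(\<lambda>\<zeta>. D n (\<zeta> k)) \<in> borel_measurable (S n)" if "k \<in> {1..N}" for k
      using measurable_compose[OF component_measurable[OF that] Am[OF n]] measurable_compose[OF component_measurable[OF that] Dm[OF n]] by auto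
    show ?thesis unfolding R_def[abs_def] by measurable
  qed
  have claim: "(\<integral>\<^sup>+\<zeta>. R n \<zeta> \<partial>psys x n) \<le> (\<integral>\<^sup>+y. h y \<partial>PN x)" if "n \<le> T" for n
    using that
  proof (induction n rule: inc_induct)
    case base
    show ?case unfolding nn_integral_icsmc[OF x h(1)]
    proof (rule nn_integral_mono)
      fix \<zeta> assume "\<zeta> \<in> space (psys x T)"
      then have \<zeta>: "\<zeta> \<in> space (S T)" using psys_prob(3)[OF order_refl order_refl x] by simp
      have "(\<Sum>k\<in>{1..N}. A T (\<zeta> k)) = ennreal (wsum T \<zeta>) * (\<integral>\<^sup>+p. h p \<partial>out \<zeta>)"
        unfolding weighted_out[OF \<zeta> h(1), symmetric] by (simp add: A_def a_def fk_T w_def)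
      moreover have "(\<Sum>k\<in>{1..N}. D T (\<zeta> k)) = ennreal (wsum T \<zeta>)"
      proof -
        have "(\<Sum>k\<in>{1..N}. D T (\<zeta> k)) = (\<Sum>k\<in>{1..N}. ennreal (pot T (\<zeta> k)))"
          by (simp add: D_def u_def fk_T w_def dconst_def)
        also have "\<dots> = ennreal (wsum T \<zeta>)" by (rule sum_ennreal) (rule pot_nonneg[OF order_refl sys_component[OF \<zeta>]])
        finally show ?thesis .
      qed
      ultimately show "R T \<zeta> \<le> (\<integral>\<^sup>+p. h p \<partial>out \<zeta>)"
        unfolding R_def by (auto intro!: ennreal_divide_leI simp: mult.commute)
    qed
  next
    case (step n)
    then have n: "n < T" "n \<le> T" "Suc n \<le> T" by auto
    have km: "(\<lambda>\<zeta>. \<integral>\<^sup>+\<zeta>'. R (Suc n) \<zeta>' \<partial>cstep x n \<zeta>) \<in> borel_measurable (S n)"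
      by (rule nn_integral_kernel_measurable[OF cstep_kernel[OF n(1) order_refl x] Rm[OF n(3)]])
    have "(\<integral>\<^sup>+\<zeta>. R n \<zeta> \<partial>psys x n) \<le> (\<integral>\<^sup>+\<zeta>. \<integral>\<^sup>+\<zeta>'. R (Suc n) \<zeta>' \<partial>cstep x n \<zeta> \<partial>psys x n)"
    proof (rule nn_integral_mono)
      fix \<zeta> assume "\<zeta> \<in> space (psys x n)"
      then have \<zeta>: "\<zeta> \<in> space (S n)" using psys_prob(3)[OF n(2) order_refl x] by simp
      note mp = mut_prob[OF n(1) \<zeta>]
      interpret mu: prob_space "mut n \<zeta>" by (rule mp)
      show "R n \<zeta> \<le> (\<integral>\<^sup>+\<zeta>'. R (Suc n) \<zeta>' \<partial>cstep x n \<zeta>)"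
      proof (cases "\<forall>k\<in>{1..N}. tame c n (\<zeta> k)")
        case True
        let ?q = "restrict x {1..Suc n}"
        have q: "?q \<in> space (E (Suc n))" using x n by (intro restrict_in) auto
        have tm: "AE p in mut n \<zeta>. tame c (Suc n) p \<and> p \<in> space (mut n \<zeta>)"
          using tame_mut[OF n(1) \<zeta>] True by (auto intro: AE_conjI)
        have Dae: "AE p in mut n \<zeta>. D (Suc n) p \<le> d (Suc n)"
          using tm by eventually_elim (use Dd[OF n(3)] mp(3) in auto)
        have mm: "A (Suc n) \<in> borel_measurable (mut n \<zeta>)" "D (Suc n) \<in> borel_measurable (mut n \<zeta>)"
          using Am[OF n(3)] Dm[OF n(3)] by (simp_all add: measurable_cong_sets[OF mp(2) refl])
        have Afin: "(\<integral>\<^sup>+p. A (Suc n) p \<partial>mut n \<zeta>) < \<infinity>"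
        proof -
          have "(\<integral>\<^sup>+p. A (Suc n) p \<partial>mut n \<zeta>) \<le> (\<integral>\<^sup>+p. of_nat (N - 1) ^ (T - Suc n) * ennreal (c ^ Suc (T - Suc n)) \<partial>mut n \<zeta>)"
            unfolding A_def by (rule nn_integral_mono_AE, use tm in eventually_elim) (use ub[OF n(3)] mp(3) in \<open>auto intro!: mult_left_mono\<close>)
          also have "\<dots> < \<infinity>" by (simp add: mu.emeasure_space_1 ennreal_mult_less_top power_less_top_ennreal of_nat_less_top)
          finally show ?thesis .
        qed
        have cI: "card {2..N} = N - 1" "card {2..N} - 1 = N - 2" using N by auto
        let ?b = "d (Suc n) + d (Suc n) + of_nat (N - 2) * (\<integral>\<^sup>+p. D (Suc n) p \<partial>mut n \<zeta>)"
        have "of_nat (N - 1) * ((\<integral>\<^sup>+p. A (Suc n) p \<partial>mut n \<zeta>) / ?b) \<le>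
            (\<integral>\<^sup>+\<xi>. (\<Sum>k\<in>{2..N}. A (Suc n) (\<xi> k)) / (D (Suc n) ?q + (\<Sum>k\<in>{2..N}. D (Suc n) (\<xi> k))) \<partial>PiM {2..N} (\<lambda>_. mut n \<zeta>))"
          using mean_ratio_ge[OF mp(1) _ _ mm d _ Dae Afin, of "{2..N}" "D (Suc n) ?q"] Dd[OF n(3) q xt[OF n(3)]] N
          unfolding cI by simp
        also have "\<dots> \<le> (\<integral>\<^sup>+\<xi>. R (Suc n) (\<xi>(1 := ?q)) \<partial>PiM {2..N} (\<lambda>_. mut n \<zeta>))"
        proof (rule nn_integral_mono_AE)
          have "AE \<xi> in PiM {2..N} (\<lambda>_. mut n \<zeta>). \<forall>k\<in>{2..N}. tame c (Suc n) (\<xi> k)"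
            using tame_mut[OF n(1) \<zeta>] True mp(1) by (intro eventually_ball_finite ballI AE_PiM_component) auto
          then show "AE \<xi> in PiM {2..N} (\<lambda>_. mut n \<zeta>). (\<Sum>k\<in>{2..N}. A (Suc n) (\<xi> k)) / (D (Suc n) ?q + (\<Sum>k\<in>{2..N}. D (Suc n) (\<xi> k))) \<le> R (Suc n) (\<xi>(1 := ?q))"
          proof eventually_elim
            case (elim \<xi>)
            have "(\<Sum>k\<in>{1..N}. f ((\<xi>(1 := ?q)) k)) = f ?q + (\<Sum>k\<in>{2..N}. f (\<xi> k))" for f :: "_ \<Rightarrow> ennreal"
            proof -
              have "(\<Sum>k\<in>{2..N}. f ((\<xi>(1 := ?q)) k)) = (\<Sum>k\<in>{2..N}. f (\<xi> k))" by (intro sum.cong) auto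
              then show ?thesis unfolding sum_particles by simp
            qed
            moreover have "\<forall>k\<in>{1..N}. tame c (Suc n) ((\<xi>(1 := ?q)) k)"
              using elim xt[OF n(3)] by (auto simp: insert_particles)
            ultimately show ?case unfolding R_def by (simp add: divide_right_mono_ennreal)
          qed
        qed
        also have "\<dots> = (\<integral>\<^sup>+\<zeta>'. R (Suc n) \<zeta>' \<partial>cstep x n \<zeta>)" by (rule nn_integral_cstep[OF n(1) order_refl x \<zeta> Rm[OF n(3)], symmetric])
        finally have low: "of_nat (N - 1) * ((\<integral>\<^sup>+p. A (Suc n) p \<partial>mut n \<zeta>) / ?b) \<le> (\<integral>\<^sup>+\<zeta>'. R (Suc n) \<zeta>' \<partial>cstep x n \<zeta>)" .
        have s: "T - n = Suc (T - Suc n)" using n by simp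
        have sumA: "(\<Sum>k\<in>{1..N}. A n (\<zeta> k)) = ennreal (wsum n \<zeta>) * (of_nat (N - 1) * (\<integral>\<^sup>+p. A (Suc n) p \<partial>mut n \<zeta>))"
        proof -
          have "A n (\<zeta> k) = of_nat (N - 1) * (ennreal (pot n (\<zeta> k)) * (\<integral>\<^sup>+p. A (Suc n) p \<partial>ext n (\<zeta> k)))" if k: "k \<in> {1..N}" for k
          proof -
            have "(\<integral>\<^sup>+p. A (Suc n) p \<partial>ext n (\<zeta> k)) = of_nat (N - 1) ^ (T - Suc n) * (\<integral>\<^sup>+p. a (Suc n) p \<partial>ext n (\<zeta> k))"
              unfolding A_def using am[OF n(3)]
              by (intro nn_integral_cmult) (simp add: measurable_cong_sets[OF prob_kernelD(2)[OF ext_kernel[OF n(1)] sys_component[OF \<zeta> k]] refl])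
            then show ?thesis unfolding A_def s by (simp add: a_def fk_step[OF n(1)] w_def mult_ac)
          qed
          then have "(\<Sum>k\<in>{1..N}. A n (\<zeta> k)) = of_nat (N - 1) * (\<Sum>k\<in>{1..N}. ennreal (pot n (\<zeta> k)) * (\<integral>\<^sup>+p. A (Suc n) p \<partial>ext n (\<zeta> k)))"
            by (simp add: sum_distrib_left)
          then show ?thesis unfolding weighted_mut[OF n(1) \<zeta> Am[OF n(3)]] by (simp add: mult_ac)
        qed
        \<comment> \<open>\<open>?b\<close> is the denominator supplied by
          \<open>mean_ratio_ge\<close>. Weighted by the potentials, it fits into the sum of
          \<open>D n\<close>, which is what the recursion for \<open>dconst\<close> ensures.\<close>
        have sumD: "ennreal (wsum n \<zeta>) * ?b \<le> (\<Sum>k\<in>{1..N}. D n (\<zeta> k))"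
        proof -
          have one: "ennreal (pot n (\<zeta> k)) * (d (Suc n) + d (Suc n)) + of_nat (N - 2) * (ennreal (pot n (\<zeta> k)) * (\<integral>\<^sup>+p. D (Suc n) p \<partial>ext n (\<zeta> k))) \<le> D n (\<zeta> k)" if k: "k \<in> {1..N}" for k
          proof -
            note \<zeta>k = sys_component[OF \<zeta> k]
            note K = prob_kernelD[OF ext_kernel[OF n(1)] \<zeta>k]
            interpret e: prob_space "ext n (\<zeta> k)" by (rule K)
            have p: "0 \<le> pot n (\<zeta> k)" "pot n (\<zeta> k) \<le> c" using pot_nonneg[OF n(2) \<zeta>k] tame_pot[OF n(2) \<zeta>k] True k by auto
            have D: "(\<integral>\<^sup>+p. D (Suc n) p \<partial>ext n (\<zeta> k)) = of_nat N ^ (T - Suc n) * (\<integral>\<^sup>+p. u (Suc n) p \<partial>ext n (\<zeta> k)) + ennreal (dconst c (T - Suc n))"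
              unfolding D_def using um[OF n(3)]
              by (subst nn_integral_add) (simp_all add: nn_integral_cmult e.emeasure_space_1 measurable_cong_sets[OF K(2) refl])
            have "of_nat (N - 2) * (ennreal (pot n (\<zeta> k)) * (\<integral>\<^sup>+p. D (Suc n) p \<partial>ext n (\<zeta> k))) \<le> of_nat N * (ennreal (pot n (\<zeta> k)) * (\<integral>\<^sup>+p. D (Suc n) p \<partial>ext n (\<zeta> k)))"
              by (intro mult_right_mono of_nat_mono) auto
            also have "\<dots> = of_nat N ^ (T - n) * u n (\<zeta> k) + ennreal (pot n (\<zeta> k)) * (of_nat N * ennreal (dconst c (T - Suc n)))"
              unfolding D s by (simp add: u_def fk_step[OF n(1)] w_def distrib_left mult_ac)
            finally have "ennreal (pot n (\<zeta> k)) * (d (Suc n) + d (Suc n)) + of_nat (N - 2) * (ennreal (pot n (\<zeta> k)) * (\<integral>\<^sup>+p. D (Suc n) p \<partial>ext n (\<zeta> k))) \<le>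
              ennreal (pot n (\<zeta> k)) * (d (Suc n) + d (Suc n)) + (of_nat N ^ (T - n) * u n (\<zeta> k) + ennreal (pot n (\<zeta> k)) * (of_nat N * ennreal (dconst c (T - Suc n))))"
              by (rule add_left_mono)
            also have "\<dots> = of_nat N ^ (T - n) * u n (\<zeta> k) + ennreal (pot n (\<zeta> k)) * (d (Suc n) + d (Suc n) + of_nat N * ennreal (dconst c (T - Suc n)))"
              by (simp add: distrib_left add_ac)
            also have "ennreal (pot n (\<zeta> k)) * (d (Suc n) + d (Suc n) + of_nat N * ennreal (dconst c (T - Suc n))) \<le> ennreal (dconst c (T - n))"
            proof -
              have "d (Suc n) + d (Suc n) + of_nat N * ennreal (dconst c (T - Suc n)) =
                  ennreal (2 * (c * (c * real N) ^ (T - Suc n) + dconst c (T - Suc n)) + real N * dconst c (T - Suc n))" (is "_ = ennreal ?r")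
                using c dc[of "T - Suc n"] by (simp add: d_def ennreal_of_nat_eq_real_of_nat flip: ennreal_plus ennreal_mult)
              moreover have "0 \<le> ?r" using c dc[of "T - Suc n"] by simp
              moreover have "pot n (\<zeta> k) * ?r \<le> c * ?r" using p \<open>0 \<le> ?r\<close> by (intro mult_right_mono)
              moreover have "c * ?r \<le> dconst c (T - n)" unfolding s by (rule dconst_Suc[OF c N])
              ultimately show ?thesis using p by (simp add: ennreal_leI flip: ennreal_mult)
            qed
            finally show ?thesis by (simp add: D_def add_left_mono)
          qed
          have "ennreal (wsum n \<zeta>) = (\<Sum>k\<in>{1..N}. ennreal (pot n (\<zeta> k)))"
            using pot_nonneg[OF n(2) sys_component[OF \<zeta>]] by (intro sum_ennreal[symmetric]) auto
          then have "ennreal (wsum n \<zeta>) * ?b = (\<Sum>k\<in>{1..N}. ennreal (pot n (\<zeta> k)) * (d (Suc n) + d (Suc n)) + of_nat (N - 2) * (ennreal (pot n (\<zeta> k)) * (\<integral>\<^sup>+p. D (Suc n) p \<partial>ext n (\<zeta> k))))"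
            unfolding sum.distrib sum_distrib_left[symmetric] weighted_mut[OF n(1) \<zeta> Dm[OF n(3)]] sum_distrib_right[symmetric]
            by (simp only: sum_distrib_right[symmetric] distrib_left mult_ac)
          also have "\<dots> \<le> (\<Sum>k\<in>{1..N}. D n (\<zeta> k))" by (rule sum_mono) (rule one)
          finally show ?thesis .
        qed
        have b: "?b \<noteq> 0" "?b \<noteq> \<infinity>"
        proof -
          have "(\<integral>\<^sup>+p. D (Suc n) p \<partial>mut n \<zeta>) \<le> (\<integral>\<^sup>+p. d (Suc n) \<partial>mut n \<zeta>)" using Dae by (rule nn_integral_mono_AE)
          then have "(\<integral>\<^sup>+p. D (Suc n) p \<partial>mut n \<zeta>) < \<infinity>" using d by (simp add: mu.emeasure_space_1 order.strict_trans1)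
          then show "?b \<noteq> 0" "?b \<noteq> \<infinity>" using d[of "Suc n"] by (auto simp: ennreal_mult_eq_top_iff)
        qed
        have "R n \<zeta> = (\<Sum>k\<in>{1..N}. A n (\<zeta> k)) / (\<Sum>k\<in>{1..N}. D n (\<zeta> k))" using True by (simp add: R_def)
        also have "\<dots> \<le> of_nat (N - 1) * ((\<integral>\<^sup>+p. A (Suc n) p \<partial>mut n \<zeta>) / ?b)" (is "_ \<le> ?r")
        proof (rule ennreal_divide_leI)
          have "(\<integral>\<^sup>+p. A (Suc n) p \<partial>mut n \<zeta>) / ?b * ?b = (\<integral>\<^sup>+p. A (Suc n) p \<partial>mut n \<zeta>)"
            by (rule ennreal_divide_cancel[OF b])
          moreover have "n * (A / b) * (w * b) = w * (n * (A / b * b))" for n A b w :: ennreal by (simp add: mult_ac)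
          ultimately have "(\<Sum>k\<in>{1..N}. A n (\<zeta> k)) = ?r * (ennreal (wsum n \<zeta>) * ?b)" unfolding sumA by simp
          also have "\<dots> \<le> ?r * (\<Sum>k\<in>{1..N}. D n (\<zeta> k))" by (rule mult_left_mono[OF sumD]) simp
          finally show "(\<Sum>k\<in>{1..N}. A n (\<zeta> k)) \<le> ?r * (\<Sum>k\<in>{1..N}. D n (\<zeta> k))" .
        qed
        also note low
        finally show ?thesis .
      next
        case False
        then have "R n \<zeta> = 0" unfolding R_def by (rule if_not_P)
        then show ?thesis by simp
      qed
    qed
    also have "\<dots> = (\<integral>\<^sup>+\<zeta>. R (Suc n) \<zeta> \<partial>psys x (Suc n))"
      by (rule nn_integral_psys_Suc[OF n(1) order_refl x Rm[OF n(3)], symmetric])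
    also have "\<dots> \<le> (\<integral>\<^sup>+y. h y \<partial>PN x)" by (rule step.IH)
    finally show ?case .
  qed
  have f0: "fk w f 0 (\<lambda>_. undefined) = 1 * gam * (\<integral>\<^sup>+y. f y \<partial>tgt)" if "f \<in> borel_measurable (E T)" for f
    by (rule fk_target[where Q = "\<lambda>_. True"]) (use w that prod_pot[OF _ order_refl] in \<open>auto simp: w_def lessThan_Suc_atMost\<close>)
  have r0: "restrict x {1..0} = (\<lambda>_. undefined)" by auto
  have tame0: "\<forall>k\<in>{1..N}. tame c 0 (sys0 k)" using xt[of 0] r0 by (auto simp: sys0_def)
  have "of_nat (N - 1) ^ T * gam * (\<integral>\<^sup>+y. h y \<partial>tgt) / (of_nat N ^ T * gam + ennreal (dconst c T)) \<le> R 0 sys0"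
  proof (rule ennreal_divide_leI)
    define \<alpha> where "\<alpha> = A 0 (\<lambda>_. undefined)"
    define \<delta> where "\<delta> = D 0 (\<lambda>_. undefined)"
    have A0: "\<alpha> = of_nat (N - 1) ^ T * gam * (\<integral>\<^sup>+y. h y \<partial>tgt)" using f0[OF h(1)] by (simp add: \<alpha>_def A_def a_def mult.assoc)
    have D0: "\<delta> = of_nat N ^ T * gam + ennreal (dconst c T)" using f0[of "\<lambda>_. 1"] by (simp add: \<delta>_def D_def u_def emeasure_space_1)
    \<comment> \<open>All \<open>N\<close> slots hold the empty path, so numerator and denominator
      are \<open>N\<close> equal terms each.\<close>
    have "R 0 sys0 = of_nat N * \<alpha> / (of_nat N * \<delta>)" using tame0 by (simp add: R_def \<alpha>_def \<delta>_def sys0_def)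
    moreover have "of_nat N * \<delta> \<noteq> 0" "of_nat N * \<delta> \<noteq> \<infinity>"
      unfolding D0 using N gam_nz by (auto simp: ennreal_mult_eq_top_iff power_eq_top_ennreal)
    moreover have "(of_nat N :: ennreal) \<noteq> 0" "(of_nat N :: ennreal) \<noteq> \<infinity>" using N by auto
    ultimately have "R 0 sys0 * (of_nat N * \<delta>) = of_nat N * \<alpha>" by (metis ennreal_divide_cancel)
    then have "of_nat N * (R 0 sys0 * \<delta>) = of_nat N * \<alpha>" by (simp only: mult_ac)
    then have "R 0 sys0 * \<delta> = \<alpha>"
      using \<open>(of_nat N :: ennreal) \<noteq> 0\<close> \<open>(of_nat N :: ennreal) \<noteq> \<infinity>\<close> by (auto simp: ennreal_mult_cancel_left)
    then show "of_nat (N - 1) ^ T * gam * (\<integral>\<^sup>+y. h y \<partial>tgt) \<le> R 0 sys0 * (of_nat N ^ T * gam + ennreal (dconst c T))"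
      unfolding A0 D0 by simp
  qed
  moreover have "(\<integral>\<^sup>+\<zeta>. R 0 \<zeta> \<partial>psys x 0) = R 0 sys0" unfolding psys.simps by (rule nn_integral_return[OF sys0_in Rm]) simp
  ultimately show ?thesis using claim[of 0] by simp
qed

end

section \<open>Consequences and constants of the minorisation\<close>

lemma (in factored_kernel) minorised_consequences:
  assumes ae: "AE x in \<pi>. minorised \<pi> \<epsilon> (P x)" and \<epsilon>: "0 < \<epsilon>" "\<epsilon> < 1"
  shows "prob_space \<rho> \<Longrightarrow> sets \<rho> = sets \<pi> \<Longrightarrow> absolutely_continuous \<pi> \<rho> \<Longrightarrow>
      L2_dist \<pi> (bind \<rho> (kernel_pow \<pi> P k)) \<pi> \<le> L2_dist \<pi> \<rho> \<pi> * ennreal ((1 - \<epsilon>) ^ k)"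
    and "AE x in \<pi>. \<forall>k. tv_dist (kernel_pow \<pi> P k x) \<pi> \<le> (1 - \<epsilon>) ^ k"
    and "f \<in> L2 \<pi> \<Longrightarrow> convergent (scaled_sum_var \<pi> P f) \<and> var_of \<pi> f \<le> asymptotic_var \<pi> P f \<and>
      asymptotic_var \<pi> P f \<le> (2 * inverse \<epsilon> - 1) * var_of \<pi> f"
proof -
  have pow: "0 < (1 - \<epsilon>) ^ k" "(1 - \<epsilon>) ^ k \<le> 1" for k using \<epsilon> by (auto intro: power_le_one)
  have aek: "AE x in \<pi>. \<forall>k. minorised \<pi> (1 - (1 - \<epsilon>) ^ k) (kernel_pow \<pi> P k x)"
    using \<epsilon> ae by (intro AE_minorised_pow) auto
  show "AE x in \<pi>. \<forall>k. tv_dist (kernel_pow \<pi> P k x) \<pi> \<le> (1 - \<epsilon>) ^ k"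
    using aek AE_space
  proof eventually_elim
    case (elim x)
    show ?case
    proof
      fix k
      show "tv_dist (kernel_pow \<pi> P k x) \<pi> \<le> (1 - \<epsilon>) ^ k"
        using tv_dist_minor[of "kernel_pow \<pi> P k x" \<pi> "1 - (1 - \<epsilon>) ^ k"] prob_kernelD[OF Pn_kernel elim(2)] elim(1) pow[of k] prob_space_axioms
        by (auto simp: minorised_def)
    qed
  qed
  show "L2_dist \<pi> (bind \<rho> (kernel_pow \<pi> P k)) \<pi> \<le> L2_dist \<pi> \<rho> \<pi> * ennreal ((1 - \<epsilon>) ^ k)"
    if "prob_space \<rho>" "sets \<rho> = sets \<pi>" "absolutely_continuous \<pi> \<rho>"
  proof -
    have "AE x in \<pi>. minorised \<pi> (1 - (1 - \<epsilon>) ^ k) (kernel_pow \<pi> P k x)" using aek by eventually_elim simp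
    from L2_dist_contraction[OF _ _ this that] show ?thesis using pow[of k] by simp
  qed
  show "f \<in> L2 \<pi> \<Longrightarrow> convergent (scaled_sum_var \<pi> P f) \<and> var_of \<pi> f \<le> asymptotic_var \<pi> P f \<and>
      asymptotic_var \<pi> P f \<le> (2 * inverse \<epsilon> - 1) * var_of \<pi> f"
  proof -
    assume f: "f \<in> L2 \<pi>"
    note contr = minorised_op_contraction[OF ae less_imp_le[OF \<epsilon>(1)] \<epsilon>(2)]
    show ?thesis using asymptotic_var_bounds[OF contr \<epsilon> f] by blast
  qed
qed

lemma (in factored_kernel) tv_dist_minorised_everywhere:
  assumes all: "\<And>x. x \<in> space \<pi> \<Longrightarrow> minorised \<pi> \<epsilon> (P x)" and \<epsilon>: "0 \<le> \<epsilon>" "\<epsilon> \<le> 1" and x: "x \<in> space \<pi>"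
  shows "tv_dist (kernel_pow \<pi> P k x) \<pi> \<le> (1 - \<epsilon>) ^ k"
proof -
  note K = prob_kernelD[OF Pn_kernel x]
  have "minorised \<pi> (1 - (1 - \<epsilon>) ^ k) (kernel_pow \<pi> P k x)"
    by (rule minorised_pow[OF x \<epsilon>]) (use all K(3) in \<open>auto intro!: AE_I2\<close>)
  moreover have "(1 - \<epsilon>) ^ k \<le> 1" using \<epsilon> by (intro power_le_one) auto
  ultimately show ?thesis
    using tv_dist_minor[of "kernel_pow \<pi> P k x" \<pi> "1 - (1 - \<epsilon>) ^ k"] K prob_space_axioms by (auto simp: minorised_def)
qed

context csmc_model
begin

lemma minorised_PN:
  assumes x: "x \<in> space (E T)" and le: "\<And>B. B \<in> sets (E T) \<Longrightarrow> ennreal \<epsilon> * emeasure tgt B \<le> emeasure (PN x) B"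
    and \<epsilon>: "0 \<le> \<epsilon>"
  shows "minorised tgt \<epsilon> (PN x)"
proof -
  interpret t: prob_space tgt by (rule prob_pi)
  interpret p: prob_space "PN x" by (rule prob_kernelD[OF icsmc_kernel x])
  show ?thesis unfolding minorised_def sets_pi
    using le \<epsilon> by (simp add: t.emeasure_eq_measure p.emeasure_eq_measure flip: ennreal_mult)
qed

text \<open>The bound of \<open>tame_ratio\<close> after division by \<open>N ^ T\<close>: the
  powers of \<open>N - 1\<close> and \<open>N\<close> form the first factor, and
  \<open>dconst c T\<close> leaves the term of order \<open>1 / N\<close> in the second
  denominator.\<close>

definition "rate c = (real (N - 1) / real N) ^ T * (enn2real gam / (enn2real gam + (2 ^ Suc T - 2) * c ^ Suc T / real N))"

lemma gam_real: "gam = ennreal (enn2real gam)" "0 < enn2real gam"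
  using gam_nz by (auto simp: less_top enn2real_positive_iff zero_less_iff_neq_zero)

text \<open>The defect of a product of two factors in the unit interval is at most the sum of the
  defects; Bernoulli's inequality bounds that of the first factor by \<open>T / N\<close>.\<close>

lemma rate_bounds:
  assumes N: "2 \<le> N" and c: "1 \<le> c"
  shows "0 < rate c" "rate c < 1" "1 - rate c \<le> (real T + (2 ^ Suc T - 2) * c ^ Suc T / enn2real gam) / real N"
proof -
  define g where "g = enn2real gam"
  have g: "0 < g" using gam_real by (simp add: g_def)
  define k where "k = (2 ^ Suc T - 2) * c ^ Suc T"
  have k: "0 \<le> k" using c power_increasing[of 1 "Suc T" "2::real"] by (simp add: k_def)
  define y where "y = real (N - 1) / real N"
  have y: "0 < y" "y < 1" "y = 1 - 1 / real N" using N by (auto simp: y_def field_simps of_nat_diff)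
  define v where "v = g / (g + k / real N)"
  have kN: "0 \<le> k / real N" using k by simp
  have v: "0 < v" "v \<le> 1" using g kN by (auto simp: v_def add_pos_nonneg divide_le_eq)
  have r: "rate c = y ^ T * v" by (simp add: rate_def y_def v_def g_def k_def mult.assoc)
  show "0 < rate c" using y v by (simp add: r)
  have "y ^ T < 1" using y T_ge_1 by (intro power_Suc_less_one[of y "T - 1", simplified] | simp add: power_less_one_iff)+
  moreover have "y ^ T * v \<le> y ^ T * 1" using v y by (intro mult_left_mono) auto
  ultimately show "rate c < 1" by (simp add: r)
  have "1 - v = (k / real N) / (g + k / real N)" using g kN by (simp add: v_def field_simps add_pos_nonneg)
  also have "\<dots> \<le> (k / real N) / g" using g kN by (intro divide_left_mono) (auto simp: add_pos_nonneg)
  finally have v1: "1 - v \<le> k / g / real N" by (simp add: mult.commute)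
  have "1 + real T * (- 1 / real N) \<le> (1 + - 1 / real N) ^ T" using N by (intro Bernoulli_inequality) (simp add: field_simps)
  moreover have "1 + - 1 / real N = y" using y(3) by simp
  ultimately have "1 - real T / real N \<le> y ^ T" by simp
  then have "(1 - y ^ T) \<le> real T / real N" by simp
  moreover have "0 \<le> (1 - y ^ T) * (1 - v)" using y v by (intro mult_nonneg_nonneg) (auto intro: power_le_one)
  then have "1 - rate c \<le> (1 - y ^ T) + (1 - v)" by (simp add: r algebra_simps)
  ultimately have "1 - rate c \<le> real T / real N + k / g / real N" using v1 by simp
  then show "1 - rate c \<le> (real T + (2 ^ Suc T - 2) * c ^ Suc T / enn2real gam) / real N"
    by (simp add: add_divide_distrib k_def g_def)
qed

lemma tame_minorised:
  assumes N: "2 \<le> N" and c: "1 \<le> c" and x: "x \<in> space (E T)"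
    and xt: "\<And>n. n \<le> T \<Longrightarrow> tame c n (restrict x {1..n})"
  shows "minorised tgt (rate c) (PN x)"
proof (rule minorised_PN[OF x])
  show "0 \<le> rate c" using rate_bounds[OF N c] by simp
  fix B assume B: "B \<in> sets (E T)"
  interpret t: prob_space tgt by (rule prob_pi)
  have sP: "sets (PN x) = sets (E T)" by (rule prob_kernelD[OF icsmc_kernel x])
  define g where "g = enn2real gam"
  have g: "gam = ennreal g" "0 < g" using gam_real by (auto simp: g_def)
  define m where "m = measure tgt B"
  have m: "emeasure tgt B = ennreal m" "0 \<le> m" by (auto simp: t.emeasure_eq_measure m_def)
  define k where "k = (2 ^ Suc T - 2) * c ^ Suc T"
  have k: "0 \<le> k" using c power_increasing[of 1 "Suc T" "2::real"] by (simp add: k_def)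
  have dc: "dconst c T = real N ^ T * (k / real N)" by (simp add: dconst_def k_def power_mult_distrib)
  have N0: "0 < real N" using N by simp
  have den: "0 < g + k / real N" using g k by (simp add: add_pos_nonneg)
  have "ennreal (rate c) * emeasure tgt B = ennreal (real (N - 1) ^ T * g * m) / ennreal (real N ^ T * g + dconst c T)"
  proof -
    have "rate c * m = real (N - 1) ^ T * g * m / (real N ^ T * (g + k / real N))"
      unfolding rate_def g_def[symmetric] k_def[symmetric] by (simp add: power_divide)
    also have "\<dots> = real (N - 1) ^ T * g * m / (real N ^ T * g + dconst c T)" by (simp only: dc distrib_left)
    finally have "rate c * m = \<dots>" .
    moreover have "0 < real N ^ T * g + dconst c T" unfolding dc using N0 g k by (intro add_pos_nonneg) auto
    ultimately show ?thesis using m g rate_bounds(1)[OF N c] by (simp add: divide_ennreal flip: ennreal_mult)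
  qed
  also have "\<dots> = of_nat (N - 1) ^ T * gam * (\<integral>\<^sup>+y. indicator B y \<partial>tgt) / (of_nat N ^ T * gam + ennreal (dconst c T))"
  proof -
    have "0 \<le> dconst c T" unfolding dc using k by simp
    then have "ennreal (real N ^ T * g + dconst c T) = of_nat N ^ T * gam + ennreal (dconst c T)"
      using g by (simp add: ennreal_of_nat_eq_real_of_nat ennreal_power ennreal_mult)
    moreover have "ennreal (real (N - 1) ^ T * g * m) = of_nat (N - 1) ^ T * gam * (\<integral>\<^sup>+y. indicator B y \<partial>tgt)"
      using g m B sets_pi by (simp add: ennreal_of_nat_eq_real_of_nat ennreal_power ennreal_mult)
    ultimately show ?thesis by simp
  qed
  also have "\<dots> \<le> (\<integral>\<^sup>+y. indicator B y \<partial>PN x)"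
    by (rule tame_ratio[OF N x c xt]) (use B in \<open>auto simp: indicator_def\<close>)
  also have "\<dots> = emeasure (PN x) B" using B sP by simp
  finally show "ennreal (rate c) * emeasure tgt B \<le> emeasure (PN x) B" .
qed

lemma AE_tgt_if_law: "AE x in law T. Q x \<Longrightarrow> AE x in tgt. Q x"
proof -
  assume "AE x in law T. Q x"
  moreover have "(\<lambda>x. ennreal (\<Prod>t\<in>{1..T}. G t (x t)) / gam) \<in> borel_measurable (law T)"
    using weight_law unfolding prod_weight by measurable
  ultimately show ?thesis unfolding target_def by (subst AE_density) auto
qed

lemma nn_integral_law_restrict:
  assumes m: "m \<le> T" and f: "f \<in> borel_measurable (E n)"
  shows "n \<le> m \<Longrightarrow> m \<le> T \<Longrightarrow> (\<integral>\<^sup>+y. f (restrict y {1..n}) \<partial>law m) = (\<integral>\<^sup>+y. f y \<partial>law n)"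
proof (induction m rule: dec_induct)
  case base
  then show ?case by (intro nn_integral_cong) (simp add: law_sets(2) restrict_self)
next
  case (step k)
  then have k: "k < T" by simp
  have m: "(\<lambda>y. f (restrict y {1..n})) \<in> borel_measurable (E (Suc k))"
    using step by (intro measurable_compose[OF restrict_path f]) auto
  have "(\<integral>\<^sup>+y. f (restrict y {1..n}) \<partial>law (Suc k)) = (\<integral>\<^sup>+x. \<integral>\<^sup>+y. f (restrict y {1..n}) \<partial>ext k x \<partial>law k)"
    by (rule nn_integral_law_Suc[OF k m])
  also have "\<dots> = (\<integral>\<^sup>+x. f (restrict x {1..n}) \<partial>law k)"
  proof (rule nn_integral_cong)
    fix x assume "x \<in> space (law k)"
    then have x: "x \<in> space (E k)" using law_sets(2)[of k] k by simp
    show "(\<integral>\<^sup>+y. f (restrict y {1..n}) \<partial>ext k x) = f (restrict x {1..n})"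
      by (rule ext_const[OF k x m]) (simp only: restrict_upd[OF step(1)])
  qed
  also have "\<dots> = (\<integral>\<^sup>+y. f y \<partial>law n)" using k by (intro step.IH) simp
  finally show ?case .
qed

text \<open>Integrated over the chain, \<open>cond_exp s (above c s) n\<close> gives the probability
  that the potential at time \<open>s\<close> exceeds \<open>c\<close>, which is 0; a nonnegative
  function with integral 0 vanishes almost everywhere.\<close>

lemma tame_AE:
  assumes c: "1 \<le> c" and ae: "\<And>t. t \<in> {1..T} \<Longrightarrow> AE y in law T. G t (y t) \<le> c"
  shows "AE y in law T. \<forall>n\<le>T. tame c n (restrict y {1..n})"
proof -
  have "AE y in law T. cond_exp s (above c s) n (restrict y {1..n}) = 0" if s: "n \<le> s" "s \<le> T" for n s
  proof -
    have "(\<integral>\<^sup>+p. above c s p \<partial>law s) = (\<integral>\<^sup>+y. above c s (restrict y {1..s}) \<partial>law T)"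
      using nn_integral_law_restrict[OF order_refl above_measurable[OF s(2)] s(2)] by simp
    also have "\<dots> = (\<integral>\<^sup>+y. 0 \<partial>law T)"
    proof (rule nn_integral_cong_AE)
      have "AE y in law T. s \<noteq> 0 \<longrightarrow> G s (y s) \<le> c" using ae[of s] s by (cases "s = 0") auto
      then show "AE y in law T. above c s (restrict y {1..s}) = 0"
        by eventually_elim (use c in \<open>auto simp: above_def pot_def indicator_def\<close>)
    qed
    finally have "(\<integral>\<^sup>+p. cond_exp s (above c s) n p \<partial>law n) = 0"
      using cond_exp_law[OF s(2) above_measurable[OF s(2)] s(1)] by simp
    moreover have m: "cond_exp s (above c s) n \<in> borel_measurable (E n)" using s by (intro cond_exp_measurable above_measurable) auto
    ultimately have "(\<integral>\<^sup>+y. cond_exp s (above c s) n (restrict y {1..n}) \<partial>law T) = 0"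
      using nn_integral_law_restrict[OF order_refl m] s by simp
    moreover have "(\<lambda>y. cond_exp s (above c s) n (restrict y {1..n})) \<in> borel_measurable (law T)"
      using measurable_compose[OF restrict_path m] s by (simp add: measurable_cong_sets[OF law_sets(1)[OF order_refl] refl])
    ultimately show ?thesis by (subst (asm) nn_integral_0_iff_AE) auto
  qed
  then have "AE y in law T. \<forall>n\<in>{..T}. \<forall>s\<in>{n..T}. cond_exp s (above c s) n (restrict y {1..n}) = 0"
    by (intro eventually_ball_finite ballI) auto
  then show ?thesis by eventually_elim (auto simp: tame_def)
qed

lemma tame_everywhere:
  assumes c: "1 \<le> c" and le: "\<And>t z. t \<in> {1..T} \<Longrightarrow> z \<in> space Z \<Longrightarrow> G t z \<le> c" and n: "n \<le> T" and p: "p \<in> space (E n)"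
  shows "tame c n p"
  unfolding tame_def
proof
  fix s assume s: "s \<in> {n..T}"
  \<comment> \<open>A sum over a one-element set, so that \<open>cond_exp_sum_le\<close> propagates
    the bound for a single function.\<close>
  have "(\<Sum>a\<in>{()}. cond_exp s (above c s) n p) \<le> 0"
  proof (rule cond_exp_sum_le[of s "{()}" "\<lambda>_. above c s"])
    fix q assume q: "q \<in> space (E s)"
    have "pot s q \<le> c" using c le[of s "q s"] q s by (auto simp: pot_def space_PiM PiE_iff)
    then show "(\<Sum>a\<in>{()}. above c s q) \<le> 0" by (simp add: above_def)
  qed (use s p in \<open>auto intro: above_measurable\<close>)
  then show "cond_exp s (above c s) n p = 0" by simp
qed

text \<open>The minimum with 1/2 keeps the constant strictly below 1, as the contraction estimates
  require.\<close>

definition "crude_rate c = min (1 / 2) (((1 / (real N * c)) ^ Suc T * enn2real gam) ^ (N - 1))"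

lemma crude_minorised:
  assumes N: "2 \<le> N" and c: "1 \<le> c" and ae: "AE y in tgt. \<forall>t\<in>{1..T}. G t (y t) \<le> c"
  shows "0 < crude_rate c" "crude_rate c < 1" "AE x in tgt. minorised tgt (crude_rate c) (PN x)"
proof -
  have Nc: "0 < real N * c" using N c by simp
  show pos: "0 < crude_rate c" using Nc gam_real by (simp add: crude_rate_def)
  show "crude_rate c < 1" by (simp add: crude_rate_def)
  show "AE x in tgt. minorised tgt (crude_rate c) (PN x)"
    using ae AE_space
  proof eventually_elim
    case (elim x)
    then have x: "x \<in> space (E T)" using space_pi by simp
    have sP: "sets (PN x) = sets (E T)" by (rule prob_kernelD[OF icsmc_kernel x])
    show ?case
    proof (rule minorised_PN[OF x _ less_imp_le[OF pos]])
      fix B assume B: "B \<in> sets (E T)"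
      have "ennreal (crude_rate c) \<le> ennreal (((1 / (real N * c)) ^ Suc T * enn2real gam) ^ (N - 1))"
        by (intro ennreal_leI) (simp add: crude_rate_def)
      also have "\<dots> = (ennreal (1 / (real N * c)) ^ Suc T * gam) ^ (N - 1)"
      proof -
        have "ennreal ((a ^ Suc T * g) ^ (N - 1)) = (ennreal a ^ Suc T * ennreal g) ^ (N - 1)" if "0 \<le> a" "0 \<le> g" for a g
          using that by (simp add: ennreal_power del: power_Suc flip: ennreal_mult)
        from this[of "1 / (real N * c)" "enn2real gam"] show ?thesis using Nc gam_real by simp
      qed
      finally have "ennreal (crude_rate c) * emeasure tgt B \<le> (ennreal (1 / (real N * c)) ^ Suc T * gam) ^ (N - 1) * (\<integral>\<^sup>+y. indicator B y \<partial>tgt)"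
        using B sets_pi by (simp add: mult_right_mono)
      also have "\<dots> \<le> (\<integral>\<^sup>+y. indicator B y \<partial>PN x)"
        by (rule crude_minorisation[OF N x c _ ae]) (use elim B in \<open>auto simp: indicator_def\<close>)
      also have "\<dots> = emeasure (PN x) B" using B sP by simp
      finally show "ennreal (crude_rate c) * emeasure tgt B \<le> emeasure (PN x) B" .
    qed
  qed
qed

end

context smc_model
begin

abbreviation "potsup \<rho> t \<equiv> esssup (marginal Z \<rho> t) (\<lambda>z. ennreal (G t z))"

lemma component_potential: "t \<in> {1..T} \<Longrightarrow> sets \<rho> = sets (path_space Z T) \<Longrightarrow> (\<lambda>y. y t) \<in> \<rho> \<rightarrow>\<^sub>M Z"
  by (subst measurable_cong_sets[OF _ refl], assumption) (rule measurable_component_singleton)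

lemma potential_marginal: "t \<in> {1..T} \<Longrightarrow> (\<lambda>z. ennreal (G t z)) \<in> borel_measurable (marginal Z \<rho> t)"
  using G_measurable[of t] by (simp add: marginal_def)

lemma esssup_finite_AE:
  assumes t: "t \<in> {1..T}" and s: "sets \<rho> = sets (path_space Z T)"
    and fin: "potsup \<rho> t < \<infinity>"
  shows "\<exists>c. AE y in \<rho>. G t (y t) \<le> c"
proof -
  obtain c where c: "potsup \<rho> t = ennreal c" "0 \<le> c"
    using fin by (cases "potsup \<rho> t") auto
  have "AE z in distr \<rho> Z (\<lambda>y. y t). ennreal (G t z) \<le> ennreal c"
    unfolding marginal_def[symmetric] c(1)[symmetric] by (rule esssup_AE)
  then have "AE y in \<rho>. ennreal (G t (y t)) \<le> ennreal c" by (rule AE_distrD[OF component_potential[OF t s]])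
  then show ?thesis using c(2) by (intro exI[of _ c]) (auto simp: ennreal_le_iff)
qed

lemma esssup_le_AE:
  assumes t: "t \<in> {1..T}" and s: "sets \<rho> = sets (path_space Z T)" and ae: "AE y in \<rho>. G t (y t) \<le> c"
  shows "potsup \<rho> t < \<infinity>"
proof -
  have "AE z in marginal Z \<rho> t. ennreal (G t z) \<le> ennreal c"
  proof -
    have [measurable]: "G t \<in> borel_measurable Z" by (rule G_measurable[OF t])
    show ?thesis unfolding marginal_def
      by (subst AE_distr_iff[OF component_potential[OF t s]]) (use ae in \<open>measurable, auto intro: ennreal_leI\<close>)
  qed
  then have "potsup \<rho> t \<le> ennreal c" by (rule esssup_I[OF potential_marginal[OF t]])
  then show ?thesis by (rule le_less_trans) simp
qed

lemma common_bound:
  assumes "\<And>t. t \<in> {1..T} \<Longrightarrow> \<exists>c. Q t c" and mono: "\<And>t c c'. Q t c \<Longrightarrow> c \<le> c' \<Longrightarrow> Q t c'"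
  shows "\<exists>c\<ge>1. \<forall>t\<in>{1..T}. Q t (c :: real)"
proof -
  obtain f where f: "\<And>t. t \<in> {1..T} \<Longrightarrow> Q t (f t)" using assms(1) by metis
  have "Q t (Max (insert 1 (f ` {1..T})))" if "t \<in> {1..T}" for t
    using f[OF that] by (rule mono) (rule Max_ge, use that in auto)
  moreover have "1 \<le> Max (insert 1 (f ` {1..T}))" by simp
  ultimately show ?thesis by blast
qed

lemma csmc: "1 \<le> n \<Longrightarrow> csmc_model Z T M1 M G n"
  by (intro csmc_model.intro smc_model_axioms csmc_model_axioms.intro)

lemma law_path: "sets (markov_law Z M1 M T) = sets (path_space Z T)" "space (markov_law Z M1 M T) = space (path_space Z T)"
proof -
  interpret csmc_model Z T M1 M G 1 by (rule csmc) simp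
  show "sets (markov_law Z M1 M T) = sets (path_space Z T)" "space (markov_law Z M1 M T) = space (path_space Z T)"
    by (rule law_sets[OF order_refl])+
qed

text \<open>One sequence has to serve three conclusions. A bound everywhere implies an essential
  bound under the chain, so the case distinction is on the latter. If it holds, \<open>rate\<close>
  is used, with a \<open>c\<close> that bounds the potentials everywhere whenever they are so
  bounded. If it fails, the potentials are not bounded everywhere either, and
  \<open>crude_rate\<close> suffices.\<close>

lemma minorisation_constants:
  assumes fin: "\<forall>t\<in>{1..T}. potsup (target Z T M1 M G) t < \<infinity>"
  shows "\<exists>\<epsilon> :: nat \<Rightarrow> real. (\<forall>n\<ge>2. 0 < \<epsilon> n \<and> \<epsilon> n < 1 \<and>
      (AE x in target Z T M1 M G. minorised (target Z T M1 M G) (\<epsilon> n) (icsmc Z T M1 M G n x))) \<and>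
    ((\<forall>t\<in>{1..T}. potsup (markov_law Z M1 M T) t < \<infinity>) \<longrightarrow>
      (\<lambda>n. 1 - \<epsilon> n) \<in> O(\<lambda>n. 1 / real n)) \<and>
    ((\<forall>t\<in>{1..T}. bdd_above (G t ` space Z)) \<longrightarrow> (\<forall>n\<ge>2. \<forall>x\<in>space (path_space Z T).
      minorised (target Z T M1 M G) (\<epsilon> n) (icsmc Z T M1 M G n x)))"
proof -
  let ?tgt = "target Z T M1 M G" and ?law = "markov_law Z M1 M T"
  define mfin where "mfin \<longleftrightarrow> (\<forall>t\<in>{1..T}. potsup ?law t < \<infinity>)"
  define bdd where "bdd \<longleftrightarrow> (\<forall>t\<in>{1..T}. bdd_above (G t ` space Z))"
  have b: "\<exists>c\<ge>1. \<forall>t\<in>{1..T}. \<forall>z\<in>space Z. G t z \<le> c" if bdd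
    by (rule common_bound[of "\<lambda>t c. \<forall>z\<in>space Z. G t z \<le> c"]) (use that in \<open>auto simp: bdd_def bdd_above_def intro: order_trans\<close>)
  have comp: "y t \<in> space Z" if "y \<in> space (path_space Z T)" "t \<in> {1..T}" for y t
    using that by (auto simp: space_PiM PiE_iff)
  show ?thesis
  proof (cases mfin)
    case True
    have m: "\<exists>c\<ge>1. \<forall>t\<in>{1..T}. AE y in ?law. G t (y t) \<le> c"
      by (rule common_bound[of "\<lambda>t c. AE y in ?law. G t (y t) \<le> c"])
        (use True esssup_finite_AE[OF _ law_path(1)] in \<open>auto simp: mfin_def elim!: eventually_mono\<close>)
    have "\<exists>c\<ge>1. (\<forall>t\<in>{1..T}. AE y in ?law. G t (y t) \<le> c) \<and> (bdd \<longrightarrow> (\<forall>t\<in>{1..T}. \<forall>z\<in>space Z. G t z \<le> c))"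
    proof (cases bdd)
      case True
      then obtain c where "c \<ge> 1" "\<forall>t\<in>{1..T}. \<forall>z\<in>space Z. G t z \<le> c" using b by blast
      then show ?thesis using comp law_path by (intro exI[of _ c]) (auto intro!: AE_I2)
    qed (use m in blast)
    then obtain c where c: "1 \<le> c" and ae: "\<And>t. t \<in> {1..T} \<Longrightarrow> AE y in ?law. G t (y t) \<le> c"
      and all: "\<And>t z. bdd \<Longrightarrow> t \<in> {1..T} \<Longrightarrow> z \<in> space Z \<Longrightarrow> G t z \<le> c" by blast
    define \<epsilon> where "\<epsilon> n = csmc_model.rate Z T M1 M G n c" for n
    have rb: "0 < \<epsilon> n" "\<epsilon> n < 1" "1 - \<epsilon> n \<le> (real T + (2 ^ Suc T - 2) * c ^ Suc T / enn2real (normalising_constant Z T M1 M G)) / real n"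
      if "2 \<le> n" for n
    proof -
      interpret csmc_model Z T M1 M G n using that by (intro csmc) simp
      show "0 < \<epsilon> n" "\<epsilon> n < 1" "1 - \<epsilon> n \<le> (real T + (2 ^ Suc T - 2) * c ^ Suc T / enn2real (normalising_constant Z T M1 M G)) / real n"
        unfolding \<epsilon>_def by (rule rate_bounds[OF that c])+
    qed
    have "(\<lambda>n. 1 - \<epsilon> n) \<in> O(\<lambda>n. 1 / real n)"
    proof (rule bigoI)
      let ?K = "real T + (2 ^ Suc T - 2) * c ^ Suc T / enn2real (normalising_constant Z T M1 M G)"
      show "eventually (\<lambda>n. norm (1 - \<epsilon> n) \<le> ?K * norm (1 / real n)) sequentially"
        using eventually_ge_at_top[of 2]
      proof eventually_elim
        case (elim n)
        show ?case using rb[OF elim] by simp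
      qed
    qed
    moreover have "AE x in ?tgt. minorised ?tgt (\<epsilon> n) (icsmc Z T M1 M G n x)" if n: "2 \<le> n" for n
    proof -
      interpret csmc_model Z T M1 M G n using n by (intro csmc) simp
      have "AE x in ?tgt. \<forall>m\<le>T. tame c m (restrict x {1..m})"
        by (rule AE_tgt_if_law[OF tame_AE[OF c ae]])
      then show ?thesis using AE_space
        by eventually_elim (unfold \<epsilon>_def, rule tame_minorised[OF n c], auto simp: space_pi)
    qed
    moreover have "minorised ?tgt (\<epsilon> n) (icsmc Z T M1 M G n x)" if n: "2 \<le> n" and bd: bdd and x: "x \<in> space (path_space Z T)" for n x
    proof -
      interpret csmc_model Z T M1 M G n using n by (intro csmc) simp
      show ?thesis unfolding \<epsilon>_def
        by (rule tame_minorised[OF n c x tame_everywhere[OF c all[OF bd] _ restrict_in[OF x]]])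
    qed
    ultimately show ?thesis using rb by (intro exI[of _ \<epsilon>]) (auto simp: bdd_def)
  next
    case False
    have "\<not> bdd"
    proof
      assume bdd
      then obtain c where "\<And>t z. t \<in> {1..T} \<Longrightarrow> z \<in> space Z \<Longrightarrow> G t z \<le> c" using b by blast
      then have mfin unfolding mfin_def
        using comp law_path by (intro ballI esssup_le_AE[OF _ law_path(1), of _ c]) (auto intro!: AE_I2)
      with False show False ..
    qed
    interpret one: csmc_model Z T M1 M G 1 by (rule csmc) simp
    have "\<exists>c\<ge>1. \<forall>t\<in>{1..T}. AE y in ?tgt. G t (y t) \<le> c"
      by (rule common_bound[of "\<lambda>t c. AE y in ?tgt. G t (y t) \<le> c"])
        (use fin esssup_finite_AE[OF _ one.sets_pi] in \<open>auto elim!: eventually_mono\<close>)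
    then obtain c where c: "1 \<le> c" and "\<forall>t\<in>{1..T}. AE y in ?tgt. G t (y t) \<le> c" by blast
    then have ae: "AE y in ?tgt. \<forall>t\<in>{1..T}. G t (y t) \<le> c" by (intro eventually_ball_finite) auto
    define \<epsilon> where "\<epsilon> n = csmc_model.crude_rate Z T M1 M G n c" for n
    have "0 < \<epsilon> n \<and> \<epsilon> n < 1 \<and> (AE x in ?tgt. minorised ?tgt (\<epsilon> n) (icsmc Z T M1 M G n x))" if n: "2 \<le> n" for n
    proof -
      interpret csmc_model Z T M1 M G n using n by (intro csmc) simp
      show ?thesis unfolding \<epsilon>_def using crude_minorised[OF n c ae] by blast
    qed
    then show ?thesis using False \<open>\<not> bdd\<close> by (intro exI[of _ \<epsilon>]) (auto simp: bdd_def mfin_def)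
  qed
qed

end

section \<open>Unbounded potentials\<close>

context csmc_model
begin

lemma level_positive:
  assumes t: "t \<in> {1..T}" and inf: "potsup tgt t = \<infinity>"
  shows "0 < measure tgt (level t K)"
proof (rule ccontr)
  interpret prob_space tgt by (rule prob_pi)
  assume "\<not> ?thesis"
  then have "emeasure tgt (level t K) = 0" by (simp add: emeasure_eq_measure zero_less_measure_iff)
  then have "level t K \<in> null_sets tgt" using level_sets[OF t] sets_pi by auto
  then have "AE y in tgt. y \<notin> level t K" by (rule AE_not_in)
  then have "AE y in tgt. G t (y t) \<le> K"
    using AE_space by eventually_elim (auto simp: level_def space_pi)
  from esssup_le_AE[OF t sets_pi this] inf show False by simp
qed

lemma potential_tgt: "t \<in> {1..T} \<Longrightarrow> (\<lambda>y. G t (y t)) \<in> borel_measurable tgt"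
  by (rule measurable_compose[OF component_potential[OF _ sets_pi] G_measurable])

text \<open>The supposed rate fixes a number \<open>n\<close> of steps after which the distance is
  below 1/4. A chain started \<open>n\<close> levels above a level of mass at most 1/4 is still in
  that level after \<open>n\<close> steps with probability at least 3/4. Such a starting point
  exists in \<open>D\<close> because every level has positive mass.\<close>

lemma not_uniformly_ergodic:
  assumes t: "t \<in> {1..T}" and inf: "potsup tgt t = \<infinity>"
    and S: "D \<in> sets (E T)" "measure tgt D = 1"
  shows "\<not> uniformly_ergodic_on D tgt PN"
proof
  interpret fk: factored_kernel tgt PN nu' out by (rule factored)
  assume "uniformly_ergodic_on D tgt PN"
  then obtain K0 \<rho> where \<rho>: "0 < \<rho>" "\<rho> < 1" and rate: "\<And>n x. x \<in> D \<Longrightarrow> tv_dist (kernel_pow tgt PN n x) tgt \<le> K0 * \<rho> ^ n"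
    unfolding uniformly_ergodic_on_def by blast
  have "(\<lambda>n. K0 * \<rho> ^ n) \<longlonglongrightarrow> K0 * 0" using \<rho> by (intro tendsto_mult tendsto_const LIMSEQ_power_zero) simp
  then have "eventually (\<lambda>n. K0 * \<rho> ^ n < 1 / 4) sequentially" by (rule order_tendstoD) simp
  then obtain n where n: "K0 * \<rho> ^ n < 1 / 4" by (auto simp: eventually_sequentially)
  obtain a0 where a0: "\<And>a. a0 \<le> a \<Longrightarrow> measure tgt {x\<in>space tgt. a \<le> G t (x t)} \<le> 1 / 4"
    using fk.measure_upper_level_small[OF potential_tgt[OF t], of "1/4"] by auto
  define K where "K = max 1 a0"
  have K: "0 < K" "a0 \<le> K" by (auto simp: K_def)
  \<comment> \<open>Makes the escape probability of a single step at most
    \<open>1 / (4 * (n + 1))\<close>, so that \<open>n\<close> steps lose at most 1/4.\<close>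
  define L where "L = 4 * real (Suc n) * real N ^ Suc T"
  have Np: "1 \<le> real N ^ Suc T" using N_ge_1 by (intro one_le_power) simp
  have L: "1 \<le> L"
  proof -
    have "1 * 1 \<le> 4 * real (Suc n) * real N ^ Suc T" using Np by (intro mult_mono) auto
    then show ?thesis by (simp add: L_def)
  qed
  define A where "A j = level t (K * L ^ j)" for j
  define q where "q = 1 - 1 / (4 * real (Suc n))"
  have q: "0 \<le> q" by (simp add: q_def field_simps)
  have sticky: "q \<le> measure (PN x) (A j)" if "x \<in> A (Suc j)" for j x
  proof -
    have "K * L ^ Suc j = K * L ^ j * L" by simp
    then have "x \<in> level t (K * L ^ j * L)" using that by (simp only: A_def)
    moreover have "0 < K * L ^ j" using K L by simp
    ultimately have "1 - real N ^ Suc T / L \<le> measure (PN x) (A j)" unfolding A_def by (intro level_escape[OF t _ L])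
    moreover have "real N ^ Suc T / L = 1 / (4 * real (Suc n))" unfolding L_def using N_ge_1 by (simp del: power_Suc of_nat_Suc)
    ultimately show ?thesis by (simp add: q_def)
  qed
  have As: "A j \<in> sets tgt" for j using level_sets[OF t] sets_pi by (simp add: A_def)
  have "\<exists>x. x \<in> D \<inter> A n"
  proof (rule ccontr)
    assume "\<not> ?thesis"
    then have "A n \<subseteq> space tgt - D" using As[of n] sets.sets_into_space by blast
    moreover have "D \<in> sets tgt" using S sets_pi by simp
    ultimately have "measure tgt (A n) \<le> measure tgt (space tgt - D)" by (intro fk.finite_measure_mono) auto
    also have "\<dots> = 0" using \<open>D \<in> sets tgt\<close> S(2) fk.prob_compl by simp
    finally show False using level_positive[OF t inf, of "K * L ^ n"] by (simp add: A_def)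
  qed
  then obtain x where x: "x \<in> D" "x \<in> A n" by blast
  have xs: "x \<in> space tgt" using x(2) As sets.sets_into_space by blast
  note Kn = prob_kernelD[OF fk.Pn_kernel xs, of n]
  have "1 - 1 / 4 \<le> 1 + real n * (- 1 / (4 * real (Suc n)))" by (simp add: field_simps)
  also have "\<dots> \<le> (1 + - 1 / (4 * real (Suc n))) ^ n" by (intro Bernoulli_inequality) (simp add: field_simps)
  also have "\<dots> = q ^ n" by (simp add: q_def)
  also have "\<dots> \<le> measure (kernel_pow tgt PN n x) (A 0)"
    by (rule kernel_pow_sticky[OF fk.P_kernel As q sticky]) (use x in auto)
  finally have "3 / 4 \<le> measure (kernel_pow tgt PN n x) (A 0)" by simp
  moreover have "measure tgt (A 0) \<le> 1 / 4" using a0[OF K(2)] by (simp add: A_def level_def space_pi)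
  moreover have "measure (kernel_pow tgt PN n x) (A 0) - measure tgt (A 0) \<le> tv_dist (kernel_pow tgt PN n x) tgt"
    by (rule tv_dist_set[OF Kn(1) prob_pi Kn(2) As])
  ultimately show False using rate[OF x(1), of n] n by simp
qed

abbreviation "trap \<theta> t a z \<equiv> lift t {p \<in> good_set \<theta> t a. p 1 = z}"

lemma trap_sets:
  assumes t: "t \<in> {1..T}" and z: "{z} \<in> sets Z" shows "trap \<theta> t a z \<in> sets (E T)"
proof (rule lift_sets)
  have "(\<lambda>p. p 1) \<in> E t \<rightarrow>\<^sub>M Z" using t by (intro measurable_component_singleton) auto
  then have "{p \<in> space (E t). p 1 = z} \<in> sets (E t)"
    by (rule measurable_sets[OF _ z, THEN back_subst[of "\<lambda>B. B \<in> sets (E t)"]]) auto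
  moreover have "{p \<in> good_set \<theta> t a. p 1 = z} = good_set \<theta> t a \<inter> {p \<in> space (E t). p 1 = z}" by (auto simp: good_set_def)
  ultimately show "{p \<in> good_set \<theta> t a. p 1 = z} \<in> sets (E t)" using good_sets[of t] t by auto
qed (use t in auto)

text \<open>\<open>\<theta>\<close> and the scale \<open>a\<close> do not depend on
  \<open>z\<close>, so all traps of one good set are sticky at once. The bound 1/2 on the level is
  for the discrete case, where the trap has positive mass.\<close>

lemma sticky_traps:
  assumes t: "t \<in> {1..T}" and inf: "potsup tgt t = \<infinity>"
    and sing: "\<And>z. z \<in> space Z \<Longrightarrow> {z} \<in> sets Z" and \<delta>: "0 < \<delta>" "\<delta> \<le> 1"
  shows "\<exists>\<theta> a. 0 < measure tgt (lift t (good_set \<theta> t a)) \<and> measure tgt (level t (2 ^ a)) \<le> 1 / 2 \<and>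
    (\<forall>z\<in>space Z. \<forall>x\<in>trap \<theta> t a z. 1 - \<delta> \<le> measure (PN x) (trap \<theta> t a z))"
proof -
  interpret tg: prob_space tgt by (rule prob_pi)
  have tT: "t \<le> T" "t \<noteq> 0" using t by auto
  interpret ml: prob_space "law t" by (rule law_sets(3)[OF tT(1)])
  \<comment> \<open>Makes the error term of \<open>good_escape\<close> equal to
    \<open>\<delta>\<close>.\<close>
  define \<theta> where "\<theta> = \<delta> / (real N ^ (2 * T) * (3 * real T))"
  have Np: "1 \<le> real N ^ (2 * T)" using N_ge_1 by (intro one_le_power) simp
  have T1: "1 \<le> real T" using T_ge_1 by simp
  define B where "B = real N ^ (2 * T) * (3 * real T)"
  have "1 * (3 * 1) \<le> B" unfolding B_def using Np T1 by (intro mult_mono) auto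
  then have B: "3 \<le> B" by simp
  have "\<delta> / B \<le> 1 / 3" using \<delta> B by (intro frac_le) auto
  then have \<theta>: "0 < \<theta>" "\<theta> \<le> 1 / 2" using \<delta> B by (auto simp: \<theta>_def B_def[symmetric])
  have "B * \<theta> = \<delta>" using B by (simp add: \<theta>_def B_def[symmetric])
  then have e: "real N ^ (2 * T) * (3 * real T * \<theta>) = \<delta>" by (simp add: B_def mult.assoc)
  have pm: "pot t \<in> borel_measurable (law t)"
    using pot_measurable[OF tT(1)] by (simp add: measurable_cong_sets[OF law_sets(1)[OF tT(1)] refl])
  obtain b1 where b1: "\<And>b. b1 \<le> b \<Longrightarrow> measure (law t) {x\<in>space (law t). b \<le> pot t x} \<le> \<theta>"
    using ml.measure_upper_level_small[OF pm \<theta>(1)] by auto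
  obtain b2 where b2: "\<And>b. b2 \<le> b \<Longrightarrow> measure tgt {x\<in>space tgt. b \<le> G t (x t)} \<le> 1 / 2"
    using tg.measure_upper_level_small[OF potential_tgt[OF t], of "1/2"] by auto
  obtain a0 :: nat where a0: "max b1 b2 \<le> real a0" using real_arch_simple by blast
  obtain a where a: "a0 \<le> a" "xi t a 0 (\<lambda>_. undefined) \<le> ennreal (\<theta> ^ t)" "0 < measure tgt (lift t (good_set \<theta> t a))"
    using exists_good_scale[OF t \<theta> level_positive[OF t inf], of a0] by blast
  \<comment> \<open>\<open>2 ^ a\<close> exceeds \<open>a\<close>, hence \<open>a0\<close>, so both
    tail bounds apply at the level \<open>2 ^ a\<close>.\<close>
  have "real a \<le> 2 ^ a" using of_nat_less_two_power[of a, where ?'a = real] by simp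
  then have b: "b1 \<le> 2 ^ a" "b2 \<le> 2 ^ a" using a0 a(1) by linarith+
  have tail: "emeasure (law t) {p \<in> space (E t). 2 ^ a \<le> pot t p} \<le> ennreal \<theta>"
    using b1[OF b(1)] law_sets(2)[OF tT(1)] by (simp add: ml.emeasure_eq_measure ennreal_leI)
  have "1 - \<delta> \<le> measure (PN x) (trap \<theta> t a z)" if "z \<in> space Z" "x \<in> trap \<theta> t a z" for x z
    using good_escape[OF t \<theta> sing[OF that(1)] a(2) tail that(2)] unfolding e .
  moreover have "measure tgt (level t (2 ^ a)) \<le> 1 / 2" using b2[OF b(2)] by (simp add: level_def space_pi)
  ultimately show ?thesis using a(3) by blast
qed

lemma in_trap: "t \<in> {1..T} \<Longrightarrow> x \<in> lift t (good_set \<theta> t a) \<Longrightarrow> x \<in> trap \<theta> t a (x 1)"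
  by (auto simp: lift_def)

lemma trap_power:
  assumes t: "t \<in> {1..T}" and z: "{z} \<in> sets Z" and x: "x \<in> trap \<theta> t a z" and q: "0 \<le> q"
    and sticky: "\<And>x. x \<in> trap \<theta> t a z \<Longrightarrow> q \<le> measure (PN x) (trap \<theta> t a z)"
  shows "q ^ n \<le> measure (kernel_pow tgt PN n x) (trap \<theta> t a z)"
proof -
  interpret fk: factored_kernel tgt PN nu' out by (rule factored)
  show ?thesis
    by (rule kernel_pow_sticky[OF fk.P_kernel _ q, of "\<lambda>_. trap \<theta> t a z" x 0 n])
      (use trap_sets[OF t z] sets_pi sticky x in auto)
qed

text \<open>The trap of a good path \<open>x\<close> is null, as it fixes the first coordinate,
  while the chain from \<open>x\<close> remains in it for \<open>n\<close> steps with probability at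
  least \<open>(1 - \<delta>) ^ n\<close>. So the distance decays no faster than this from any good
  \<open>x\<close>, and good paths have positive mass.\<close>

lemma not_geometrically_ergodic_diffuse:
  assumes t: "t \<in> {1..T}" and inf: "potsup tgt t = \<infinity>"
    and sing: "\<And>z. z \<in> space Z \<Longrightarrow> {z} \<in> sets Z"
    and diffuse: "\<And>z. z \<in> space Z \<Longrightarrow> emeasure tgt {y \<in> space (E T). y 1 = z} = 0"
  shows "\<not> geometrically_ergodic tgt PN"
proof
  interpret fk: factored_kernel tgt PN nu' out by (rule factored)
  assume "geometrically_ergodic tgt PN"
  then obtain C \<rho> where \<rho>: "0 < \<rho>" "\<rho> < 1" and ae: "AE x in tgt. \<forall>n. tv_dist (kernel_pow tgt PN n x) tgt \<le> C x * \<rho> ^ n"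
    unfolding geometrically_ergodic_def by blast
  define \<delta> where "\<delta> = (1 - \<rho>) / 2"
  have \<delta>: "0 < \<delta>" "\<delta> \<le> 1" using \<rho> by (auto simp: \<delta>_def)
  obtain \<theta> a where pos: "0 < measure tgt (lift t (good_set \<theta> t a))"
    and sticky: "\<And>z x. z \<in> space Z \<Longrightarrow> x \<in> trap \<theta> t a z \<Longrightarrow> 1 - \<delta> \<le> measure (PN x) (trap \<theta> t a z)"
    using sticky_traps[OF t inf sing \<delta>] by blast
  have gs: "lift t (good_set \<theta> t a) \<in> sets tgt" using lift_sets[OF _ good_sets] t sets_pi by simp
  have "\<exists>x. x \<in> lift t (good_set \<theta> t a) \<and> (\<forall>n. tv_dist (kernel_pow tgt PN n x) tgt \<le> C x * \<rho> ^ n)"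
  proof (rule ccontr)
    assume neg: "\<not> ?thesis"
    have "AE x in tgt. x \<notin> lift t (good_set \<theta> t a)" using ae by (rule eventually_mono) (use neg in blast)
    then have "measure tgt (lift t (good_set \<theta> t a)) = 0"
      using gs by (simp add: fk.prob_eq_0)
    with pos show False by simp
  qed
  then obtain x where x: "x \<in> lift t (good_set \<theta> t a)" and rate: "\<And>n. tv_dist (kernel_pow tgt PN n x) tgt \<le> C x * \<rho> ^ n" by blast
  have xE: "x \<in> space (E T)" using x by (simp add: lift_def)
  then have xs: "x \<in> space tgt" by (simp add: space_pi)
  have z: "x 1 \<in> space Z" using xE T_ge_1 by (auto simp: space_PiM PiE_iff)
  let ?A = "trap \<theta> t a (x 1)"
  have A: "?A \<in> sets tgt" using trap_sets[OF t sing[OF z]] sets_pi by simp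
  have "emeasure tgt ?A \<le> emeasure tgt {y \<in> space (E T). y 1 = x 1}"
  proof (rule emeasure_mono)
    show "?A \<subseteq> {y \<in> space (E T). y 1 = x 1}" using t by (auto simp: lift_def)
    have "(\<lambda>y. y 1) \<in> tgt \<rightarrow>\<^sub>M Z" using T_ge_1 by (intro component_potential[OF _ sets_pi]) auto
    from measurable_sets[OF this sing[OF z]] show "{y \<in> space (E T). y 1 = x 1} \<in> sets tgt"
      by (simp add: vimage_def Int_def conj_commute space_pi)
  qed
  then have A0: "measure tgt ?A = 0" using diffuse[OF z] by (simp add: measure_def)
  have "1 * (1 - \<delta>) ^ n \<le> C x * \<rho> ^ n" for n
  proof -
    note Kn = prob_kernelD[OF fk.Pn_kernel xs, of n]
    have "(1 - \<delta>) ^ n \<le> measure (kernel_pow tgt PN n x) ?A"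
      by (rule trap_power[OF t sing[OF z] in_trap[OF t x]]) (use \<delta> sticky[OF z] in auto)
    also have "\<dots> \<le> tv_dist (kernel_pow tgt PN n x) tgt"
      using tv_dist_set[OF Kn(1) prob_pi Kn(2) A] A0 by simp
    also have "\<dots> \<le> C x * \<rho> ^ n" by (rule rate)
    finally show ?thesis by simp
  qed
  then have "1 - \<delta> \<le> \<rho>" by (intro geometric_dominated_le[of 1 "1 - \<delta>" \<rho> "C x"]) (use \<delta> \<rho> in auto)
  then show False using \<rho> by (simp add: \<delta>_def field_simps)
qed

text \<open>Every path is an atom, so the supposed rate holds at every path and one good path
  already gives a trap of positive mass. The trap lies in a level of mass at most 1/2, and being
  countable it has a finite subset with almost all of its mass, as \<open>finite_sticky_rate\<close>
  demands.\<close>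

lemma not_geometrically_ergodic_discrete:
  assumes t: "t \<in> {1..T}" and inf: "potsup tgt t = \<infinity>"
    and cZ: "countable (space Z)" and sZ: "sets Z = Pow (space Z)"
    and atoms: "\<And>x. x \<in> space (E T) \<Longrightarrow> emeasure tgt {x} \<noteq> 0"
  shows "\<not> geometrically_ergodic tgt PN"
proof
  interpret fk: factored_kernel tgt PN nu' out by (rule factored)
  have sing: "\<And>z. z \<in> space Z \<Longrightarrow> {z} \<in> sets Z" by (simp add: sZ)
  have singE: "{x} \<in> sets tgt" if x: "x \<in> space (E T)" for x
  proof -
    have "PiE {1..T} (\<lambda>i. {x i}) = {x}" using x by (intro PiE_singleton) (auto simp: space_PiM PiE_iff)
    moreover have "PiE {1..T} (\<lambda>i. {x i}) \<in> sets (E T)"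
      using x by (intro sets_PiM_I_finite) (auto simp: space_PiM PiE_iff sing)
    ultimately show ?thesis by (simp only: sets_pi)
  qed
  have cE: "countable (space (E T))" unfolding space_PiM using cZ by (intro countable_PiE) auto
  have all: "F \<in> sets tgt" if "F \<subseteq> space (E T)" for F
  proof -
    have "(\<Union>x\<in>F. {x}) \<in> sets tgt"
      using that countable_subset[OF that cE] singE by (intro sets.countable_UN'') auto
    then show ?thesis by simp
  qed
  assume "geometrically_ergodic tgt PN"
  then obtain C \<rho> where \<rho>: "0 < \<rho>" "\<rho> < 1" and ae: "AE x in tgt. \<forall>n. tv_dist (kernel_pow tgt PN n x) tgt \<le> C x * \<rho> ^ n"
    unfolding geometrically_ergodic_def by blast
  have rate: "tv_dist (kernel_pow tgt PN n x) tgt \<le> C x * \<rho> ^ n" if x: "x \<in> space (E T)" for x n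
  proof (rule ccontr)
    assume neg: "\<not> ?thesis"
    have "AE y in tgt. y \<notin> {x}" using ae by eventually_elim (use neg in auto)
    then have "emeasure tgt {x} = 0" using singE[OF x] by (simp add: fk.prob_eq_0 fk.emeasure_eq_measure)
    with atoms[OF x] show False by simp
  qed
  \<comment> \<open>Then \<open>1 - 6 * \<delta>\<close> is \<open>(1 + \<rho>) / 2\<close>, which
    exceeds \<open>\<rho>\<close>.\<close>
  define \<delta> where "\<delta> = (1 - \<rho>) / 12"
  have \<delta>: "0 < \<delta>" "\<delta> \<le> 1" "\<delta> \<le> 1 / 6" using \<rho> by (auto simp: \<delta>_def)
  obtain \<theta> a where pos: "0 < measure tgt (lift t (good_set \<theta> t a))" and half: "measure tgt (level t (2 ^ a)) \<le> 1 / 2"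
    and sticky: "\<And>z x. z \<in> space Z \<Longrightarrow> x \<in> trap \<theta> t a z \<Longrightarrow> 1 - \<delta> \<le> measure (PN x) (trap \<theta> t a z)"
    using sticky_traps[OF t inf sing \<delta>(1,2)] by blast
  obtain x where x: "x \<in> lift t (good_set \<theta> t a)" using pos by (metis measure_empty less_irrefl ex_in_conv)
  have xE: "x \<in> space (E T)" using x by (simp add: lift_def)
  have z: "x 1 \<in> space Z" using xE T_ge_1 by (auto simp: space_PiM PiE_iff)
  define A where "A = trap \<theta> t a (x 1)"
  have AE: "A \<subseteq> space (E T)" by (auto simp: A_def lift_def)
  have A: "A \<in> sets tgt" by (rule all[OF AE])
  have "0 < measure tgt {x}" using atoms[OF xE] by (simp add: fk.emeasure_eq_measure zero_less_measure_iff)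
  also have "\<dots> \<le> measure tgt A" using in_trap[OF t x] A by (intro fk.finite_measure_mono) (auto simp: A_def)
  finally have Apos: "0 < measure tgt A" .
  have "measure tgt A \<le> measure tgt (level t (2 ^ a))"
  proof (rule fk.finite_measure_mono)
    show "A \<subseteq> level t (2 ^ a)" using t by (auto simp: A_def lift_def level_def good_set_def good_def pot_def)
  qed (use level_sets[OF t] sets_pi in simp)
  then have Ahalf: "measure tgt A \<le> 1 / 2" using half by simp
  have cA: "countable A" by (rule countable_subset[OF AE cE])
  define F where "F n = {y \<in> A. to_nat_on A y \<le> n}" for n
  have "(\<lambda>n. measure tgt (F n)) \<longlonglongrightarrow> measure tgt (\<Union>n. F n)"
    using AE by (intro fk.finite_Lim_measure_incseq) (auto simp: F_def incseq_def intro!: all)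
  moreover have "(\<Union>n. F n) = A" by (auto simp: F_def)
  moreover have "(1 - \<delta>) * measure tgt A < measure tgt A" using Apos \<delta> by simp
  ultimately have "eventually (\<lambda>n. (1 - \<delta>) * measure tgt A < measure tgt (F n)) sequentially"
    by (intro order_tendstoD) auto
  then obtain n where n: "(1 - \<delta>) * measure tgt A < measure tgt (F n)" by (auto simp: eventually_sequentially)
  have "finite (F n)"
  proof (rule finite_imageD)
    show "finite (to_nat_on A ` F n)" by (rule finite_subset[of _ "{..n}"]) (auto simp: F_def)
    show "inj_on (to_nat_on A) (F n)" using inj_on_to_nat_on[OF cA] by (rule inj_on_subset) (auto simp: F_def)
  qed
  moreover have FA: "F n \<subseteq> A" by (auto simp: F_def)
  moreover have "F n \<in> sets tgt" using FA AE by (intro all) blast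
  moreover have "1 - \<delta> \<le> measure (PN y) A" if "y \<in> A" for y using that unfolding A_def by (rule sticky[OF z])
  moreover have "tv_dist (kernel_pow tgt PN m y) tgt \<le> C y * \<rho> ^ m" if "y \<in> F n" for y m
    using that FA AE by (intro rate) blast
  ultimately have "1 - 6 * \<delta> \<le> \<rho>"
    using n \<rho>(1) by (intro fk.finite_sticky_rate[OF A Apos Ahalf \<delta>(1,3), of "F n" \<rho> C]) auto
  then show False using \<rho> by (simp add: \<delta>_def field_simps)
qed

end

text \<open>The map \<open>\<phi>\<close> carries points to points of a Euclidean space of dimension
  \<open>d\<close>. These are null for \<open>d > 0\<close>, whereas for \<open>d = 0\<close> there
  is a single point; hence the alternative in the last conclusion.\<close>

lemma lebesgue_type_singleton:
  assumes L: "lebesgue_type L"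
  shows "sigma_finite_measure L" "\<And>z. z \<in> space L \<Longrightarrow> {z} \<in> sets L"
    "\<And>z. z \<in> space L \<Longrightarrow> emeasure L {z} = 0 \<or> space L = {z}"
proof -
  obtain d :: nat and D \<phi> \<psi> where D: "D \<in> sets (PiM {..<d} (\<lambda>_. lborel :: real measure))"
    and \<phi>: "\<phi> \<in> measurable L (restrict_space (PiM {..<d} (\<lambda>_. lborel)) D)"
    and \<psi>: "\<psi> \<in> measurable (restrict_space (PiM {..<d} (\<lambda>_. lborel)) D) L"
    and inv: "\<And>z. z \<in> space L \<Longrightarrow> \<psi> (\<phi> z) = z" "\<And>v. v \<in> D \<Longrightarrow> \<phi> (\<psi> v) = v"
    and Leq: "L = distr (restrict_space (PiM {..<d} (\<lambda>_. lborel)) D) L \<psi>"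
    using L unfolding lebesgue_type_def by blast
  let ?B = "PiM {..<d} (\<lambda>_. lborel :: real measure)"
  let ?R = "restrict_space ?B D"
  interpret product_sigma_finite "\<lambda>_. lborel :: real measure" ..
  interpret B: sigma_finite_measure ?B by (rule sigma_finite) simp
  have DB: "D \<subseteq> space ?B" using D sets.sets_into_space by blast
  have sR: "space ?R = D" using DB by (auto simp: space_restrict_space)
  have \<phi>D: "\<phi> z \<in> D" if "z \<in> space L" for z using measurable_space[OF \<phi> that] by (simp add: sR)
  have em: "emeasure L (\<phi> -` V \<inter> space L) = emeasure ?B V" "\<phi> -` V \<inter> space L \<in> sets L" if V: "V \<in> sets ?B" "V \<subseteq> D" for V
  proof -
    have VR: "V \<in> sets ?R" using V D by (auto simp: sets_restrict_space_iff)
    show m: "\<phi> -` V \<inter> space L \<in> sets L" by (rule measurable_sets[OF \<phi> VR])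
    have "emeasure L (\<phi> -` V \<inter> space L) = emeasure ?R (\<psi> -` (\<phi> -` V \<inter> space L) \<inter> space ?R)"
      by (subst Leq) (rule emeasure_distr[OF \<psi> m])
    also have "\<psi> -` (\<phi> -` V \<inter> space L) \<inter> space ?R = V"
      using V(2) inv(2) measurable_space[OF \<psi>] by (auto simp: sR)
    also have "emeasure ?R V = emeasure ?B V" using V D DB by (intro emeasure_restrict_space) (auto simp: Int_absorb2)
    finally show "emeasure L (\<phi> -` V \<inter> space L) = emeasure ?B V" .
  qed
  obtain A :: "nat \<Rightarrow> _" where A: "range A \<subseteq> sets ?B" "(\<Union>i. A i) = space ?B" "\<And>i. emeasure ?B (A i) \<noteq> \<infinity>"
    using B.sigma_finite by blast
  show "sigma_finite_measure L"
  proof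
    define F where "F = (\<lambda>i. \<phi> -` (A i \<inter> D) \<inter> space L) ` UNIV"
    have "A i \<inter> D \<in> sets ?B" for i using A(1) D by auto
    note e = em[OF this]
    have "emeasure ?B (A i \<inter> D) \<noteq> \<infinity>" for i
    proof -
      have "emeasure ?B (A i \<inter> D) \<le> emeasure ?B (A i)" using A(1) by (intro emeasure_mono) auto
      then show ?thesis using A(3)[of i] by (auto simp: top_unique)
    qed
    then have "\<forall>a\<in>F. emeasure L a \<noteq> \<infinity>" using e by (auto simp: F_def)
    moreover have "\<Union>F = space L" using A(2) DB \<phi>D by (fastforce simp: F_def)
    moreover have "countable F" "F \<subseteq> sets L" using e by (auto simp: F_def)
    ultimately show "\<exists>A. countable A \<and> A \<subseteq> sets L \<and> \<Union>A = space L \<and> (\<forall>a\<in>A. emeasure L a \<noteq> \<infinity>)" by blast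
  qed
  fix z assume z: "z \<in> space L"
  have vB: "\<phi> z \<in> space ?B" using \<phi>D[OF z] DB by auto
  have V: "{\<phi> z} = PiE {..<d} (\<lambda>i. {\<phi> z i})"
    using vB by (intro PiE_singleton[symmetric]) (auto simp: space_PiM PiE_iff)
  have Vs: "{\<phi> z} \<in> sets ?B" unfolding V by (intro sets_PiM_I_finite) auto
  have zz: "\<phi> -` {\<phi> z} \<inter> space L = {z}" using z inv(1) by (auto, metis)
  note ev = em[OF Vs, unfolded zz]
  show "{z} \<in> sets L" using ev(2) \<phi>D[OF z] by simp
  show "emeasure L {z} = 0 \<or> space L = {z}"
  proof (cases "d = 0")
    case True
    have "y = z" if y: "y \<in> space L" for y
    proof -
      have "\<phi> y = \<phi> z" using subsetD[OF DB \<phi>D[OF y]] subsetD[OF DB \<phi>D[OF z]] True by (simp add: space_PiM)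
      then show ?thesis using inv(1) y z by metis
    qed
    then show ?thesis using z by blast
  next
    case False
    have "emeasure ?B {\<phi> z} = (\<Prod>i<d. emeasure lborel {\<phi> z i})"
      unfolding V by (rule emeasure_PiM) auto
    also have "\<dots> = 0" using False by (intro prod_zero) auto
    finally show ?thesis using ev(1) \<phi>D[OF z] by simp
  qed
qed

lemma emeasure_path_slice:
  assumes L: "sigma_finite_measure L" and T: "1 \<le> (T::nat)" and z: "{z} \<in> sets L" "emeasure L {z} = 0"
  shows "emeasure (path_space L T) {y \<in> space (path_space L T). y 1 = z} = 0"
    "{y \<in> space (path_space L T). y 1 = z} \<in> sets (path_space L T)"
proof -
  interpret product_sigma_finite "\<lambda>_. L" by (intro product_sigma_finite.intro L)
  have z': "z \<in> space L" using z(1) sets.sets_into_space by blast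
  have eq: "{y \<in> space (path_space L T). y 1 = z} = PiE {1..T} (\<lambda>i. if i = 1 then {z} else space L)"
  proof (rule set_eqI)
    fix y
    show "y \<in> {y \<in> space (path_space L T). y 1 = z} \<longleftrightarrow> y \<in> PiE {1..T} (\<lambda>i. if i = 1 then {z} else space L)"
      using T z' unfolding space_PiM mem_Collect_eq PiE_iff by (smt (verit) atLeastAtMost_iff order_refl singletonD singletonI)
  qed
  show "{y \<in> space (path_space L T). y 1 = z} \<in> sets (path_space L T)"
    unfolding eq using z by (intro sets_PiM_I_finite) auto
  have "emeasure (path_space L T) {y \<in> space (path_space L T). y 1 = z} =
      (\<Prod>i\<in>{1..T}. emeasure L (if i = 1 then {z} else space L))"
    unfolding eq using z by (intro emeasure_PiM) auto
  also have "\<dots> = 0" using T z by (intro prod_zero) (auto intro!: bexI[of _ 1])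
  finally show "emeasure (path_space L T) {y \<in> space (path_space L T). y 1 = z} = 0" .
qed

lemma (in csmc_model) not_geometrically_ergodic:
  assumes t: "t \<in> {1..T}" and inf: "potsup tgt t = \<infinity>"
    and nc: "\<not> (\<exists>z\<in>space Z. AE y in marginal Z tgt 1. y = z)"
    and ref: "countable (space Z) \<and> sets Z = Pow (space Z) \<and> equivalent_measures tgt (count_space (space (E T))) \<or>
       (\<exists>L. sets L = sets Z \<and> lebesgue_type L \<and> equivalent_measures tgt (path_space L T))"
  shows "\<not> geometrically_ergodic tgt PN"
  using ref
proof
  assume c: "countable (space Z) \<and> sets Z = Pow (space Z) \<and> equivalent_measures tgt (count_space (space (E T)))"
  show ?thesis
  proof (rule not_geometrically_ergodic_discrete[OF t inf])
    fix x assume x: "x \<in> space (E T)"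
    show "emeasure tgt {x} \<noteq> 0"
    proof
      assume e: "emeasure tgt {x} = 0"
      have "PiE {1..T} (\<lambda>i. {x i}) = {x}" using x by (intro PiE_singleton) (auto simp: space_PiM PiE_iff)
      moreover have "PiE {1..T} (\<lambda>i. {x i}) \<in> sets (E T)"
        using x c by (intro sets_PiM_I_finite) (auto simp: space_PiM PiE_iff)
      ultimately have "{x} \<in> sets tgt" by (simp only: sets_pi)
      then have "{x} \<in> null_sets tgt" using e by auto
      then have "{x} \<in> null_sets (count_space (space (E T)))"
        using c by (auto simp: equivalent_measures_def absolutely_continuous_def)
      then show False using x by (simp add: null_sets_count_space)
    qed
  qed (use c in auto)
next
  assume "\<exists>L. sets L = sets Z \<and> lebesgue_type L \<and> equivalent_measures tgt (path_space L T)"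
  then obtain L where L: "sets L = sets Z" "lebesgue_type L" "equivalent_measures tgt (path_space L T)" by blast
  have sp: "space L = space Z" by (rule sets_eq_imp_space_eq[OF L(1)])
  have sE: "sets (path_space L T) = sets (E T)" by (intro sets_PiM_cong refl L(1))
  have spE: "space (path_space L T) = space (E T)" by (rule sets_eq_imp_space_eq[OF sE])
  note lt = lebesgue_type_singleton[OF L(2)]
  have T1: "1 \<in> {1..T}" using T_ge_1 by simp
  show ?thesis
  proof (rule not_geometrically_ergodic_diffuse[OF t inf])
    fix z assume z: "z \<in> space Z"
    show zs: "{z} \<in> sets Z" using lt(2)[of z] z sp L(1) by simp
    \<comment> \<open>The assumption that the first marginal is not concentrated on a point excludes
      dimension 0.\<close>
    have "space L \<noteq> {z}"
    proof
      assume "space L = {z}"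
      then have "AE y in marginal Z tgt 1. y = z" using sp by (intro AE_I2) (auto simp: marginal_def)
      with nc z show False by blast
    qed
    then have "emeasure L {z} = 0" using lt(3)[of z] z sp by auto
    from emeasure_path_slice[OF lt(1) T_ge_1 _ this] zs L(1)
    have "{y \<in> space (E T). y 1 = z} \<in> null_sets (path_space L T)" by (simp add: spE null_sets_def)
    then have "{y \<in> space (E T). y 1 = z} \<in> null_sets tgt"
      using L(3) by (auto simp: equivalent_measures_def absolutely_continuous_def)
    then show "emeasure tgt {y \<in> space (E T). y 1 = z} = 0" by auto
  qed
qed

theorem theorem1:
  fixes Z :: "'z measure" and T :: nat and M1 :: "'z measure"
    and M :: "nat \<Rightarrow> 'z \<Rightarrow> 'z measure" and G :: "nat \<Rightarrow> 'z \<Rightarrow> real"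
    and X \<pi> :: "(nat \<Rightarrow> 'z) measure"
    and P :: "nat \<Rightarrow> (nat \<Rightarrow> 'z) \<Rightarrow> (nat \<Rightarrow> 'z) measure"
    and Gsup :: "nat \<Rightarrow> ennreal"
  assumes model: "smc_model Z T M1 M G"
    and X_eq: "X = path_space Z T"
    and \<pi>_eq: "\<pi> = target Z T M1 M G"
    and P_eq: "P = icsmc Z T M1 M G"
    and Gsup_eq: "Gsup = (\<lambda>t. esssup (marginal Z \<pi> t) (\<lambda>z. ennreal (G t z)))"
  shows
    "(\<forall>N\<ge>2. reversible \<pi> (P N) \<and> positive_L2_operator \<pi> (P N))
     \<and>
     ((\<forall>t\<in>{1..T}. Gsup t < \<infinity>) \<longrightarrow>
       (\<exists>\<epsilon> :: nat \<Rightarrow> real.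
          (\<forall>N\<ge>2.
             0 < \<epsilon> N \<and>
             (AE x in \<pi>. \<forall>B\<in>sets X. measure (P N x) B \<ge> \<epsilon> N * measure \<pi> B) \<and>
             (\<forall>\<nu>. prob_space \<nu> \<and> sets \<nu> = sets X \<and> absolutely_continuous \<pi> \<nu> \<longrightarrow>
                (\<forall>k\<ge>1. L2_dist \<pi> (bind \<nu> (kernel_pow X (P N) k)) \<pi>
                        \<le> L2_dist \<pi> \<nu> \<pi> * ennreal ((1 - \<epsilon> N) ^ k))) \<and>
             (AE x in \<pi>. \<forall>k\<ge>1. tv_dist (kernel_pow X (P N) k x) \<pi> \<le> (1 - \<epsilon> N) ^ k) \<and>
             (\<forall>f\<in>L2 \<pi>.
                convergent (scaled_sum_var \<pi> (P N) f) \<and>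
                var_of \<pi> f \<le> asymptotic_var \<pi> (P N) f \<and>
                asymptotic_var \<pi> (P N) f \<le> (2 * inverse (\<epsilon> N) - 1) * var_of \<pi> f)) \<and>
          ((\<forall>t\<in>{1..T}. esssup (marginal Z (markov_law Z M1 M T) t) (\<lambda>z. ennreal (G t z)) < \<infinity>) \<longrightarrow>
             (\<lambda>N. 1 - \<epsilon> N) \<in> O(\<lambda>N. 1 / real N)) \<and>
          ((\<forall>t\<in>{1..T}. bdd_above (G t ` space Z)) \<longrightarrow>
             (\<forall>N\<ge>2. \<forall>x\<in>space X.
                (\<forall>B\<in>sets X. measure (P N x) B \<ge> \<epsilon> N * measure \<pi> B) \<and>
                (\<forall>k\<ge>1. tv_dist (kernel_pow X (P N) k x) \<pi> \<le> (1 - \<epsilon> N) ^ k)))))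
     \<and>
     ((\<exists>t\<in>{1..T}. Gsup t = \<infinity>) \<and>
      \<not> (\<exists>z\<in>space Z. AE y in marginal Z \<pi> 1. y = z) \<longrightarrow>
       (\<forall>S N. S \<in> sets X \<and> measure \<pi> S = 1 \<and> (\<forall>x\<in>S. (\<Prod>t\<in>{1..T}. G t (x t)) > 0) \<and> N \<ge> 1 \<longrightarrow>
          \<not> uniformly_ergodic_on S \<pi> (P N)))
     \<and>
     ((\<exists>t\<in>{1..T}. Gsup t = \<infinity>) \<and>
      \<not> (\<exists>z\<in>space Z. AE y in marginal Z \<pi> 1. y = z) \<and>
      (countable (space Z) \<and> sets Z = Pow (space Z) \<and>
         equivalent_measures \<pi> (count_space (space X)) \<or>
       (\<exists>L. sets L = sets Z \<and> lebesgue_type L \<and> equivalent_measures \<pi> (path_space L T))) \<longrightarrow>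
       (\<forall>N\<ge>1. \<not> geometrically_ergodic \<pi> (P N)))"
proof -
  interpret smc_model Z T M1 M G by (rule model)
  have fk: "factored_kernel \<pi> (P n) (csmc_model.nu' Z T M1 M G n) (csmc_model.out Z T G n)" if "1 \<le> n" for n
    unfolding \<pi>_eq P_eq by (rule csmc_model.factored[OF csmc[OF that]])
  have sX: "sets \<pi> = sets X" and spX: "space \<pi> = space X"
    unfolding \<pi>_eq X_eq using csmc_model.sets_pi[OF csmc[of 1]] csmc_model.space_pi[OF csmc[of 1]] by auto
  have kp: "kernel_pow X (P n) k = kernel_pow \<pi> (P n) k" for n k
    using sX by (intro kernel_pow_cong_sets) simp
  have a: "\<forall>N\<ge>2. reversible \<pi> (P N) \<and> positive_L2_operator \<pi> (P N)"
    using factored_kernel.reversible[OF fk] factored_kernel.positive_L2_operator[OF fk] by simp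
  have b: "(\<forall>t\<in>{1..T}. Gsup t < \<infinity>) \<longrightarrow> (\<exists>\<epsilon> :: nat \<Rightarrow> real.
      (\<forall>N\<ge>2. 0 < \<epsilon> N \<and>
         (AE x in \<pi>. \<forall>B\<in>sets X. measure (P N x) B \<ge> \<epsilon> N * measure \<pi> B) \<and>
         (\<forall>\<nu>. prob_space \<nu> \<and> sets \<nu> = sets X \<and> absolutely_continuous \<pi> \<nu> \<longrightarrow>
            (\<forall>k\<ge>1. L2_dist \<pi> (bind \<nu> (kernel_pow X (P N) k)) \<pi> \<le> L2_dist \<pi> \<nu> \<pi> * ennreal ((1 - \<epsilon> N) ^ k))) \<and>
         (AE x in \<pi>. \<forall>k\<ge>1. tv_dist (kernel_pow X (P N) k x) \<pi> \<le> (1 - \<epsilon> N) ^ k) \<and>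
         (\<forall>f\<in>L2 \<pi>. convergent (scaled_sum_var \<pi> (P N) f) \<and>
            var_of \<pi> f \<le> asymptotic_var \<pi> (P N) f \<and>
            asymptotic_var \<pi> (P N) f \<le> (2 * inverse (\<epsilon> N) - 1) * var_of \<pi> f)) \<and>
      ((\<forall>t\<in>{1..T}. esssup (marginal Z (markov_law Z M1 M T) t) (\<lambda>z. ennreal (G t z)) < \<infinity>) \<longrightarrow>
         (\<lambda>N. 1 - \<epsilon> N) \<in> O(\<lambda>N. 1 / real N)) \<and>
      ((\<forall>t\<in>{1..T}. bdd_above (G t ` space Z)) \<longrightarrow>
         (\<forall>N\<ge>2. \<forall>x\<in>space X.
            (\<forall>B\<in>sets X. measure (P N x) B \<ge> \<epsilon> N * measure \<pi> B) \<and>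
            (\<forall>k\<ge>1. tv_dist (kernel_pow X (P N) k x) \<pi> \<le> (1 - \<epsilon> N) ^ k))))"
    (is "_ \<longrightarrow> (\<exists>\<epsilon>. ?Q \<epsilon>)")
  proof
    assume fin: "\<forall>t\<in>{1..T}. Gsup t < \<infinity>"
    have fin': "\<forall>t\<in>{1..T}. esssup (marginal Z (target Z T M1 M G) t) (\<lambda>z. ennreal (G t z)) < \<infinity>"
      using fin unfolding Gsup_eq \<pi>_eq .
    obtain \<epsilon> where all: "\<forall>n\<ge>2. 0 < \<epsilon> n \<and> \<epsilon> n < 1 \<and> (AE x in \<pi>. minorised \<pi> (\<epsilon> n) (P n x))"
      and O: "(\<forall>t\<in>{1..T}. esssup (marginal Z (markov_law Z M1 M T) t) (\<lambda>z. ennreal (G t z)) < \<infinity>) \<longrightarrow>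
        (\<lambda>n. 1 - \<epsilon> n) \<in> O(\<lambda>n. 1 / real n)"
      and every: "(\<forall>t\<in>{1..T}. bdd_above (G t ` space Z)) \<longrightarrow> (\<forall>n\<ge>2. \<forall>x\<in>space X. minorised \<pi> (\<epsilon> n) (P n x))"
    proof (rule exE[OF minorisation_constants[OF fin', folded \<pi>_eq P_eq X_eq]], elim conjE)
    qed (rule that)
    have \<epsilon>: "0 < \<epsilon> n" "\<epsilon> n < 1" "AE x in \<pi>. minorised \<pi> (\<epsilon> n) (P n x)" if "2 \<le> n" for n
      using all that by auto
    show "\<exists>\<epsilon>. ?Q \<epsilon>"
    proof (intro exI[of _ \<epsilon>] conjI O allI impI ballI)
      fix n :: nat assume n: "2 \<le> n"
      interpret factored_kernel \<pi> "P n" "csmc_model.nu' Z T M1 M G n" "csmc_model.out Z T G n"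
        using n by (intro fk) simp
      note cons = minorised_consequences[OF \<epsilon>(3)[OF n] \<epsilon>(1)[OF n] \<epsilon>(2)[OF n]]
      show "0 < \<epsilon> n" by (rule \<epsilon>(1)[OF n])
      show "AE x in \<pi>. \<forall>B\<in>sets X. \<epsilon> n * measure \<pi> B \<le> measure (P n x) B"
        using \<epsilon>(3)[OF n] by (simp add: minorised_def sX)
      show "AE x in \<pi>. \<forall>k\<ge>1. tv_dist (kernel_pow X (P n) k x) \<pi> \<le> (1 - \<epsilon> n) ^ k"
        using cons(2) unfolding kp by eventually_elim blast
      show "L2_dist \<pi> (bind \<nu> (kernel_pow X (P n) k)) \<pi> \<le> L2_dist \<pi> \<nu> \<pi> * ennreal ((1 - \<epsilon> n) ^ k)"
        if "prob_space \<nu> \<and> sets \<nu> = sets X \<and> absolutely_continuous \<pi> \<nu>" for \<nu> k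
        unfolding kp using that by (intro cons(1)) (auto simp: sX)
      show "convergent (scaled_sum_var \<pi> (P n) f)" "var_of \<pi> f \<le> asymptotic_var \<pi> (P n) f"
        "asymptotic_var \<pi> (P n) f \<le> (2 * inverse (\<epsilon> n) - 1) * var_of \<pi> f" if "f \<in> L2 \<pi>" for f
        using cons(3)[OF that] by auto
      assume b: "\<forall>t\<in>{1..T}. bdd_above (G t ` space Z)"
      show "\<epsilon> n * measure \<pi> B \<le> measure (P n x) B" if "x \<in> space X" "B \<in> sets X" for x B
        using every b n that by (simp add: minorised_def sX)
      show "tv_dist (kernel_pow X (P n) k x) \<pi> \<le> (1 - \<epsilon> n) ^ k" if "x \<in> space X" for x k
        unfolding kp using every b n \<epsilon>(1,2)[OF n] that
        by (intro tv_dist_minorised_everywhere) (auto simp: spX)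
    qed
  qed
  have c: "(\<exists>t\<in>{1..T}. Gsup t = \<infinity>) \<and> \<not> (\<exists>z\<in>space Z. AE y in marginal Z \<pi> 1. y = z) \<longrightarrow>
      (\<forall>S N. S \<in> sets X \<and> measure \<pi> S = 1 \<and> (\<forall>x\<in>S. (\<Prod>t\<in>{1..T}. G t (x t)) > 0) \<and> N \<ge> 1 \<longrightarrow>
        \<not> uniformly_ergodic_on S \<pi> (P N))"
    unfolding Gsup_eq \<pi>_eq P_eq X_eq using csmc_model.not_uniformly_ergodic[OF csmc] by blast
  have d: "(\<exists>t\<in>{1..T}. Gsup t = \<infinity>) \<and> \<not> (\<exists>z\<in>space Z. AE y in marginal Z \<pi> 1. y = z) \<and>
      (countable (space Z) \<and> sets Z = Pow (space Z) \<and> equivalent_measures \<pi> (count_space (space X)) \<or>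
       (\<exists>L. sets L = sets Z \<and> lebesgue_type L \<and> equivalent_measures \<pi> (path_space L T))) \<longrightarrow>
      (\<forall>N\<ge>1. \<not> geometrically_ergodic \<pi> (P N))"
    unfolding Gsup_eq \<pi>_eq P_eq X_eq
    by (intro impI allI, elim conjE bexE, rule csmc_model.not_geometrically_ergodic[OF csmc])
  show ?thesis by (rule conjI[OF a conjI[OF b conjI[OF c d]]])
qed

end
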